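(* Let $\mathfrak{L}=L_{\boldsymbol m}(\mathfrak g,\boldsymbol\sigma,\mathfrak h)$ and $\mathfrak{L}'=L_{\boldsymbol m'}(\mathfrak g',\boldsymbol\sigma',\mathfrak h')$ be multiloop Lie algebras of nullity $n$ (graded by $Q_{\mathfrak h}\times\mathbb Z^n$ and $Q_{\mathfrak h'}\times\mathbb Z^n$ respectively). Then the following are equivalent: (a) $\mathfrak L$ and $\mathfrak L'$ are support-isomorphic. (b) There exist $s=(s_1,\dots,s_n)\in\mathrm{Hom}(Q_{\mathfrak h},\mathbb Q^n)$, $P\in GL_n(\mathbb Z)$ and a Lie algebra isomorphism $\varphi:\mathfrak g\to\mathfrak g'$ such that, defining $\tau_i\in\mathrm{Aut}(\mathfrak g)$ by $\tau_i(x_\alpha)=\zeta^{-s_i(\alpha)}x_\alpha$ for $\alpha\in Q_{\mathfrak h}$, $x_\alpha\in\mathfrak g_\alpha$, and $\boldsymbol\tau=(\tau_1,\dots,\tau_n)$, one has $\boldsymbol\sigma'=\varphi(\boldsymbol\tau\boldsymbol\sigma)^P\varphi^{-1}$. (c) There exists a finite sequence of $Q_{\mathfrak h}\times\mathbb Z^n$-graded Lie algebras $\mathfrak L_0,\mathfrak L_1,\dots,\mathfrak L_p$ such that (i) $\mathfrak L_0=\mathfrak L$; (ii) $\mathfrak L_p$ and $\mathfrak L'$ are $\mathbb Z^n$-isograded-isomorphic; (iii) for each $0\le i\le p-1$, $\mathfrak L_{i+1}$ is either $(\mathfrak L_i)_{(\rho_i)}$ for some group monomorphism $\rho_i:\langle\mathrm{supp}_{\mathbb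 Z^n}(\mathfrak L_i)\rangle\to\mathbb Z^n$, or $\mathfrak L_i^{(s_i)}$ for some $s_i\in\mathrm{Hom}(Q_{\mathfrak h},\mathbb Z^n)$.
   Context: Throughout, $k$ is an algebraically closed field of characteristic $0$; for each $n\in\mathbb Z_{>0}$ a primitive $n$-th root of unity $\zeta_n\in k$ is fixed so that $\zeta_{mn}^m=\zeta_n$ for all $m,n$. For $q\in\mathbb Q$ written $q=a/b$ with $a\in\mathbb Z$, $b\in\mathbb Z_{>0}$, put $\zeta^q=\zeta_b^a$ (well defined). Multiloop Lie algebras: let $\mathfrak g$ be a finite-dimensional simple Lie algebra over $k$; $\mathrm{Aut}^n_{\mathrm{cfo}}(\mathfrak g)$ is the set of $n$-tuples $\boldsymbol\sigma=(\sigma_1,\dots,\sigma_n)$ of pairwise commuting finite-order automorphisms. Let $\boldsymbol m=(m_1,\dots,m_n)\in\mathbb Z^n_{>0}$ with $\sigma_i^{m_i}=\mathrm{id}$ for all $i$. For $\lambda=(l_1,\dots,l_n)\in\mathbb Z^n$ put $\mathfrak g^{\bar\lambda}=\{g\in\mathfrak g:\sigma_i(g)=\zeta_{m_i}^{l_i}g\ \text{for }1\le i\le n\}$ and $\mathfrak g^{\boldsymbol\sigma}=\mathfrak g^{\bar 0}$ (common fixed points). If $\mathfrak g^{\boldsymbol\sigma}\neq0$, $\mathfrak h$ is a Cartan subalgebra (maximal ad-diagonalizable subalgebra) of the reductive algebra $\mathfrak g^{\boldsymbol\sigma}$; $\mathfrak h$ acts diagonalizably on $\mathfrak g$, giving $\mathfrak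 g=\bigoplus_{\alpha\in\mathfrak h^*}\mathfrak g_\alpha$; $\Delta=\{\alpha\ne0:\mathfrak g_\alpha\ne0\}$, $Q_{\mathfrak h}=\sum_{\alpha\in\Delta}\mathbb Z\alpha$, $\mathfrak g^{\bar\lambda}_\alpha=\mathfrak g_\alpha\cap\mathfrak g^{\bar\lambda}$, and $L_{\boldsymbol m}(\mathfrak g,\boldsymbol\sigma,\mathfrak h)=\bigoplus_{(\alpha,\lambda)\in Q_{\mathfrak h}\times\mathbb Z^n}\mathfrak g^{\bar\lambda}_\alpha\otimes t^\lambda\subseteq\mathfrak g\otimes k[t_1^{\pm1},\dots,t_n^{\pm1}]$, a $Q_{\mathfrak h}\times\mathbb Z^n$-graded Lie algebra with $(\alpha,\lambda)$-component $\mathfrak L^\lambda_\alpha=\mathfrak g^{\bar\lambda}_\alpha\otimes t^\lambda$. If $\mathfrak g^{\boldsymbol\sigma}=0$, set $\mathfrak h=0$, $Q_{\mathfrak h}=\{0\}$ and $L_{\boldsymbol m}(\mathfrak g,\boldsymbol\sigma,\mathfrak h)=\bigoplus_\lambda\mathfrak g^{\bar\lambda}\otimes t^\lambda$, graded by $Q_{\mathfrak h}\times\mathbb Z^n$. $n$ is the nullity. Write $\mathfrak L^\lambda=\bigoplus_\alpha\mathfrak L^\lambda_\alpha$. Notation: for $P=(p_{ij})\in GL_n(\mathbb Z)$, $\boldsymbol\sigma^P=(\prod_i\sigma_i^{p_{i1}},\dots,\prod_i\sigma_i^{p_{in}})$; $\boldsymbol\tau\boldsymbol\sigma=(\tau_1\sigma_1,\dots,\tau_n\sigma_n)$;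 $\varphi\boldsymbol\sigma\varphi^{-1}=(\varphi\sigma_1\varphi^{-1},\dots,\varphi\sigma_n\varphi^{-1})$. Graded isomorphisms: for an abelian group $\Lambda$ and a $\Lambda$-graded algebra $B$, $\mathrm{supp}_\Lambda(B)=\{\lambda:B^\lambda\neq0\}$ and $\langle\mathrm{supp}_\Lambda(B)\rangle$ is the subgroup it generates. A $\Lambda$-graded $B$ and a $\Lambda'$-graded $B'$ are isograded-isomorphic if there are an algebra isomorphism $\varphi:B\to B'$ and a group isomorphism $\varphi_\Lambda:\Lambda\to\Lambda'$ with $\varphi(B^\lambda)=B'^{\varphi_\Lambda(\lambda)}$ for all $\lambda$; support-isomorphic if there are an algebra isomorphism $\varphi$ and a group isomorphism $\varphi_{\mathrm{su}}:\langle\mathrm{supp}_\Lambda(B)\rangle\to\langle\mathrm{supp}_{\Lambda'}(B')\rangle$ with $\varphi(B^\lambda)=B'^{\varphi_{\mathrm{su}}(\lambda)}$ for all $\lambda\in\langle\mathrm{supp}_\Lambda(B)\rangle$. Two multiloop Lie algebras of nullity $n$ are $\mathbb Z^n$-isograded-isomorphic if they are isograded-isomorphic when regarded only as $\mathbb Z^n$-graded. Regradings: for abelian groups $Q,\Lambda$ and a $Q\times\Lambda$-graded Lie algebra $\mathfrak B$: for a group monomorphism $\rho:\langle\mathrm{supp}_\Lambda(\mathfrak B)\rangle\to\Lambda$ (support w.r.t. the $\Lambda$-grading), $\mathfrak B_{(\rho)}$ is $\mathfrak B$ with grading $(\mathfrak B_{(\rho)})^\lambda_\alpha=\mathfrak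 B^{\rho^{-1}(\lambda)}_\alpha$ if $\lambda\in\mathrm{Im}\,\rho$ and $\{0\}$ otherwise; for $s\in\mathrm{Hom}(Q,\Lambda)$, $\mathfrak B^{(s)}$ is $\mathfrak B$ with grading $(\mathfrak B^{(s)})^\lambda_\alpha=\mathfrak B^{\lambda+s(\alpha)}_\alpha$. *)

theory Defs
  imports "HOL-Analysis.Analysis" "HOL-Library.Function_Algebras"
          "HOL-Computational_Algebra.Polynomial"
begin

definition alg_closed :: "'k::field itself \<Rightarrow> bool" where
  "alg_closed _ \<longleftrightarrow> (\<forall>p::'k poly. degree p > 0 \<longrightarrow> (\<exists>x. poly p x = 0))"

definition root_system :: "(nat \<Rightarrow> 'k::field) \<Rightarrow> bool" where
  "root_system z \<longleftrightarrow>
     (\<forall>n>0. z n ^ n = 1 \<and> (\<forall>d. 0 < d \<and> d < n \<longrightarrow> z n ^ d \<noteq> 1)) \<and>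
     (\<forall>m n. 0 < m \<and> 0 < n \<longrightarrow> z (m * n) ^ m = z n)"

definition zpow :: "(nat \<Rightarrow> 'k::field) \<Rightarrow> rat \<Rightarrow> 'k" where
  "zpow z q = (case quotient_of q of (a, b) \<Rightarrow> power_int (z (nat b)) a)"

definition lie_algebra :: "('k::field \<Rightarrow> 'v::ab_group_add \<Rightarrow> 'v) \<Rightarrow> ('v \<Rightarrow> 'v \<Rightarrow> 'v) \<Rightarrow> bool" where
  "lie_algebra sc br \<longleftrightarrow> vector_space sc \<and>
     (\<forall>x y w. br (x + y) w = br x w + br y w) \<and>
     (\<forall>x y w. br x (y + w) = br x y + br x w) \<and>
     (\<forall>c x y. br (sc c x) y = sc c (br x y)) \<and>
     (\<forall>c x y. br x (sc c y) = sc c (br x y)) \<and>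
     (\<forall>x. br x x = 0) \<and>
     (\<forall>x y w. br x (br y w) + br y (br w x) + br w (br x y) = 0)"

definition lie_ideal :: "('k::field \<Rightarrow> 'v::ab_group_add \<Rightarrow> 'v) \<Rightarrow> ('v \<Rightarrow> 'v \<Rightarrow> 'v) \<Rightarrow> 'v set \<Rightarrow> bool" where
  "lie_ideal sc br I \<longleftrightarrow> module.subspace sc I \<and> (\<forall>x. \<forall>i\<in>I. br x i \<in> I)"

definition fin_dim_simple_lie :: "('k::field \<Rightarrow> 'v::ab_group_add \<Rightarrow> 'v) \<Rightarrow> ('v \<Rightarrow> 'v \<Rightarrow> 'v) \<Rightarrow> bool" where
  "fin_dim_simple_lie sc br \<longleftrightarrow> lie_algebra sc br \<and>
     (\<exists>B. finite B \<and> module.span sc B = UNIV) \<and>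
     (\<exists>x y. br x y \<noteq> 0) \<and>
     (\<forall>I. lie_ideal sc br I \<longrightarrow> I = {0} \<or> I = UNIV)"

definition lie_iso :: "('k::field \<Rightarrow> 'v::ab_group_add \<Rightarrow> 'v) \<Rightarrow> ('v \<Rightarrow> 'v \<Rightarrow> 'v) \<Rightarrow>
    ('k \<Rightarrow> 'w::ab_group_add \<Rightarrow> 'w) \<Rightarrow> ('w \<Rightarrow> 'w \<Rightarrow> 'w) \<Rightarrow> ('v \<Rightarrow> 'w) \<Rightarrow> bool" where
  "lie_iso sc br sc' br' \<phi> \<longleftrightarrow> bij \<phi> \<and>
     (\<forall>x y. \<phi> (x + y) = \<phi> x + \<phi> y) \<and> (\<forall>c x. \<phi> (sc c x) = sc' c (\<phi> x)) \<and>
     (\<forall>x y. \<phi> (br x y) = br' (\<phi> x) (\<phi> y))"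

definition fpow :: "('v \<Rightarrow> 'v) \<Rightarrow> int \<Rightarrow> ('v \<Rightarrow> 'v)" where
  "fpow f k = (if 0 \<le> k then f ^^ nat k else (inv f) ^^ nat (- k))"

text \<open>The tuple sigma^P: its j-th entry is the product over i of sigma_i^(p_ij)
  (the factors commute in all uses below).\<close>
definition tuple_pow :: "('n::finite \<Rightarrow> 'v \<Rightarrow> 'v) \<Rightarrow> int^'n^'n \<Rightarrow> 'n \<Rightarrow> ('v \<Rightarrow> 'v)" where
  "tuple_pow \<sigma> P j = Finite_Set.fold (\<lambda>i acc. fpow (\<sigma> i) (P $ i $ j) \<circ> acc) id UNIV"

definition GL_int :: "int^'n::finite^'n \<Rightarrow> bool" where
  "GL_int P \<longleftrightarrow> (\<exists>R. P ** R = mat 1 \<and> R ** P = mat 1)"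

definition cfo_tuple :: "('k::field \<Rightarrow> 'v::ab_group_add \<Rightarrow> 'v) \<Rightarrow> ('v \<Rightarrow> 'v \<Rightarrow> 'v) \<Rightarrow>
    ('n::finite \<Rightarrow> 'v \<Rightarrow> 'v) \<Rightarrow> ('n \<Rightarrow> nat) \<Rightarrow> bool" where
  "cfo_tuple sc br \<sigma> m \<longleftrightarrow> (\<forall>i. lie_iso sc br sc br (\<sigma> i)) \<and>
     (\<forall>i j. \<sigma> i \<circ> \<sigma> j = \<sigma> j \<circ> \<sigma> i) \<and>
     (\<forall>i. 0 < m i \<and> (\<sigma> i) ^^ (m i) = id)"

definition gbar :: "('k::field \<Rightarrow> 'v::ab_group_add \<Rightarrow> 'v) \<Rightarrow> (nat \<Rightarrow> 'k) \<Rightarrow>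
    ('n::finite \<Rightarrow> 'v \<Rightarrow> 'v) \<Rightarrow> ('n \<Rightarrow> nat) \<Rightarrow> int^'n \<Rightarrow> 'v set" where
  "gbar sc z \<sigma> m l = {x. \<forall>i. \<sigma> i x = sc (power_int (z (m i)) (l $ i)) x}"

definition ad_diag_on :: "('k::field \<Rightarrow> 'v::ab_group_add \<Rightarrow> 'v) \<Rightarrow> ('v \<Rightarrow> 'v \<Rightarrow> 'v) \<Rightarrow> 'v set \<Rightarrow> 'v \<Rightarrow> bool" where
  "ad_diag_on sc br S h \<longleftrightarrow> module.span sc {x \<in> S. \<exists>c. br h x = sc c x} = S"

definition ad_diag_subalg :: "('k::field \<Rightarrow> 'v::ab_group_add \<Rightarrow> 'v) \<Rightarrow> ('v \<Rightarrow> 'v \<Rightarrow> 'v) \<Rightarrow> 'v set \<Rightarrow> 'v set \<Rightarrow> bool" where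
  "ad_diag_subalg sc br S T \<longleftrightarrow> module.subspace sc T \<and> T \<subseteq> S \<and>
     (\<forall>x\<in>T. \<forall>y\<in>T. br x y \<in> T) \<and> (\<forall>t\<in>T. ad_diag_on sc br S t)"

text \<open>Cartan subalgebra of the (reductive) subalgebra S = maximal ad-diagonalizable
  subalgebra; for S = {0} this forces H = {0}.\<close>
definition cartan_sub :: "('k::field \<Rightarrow> 'v::ab_group_add \<Rightarrow> 'v) \<Rightarrow> ('v \<Rightarrow> 'v \<Rightarrow> 'v) \<Rightarrow> 'v set \<Rightarrow> 'v set \<Rightarrow> bool" where
  "cartan_sub sc br S H \<longleftrightarrow> ad_diag_subalg sc br S H \<and>
     (\<forall>T. ad_diag_subalg sc br S T \<and> H \<subseteq> T \<longrightarrow> T = H)"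

text \<open>Elements of h^* represented as functions vanishing outside H (canonical representatives).\<close>
definition hdual :: "('k::field \<Rightarrow> 'v::ab_group_add \<Rightarrow> 'v) \<Rightarrow> 'v set \<Rightarrow> ('v \<Rightarrow> 'k) set" where
  "hdual sc H = {\<alpha>. (\<forall>x. x \<notin> H \<longrightarrow> \<alpha> x = 0) \<and>
      (\<forall>x\<in>H. \<forall>y\<in>H. \<alpha> (x + y) = \<alpha> x + \<alpha> y) \<and> (\<forall>c. \<forall>x\<in>H. \<alpha> (sc c x) = c * \<alpha> x)}"

definition wspace :: "('k::field \<Rightarrow> 'v::ab_group_add \<Rightarrow> 'v) \<Rightarrow> ('v \<Rightarrow> 'v \<Rightarrow> 'v) \<Rightarrow> 'v set \<Rightarrow> ('v \<Rightarrow> 'k) \<Rightarrow> 'v set" where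
  "wspace sc br H \<alpha> = {x. \<forall>h\<in>H. br h x = sc (\<alpha> h) x}"

definition roots :: "('k::field \<Rightarrow> 'v::ab_group_add \<Rightarrow> 'v) \<Rightarrow> ('v \<Rightarrow> 'v \<Rightarrow> 'v) \<Rightarrow> 'v set \<Rightarrow> ('v \<Rightarrow> 'k) set" where
  "roots sc br H = {\<alpha> \<in> hdual sc H. \<alpha> \<noteq> 0 \<and> wspace sc br H \<alpha> \<noteq> {0}}"

definition gen_subgroup :: "'a::ab_group_add set \<Rightarrow> 'a set" where
  "gen_subgroup S = \<Inter>{G. S \<subseteq> G \<and> 0 \<in> G \<and> (\<forall>x\<in>G. \<forall>y\<in>G. x - y \<in> G)}"

definition root_lattice :: "('k::field \<Rightarrow> 'v::ab_group_add \<Rightarrow> 'v) \<Rightarrow> ('v \<Rightarrow> 'v \<Rightarrow> 'v) \<Rightarrow> 'v set \<Rightarrow> ('v \<Rightarrow> 'k) set" where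
  "root_lattice sc br H = gen_subgroup (roots sc br H)"

definition group_hom_on :: "'a::ab_group_add set \<Rightarrow> ('a \<Rightarrow> 'b::ab_group_add) \<Rightarrow> bool" where
  "group_hom_on G f \<longleftrightarrow> (\<forall>x\<in>G. \<forall>y\<in>G. f (x + y) = f x + f y)"

definition group_iso_on :: "'a::ab_group_add set \<Rightarrow> 'b::ab_group_add set \<Rightarrow> ('a \<Rightarrow> 'b) \<Rightarrow> bool" where
  "group_iso_on G G' f \<longleftrightarrow> bij_betw f G G' \<and> group_hom_on G f"

section \<open>Multiloop Lie algebras: elements of g (x) k[t^{+-1}] as finitely supported maps Z^n -> g\<close>

definition mloop :: "('k::field \<Rightarrow> 'v::ab_group_add \<Rightarrow> 'v) \<Rightarrow> (nat \<Rightarrow> 'k) \<Rightarrow>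
    ('n::finite \<Rightarrow> 'v \<Rightarrow> 'v) \<Rightarrow> ('n \<Rightarrow> nat) \<Rightarrow> (int^'n \<Rightarrow> 'v) set" where
  "mloop sc z \<sigma> m = {f. finite {l. f l \<noteq> 0} \<and> (\<forall>l. f l \<in> gbar sc z \<sigma> m l)}"

definition lsc :: "('k \<Rightarrow> 'v \<Rightarrow> 'v) \<Rightarrow> 'k \<Rightarrow> (int^'n::finite \<Rightarrow> 'v) \<Rightarrow> (int^'n \<Rightarrow> 'v)" where
  "lsc sc c f = (\<lambda>l. sc c (f l))"

text \<open>[x (x) t^a, y (x) t^b] = [x,y] (x) t^(a+b), extended bilinearly.\<close>
definition lbr :: "('v::ab_group_add \<Rightarrow> 'v \<Rightarrow> 'v) \<Rightarrow> (int^'n::finite \<Rightarrow> 'v) \<Rightarrow> (int^'n \<Rightarrow> 'v) \<Rightarrow> (int^'n \<Rightarrow> 'v)" where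
  "lbr br f g = (\<lambda>\<nu>. \<Sum>l\<in>{l. f l \<noteq> 0}. br (f l) (g (\<nu> - l)))"

definition mloop_comp :: "('k::field \<Rightarrow> 'v::ab_group_add \<Rightarrow> 'v) \<Rightarrow> ('v \<Rightarrow> 'v \<Rightarrow> 'v) \<Rightarrow> (nat \<Rightarrow> 'k) \<Rightarrow>
    ('n::finite \<Rightarrow> 'v \<Rightarrow> 'v) \<Rightarrow> ('n \<Rightarrow> nat) \<Rightarrow> 'v set \<Rightarrow>
    ('v \<Rightarrow> 'k) \<times> (int^'n) \<Rightarrow> (int^'n \<Rightarrow> 'v) set" where
  "mloop_comp sc br z \<sigma> m H = (\<lambda>(\<alpha>, l). {f \<in> mloop sc z \<sigma> m.
      (\<forall>\<mu>. \<mu> \<noteq> l \<longrightarrow> f \<mu> = 0) \<and> f l \<in> wspace sc br H \<alpha>})"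

definition alg_iso :: "'a::ab_group_add set \<Rightarrow> ('k \<Rightarrow> 'a \<Rightarrow> 'a) \<Rightarrow> ('a \<Rightarrow> 'a \<Rightarrow> 'a) \<Rightarrow>
    'b::ab_group_add set \<Rightarrow> ('k \<Rightarrow> 'b \<Rightarrow> 'b) \<Rightarrow> ('b \<Rightarrow> 'b \<Rightarrow> 'b) \<Rightarrow> ('a \<Rightarrow> 'b) \<Rightarrow> bool" where
  "alg_iso A sc br A' sc' br' \<phi> \<longleftrightarrow> bij_betw \<phi> A A' \<and>
     (\<forall>x\<in>A. \<forall>y\<in>A. \<phi> (x + y) = \<phi> x + \<phi> y) \<and>
     (\<forall>c. \<forall>x\<in>A. \<phi> (sc c x) = sc' c (\<phi> x)) \<and>
     (\<forall>x\<in>A. \<forall>y\<in>A. \<phi> (br x y) = br' (\<phi> x) (\<phi> y))"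

definition gsupp :: "'g set \<Rightarrow> ('g \<Rightarrow> 'a::zero set) \<Rightarrow> 'g set" where
  "gsupp Lam cmp = {\<gamma> \<in> Lam. cmp \<gamma> \<noteq> {0}}"

definition support_iso :: "'a::ab_group_add set \<Rightarrow> ('k \<Rightarrow> 'a \<Rightarrow> 'a) \<Rightarrow> ('a \<Rightarrow> 'a \<Rightarrow> 'a) \<Rightarrow>
    'g::ab_group_add set \<Rightarrow> ('g \<Rightarrow> 'a set) \<Rightarrow>
    'b::ab_group_add set \<Rightarrow> ('k \<Rightarrow> 'b \<Rightarrow> 'b) \<Rightarrow> ('b \<Rightarrow> 'b \<Rightarrow> 'b) \<Rightarrow>
    'h::ab_group_add set \<Rightarrow> ('h \<Rightarrow> 'b set) \<Rightarrow> bool" where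
  "support_iso A sc br Lam cmp A' sc' br' Lam' cmp' \<longleftrightarrow>
     (\<exists>\<phi> \<psi>. alg_iso A sc br A' sc' br' \<phi> \<and>
        group_iso_on (gen_subgroup (gsupp Lam cmp)) (gen_subgroup (gsupp Lam' cmp')) \<psi> \<and>
        (\<forall>\<gamma>\<in>gen_subgroup (gsupp Lam cmp). \<phi> ` cmp \<gamma> = cmp' (\<psi> \<gamma>)))"

definition zn_comp :: "'q::ab_group_add set \<Rightarrow> ('q \<times> (int^'n::finite) \<Rightarrow> 'a::ab_group_add set) \<Rightarrow> int^'n \<Rightarrow> 'a set" where
  "zn_comp Q cmp l = {sum f S | S f. finite S \<and> S \<subseteq> Q \<and> (\<forall>\<alpha>\<in>S. f \<alpha> \<in> cmp (\<alpha>, l))}"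

definition zn_isograded_iso :: "'a::ab_group_add set \<Rightarrow> ('k \<Rightarrow> 'a \<Rightarrow> 'a) \<Rightarrow> ('a \<Rightarrow> 'a \<Rightarrow> 'a) \<Rightarrow>
    'q::ab_group_add set \<Rightarrow> ('q \<times> (int^'n::finite) \<Rightarrow> 'a set) \<Rightarrow>
    'b::ab_group_add set \<Rightarrow> ('k \<Rightarrow> 'b \<Rightarrow> 'b) \<Rightarrow> ('b \<Rightarrow> 'b \<Rightarrow> 'b) \<Rightarrow>
    'r::ab_group_add set \<Rightarrow> ('r \<times> (int^'n) \<Rightarrow> 'b set) \<Rightarrow> bool" where
  "zn_isograded_iso A sc br Q cmp A' sc' br' Q' cmp' \<longleftrightarrow>
     (\<exists>\<phi> \<psi>. alg_iso A sc br A' sc' br' \<phi> \<and> group_iso_on (UNIV :: (int^'n) set) UNIV \<psi> \<and>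
        (\<forall>l. \<phi> ` zn_comp Q cmp l = zn_comp Q' cmp' (\<psi> l)))"

definition regrade_rho :: "'q::ab_group_add set \<Rightarrow> ('q \<times> (int^'n::finite) \<Rightarrow> 'a::ab_group_add set) \<Rightarrow>
    (int^'n \<Rightarrow> int^'n) \<Rightarrow> ('q \<times> (int^'n) \<Rightarrow> 'a set)" where
  "regrade_rho Q cmp \<rho> = (\<lambda>(\<alpha>, l).
     let D = gen_subgroup {\<mu>. zn_comp Q cmp \<mu> \<noteq> {0}} in
     if l \<in> \<rho> ` D then cmp (\<alpha>, the_inv_into D \<rho> l) else {0})"

definition zn_monomorphism :: "'q::ab_group_add set \<Rightarrow> ('q \<times> (int^'n::finite) \<Rightarrow> 'a::ab_group_add set) \<Rightarrow>
    (int^'n \<Rightarrow> int^'n) \<Rightarrow> bool" where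
  "zn_monomorphism Q cmp \<rho> \<longleftrightarrow>
     (let D = gen_subgroup {\<mu>. zn_comp Q cmp \<mu> \<noteq> {0}} in inj_on \<rho> D \<and> group_hom_on D \<rho>)"

definition regrade_s :: "('q \<times> (int^'n::finite) \<Rightarrow> 'a set) \<Rightarrow> ('q \<Rightarrow> int^'n) \<Rightarrow> ('q \<times> (int^'n) \<Rightarrow> 'a set)" where
  "regrade_s cmp s = (\<lambda>(\<alpha>, l). cmp (\<alpha>, l + s \<alpha>))"

definition regrade_step :: "'q::ab_group_add set \<Rightarrow> ('q \<times> (int^'n::finite) \<Rightarrow> 'a::ab_group_add set) \<Rightarrow>
    ('q \<times> (int^'n) \<Rightarrow> 'a set) \<Rightarrow> bool" where
  "regrade_step Q cmp cmp' \<longleftrightarrow>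
     (\<exists>\<rho>. zn_monomorphism Q cmp \<rho> \<and> cmp' = regrade_rho Q cmp \<rho>) \<or>
     (\<exists>s. group_hom_on Q s \<and> cmp' = regrade_s cmp s)"

end

theory Submission imports Defs begin

text \<open>The conditions (a) and (c) both yield an
  isomorphism \<open>\<phi>\<close> of the loop algebras that sends degree \<open>(\<alpha>, l)\<close> into \<open>\<int>\<^sup>n\<close>-degree \<open>F(\<alpha>, l)\<close> for a
  homomorphism \<open>F\<close> on the group generated by the support, and every such \<open>F\<close> is of the form
  \<open>A l - s(\<alpha>)\<close> with \<open>A\<close> a rational matrix. Multiplication by \<open>t\<^sup>m\<^sup>\<kappa>\<close> is a homogeneous element of the centroid,
  so Schur's lemma shows that \<open>\<phi>\<close> transports it to a scalar multiple of some \<open>t\<^sup>m\<^sup>'\<^sup>\<nu>\<close>; the map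
  \<open>\<kappa> \<mapsto> \<nu>\<close> is the matrix in \<open>GL\<^sub>n(\<int>)\<close>, and composing \<open>\<phi>\<close> with the evaluation at a point of the torus that
  absorbs the scalars gives the isomorphism of the simple Lie algebras required by (b). Conversely, under (b)
  the image of \<open>H\<close> is a Cartan subalgebra of the fixed points of the second tuple; these are conjugate, so one may
  assume that \<open>H\<close> is mapped to \<open>H'\<close>, and then \<open>x \<otimes> t\<^sup>l \<mapsto> \<phi>(x) \<otimes> t\<^sup>\<mu>\<close> with \<open>\<mu> = A l - s(\<alpha>)\<close>
  for \<open>x\<close> of weight \<open>\<alpha>\<close> is a graded isomorphism. For the conjugacy, two Borel-like
  subalgebras, one for each Cartan subalgebra, share an element that exponentials of nilpotent elements move to
  a regular element of either Cartan subalgebra.\<close>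

text \<open>Two difficulties shape the argument. The ground field carries no topology, and the
  fixed-point algebra S may be zero or fail to be semisimple. Its structure is therefore drawn from
  the Killing form of the whole algebra: eigenvectors of the tuple outside S are orthogonal to S, so
  the form stays nondegenerate on S, and the semisimple part of an element of S lies in S because
  the derivation producing it commutes with the tuple. Secondly, the group generated by the support
  need not be all of Q times Z^n. It does contain 0 times m Z^n, whose second factor has finite
  index in Z^n; hence degree maps are rational matrices, and s in (b) takes rational values. That
  \<kappa> \<mapsto> \<nu> is onto requires pulling shifts of the second algebra back along \<phi>,
  whose inverse is not known to be homogeneous; injectivity of A restores homogeneity. Evaluation at
  a torus point must respect the equality of G l and G (l + m \<kappa>), and this is what absorbing
  the scalars achieves.\<close>

locale fd_space = vector_space sc
  for sc :: "'k::field_char_0 \<Rightarrow> 'v::ab_group_add \<Rightarrow> 'v" +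
  assumes ex_finite_span: "\<exists>B. finite B \<and> span B = UNIV"
begin

definition fbasis :: "'v set" where
  "fbasis = (SOME B. finite B \<and> independent B \<and> span B = UNIV)"

lemma fbasis: "finite fbasis" "independent fbasis" "span fbasis = UNIV"
proof -
  obtain A where A: "finite A" "span A = UNIV" using ex_finite_span by blast
  obtain B where "B \<subseteq> A" "independent B" "A \<subseteq> span B" "span B = UNIV"
    using maximal_independent_subset[of A] A(2)
    by (metis span_mono span_span top.extremum_uniqueI)
  then have "\<exists>B. finite B \<and> independent B \<and> span B = UNIV"
    using A(1) finite_subset by blast
  from someI_ex[OF this] show "finite fbasis" "independent fbasis" "span fbasis = UNIV"
    unfolding fbasis_def by blast+
qed

sublocale finite_dimensional_vector_space sc fbasis
  by unfold_locales (use fbasis in auto)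

abbreviation lin :: "('v \<Rightarrow> 'v) \<Rightarrow> bool" where
  "lin f \<equiv> Vector_Spaces.linear sc sc f"

lemma linI:
  "(\<And>x y. f (x + y) = f x + f y) \<Longrightarrow> (\<And>c x. f (sc c x) = sc c (f x)) \<Longrightarrow> lin f"
  by (simp add: Vector_Spaces.linear_iff vector_space_axioms)

lemma
  assumes "lin f"
  shows lin_add: "f (x + y) = f x + f y"
    and lin_sc: "f (sc c x) = sc c (f x)"
    and lin_0: "f 0 = 0"
    and lin_diff: "f (x - y) = f x - f y"
    and lin_neg: "f (- x) = - f x"
    and lin_sum: "f (sum g A) = (\<Sum>a\<in>A. f (g a))"
proof -
  interpret module_hom sc sc f using assms by (simp add: module_hom_iff_linear)
  show "f (x + y) = f x + f y" "f (sc c x) = sc c (f x)" "f 0 = 0" "f (x - y) = f x - f y"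
    "f (- x) = - f x" "f (sum g A) = (\<Sum>a\<in>A. f (g a))"
    by (simp_all add: add scale diff neg sum)
qed

lemma lin_comp: "lin f \<Longrightarrow> lin g \<Longrightarrow> lin (\<lambda>x. f (g x))"
  by (rule linI) (simp_all add: lin_add lin_sc)

lemma lin_sub: "lin f \<Longrightarrow> lin g \<Longrightarrow> lin (\<lambda>x. f x - g x)"
  by (rule linI) (simp_all add: lin_add lin_sc algebra_simps)

lemma lin_shift: "lin f \<Longrightarrow> lin (\<lambda>x. f x - sc c x)"
  by (rule linI) (simp_all add: lin_add lin_sc algebra_simps)

lemma lin_id: "lin (\<lambda>x. x)"
  by (rule linI) simp_all

lemma lin_zero: "lin (\<lambda>x. 0)"
  by (rule linI) simp_all

lemma lin_pow: "lin f \<Longrightarrow> lin (f ^^ n)"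
proof (induction n)
  case 0
  show ?case using lin_id by (simp add: id_def)
next
  case (Suc n)
  then show ?case using lin_comp[of f "f ^^ n"] by (simp add: o_def)
qed

lemma lin_extend:
  assumes "independent B"
  shows "\<exists>g. lin g \<and> (\<forall>x\<in>B. g x = f x)"
proof -
  interpret p: vector_space_pair sc sc by unfold_locales
  show ?thesis using p.linear_independent_extend[OF assms] .
qed

lemma lin_inj_surj: "lin f \<Longrightarrow> (\<And>x. f x = 0 \<Longrightarrow> x = 0) \<Longrightarrow> surj f"
proof (rule linear_inj_imp_surj, assumption)
  assume l: "lin f" and z: "\<And>x. f x = 0 \<Longrightarrow> x = 0"
  show "inj f"
  proof (rule injI)
    fix x y assume "f x = f y"
    then have "f (x - y) = 0" by (simp add: lin_diff[OF l])
    then have "x - y = 0" by (rule z)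
    then show "x = y" by simp
  qed
qed

lemma subspace_kernel: "lin f \<Longrightarrow> subspace {x. f x = 0}"
  by (rule subspaceI) (auto simp: lin_add lin_sc lin_0)

lemma subspace_vimage: "lin f \<Longrightarrow> subspace S \<Longrightarrow> subspace {x. f x \<in> S}"
  by (rule subspaceI) (auto simp: lin_add lin_sc lin_0 subspace_0 subspace_add subspace_scale)

lemma subspace_image: "lin f \<Longrightarrow> subspace S \<Longrightarrow> subspace (f ` S)"
  apply (rule subspaceI)
  subgoal by (metis image_eqI lin_0 subspace_0)
  subgoal by (smt (verit, ccfv_threshold) image_iff lin_add subspace_add)
  subgoal by (smt (verit, ccfv_threshold) image_iff lin_sc subspace_scale)
  done

text \<open>The components form a total function that vanishes off a finite set, so adding one more
  vector is a pointwise update at a single index.\<close>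

lemma span_family_decomp:
  assumes sub: "\<And>i. i \<in> I \<Longrightarrow> subspace (W i)" and x: "x \<in> span (\<Union>i\<in>I. W i)"
  shows "\<exists>F y. finite F \<and> F \<subseteq> I \<and> (\<forall>i\<in>I. y i \<in> W i) \<and> (\<forall>i. i \<notin> F \<longrightarrow> y i = 0) \<and> x = sum y F"
  using x
proof (induction rule: span_induct_alt)
  case base
  show ?case by (rule exI[of _ "{}"], rule exI[of _ "\<lambda>_. 0"]) (auto simp: subspace_0 sub)
next
  case (step c w z)
  from step(2) obtain F y where F: "finite F" "F \<subseteq> I" "\<forall>i\<in>I. y i \<in> W i"
    "\<forall>i. i \<notin> F \<longrightarrow> y i = 0" "z = sum y F" by blast
  obtain j where j: "j \<in> I" "w \<in> W j" using step(1) by blast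
  define y' where "y' = y(j := sc c w + y j)"
  have "sum y' (insert j F) = y' j + sum y' (F - {j})"
    by (rule sum.insert_remove) (rule F)
  also have "sum y' (F - {j}) = sum y (F - {j})"
    by (rule sum.cong) (auto simp: y'_def)
  also have "y' j + \<dots> = sc c w + (y j + sum y (F - {j}))" by (simp add: y'_def algebra_simps)
  also have "y j + sum y (F - {j}) = sum y (insert j F)" using F(1) by (simp add: sum.insert_remove)
  also have "\<dots> = sum y F" using F by (cases "j \<in> F") (auto simp: insert_absorb)
  finally have s: "sc c w + z = sum y' (insert j F)" using F by simp
  show ?case
    by (rule exI[of _ "insert j F"], rule exI[of _ y'])
       (use F j s sub in \<open>auto simp: y'_def subspace_add subspace_scale\<close>)
qed

text \<open>Directness of the sum of the W i. It is quantified over finite subfamilies because the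
  index set may be infinite, such as all scalars or all of \<open>hdual\<close>; zero summands are
  allowed.\<close>

definition indep_fam :: "'i set \<Rightarrow> ('i \<Rightarrow> 'v set) \<Rightarrow> bool" where
  "indep_fam I W \<longleftrightarrow> (\<forall>F x. finite F \<longrightarrow> F \<subseteq> I \<longrightarrow> (\<forall>i\<in>F. x i \<in> W i) \<longrightarrow> sum x F = 0 \<longrightarrow> (\<forall>i\<in>F. x i = 0))"

lemma indep_famD:
  "indep_fam I W \<Longrightarrow> finite F \<Longrightarrow> F \<subseteq> I \<Longrightarrow> (\<And>i. i \<in> F \<Longrightarrow> x i \<in> W i) \<Longrightarrow> sum x F = 0 \<Longrightarrow> i \<in> F \<Longrightarrow> x i = 0"
  unfolding indep_fam_def by blast

text \<open>A basis chosen from the union of the W i carries the map: each basis vector is scaled by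
  the constant of some summand containing it, and directness makes this correct on whole summands.
  Projections, semisimple parts and the twists \<tau> of condition (b) all come from here.\<close>

lemma diag_map:
  assumes sub: "\<And>i. i \<in> I \<Longrightarrow> subspace (W i)" and sp: "span (\<Union>i\<in>I. W i) = UNIV"
    and ind: "indep_fam I W"
  shows "\<exists>T. lin T \<and> (\<forall>i\<in>I. \<forall>x\<in>W i. T x = sc (c i) x)"
proof -
  obtain B where B: "B \<subseteq> (\<Union>i\<in>I. W i)" "independent B" "(\<Union>i\<in>I. W i) \<subseteq> span B"
    using maximal_independent_subset by blast
  have spB: "span B = UNIV" using B(3) sp
    by (metis span_mono span_span top.extremum_uniqueI)
  define ix where "ix b = (SOME i. i \<in> I \<and> b \<in> W i)" for b
  have ix: "ix b \<in> I" "b \<in> W (ix b)" if "b \<in> B" for b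
  proof -
    have "\<exists>i. i \<in> I \<and> b \<in> W i" using that B(1) by blast
    from someI_ex[OF this] show "ix b \<in> I" "b \<in> W (ix b)" unfolding ix_def by blast+
  qed
  have fB: "finite B" using B(2) finiteI_independent by blast
  obtain T where T: "lin T" "\<And>b. b \<in> B \<Longrightarrow> T b = sc (c (ix b)) b"
    using lin_extend[OF B(2), of "\<lambda>b. sc (c (ix b)) b"] by blast
  have "T x = sc (c i) x" if i: "i \<in> I" and x: "x \<in> W i" for i x
  proof -
    have "x \<in> span B" by (simp add: spB)
    then obtain r where r: "x = (\<Sum>b\<in>B. sc (r b) b)" using span_finite[OF fB] by auto
    define J where "J = insert i (ix ` B)"
    define y where "y j = (\<Sum>b\<in>{b\<in>B. ix b = j}. sc (r b) b)" for j
    have fJ: "finite J" using fB J_def by auto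
    have xy: "x = sum y J"
      unfolding r y_def by (rule sum.group[symmetric]) (use fB fJ J_def in auto)
    have yW: "y j \<in> W j" if "j \<in> J" for j
      unfolding y_def using that i ix by (intro subspace_sum subspace_scale sub) (auto simp: J_def)
    \<comment> \<open>Subtracting x from its own component turns the decomposition of x into a
      vanishing sum, so directness yields x = \<open>y i\<close>.\<close>
    define z where "z j = (if j = i then y i - x else y j)" for j
    have "sum z J = z i + sum z (J - {i})" using fJ by (simp add: J_def sum.insert_remove)
    also have "sum z (J - {i}) = sum y (J - {i})" by (rule sum.cong) (auto simp: z_def)
    also have "z i + \<dots> = (y i + sum y (J - {i})) - x" by (simp add: z_def)
    also have "y i + sum y (J - {i}) = x" unfolding xy using fJ by (simp add: J_def sum.insert_remove)
    finally have sz: "sum z J = 0" by simp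
    have zW: "z j \<in> W j" if "j \<in> J" for j
      using yW[OF that] x sub[of i] i by (auto simp: z_def subspace_diff)
    have JI: "J \<subseteq> I" using i ix J_def by auto
    have z0: "z j = 0" if "j \<in> J" for j
      using indep_famD[OF ind fJ JI zW sz that] .
    have xi: "x = y i" using z0[of i] by (auto simp: z_def J_def)
    have "T x = T (y i)" using xi by simp
    also have "\<dots> = (\<Sum>b\<in>{b\<in>B. ix b = i}. sc (r b) (T b))"
      unfolding y_def by (simp add: lin_sum[OF T(1)] lin_sc[OF T(1)])
    also have "\<dots> = (\<Sum>b\<in>{b\<in>B. ix b = i}. sc (c i) (sc (r b) b))"
      by (rule sum.cong) (auto simp: T(2) mult.commute)
    also have "\<dots> = sc (c i) (y i)" by (simp add: y_def scale_sum_right)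
    finally show ?thesis using xi by simp
  qed
  then show ?thesis using T(1) by blast
qed

text \<open>Inductive form of directness: once all components except the one at the new index are
  known to vanish, the vanishing sum kills that one too.\<close>

lemma indep_famI_insert:
  assumes "\<And>F x i0. finite F \<Longrightarrow> i0 \<notin> F \<Longrightarrow> insert i0 F \<subseteq> I \<Longrightarrow>
     (\<And>y. (\<And>i. i \<in> F \<Longrightarrow> y i \<in> W i) \<Longrightarrow> sum y F = 0 \<Longrightarrow> (\<And>i. i \<in> F \<Longrightarrow> y i = 0)) \<Longrightarrow>
     (\<And>i. i \<in> insert i0 F \<Longrightarrow> x i \<in> W i) \<Longrightarrow> x i0 + sum x F = 0 \<Longrightarrow> (\<forall>i\<in>F. x i = 0)"
  shows "indep_fam I W"
  unfolding indep_fam_def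
proof (intro allI impI)
  fix F x
  assume "finite F" "F \<subseteq> I" "\<forall>i\<in>F. x i \<in> W i" "sum x F = 0"
  then show "\<forall>i\<in>F. x i = 0"
  proof (induction F arbitrary: x rule: finite_induct)
    case (insert j F)
    have "\<forall>i\<in>F. x i = 0"
    proof (rule assms[OF insert(1,2,4)])
      show "y i = 0" if "\<And>i. i \<in> F \<Longrightarrow> y i \<in> W i" "sum y F = 0" "i \<in> F" for y i
        using insert.IH[of y] insert.prems(1) that by blast
    qed (use insert in auto)
    then show ?case using insert by auto
  qed simp
qed

section \<open>Generalised eigenspaces\<close>

definition gspace :: "('v \<Rightarrow> 'v) \<Rightarrow> 'k \<Rightarrow> 'v set" where
  "gspace D a = {x. \<exists>N. ((\<lambda>y. D y - sc a y) ^^ N) x = 0}"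

lemma pow_zero_mono:
  assumes "lin f" "(f ^^ N) x = 0" "N \<le> M" shows "(f ^^ M) x = 0"
proof -
  have "f ^^ M = (f ^^ (M - N)) \<circ> (f ^^ N)" using assms(3) by (simp flip: funpow_add)
  then show ?thesis using assms lin_0[OF lin_pow[OF assms(1)]] by simp
qed

lemma subspace_gspace:
  assumes "lin D" shows "subspace (gspace D a)"
proof (rule subspaceI)
  let ?E = "\<lambda>y. D y - sc a y"
  have l: "lin ?E" using assms by (rule lin_shift)
  show "0 \<in> gspace D a" by (simp add: gspace_def lin_0[OF lin_pow[OF l]])
  show "x + y \<in> gspace D a" if xy: "x \<in> gspace D a" "y \<in> gspace D a" for x y
  proof -
    obtain N M where "(?E ^^ N) x = 0" "(?E ^^ M) y = 0" using xy by (auto simp: gspace_def)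
    then have "(?E ^^ (max N M)) x = 0" "(?E ^^ (max N M)) y = 0" using pow_zero_mono[OF l] by auto
    then have "(?E ^^ (max N M)) (x + y) = 0" by (simp add: lin_add[OF lin_pow[OF l]])
    then show ?thesis by (auto simp: gspace_def)
  qed
  show "sc c x \<in> gspace D a" if x: "x \<in> gspace D a" for c x
  proof -
    obtain N where "(?E ^^ N) x = 0" using x by (auto simp: gspace_def)
    then have "(?E ^^ N) (sc c x) = 0" by (simp add: lin_sc[OF lin_pow[OF l]])
    then show ?thesis by (auto simp: gspace_def)
  qed
qed

lemma comm_pow: "(\<And>x. f (g x) = g (f x)) \<Longrightarrow> f ((g ^^ n) x) = (g ^^ n) (f x)"
  by (induction n) auto

lemma gspace_comm:
  assumes "lin D" "lin f" "\<And>x. f (D x) = D (f x)" "x \<in> gspace D a"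
  shows "f x \<in> gspace D a"
proof -
  let ?E = "\<lambda>y. D y - sc a y"
  obtain N where N: "(?E ^^ N) x = 0" using assms(4) unfolding gspace_def by blast
  have "f (?E y) = ?E (f y)" for y using assms by (simp add: lin_diff lin_sc)
  then have "(?E ^^ N) (f x) = f ((?E ^^ N) x)" by (simp add: comm_pow)
  then show ?thesis using N lin_0[OF assms(2)] unfolding gspace_def by auto
qed

lemma gspace_step:
  assumes "lin D" "D x - sc a x \<in> gspace D a" shows "x \<in> gspace D a"
proof -
  let ?E = "\<lambda>y. D y - sc a y"
  obtain N where N: "(?E ^^ N) (?E x) = 0" using assms(2) unfolding gspace_def by blast
  then have "(?E ^^ Suc N) x = 0" by (simp only: funpow_Suc_right o_apply)
  then show ?thesis unfolding gspace_def by blast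
qed

text \<open>A vector killed by D - a is multiplied by a - b under D - b, so a power of D - b kills
  it only if it is zero. Hence D - a, and then each of its powers, has trivial kernel on
  \<open>gspace D b\<close>.\<close>

lemma gspace_shift_inj:
  assumes l: "lin D" and ab: "a \<noteq> b" and x: "x \<in> gspace D b"
    and z: "((\<lambda>y. D y - sc a y) ^^ M) x = 0"
  shows "x = 0"
proof -
  let ?A = "\<lambda>y. D y - sc a y" and ?B = "\<lambda>y. D y - sc b y"
  have lA: "lin ?A" and lB: "lin ?B" using l by (simp_all add: lin_shift)
  have 1: "y = 0" if "(?B ^^ N) y = 0" "?A y = 0" for N y
    using that
  proof (induction N)
    case (Suc N)
    have "?B y = sc (a - b) y" using Suc(3) by (simp add: algebra_simps)
    moreover have "(?B ^^ N) (?B y) = 0" using Suc(2) by (simp only: funpow_Suc_right o_apply)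
    ultimately have "(?B ^^ N) (sc (a - b) y) = 0" by simp
    then have "sc (a - b) ((?B ^^ N) y) = 0" by (simp add: lin_sc[OF lin_pow[OF lB]])
    then have "(?B ^^ N) y = 0" using ab by simp
    then show ?case using Suc by blast
  qed simp
  obtain N where N: "(?B ^^ N) x = 0" using x by (auto simp: gspace_def)
  have comm: "?A (?B y) = ?B (?A y)" for y by (simp add: lin_diff[OF l] lin_sc[OF l] algebra_simps)
  show ?thesis using N z
  proof (induction M arbitrary: x)
    case (Suc M)
    have "(?B ^^ N) (?A x) = 0" using Suc(2) comm_pow[of ?A ?B N x] comm lin_0[OF lA] by simp
    moreover have "(?A ^^ M) (?A x) = 0" using Suc(3) by (simp only: funpow_Suc_right o_apply)
    ultimately have "?A x = 0" using Suc.IH by blast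
    then show ?case using 1 Suc(2) by blast
  qed simp
qed

lemma indep_gspace: assumes l: "lin D" shows "indep_fam UNIV (gspace D)"
proof (rule indep_famI_insert, intro ballI)
  fix F :: "'k set" and x a j
  assume F: "finite F" "a \<notin> F" "j \<in> F" and s: "x a + sum x F = 0"
    and IH: "\<And>y i. (\<And>i. i \<in> F \<Longrightarrow> y i \<in> gspace D i) \<Longrightarrow> sum y F = 0 \<Longrightarrow> i \<in> F \<Longrightarrow> y i = 0"
    and x: "\<And>i. i \<in> insert a F \<Longrightarrow> x i \<in> gspace D i"
  let ?A = "\<lambda>y. D y - sc a y"
  have lA: "lin ?A" using l by (rule lin_shift)
  obtain N where N: "(?A ^^ N) (x a) = 0" using x[of a] unfolding gspace_def by auto
  have "(?A ^^ N) (x a + sum x F) = 0" using s lin_0[OF lin_pow[OF lA]] by simp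
  then have z: "(\<Sum>i\<in>F. (?A ^^ N) (x i)) = 0"
    by (simp add: lin_add[OF lin_pow[OF lA]] lin_sum[OF lin_pow[OF lA]] N)
  have c: "?A (D y) = D (?A y)" for y by (simp add: lin_diff[OF l] lin_sc[OF l])
  have "(?A ^^ N) (x i) \<in> gspace D i" if "i \<in> F" for i
    by (rule gspace_comm[OF l lin_pow[OF lA]]) (use comm_pow[of D ?A] c x that in auto)
  then have "(?A ^^ N) (x j) = 0" using IH[OF _ z F(3)] by blast
  then show "x j = 0" using gspace_shift_inj[OF l _ x[of j], of a N] F by auto
qed

definition pact :: "('v \<Rightarrow> 'v) \<Rightarrow> 'k poly \<Rightarrow> 'v \<Rightarrow> 'v" where
  "pact D p x = (\<Sum>i\<le>degree p. sc (coeff p i) ((D ^^ i) x))"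

lemma pact_ge: "degree p \<le> n \<Longrightarrow> pact D p x = (\<Sum>i\<le>n. sc (coeff p i) ((D ^^ i) x))"
  unfolding pact_def by (rule sum.mono_neutral_left) (auto simp: coeff_eq_0)

lemma pact_linear_factor:
  assumes l: "lin D"
  shows "pact D ([:-a, 1:] * p) x = pact D p (D x - sc a x)"
proof -
  let ?n = "Suc (degree p)"
  have e: "[:-a, 1:] * p = pCons 0 p - smult a p" by (simp add: algebra_simps)
  have d: "degree ([:-a, 1:] * p) \<le> ?n"
    using degree_mult_le[of "[:-a, 1:]" p] by simp
  have "pact D ([:-a, 1:] * p) x = (\<Sum>i\<le>?n. sc (coeff (pCons 0 p) i) ((D ^^ i) x))
     - (\<Sum>i\<le>?n. sc (a * coeff p i) ((D ^^ i) x))"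
    unfolding e pact_ge[OF d[unfolded e]] by (simp add: scale_left_diff_distrib sum_subtractf del: sum.atMost_Suc)
  also have "(\<Sum>i\<le>?n. sc (coeff (pCons 0 p) i) ((D ^^ i) x)) = (\<Sum>i\<le>degree p. sc (coeff p i) ((D ^^ i) (D x)))"
    by (simp only: sum.atMost_Suc_shift) (simp add: funpow_swap1)
  also have "(\<Sum>i\<le>?n. sc (a * coeff p i) ((D ^^ i) x)) = (\<Sum>i\<le>degree p. sc (coeff p i) ((D ^^ i) (sc a x)))"
    by (simp add: coeff_eq_0 lin_sc[OF lin_pow[OF l]] mult.commute)
  finally show ?thesis
    by (simp add: pact_def lin_diff[OF lin_pow[OF l]] scale_right_diff_distrib sum_subtractf)
qed

text \<open>If two iterates of x coincide, counting distinct iterates gives no dependence, and the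
  difference of two monomials annihilates x instead. Otherwise one iterate more than the dimension
  forces a linear relation.\<close>

lemma ex_annihilator: "\<exists>p. p \<noteq> 0 \<and> pact D p x = 0"
proof (cases "inj (\<lambda>i. (D ^^ i) x)")
  case False
  then obtain i j where ij: "i < j" "(D ^^ i) x = (D ^^ j) x"
    unfolding inj_def by (metis linorder_neqE_nat)
  let ?p = "monom 1 j - monom 1 i :: 'k poly"
  have d: "degree ?p \<le> j" using ij
    by (intro degree_diff_le order.trans[OF degree_monom_le]) auto
  have "coeff ?p j \<noteq> 0" using ij by simp
  then have "?p \<noteq> 0" by force
  moreover have "pact D ?p x = (\<Sum>k\<le>j. sc (if k = j then 1 else 0) ((D ^^ k) x)) - (\<Sum>k\<le>j. sc (if k = i then 1 else 0) ((D ^^ k) x))"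
    unfolding pact_ge[OF d] sum_subtractf[symmetric] scale_left_diff_distrib[symmetric] by (rule sum.cong) auto
  then have "pact D ?p x = 0" using ij by (simp add: if_distribR if_distrib[of sc] cong: if_cong)
  ultimately show ?thesis by blast
next
  case True
  let ?n = "card fbasis" and ?v = "\<lambda>i. (D ^^ i) x"
  have inj: "inj_on ?v {..?n}" using True by (rule inj_on_subset) auto
  have "card (?v ` {..?n}) = Suc ?n" using card_image[OF inj] by simp
  then have "dependent (?v ` {..?n})"
    using independent_span_bound[OF fbasis(1), of "?v ` {..?n}"] fbasis(3) by fastforce
  then obtain u where u: "\<exists>v\<in>?v ` {..?n}. u v \<noteq> 0" "(\<Sum>v\<in>?v ` {..?n}. sc (u v) v) = 0"
    by (subst (asm) dependent_finite) auto
  have s: "(\<Sum>i\<le>?n. sc (u (?v i)) (?v i)) = 0" using u(2) inj by (simp add: sum.reindex)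
  define p where "p = (\<Sum>i\<le>?n. monom (u (?v i)) i)"
  have c: "coeff p i = (if i \<le> ?n then u (?v i) else 0)" for i
    by (simp add: p_def coeff_sum)
  have "degree p \<le> ?n" using c by (intro degree_le) auto
  then have "pact D p x = 0" using s by (simp add: pact_ge c)
  moreover have "p \<noteq> 0"
  proof
    assume p0: "p = 0"
    obtain i where "i \<le> ?n" "u (?v i) \<noteq> 0" using u(1) by blast
    then show False using c[of i] by (simp add: p0)
  qed
  ultimately show ?thesis by blast
qed

end

locale ac_space = fd_space +
  assumes alg_closed: "\<And>p::'a poly. degree p > 0 \<Longrightarrow> \<exists>x. poly p x = 0"
begin

text \<open>For b different from a, the map D - a is onto on \<open>gspace D b\<close>. Subtracting
  suitable preimages from x leaves a vector whose image under D - a lies in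
  \<open>gspace D a\<close>, hence a vector of \<open>gspace D a\<close>.\<close>

lemma gspace_closed:
  assumes l: "lin D" and x: "D x - sc a x \<in> span (\<Union>b. gspace D b)"
  shows "x \<in> span (\<Union>b. gspace D b)"
proof -
  let ?A = "\<lambda>y. D y - sc a y"
  have lA: "lin ?A" using l by (rule lin_shift)
  have inv: "\<exists>u\<in>gspace D b. ?A u = w" if w: "w \<in> gspace D b" and ab: "a \<noteq> b" for b w
  proof -
    let ?B = "\<lambda>y. D y - sc b y"
    obtain N where "(?B ^^ N) w = 0" using w unfolding gspace_def by blast
    then show ?thesis using w
    proof (induction N arbitrary: w)
      case 0
      then have "w = 0" by simp
      then show ?case using subspace_0[OF subspace_gspace[OF l]] lin_0[OF lA] by (intro bexI[of _ 0]) simp_all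
    next
      case (Suc N)
      have Bw: "?B w \<in> gspace D b"
        by (rule gspace_comm[OF l lin_shift[OF l]]) (use Suc in \<open>auto simp: lin_diff[OF l] lin_sc[OF l]\<close>)
      have "(?B ^^ N) (?B w) = 0" using Suc(2) by (simp only: funpow_Suc_right o_apply)
      then obtain u where u: "u \<in> gspace D b" "?A u = ?B w" using Suc.IH Bw by blast
      \<comment> \<open>From (D - a) w - (D - b) w = (b - a) w and (D - a) u = (D - b) w, the
        preimage of w under D - a can be read off.\<close>
      have "?A (sc (1/(b-a)) (w - u)) = sc (1/(b-a)) (?A w - ?A u)"
        by (simp add: lin_sc[OF l] lin_diff[OF l] algebra_simps)
      also have "?A w - ?A u = ?A w - ?B w" by (simp only: u(2))
      also have "\<dots> = sc (b-a) w" by (simp add: algebra_simps)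
      also have "sc (1/(b-a)) \<dots> = w" using ab by simp
      finally have "?A (sc (1/(b-a)) (w - u)) = w" .
      moreover have "sc (1/(b-a)) (w - u) \<in> gspace D b"
        using subspace_gspace[OF l] u(1) Suc(3) by (intro subspace_scale subspace_diff)
      ultimately show ?case by blast
    qed
  qed
  obtain F y where F: "finite F" "\<forall>b. y b \<in> gspace D b" "\<forall>b. b \<notin> F \<longrightarrow> y b = 0" "?A x = sum y F"
    using span_family_decomp[of UNIV "gspace D", OF _ x] subspace_gspace[OF l] by auto
  have "\<forall>b. \<exists>u. b \<noteq> a \<longrightarrow> u \<in> gspace D b \<and> ?A u = y b" using inv F(2) by blast
  from choice[OF this] obtain u
    where u: "\<And>b. b \<noteq> a \<Longrightarrow> u b \<in> gspace D b" "\<And>b. b \<noteq> a \<Longrightarrow> ?A (u b) = y b" by blast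
  have "?A (x - (\<Sum>b\<in>F - {a}. u b)) = ?A x - ?A (\<Sum>b\<in>F - {a}. u b)" by (rule lin_diff[OF lA])
  also have "?A (\<Sum>b\<in>F - {a}. u b) = (\<Sum>b\<in>F - {a}. ?A (u b))" by (rule lin_sum[OF lA])
  also have "\<dots> = (\<Sum>b\<in>F - {a}. y b)" by (rule sum.cong) (use u(2) in auto)
  also have "?A x - \<dots> = sum y F - (\<Sum>b\<in>F - {a}. y b)" by (simp only: F(4))
  also have "\<dots> \<in> gspace D a"
    using F subspace_0[OF subspace_gspace[OF l]] by (cases "a \<in> F") (auto simp: sum.remove)
  finally have "x - (\<Sum>b\<in>F - {a}. u b) \<in> gspace D a" by (rule gspace_step[OF l])
  then have "x - (\<Sum>b\<in>F - {a}. u b) \<in> span (\<Union>b. gspace D b)" by (intro span_base) auto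
  moreover have "(\<Sum>b\<in>F - {a}. u b) \<in> span (\<Union>b. gspace D b)"
    using u(1) by (intro span_sum span_base) auto
  ultimately show ?thesis by (metis diff_add_cancel span_add)
qed

text \<open>Induction on the degree of a polynomial annihilating x: a root a splits off one linear
  factor, the quotient annihilates D x - a x, and \<open>gspace_closed\<close> passes from there
  back to x.\<close>

lemma gspace_span:
  assumes l: "lin D" shows "span (\<Union>b. gspace D b) = UNIV"
proof -
  have "x \<in> span (\<Union>b. gspace D b)" if "p \<noteq> 0" "pact D p x = 0" for p x
    using that
  proof (induction "degree p" arbitrary: p x)
    case 0
    then obtain c where "p = [:c:]" "c \<noteq> 0" by (metis degree_eq_zeroE pCons_0_0)
    then have "x = 0" using 0 by (simp add: pact_def)
    then show ?case by (simp add: span_zero)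
  next
    case (Suc n)
    then obtain a where "poly p a = 0" using alg_closed[of p] by auto
    then obtain q where q: "p = [:-a, 1:] * q" by (metis dvdE poly_eq_0_iff_dvd)
    then have q0: "q \<noteq> 0" using Suc by auto
    have "degree p = Suc (degree q)" unfolding q using q0 by (subst degree_mult_eq) auto
    then have "D x - sc a x \<in> span (\<Union>b. gspace D b)"
      using Suc.hyps(1)[of q] Suc q0 pact_linear_factor[OF l] q by auto
    then show ?case by (rule gspace_closed[OF l])
  qed
  then show ?thesis using ex_annihilator by blast
qed

end

context fd_space begin

section \<open>Trace\<close>

text \<open>B need not span the whole space: on an invariant span this is the trace of the
  restriction of f, which the induction for nilpotent maps requires.\<close>

definition trB :: "'v set \<Rightarrow> ('v \<Rightarrow> 'v) \<Rightarrow> 'k" where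
  "trB B f = (\<Sum>b\<in>B. representation B (f b) b)"

text \<open>Change of basis for single coefficients. It serves both the independence of the trace
  from the basis and the identity tr (f g) = tr (g f).\<close>

lemma repr_expand:
  assumes B: "independent B" and B': "independent B'" and sp: "span B = span B'" and x: "x \<in> span B"
    and l: "lin f" and inv: "\<And>x. x \<in> span B \<Longrightarrow> f x \<in> span B"
  shows "representation B (f x) b = (\<Sum>c\<in>B'. representation B' x c * representation B (f c) b)"
proof -
  have fB': "finite B'" using B' finiteI_independent by blast
  have "f x = f (\<Sum>c\<in>B'. sc (representation B' x c) c)"
    using sum_representation_eq[OF B' _ fB'] x sp by auto
  also have "\<dots> = (\<Sum>c\<in>B'. sc (representation B' x c) (f c))" by (simp add: lin_sum[OF l] lin_sc[OF l])
  finally have "f x = (\<Sum>c\<in>B'. sc (representation B' x c) (f c))" .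
  moreover have "f c \<in> span B" if "c \<in> B'" for c using inv that sp span_base by blast
  ultimately show ?thesis
    by (simp add: representation_sum[OF B] representation_scale[OF B] span_scale)
qed

lemma trB_basis:
  assumes B: "independent B" and B': "independent B'" and sp: "span B = span B'"
    and l: "lin f" and inv: "\<And>x. x \<in> span B \<Longrightarrow> f x \<in> span B"
  shows "trB B f = trB B' f"
proof -
  have fB: "finite B" using B finiteI_independent by blast
  have "trB B f = (\<Sum>b\<in>B. \<Sum>c\<in>B'. representation B' b c * representation B (f c) b)"
    unfolding trB_def by (rule sum.cong[OF refl repr_expand[OF B B' sp span_base l inv]])
  also have "\<dots> = (\<Sum>c\<in>B'. \<Sum>b\<in>B. representation B (f c) b * representation B' b c)"
    by (subst sum.swap) (simp add: mult.commute)
  also have "\<dots> = (\<Sum>c\<in>B'. representation B' (f c) c)"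
  proof (rule sum.cong[OF refl])
    fix c assume c: "c \<in> B'"
    have "f c \<in> span B" using c inv sp span_base by blast
    then show "(\<Sum>b\<in>B. representation B (f c) b * representation B' b c) = representation B' (f c) c"
      using repr_expand[OF B' B sp[symmetric] _ lin_id, of "f c" c] sp by simp
  qed
  finally show ?thesis by (simp add: trB_def)
qed

text \<open>The trace of f on a space equals its trace on the image of f. The image is smaller
  unless f is onto, and a nilpotent map is onto only on the zero space.\<close>

lemma trB_nilpotent:
  assumes "independent B" "lin f" "\<And>x. x \<in> span B \<Longrightarrow> f x \<in> span B"
    and "\<And>x. x \<in> span B \<Longrightarrow> \<exists>N. (f ^^ N) x = 0"
  shows "trB B f = 0"
  using assms
proof (induction "card B" arbitrary: B rule: less_induct)
  case less
  have fB: "finite B" using less finiteI_independent by blast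
  let ?R = "f ` span B"
  have subR: "subspace ?R" by (intro subspace_image less subspace_span)
  obtain C where C: "C \<subseteq> ?R" "independent C" "?R \<subseteq> span C"
    using maximal_independent_subset by blast
  have spC: "span C = ?R" using C subR span_minimal by blast
  have fC: "finite C" using C finiteI_independent by blast
  have RB: "?R \<subseteq> span B" using less(4) by blast
  \<comment> \<open>In a basis extending one of the image, vectors outside C contribute nothing to
    the trace, because each f b is a combination of C alone.\<close>
  obtain B' where B': "C \<subseteq> B'" "B' \<subseteq> span B" "independent B'" "span B \<subseteq> span B'"
    using maximal_independent_subset_extend[OF _ C(2), of "span B"] C(1) RB by blast
  have spB': "span B' = span B" using B' span_minimal[OF B'(2)] by auto
  have fB': "finite B'" using B' finiteI_independent by blast
  have "trB B f = trB B' f" by (rule trB_basis) (use less B' spB' in auto)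
  also have "\<dots> = (\<Sum>b\<in>B'. representation C (f b) b)"
    unfolding trB_def
  proof (rule sum.cong[OF refl])
    fix b assume "b \<in> B'"
    then have "f b \<in> span C" using spC B'(2) by blast
    then show "representation B' (f b) b = representation C (f b) b"
      using representation_extend[OF B'(3) _ B'(1)] by simp
  qed
  also have "\<dots> = trB C f"
    unfolding trB_def
    by (rule sum.mono_neutral_right[OF fB' B'(1)]) (use representation_ne_zero in blast)
  finally have e: "trB B f = trB C f" .
  show ?case
  proof (cases "card C < card B")
    case True
    have "trB C f = 0"
      by (rule less(1)[OF True C(2) less(3)]) (use spC RB less(4,5) in blast)+
    then show ?thesis using e by simp
  next
    \<comment> \<open>Without a drop in dimension f is onto on span B, and so are all its powers;
      nilpotency then leaves only the zero space.\<close>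
    case False
    have cB': "card B' = card B" using spB' dim_span_eq_card_independent B'(3) less(2) by metis
    then have "C = B'" using False card_seteq[OF fB' B'(1)] by simp
    then have sur: "f ` span B = span B" using spC spB' by simp
    have "(f ^^ N) ` span B = span B" for N
    proof (induction N)
      case (Suc N)
      have "(f ^^ Suc N) ` span B = f ` ((f ^^ N) ` span B)" by (simp add: image_image)
      then show ?case using Suc sur by simp
    qed simp
    moreover obtain N where "\<forall>x\<in>span B. (f ^^ N) x = 0"
    proof -
      have "\<forall>b\<in>B. \<exists>N. (f ^^ N) b = 0" using less(5) span_base by blast
      then obtain N where N: "\<And>b. b \<in> B \<Longrightarrow> (f ^^ N b) b = 0" by metis
      define M where "M = Max (N ` B)"
      have "(f ^^ M) b = 0" if "b \<in> B" for b
        using pow_zero_mono[OF less(3) N[OF that]] that fB by (simp add: M_def)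
      then have "B \<subseteq> {x. (f ^^ M) x = 0}" by blast
      then have "span B \<subseteq> {x. (f ^^ M) x = 0}"
        by (rule span_minimal) (intro subspace_kernel lin_pow less)
      then show ?thesis using that by blast
    qed
    ultimately have "span B \<subseteq> {0}" by (metis image_subsetI singletonI)
    then have "B \<subseteq> {0}" using span_superset by (rule order.trans[rotated])
    then have "B = {}" using less(2) dependent_zero[of B] by auto
    then show ?thesis by (simp add: trB_def)
  qed
qed

definition tr :: "('v \<Rightarrow> 'v) \<Rightarrow> 'k" where "tr f = trB fbasis f"

lemma tr_basis: "independent B \<Longrightarrow> span B = UNIV \<Longrightarrow> lin f \<Longrightarrow> tr f = trB B f"
  unfolding tr_def by (rule trB_basis) (auto simp: fbasis)

lemma tr_add: "tr (\<lambda>x. f x + g x) = tr f + tr g"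
  by (simp add: tr_def trB_def representation_add[OF fbasis(2)] fbasis(3) sum.distrib)

lemma tr_diff: "tr (\<lambda>x. f x - g x) = tr f - tr g"
  by (simp add: tr_def trB_def representation_diff[OF fbasis(2)] fbasis(3) sum_subtractf)

lemma tr_scale: "tr (\<lambda>x. sc c (f x)) = c * tr f"
  by (simp add: tr_def trB_def representation_scale[OF fbasis(2)] fbasis(3) sum_distrib_left)

lemma tr_commute:
  assumes f: "lin f" and g: "lin g" shows "tr (\<lambda>x. f (g x)) = tr (\<lambda>x. g (f x))"
proof -
  have e: "tr (\<lambda>x. f (g x)) = (\<Sum>b\<in>fbasis. \<Sum>c\<in>fbasis. representation fbasis (g b) c * representation fbasis (f c) b)"
    if "lin f" for f g
    unfolding tr_def trB_def
    by (intro sum.cong refl repr_expand) (use that fbasis in auto)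
  show ?thesis unfolding e[OF f] e[OF g] by (subst sum.swap) (simp add: mult.commute)
qed

text \<open>Nilpotency is stated pointwise, which is what generalised eigenspaces deliver;
  \<open>lnil_uniform\<close> recovers a common exponent from finite dimension.\<close>

definition lnil :: "('v \<Rightarrow> 'v) \<Rightarrow> bool" where "lnil f \<longleftrightarrow> (\<forall>x. \<exists>N. (f ^^ N) x = 0)"

lemma tr_lnil: "lin f \<Longrightarrow> lnil f \<Longrightarrow> tr f = 0"
  unfolding tr_def by (rule trB_nilpotent) (auto simp: fbasis lnil_def)

lemma lnil_comp:
  assumes f: "lin f" and n: "lnil f" and g: "lin g" and c: "\<And>x. f (g x) = g (f x)"
  shows "lnil (\<lambda>x. f (g x))" "lnil (\<lambda>x. g (f x))"
proof -
  have e: "((\<lambda>x. g (f x)) ^^ n) x = (g ^^ n) ((f ^^ n) x)" for n x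
  proof (induction n)
    case (Suc n)
    have "f ((g ^^ n) ((f ^^ n) x)) = (g ^^ n) (f ((f ^^ n) x))" by (rule comm_pow) (rule c)
    then show ?case using Suc by simp
  qed simp
  show l: "lnil (\<lambda>x. g (f x))"
    unfolding lnil_def e using n lin_0[OF lin_pow[OF g]] unfolding lnil_def by metis
  then show "lnil (\<lambda>x. f (g x))" by (simp add: c)
qed

lemma lnil_uniform:
  assumes f: "lin f" and n: "lnil f" shows "\<exists>N. \<forall>x. (f ^^ N) x = 0"
proof -
  obtain N where N: "\<And>b. (f ^^ N b) b = 0" using n unfolding lnil_def by metis
  define M where "M = Max (N ` fbasis)"
  have "(f ^^ M) b = 0" if "b \<in> fbasis" for b
    using pow_zero_mono[OF f N] that fbasis(1) by (simp add: M_def)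
  then have "fbasis \<subseteq> {x. (f ^^ M) x = 0}" by blast
  then have "span fbasis \<subseteq> {x. (f ^^ M) x = 0}"
    by (rule span_minimal) (intro subspace_kernel lin_pow f)
  then show ?thesis using fbasis(3) by blast
qed

section \<open>Simultaneous eigenvectors\<close>

text \<open>Applying D j - c k j to the sum kills the component at k and rescales the component at i
  by c i j - c k j, which is nonzero for a suitable j depending on i. Induction thus isolates all
  components other than k, and subtraction gives k. Components in eigenspaces and weight spaces are
  extracted by this lemma.\<close>

lemma separated_invariant:
  assumes "finite F" "subspace T"
    and "\<And>j x. j \<in> J \<Longrightarrow> x \<in> T \<Longrightarrow> D j x \<in> T" "\<And>j. j \<in> J \<Longrightarrow> lin (D j)"
    and "\<And>i j. i \<in> F \<Longrightarrow> j \<in> J \<Longrightarrow> D j (x i) = sc (c i j) (x i)"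
    and "\<And>i i'. i \<in> F \<Longrightarrow> i' \<in> F \<Longrightarrow> i \<noteq> i' \<Longrightarrow> \<exists>j\<in>J. c i j \<noteq> c i' j"
    and "sum x F \<in> T" "i \<in> F"
  shows "x i \<in> T"
  using assms(1,5-)
proof (induction F arbitrary: x i rule: finite_induct)
  case (insert k F)
  have xF: "x i \<in> T" if i: "i \<in> F" for i
  proof -
    obtain j where j: "j \<in> J" "c i j \<noteq> c k j" using insert.prems(2)[of i k] i insert.hyps by auto
    let ?s = "x k + sum x F"
    have s: "?s \<in> T" using insert by simp
    have "D j ?s - sc (c k j) ?s = (\<Sum>i\<in>F. D j (x i) - sc (c k j) (x i))"
      using insert.prems(1)[of k j] j(1)
      by (simp add: lin_add[OF assms(4)] lin_sum[OF assms(4)] scale_right_distrib scale_sum_right sum_subtractf)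
    also have "\<dots> = (\<Sum>i\<in>F. sc (c i j - c k j) (x i))"
      using insert.prems(1) j(1) by (intro sum.cong) (auto simp: scale_left_diff_distrib)
    finally have "(\<Sum>i\<in>F. sc (c i j - c k j) (x i)) = D j ?s - sc (c k j) ?s" by simp
    also have "\<dots> \<in> T" using s assms(2,3) j(1) by (intro subspace_diff subspace_scale) auto
    finally have "sc (c i j - c k j) (x i) \<in> T"
      by (intro insert.IH[of "\<lambda>i. sc (c i j - c k j) (x i)" i])
         (use insert.prems i in \<open>auto simp: lin_sc[OF assms(4)] mult.commute\<close>)
    then have "sc (1 / (c i j - c k j)) (sc (c i j - c k j) (x i)) \<in> T"
      by (rule subspace_scale[OF assms(2)])
    then show ?thesis using j(2) by simp
  qed
  have "x k = sum x (insert k F) - sum x F" using insert by simp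
  also have "\<dots> \<in> T"
    by (rule subspace_diff[OF assms(2) insert.prems(3) subspace_sum[OF assms(2) xF]])
  finally have "x k \<in> T" .
  then show ?case using xF insert.prems by blast
qed simp

lemma indep_fam_separated:
  assumes "\<And>j. j \<in> J \<Longrightarrow> lin (D j)"
    and "\<And>i j x. i \<in> I \<Longrightarrow> j \<in> J \<Longrightarrow> x \<in> W i \<Longrightarrow> D j x = sc (c i j) x"
    and "\<And>i i'. i \<in> I \<Longrightarrow> i' \<in> I \<Longrightarrow> i \<noteq> i' \<Longrightarrow> \<exists>j\<in>J. c i j \<noteq> c i' j"
  shows "indep_fam I W"
  unfolding indep_fam_def
proof (intro allI impI ballI)
  fix F x i assume F: "finite F" "F \<subseteq> I" "\<forall>i\<in>F. x i \<in> W i" "sum x F = 0" "i \<in> F"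
  \<comment> \<open>Directness is the instance T = {0} of the invariance lemma.\<close>
  have "x i \<in> {0}"
    by (rule separated_invariant[where J = J and D = D and c = c and F = F])
       (use F assms in \<open>auto simp: lin_0 subset_iff\<close>)
  then show "x i = 0" by simp
qed

definition diagble :: "('v \<Rightarrow> 'v) \<Rightarrow> bool" where
  "diagble D \<longleftrightarrow> span {x. \<exists>c. D x = sc c x} = UNIV"

lemma subspace_eigen: "lin D \<Longrightarrow> subspace {x. D x = sc c x}"
  using subspace_kernel[OF lin_shift, of D c] by simp

lemma eigen_decomp:
  assumes l: "lin D" and x: "x \<in> span {x \<in> S. \<exists>c. D x = sc c x}" and S: "subspace S"
  shows "\<exists>F y. finite F \<and> (\<forall>c. y c \<in> S \<and> D (y c) = sc c (y c)) \<and> x = sum y F"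
proof -
  have "{x \<in> S. \<exists>c. D x = sc c x} = (\<Union>c\<in>UNIV. S \<inter> {x. D x = sc c x})" by blast
  then have "x \<in> span (\<Union>c\<in>UNIV. S \<inter> {x. D x = sc c x})" using x by simp
  from span_family_decomp[OF _ this] show ?thesis
    using subspace_inter[OF S subspace_eigen[OF l]] by auto
qed

lemma eigen_component:
  assumes "finite F" "\<And>c. D (y c) = sc c (y c)" "subspace T" "lin D"
    "\<And>x. x \<in> T \<Longrightarrow> D x \<in> T" "sum y F \<in> T" "c \<in> F"
  shows "y c \<in> T"
proof (rule separated_invariant[where J = "{()}" and D = "\<lambda>_. D" and c = "\<lambda>c _. c", OF assms(1,3)])
  show "D x \<in> T" if "x \<in> T" for x by (rule assms(5)[OF that])
qed (use assms(2,4,6,7) in simp_all)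

lemma diagble_invariant:
  assumes l: "lin D" and d: "span {x. \<exists>c. D x = sc c x} = UNIV" and T: "subspace T" "\<And>x. x \<in> T \<Longrightarrow> D x \<in> T"
  shows "span {x \<in> T. \<exists>c. D x = sc c x} = T"
proof
  show "span {x \<in> T. \<exists>c. D x = sc c x} \<subseteq> T" using T(1) by (intro span_minimal) auto
  show "T \<subseteq> span {x \<in> T. \<exists>c. D x = sc c x}"
  proof
    fix x assume x: "x \<in> T"
    obtain F y where F: "finite F" "\<And>c. D (y c) = sc c (y c)" "x = sum y F"
      using eigen_decomp[OF l, of x UNIV] d by auto
    have "y c \<in> T" if "c \<in> F" for c
      by (rule eigen_component[OF F(1,2) T(1) l T(2)]) (use x F that in auto)
    then show "x \<in> span {x \<in> T. \<exists>c. D x = sc c x}"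
      unfolding F(3) using F(2) by (intro span_sum span_base) auto
  qed
qed

lemma simultaneous_diag:
  assumes "finite J" "\<And>j. j \<in> J \<Longrightarrow> lin (D j)" "\<And>j. j \<in> J \<Longrightarrow> diagble (D j)"
    "\<And>i j x. i \<in> J \<Longrightarrow> j \<in> J \<Longrightarrow> D i (D j x) = D j (D i x)"
  shows "span {x. \<forall>j\<in>J. \<exists>c. D j x = sc c x} = UNIV"
  using assms
proof (induction J rule: finite_induct)
  case empty
  show ?case by simp
next
  case (insert k J)
  have IH: "span {x. \<forall>j\<in>J. \<exists>c. D j x = sc c x} = UNIV" using insert by auto
  have "{x. \<forall>j\<in>J. \<exists>c. D j x = sc c x} \<subseteq> span {x. \<forall>j\<in>insert k J. \<exists>c. D j x = sc c x}"
  proof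
    fix x assume "x \<in> {x. \<forall>j\<in>J. \<exists>c. D j x = sc c x}"
    then have "\<forall>j\<in>J. \<exists>c. D j x = sc c x" by simp
    from bchoice[OF this] obtain c where c: "\<And>j. j \<in> J \<Longrightarrow> D j x = sc (c j) x" by blast
    have lk: "lin (D k)" using insert by blast
    obtain F y where F: "finite F" "\<And>c. D k (y c) = sc c (y c)" "x = sum y F"
      using eigen_decomp[OF lk, of x UNIV] insert.prems(2)[of k] by (auto simp: diagble_def)
    have "D j (y a) = sc (c j) (y a)" if j: "j \<in> J" and a: "a \<in> F" for a j
    proof -
      have lj: "lin (D j)" using insert j by blast
      have "y a \<in> {x. D j x = sc (c j) x}"
        by (rule eigen_component[OF F(1,2) subspace_eigen[OF lj] lk])
           (use insert.prems(3)[of j k] j a c F(3) in \<open>auto simp: lin_sc[OF lk]\<close>)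
      then show ?thesis by simp
    qed
    then have "y a \<in> {x. \<forall>j\<in>insert k J. \<exists>c. D j x = sc c x}" if "a \<in> F" for a
      using F(2)[of a] that by (auto intro: exI[of _ a] exI[of _ "c _"])
    then show "x \<in> span {x. \<forall>j\<in>insert k J. \<exists>c. D j x = sc c x}"
      unfolding F(3) by (intro span_sum span_base)
  qed
  then have "span {x. \<forall>j\<in>J. \<exists>c. D j x = sc c x} \<subseteq> span {x. \<forall>j\<in>insert k J. \<exists>c. D j x = sc c x}"
    by (rule span_minimal) simp
  then show ?case unfolding IH by blast
qed

end

context ac_space begin

text \<open>A Jordan block of size two with eigenvalue a would contribute m a^(m-1) to the m-th
  power, and this is nonzero in characteristic 0. So generalised eigenvectors are
  eigenvectors.\<close>

lemma finite_order_diagble: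
  assumes l: "lin f" and m: "0 < m" "f ^^ m = id"
  shows "diagble f"
proof -
  have sq: "f x = sc a x" if z: "f (f x - sc a x) = sc a (f x - sc a x)" for x a
  proof -
    define y where "y = f x - sc a x"
    have fy: "f y = sc a y" using z by (simp add: y_def)
    have fx: "f x = sc a x + y" by (simp add: y_def)
    have py: "(f ^^ n) y = sc (a ^ n) y" for n
      by (induction n) (simp_all add: lin_sc[OF l] fy mult.commute)
    \<comment> \<open>On x and y the map f is a Jordan block with eigenvector y, so the coefficient
      of y is the derivative of a^(n+1).\<close>
    have px: "(f ^^ Suc n) x = sc (a ^ Suc n) x + sc (of_nat (Suc n) * a ^ n) y" for n
    proof (induction n)
      case (Suc n)
      have "(f ^^ Suc (Suc n)) x = sc (a ^ Suc n) (sc a x + y) + sc (of_nat (Suc n) * a ^ n) (sc a y)"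
        unfolding funpow.simps(2)[of "Suc n"] o_apply Suc by (simp only: lin_add[OF l] lin_sc[OF l] fx fy)
      also have "\<dots> = sc (a ^ Suc (Suc n)) x + (sc (a ^ Suc n) y + sc (of_nat (Suc n) * a ^ Suc n) y)"
        by (simp add: scale_right_distrib mult.commute mult.left_commute)
      also have "sc (a ^ Suc n) y + sc (of_nat (Suc n) * a ^ Suc n) y = sc (of_nat (Suc (Suc n)) * a ^ Suc n) y"
        unfolding scale_left_distrib[symmetric] by (simp add: algebra_simps)
      finally show ?case .
    qed (simp add: fx)
    obtain n where n: "m = Suc n" using m(1) by (cases m) auto
    have "y = 0"
    proof (rule ccontr)
      assume y: "y \<noteq> 0"
      have "sc (a ^ m) y = sc 1 y" using py[of m] m(2) by simp
      then have am: "a ^ m = 1" using y scale_right_imp_eq by blast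
      have "x = x + sc (of_nat m * a ^ n) y" using px[of n, folded n] m(2) am by simp
      then have "sc (of_nat m * a ^ n) y = 0" by simp
      then have "of_nat m * a ^ n = 0" using y scale_eq_0_iff by blast
      then show False using am n m(1) by (auto simp del: of_nat_Suc)
    qed
    then show ?thesis by (simp add: y_def)
  qed
  have "f x = sc a x" if "((\<lambda>y. f y - sc a y) ^^ N) x = 0" for a N x
    using that
  proof (induction N arbitrary: x)
    case (Suc N)
    have "((\<lambda>y. f y - sc a y) ^^ N) (f x - sc a x) = 0"
      using Suc(2) by (simp only: funpow_Suc_right o_apply)
    then have "f (f x - sc a x) = sc a (f x - sc a x)" by (rule Suc.IH)
    then show ?case by (rule sq)
  qed (simp add: lin_0[OF l])
  then have "(\<Union>a. gspace f a) \<subseteq> {x. \<exists>c. f x = sc c x}" by (auto simp: gspace_def)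
  then have "span (\<Union>a. gspace f a) \<subseteq> span {x. \<exists>c. f x = sc c x}" by (rule span_mono)
  then show ?thesis using gspace_span[OF l] by (auto simp: diagble_def)
qed

end

context fd_space begin

lemma lin_eq_on_span:
  assumes "lin f" "lin g" "\<And>x. x \<in> X \<Longrightarrow> f x = g x" "x \<in> span X"
  shows "f x = g x"
proof -
  have "span X \<subseteq> {x. f x - g x = 0}"
    by (rule span_minimal) (use assms(3) subspace_kernel[OF lin_sub[OF assms(1,2)]] in auto)
  then show ?thesis using assms(4) by auto
qed

end

section \<open>Simple Lie algebras: first consequences of simplicity\<close>

locale simple_lie = ac_space sc
  for sc :: "'k::field_char_0 \<Rightarrow> 'v::ab_group_add \<Rightarrow> 'v" +
  fixes br :: "'v \<Rightarrow> 'v \<Rightarrow> 'v"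
  assumes simple: "fin_dim_simple_lie sc br"
begin

lemma lie: "lie_algebra sc br" using simple by (simp add: fin_dim_simple_lie_def)

lemma br_add_left: "br (x + y) w = br x w + br y w"
  and br_add_right: "br x (y + w) = br x y + br x w"
  and br_sc_left: "br (sc c x) y = sc c (br x y)"
  and br_sc_right: "br x (sc c y) = sc c (br x y)"
  and br_self [simp]: "br x x = 0"
  and jacobi_cyclic: "br x (br y w) + br y (br w x) + br w (br x y) = 0"
  using lie by (simp_all add: lie_algebra_def)

lemma lin_ad: "lin (br x)" by (rule linI) (simp_all add: br_add_right br_sc_right)

lemma lin_br_left: "lin (\<lambda>x. br x y)" by (rule linI) (simp_all add: br_add_left br_sc_left)

lemma br_0_left [simp]: "br 0 y = 0" and br_0_right [simp]: "br x 0 = 0"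
  using lin_0[OF lin_br_left] lin_0[OF lin_ad] by auto

lemma br_diff_left: "br (x - y) w = br x w - br y w"
  and br_diff_right: "br x (y - w) = br x y - br x w"
  using lin_diff[OF lin_br_left] lin_diff[OF lin_ad] by auto

lemma br_neg_left: "br (- x) w = - br x w"
  and br_neg_right: "br x (- w) = - br x w"
  using lin_neg[OF lin_br_left] lin_neg[OF lin_ad] by auto

lemma br_sum_left: "br (sum f A) w = (\<Sum>a\<in>A. br (f a) w)"
  and br_sum_right: "br x (sum f A) = (\<Sum>a\<in>A. br x (f a))"
  using lin_sum[OF lin_br_left] lin_sum[OF lin_ad] by auto

lemma br_anti: "br x y = - br y x"
proof -
  have "br (x + y) (x + y) = br x x + br y x + (br x y + br y y)"
    by (simp only: br_add_left br_add_right)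
  then have "br x y + br y x = 0" by (simp add: add.commute)
  then show ?thesis by (simp add: eq_neg_iff_add_eq_0)
qed

lemma jacobi: "br x (br y w) = br (br x y) w + br y (br x w)"
proof -
  have B: "br y (br w x) = - br y (br x w)" using br_anti[of w x] by (simp add: br_neg_right)
  have "br x (br y w) - (br (br x y) w + br y (br x w)) = 0"
    using jacobi_cyclic[of x y w] B br_anti[of w "br x y"] by (simp add: algebra_simps)
  then show ?thesis by simp
qed

lemma ideal_trivial:
  assumes "subspace I" "\<And>x i. i \<in> I \<Longrightarrow> br x i \<in> I" shows "I = {0} \<or> I = UNIV"
  using simple assms unfolding fin_dim_simple_lie_def lie_ideal_def by blast

lemma nonabelian: "\<exists>x y. br x y \<noteq> 0"
  using simple unfolding fin_dim_simple_lie_def by blast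

lemma center_trivial: assumes "\<And>x. br x w = 0" shows "w = 0"
proof -
  let ?Z = "{w. \<forall>x. br x w = 0}"
  have "subspace ?Z" by (rule subspaceI) (auto simp: br_add_right br_sc_right)
  then have "?Z = {0} \<or> ?Z = UNIV" by (rule ideal_trivial) simp
  moreover have "?Z \<noteq> UNIV" using nonabelian by auto
  ultimately have "?Z = {0}" by simp
  then show ?thesis using assms by blast
qed

lemma perfect: "span (\<Union>x. range (br x)) = UNIV"
proof -
  let ?I = "span (\<Union>x. range (br x))"
  have "?I = {0} \<or> ?I = UNIV"
  proof (rule ideal_trivial)
    show "br x i \<in> ?I" for x i by (rule span_base) blast
  qed simp
  moreover have "?I \<noteq> {0}"
  proof
    assume z: "?I = {0}"
    obtain x y where "br x y \<noteq> 0" using nonabelian by auto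
    moreover have "br x y \<in> ?I" by (rule span_base) blast
    ultimately show False using z by simp
  qed
  ultimately show ?thesis by simp
qed

section \<open>Engel's theorem\<close>

definition subalg :: "'v set \<Rightarrow> bool" where
  "subalg K \<longleftrightarrow> subspace K \<and> (\<forall>x\<in>K. \<forall>y\<in>K. br x y \<in> K)"

text \<open>Invariant pairs \<open>U \<subset> W\<close> stand in for the quotient modules \<open>W/U\<close>.\<close>

definition engel :: "'v set \<Rightarrow> 'v set \<Rightarrow> bool" where
  "engel C K \<longleftrightarrow> (\<forall>U W. subspace U \<longrightarrow> subspace W \<longrightarrow> U \<subset> W \<longrightarrow> W \<subseteq> C \<longrightarrow>
     (\<forall>k\<in>K. \<forall>u\<in>U. br k u \<in> U) \<longrightarrow> (\<forall>k\<in>K. \<forall>w\<in>W. br k w \<in> W) \<longrightarrow>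
     (\<exists>w. w \<in> W \<and> w \<notin> U \<and> (\<forall>k\<in>K. br k w \<in> U)))"

lemma engelD:
  assumes "engel C K" "subspace U" "subspace W" "U \<subset> W" "W \<subseteq> C"
    "\<And>k u. k \<in> K \<Longrightarrow> u \<in> U \<Longrightarrow> br k u \<in> U" "\<And>k w. k \<in> K \<Longrightarrow> w \<in> W \<Longrightarrow> br k w \<in> W"
  obtains w where "w \<in> W" "w \<notin> U" "\<And>k. k \<in> K \<Longrightarrow> br k w \<in> U"
proof -
  have "\<exists>w. w \<in> W \<and> w \<notin> U \<and> (\<forall>k\<in>K. br k w \<in> U)"
    using assms(1)[unfolded engel_def, rule_format, OF assms(2-5)] assms(6,7) by blast
  then show thesis using that by blast
qed

text \<open>Because y normalises K, ad y preserves the vectors of W that K sends into U. The last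
  iterate of such a vector under ad y that is still outside U is sent into U by K and by y.\<close>

lemma engel_step:
  assumes K: "subalg K" "engel C K" and yC: "y \<in> C" and C: "subalg C"
    and yK: "\<And>k. k \<in> K \<Longrightarrow> br k y \<in> K"
    and nil: "\<And>x. x \<in> C \<Longrightarrow> \<exists>N. (br y ^^ N) x = 0"
  shows "engel C (span (insert y K))"
  unfolding engel_def
proof (intro allI impI)
  let ?K = "span (insert y K)"
  fix U W assume U: "subspace U" and W: "subspace W" and UW: "U \<subset> W" "W \<subseteq> C"
    and iU: "\<forall>k\<in>?K. \<forall>u\<in>U. br k u \<in> U" and iW: "\<forall>k\<in>?K. \<forall>w\<in>W. br k w \<in> W"
  have KK: "k \<in> ?K" if "k \<in> K" for k using that by (intro span_base) auto
  have y: "y \<in> ?K" by (intro span_base) auto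
  obtain w1 where w1: "w1 \<in> W" "w1 \<notin> U" "\<And>k. k \<in> K \<Longrightarrow> br k w1 \<in> U"
    using engelD[OF K(2) U W UW] iU iW KK by auto
  have inv: "(br y ^^ n) w1 \<in> W \<and> (\<forall>k\<in>K. br k ((br y ^^ n) w1) \<in> U)" for n
  proof (induction n)
    case (Suc n)
    let ?w = "(br y ^^ n) w1"
    have "br k (br y ?w) \<in> U" if k: "k \<in> K" for k
    proof -
      have "br k (br y ?w) = br (br k y) ?w + br y (br k ?w)" by (rule jacobi)
      also have "\<dots> \<in> U" using Suc yK[OF k] k iU y by (intro subspace_add[OF U]) auto
      finally show ?thesis .
    qed
    then show ?case using Suc iW y by auto
  qed (use w1 in auto)
  define n where "n = (LEAST n. (br y ^^ n) w1 \<in> U)"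
  have ex: "\<exists>n. (br y ^^ n) w1 \<in> U"
  proof -
    obtain N where "(br y ^^ N) w1 = 0" using nil[of w1] w1(1) UW by auto
    then show ?thesis using subspace_0[OF U] by metis
  qed
  have n: "(br y ^^ n) w1 \<in> U" unfolding n_def by (rule LeastI_ex[OF ex])
  then obtain m where m: "n = Suc m" using w1(2) by (cases n) auto
  define w where "w = (br y ^^ m) w1"
  have wU: "w \<notin> U" using not_less_Least[of m "\<lambda>n. (br y ^^ n) w1 \<in> U"] m
    by (auto simp: n_def w_def)
  have yw: "br y w \<in> U" using n by (simp add: m w_def)
  have "?K \<subseteq> {k. br k w \<in> U}"
    by (rule span_minimal) (use inv[of m] yw subspace_vimage[OF lin_br_left U] in \<open>auto simp: w_def\<close>)
  then show "\<exists>w. w \<in> W \<and> w \<notin> U \<and> (\<forall>k\<in>?K. br k w \<in> U)"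
    using wU inv[of m] by (intro exI[of _ w]) (auto simp: w_def)
qed

text \<open>A subalgebra K of greatest dimension among those satisfying the statement must be C:
  applied to the pair K \<subset> C, the statement for K gives a vector outside K that normalises K,
  and \<open>engel_step\<close> enlarges K by it.\<close>

lemma engel:
  assumes C: "subalg C" and nil: "\<And>x y. x \<in> C \<Longrightarrow> y \<in> C \<Longrightarrow> \<exists>N. (br y ^^ N) x = 0"
  shows "engel C C"
proof -
  define G where "G = {K. subalg K \<and> K \<subseteq> C \<and> engel C K}"
  have sC: "subspace C" using C by (simp add: subalg_def)
  have "{0} \<in> G"
    unfolding G_def engel_def subalg_def using subspace_0[OF sC]
    by (auto dest: subspace_0)
  then obtain K where K: "K \<in> G" and max: "\<And>K'. K' \<in> G \<Longrightarrow> dim K' \<le> dim K"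
    using ex_has_greatest_nat[of "\<lambda>K. K \<in> G" "{0}" dim "Suc dimension"] dim_subset_UNIV
    by (auto simp: less_Suc_eq_le)
  have K': "subalg K" "K \<subseteq> C" "engel C K" using K by (auto simp: G_def)
  have sK: "subspace K" using K' by (simp add: subalg_def)
  have "K = C"
  proof (rule ccontr)
    assume "K \<noteq> C"
    then have "K \<subset> C" using K' by blast
    then obtain y where y: "y \<in> C" "y \<notin> K" "\<And>k. k \<in> K \<Longrightarrow> br k y \<in> K"
    proof (rule engelD[OF K'(3) sK sC _ order_refl])
      show "br k u \<in> K" if "k \<in> K" "u \<in> K" for k u using that K'(1) by (simp add: subalg_def)
      show "br k u \<in> C" if "k \<in> K" "u \<in> C" for k u using that K'(2) C by (auto simp: subalg_def)
    qed (assumption | blast)+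
    let ?K = "span (insert y K)"
    have "subalg ?K"
      unfolding subalg_def
    proof (intro conjI ballI)
      have 1: "br k x \<in> K" if k: "k \<in> K" and x: "x \<in> ?K" for k x
      proof -
        have "?K \<subseteq> {x. br k x \<in> K}"
          by (rule span_minimal) (use k y K'(1) subspace_vimage[OF lin_ad sK] in \<open>auto simp: subalg_def\<close>)
        then show ?thesis using x by auto
      qed
      have 2: "br y x \<in> K" if x: "x \<in> ?K" for x
      proof -
        have "br y k \<in> K" if "k \<in> K" for k
          using subspace_neg[OF sK y(3)[OF that]] br_anti[of y k] by simp
        then have "?K \<subseteq> {x. br y x \<in> K}"
          by (intro span_minimal) (use subspace_0[OF sK] subspace_vimage[OF lin_ad sK] in auto)
        then show ?thesis using x by auto
      qed
      fix a b assume a: "a \<in> ?K" and b: "b \<in> ?K"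
      have "?K \<subseteq> {a. br a b \<in> K}"
        by (rule span_minimal) (use 1 2 b subspace_vimage[OF lin_br_left sK] in auto)
      then have "br a b \<in> K" using a by auto
      then show "br a b \<in> ?K" by (intro span_base) auto
    qed simp
    moreover have "?K \<subseteq> C" using y(1) K'(2) sC by (intro span_minimal) auto
    moreover have "engel C ?K"
      by (rule engel_step[OF K'(1,3) y(1) C y(3)]) (use nil y(1) in auto)
    ultimately have "?K \<in> G" by (simp add: G_def)
    then have "dim ?K \<le> dim K" by (rule max)
    moreover have "dim K < dim ?K"
    proof (rule dim_psubset)
      have "span K = K" using sK by simp
      moreover have "K \<subseteq> ?K" "y \<in> ?K" by (auto intro: span_base)
      ultimately show "span K \<subset> span ?K" unfolding span_span using y(2) by blast
    qed
    ultimately show False by simp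
  qed
  then show ?thesis using K' by simp
qed

section \<open>Derivations and the Killing form\<close>

definition deriv_lie :: "('v \<Rightarrow> 'v) \<Rightarrow> bool" where
  "deriv_lie d \<longleftrightarrow> lin d \<and> (\<forall>x y. d (br x y) = br (d x) y + br x (d y))"

lemma deriv_ad: "deriv_lie (br x)"
  unfolding deriv_lie_def using lin_ad jacobi by blast

text \<open>By the Leibniz rule, D - a - b applied to [x, y] gives [(D - a) x, y] + [x, (D - b) y].
  After i + j applications, every term has either its left factor hit i times or its right factor
  hit j times.\<close>

lemma gspace_br:
  assumes D: "deriv_lie D" and x: "x \<in> gspace D a" and y: "y \<in> gspace D b"
  shows "br x y \<in> gspace D (a + b)"
proof -
  have l: "lin D" and d: "\<And>x y. D (br x y) = br (D x) y + br x (D y)"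
    using D by (auto simp: deriv_lie_def)
  let ?E = "\<lambda>c y. D y - sc c y"
  have e: "?E (a + b) (br x y) = br (?E a x) y + br x (?E b y)" for x y
    by (simp add: d br_diff_left br_diff_right br_sc_left br_sc_right scale_left_distrib)
  obtain i j where "(?E a ^^ i) x = 0" "(?E b ^^ j) y = 0"
    using x y by (auto simp: gspace_def)
  then have "(?E (a+b) ^^ (i + j)) (br x y) = 0"
  proof (induction "i + j" arbitrary: i j x y)
    case 0
    then show ?case by simp
  next
    case (Suc n)
    show ?case
    proof (cases "i = 0 \<or> j = 0")
      case True
      then have "br x y = 0" using Suc.prems by auto
      then show ?thesis using lin_0[OF lin_pow[OF lin_shift[OF l]]] by auto
    next
      case False
      then obtain i' j' where ij: "i = Suc i'" "j = Suc j'" by (meson not0_implies_Suc)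
      have xi: "(?E a ^^ i') (?E a x) = 0" and yj: "(?E b ^^ j') (?E b y) = 0"
        using Suc.prems unfolding ij by (simp_all only: funpow_Suc_right o_apply)
      have "(?E (a+b) ^^ (i' + j)) (br (?E a x) y) = 0" "(?E (a+b) ^^ (i + j')) (br x (?E b y)) = 0"
        using Suc.hyps(1)[OF _ xi Suc.prems(2)] Suc.hyps(1)[OF _ Suc.prems(1) yj] Suc.hyps(2) ij by auto
      then have "(?E (a+b) ^^ n) (br (?E a x) y) = 0" "(?E (a+b) ^^ n) (br x (?E b y)) = 0"
        using Suc.hyps(2) ij by simp_all
      then have "(?E (a+b) ^^ n) (?E (a+b) (br x y)) = 0"
        unfolding e by (simp only: lin_add[OF lin_pow[OF lin_shift[OF l]]]) simp
      then show ?thesis unfolding Suc.hyps(2)[symmetric] by (simp only: funpow_Suc_right o_apply)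
    qed
  qed
  then show ?thesis by (auto simp: gspace_def)
qed

text \<open>The semisimple part of a derivation, and all its images under additive maps of the
  eigenvalues, are again derivations.\<close>

lemma deriv_of_spectrum:
  assumes D: "deriv_lie D" and s: "lin s" "\<And>a x. x \<in> gspace D a \<Longrightarrow> s x = sc (f a) x"
    and f: "\<And>a b. f (a + b) = f a + f b"
  shows "deriv_lie s"
proof -
  have l: "lin D" using D by (simp add: deriv_lie_def)
  have 1: "s (br x y) = br (s x) y + br x (s y)" if x: "x \<in> gspace D a" and y: "y \<in> gspace D b" for x y a b
    using s(2)[OF gspace_br[OF D x y]] s(2)[OF x] s(2)[OF y] f
    by (simp add: br_sc_left br_sc_right scale_left_distrib)
  have lr: "lin (\<lambda>y. br (s x) y + br x (s y))" for x
    by (rule linI) (simp_all add: br_add_right br_sc_right lin_add[OF s(1)] lin_sc[OF s(1)] algebra_simps)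
  have ll: "lin (\<lambda>x. br (s x) y + br x (s y))" for y
    by (rule linI) (simp_all add: br_add_left br_sc_left lin_add[OF s(1)] lin_sc[OF s(1)] algebra_simps)
  have 2: "s (br x y) = br (s x) y + br x (s y)" if x: "x \<in> gspace D a" for x y a
  proof (rule lin_eq_on_span[where X = "\<Union>b. gspace D b" and f = "\<lambda>y. s (br x y)", OF _ lr])
    show "lin (\<lambda>y. s (br x y))" by (rule lin_comp[OF s(1) lin_ad])
    show "s (br x y) = br (s x) y + br x (s y)" if "y \<in> (\<Union>b. gspace D b)" for y
      using 1[OF x] that by auto
  qed (simp add: gspace_span[OF l])
  have "s (br x y) = br (s x) y + br x (s y)" for x y
  proof (rule lin_eq_on_span[where X = "\<Union>b. gspace D b" and f = "\<lambda>x. s (br x y)", OF _ ll])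
    show "lin (\<lambda>x. s (br x y))" by (rule lin_comp[OF s(1) lin_br_left])
    show "s (br x y) = br (s x) y + br x (s y)" if "x \<in> (\<Union>b. gspace D b)" for x
      using 2 that by auto
  qed (simp add: gspace_span[OF l])
  then show ?thesis using s(1) by (simp add: deriv_lie_def)
qed

lemma spectral_map:
  assumes l: "lin D"
  shows "\<exists>s. lin s \<and> (\<forall>a. \<forall>x\<in>gspace D a. s x = sc (f a) x)"
  using diag_map[of UNIV "gspace D" f] subspace_gspace[OF l] gspace_span[OF l] indep_gspace[OF l] by simp

text \<open>On the generalised eigenspace of a, the map s is the scalar a, so D - s agrees there
  with the nilpotent D - a.\<close>

lemma semisimple_part:
  assumes l: "lin D" and s: "lin s" "\<And>a x. x \<in> gspace D a \<Longrightarrow> s x = sc a x"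
  shows "lnil (\<lambda>x. D x - s x)"
  unfolding lnil_def
proof
  fix x
  let ?n = "\<lambda>x. D x - s x"
  have ln: "lin ?n" using lin_sub[OF l s(1)] .
  have sub: "subspace {x. \<exists>N. (?n ^^ N) x = 0}"
    using subspace_gspace[OF ln, of 0] by (simp add: gspace_def)
  have *: "(?n ^^ N) x = ((\<lambda>y. D y - sc a y) ^^ N) x \<and> (?n ^^ N) x \<in> gspace D a" if "x \<in> gspace D a" for x a N
  proof (induction N)
    case (Suc N)
    let ?y = "(?n ^^ N) x"
    have y: "?y \<in> gspace D a" by (rule conjunct2[OF Suc])
    have ny: "?n ?y = D ?y - sc a ?y" using s(2)[OF y] by simp
    have "D ?y - sc a ?y \<in> gspace D a"
      by (rule gspace_comm[OF l lin_shift[OF l] _ y]) (simp add: lin_diff[OF l] lin_sc[OF l])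
    moreover have "(?n ^^ Suc N) x = ?n ?y" by simp
    moreover have "((\<lambda>y. D y - sc a y) ^^ Suc N) x = D ?y - sc a ?y" using Suc by simp
    ultimately show ?case by (simp only: ny)
  qed (use that in simp)
  have "(\<Union>a. gspace D a) \<subseteq> {x. \<exists>N. (?n ^^ N) x = 0}"
  proof clarify
    fix x a assume x: "x \<in> gspace D a"
    then obtain N where "((\<lambda>y. D y - sc a y) ^^ N) x = 0" by (auto simp: gspace_def)
    then show "\<exists>N. (?n ^^ N) x = 0" using *[OF x, of N] by auto
  qed
  then have "span (\<Union>a. gspace D a) \<subseteq> {x. \<exists>N. (?n ^^ N) x = 0}" by (rule span_minimal[OF _ sub])
  then show "\<exists>N. (?n ^^ N) x = 0" using gspace_span[OF l] by auto
qed

definition kap :: "'v \<Rightarrow> 'v \<Rightarrow> 'k" where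
  "kap x y = tr (\<lambda>v. br x (br y v))"

lemma kap_sym: "kap x y = kap y x"
  unfolding kap_def by (rule tr_commute[OF lin_ad lin_ad])

lemma kap_add_left: "kap (x + y) w = kap x w + kap y w"
  by (simp add: kap_def br_add_left tr_add)

lemma kap_sc_left: "kap (sc c x) w = c * kap x w"
  by (simp add: kap_def br_sc_left tr_scale)

lemma kap_add_right: "kap w (x + y) = kap w x + kap w y"
  by (simp add: kap_sym[of w] kap_add_left)

lemma kap_sc_right: "kap w (sc c x) = c * kap w x"
  by (simp add: kap_sym[of w] kap_sc_left)

lemma kap_0_left [simp]: "kap 0 w = 0" and kap_0_right [simp]: "kap w 0 = 0"
  using kap_sc_left[of 0 0 w] kap_sc_right[of w 0 0] by simp_all

lemma kap_diff_left: "kap (x - y) w = kap x w - kap y w"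
  using kap_add_left[of "x - y" y w] by simp

lemma kap_sum_left: "kap (sum f A) w = (\<Sum>a\<in>A. kap (f a) w)"
  by (induction A rule: infinite_finite_induct) (simp_all add: kap_add_left)

lemma kap_sum_right: "kap w (sum f A) = (\<Sum>a\<in>A. kap w (f a))"
  by (simp add: kap_sym[of w] kap_sum_left)

text \<open>Cyclic invariance of the trace moves the commutator from [ad y, ad w] onto d and ad y,
  and the commutator of d with ad y is ad (d y). With d inner this is invariance of the Killing
  form; for general d it drives both Cartan's criterion and the innerness of derivations.\<close>

lemma tr_deriv_ad:
  assumes d: "deriv_lie d" shows "tr (\<lambda>v. d (br (br y w) v)) = kap (d y) w"
proof -
  have l: "lin d" and dd: "\<And>x y. d (br x y) = br (d x) y + br x (d y)"
    using d by (auto simp: deriv_lie_def)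
  have "tr (\<lambda>v. d (br (br y w) v)) = tr (\<lambda>v. d (br y (br w v)) - d (br w (br y v)))"
    by (simp add: jacobi[of y w] lin_diff[OF l] lin_add[OF l])
  also have "\<dots> = tr (\<lambda>v. d (br y (br w v))) - tr (\<lambda>v. (\<lambda>v. d (br w v)) (br y v))" by (simp add: tr_diff)
  also have "tr (\<lambda>v. (\<lambda>v. d (br w v)) (br y v)) = tr (\<lambda>v. br y (d (br w v)))"
    by (rule tr_commute) (auto intro: lin_comp l lin_ad)
  also have "tr (\<lambda>v. d (br y (br w v))) - \<dots> = tr (\<lambda>v. br (d y) (br w v))"
    unfolding tr_diff[symmetric] by (simp add: dd)
  finally show ?thesis by (simp add: kap_def)
qed

lemma kap_invariant: "kap (br x y) w = kap x (br y w)"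
proof -
  have "kap (br y x) w = kap y (br x w)" for x y w
    using tr_deriv_ad[OF deriv_ad, of y x w] by (simp add: kap_def)
  then show ?thesis .
qed

end

section \<open>Rational-valued functionals on the ground field\<close>

definition rat_linear :: "('k::field_char_0 \<Rightarrow> rat) \<Rightarrow> bool" where
  "rat_linear f \<longleftrightarrow> (\<forall>x y. f (x + y) = f x + f y) \<and> (\<forall>q x. f (of_rat q * x) = q * f x)"

text \<open>The field is viewed as a vector space over the rationals, and {x} is extended to a
  basis.\<close>

lemma rat_linear_separates:
  assumes x: "(x::'k::field_char_0) \<noteq> 0" shows "\<exists>f. rat_linear f \<and> f x \<noteq> 0"
proof -
  interpret v: vector_space "\<lambda>q (x::'k). of_rat q * x"
    by unfold_locales (simp_all add: distrib_left distrib_right of_rat_add of_rat_mult)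
  interpret w: vector_space "(*) :: rat \<Rightarrow> rat \<Rightarrow> rat"
    by unfold_locales (simp_all add: distrib_left distrib_right)
  interpret p: vector_space_pair "\<lambda>q (x::'k). of_rat q * x" "(*) :: rat \<Rightarrow> rat \<Rightarrow> rat"
    by unfold_locales
  have "v.independent {x}" using x by simp
  from p.linear_independent_extend[OF this, of "\<lambda>_. 1"] obtain g
    where g: "Vector_Spaces.linear (\<lambda>q (x::'k). of_rat q * x) (*) g" "\<forall>x\<in>{x}. g x = (1::rat)" by (elim exE conjE)
  show ?thesis using g by (intro exI[of _ g]) (simp add: Vector_Spaces.linear_iff rat_linear_def)
qed

text \<open>One functional that is nonzero on all prescribed scalars serves twice: for the sum of
  squares in Cartan's criterion and for a height function on the weights.\<close>

lemma rat_linear_separates_finite: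
  assumes "finite X" "(0::'k::field_char_0) \<notin> X"
  shows "\<exists>f. rat_linear f \<and> (\<forall>x\<in>X. f x \<noteq> 0)"
  using assms
proof (induction X rule: finite_induct)
  case empty
  then show ?case by (intro exI[of _ "\<lambda>_. 0"]) (simp add: rat_linear_def)
next
  case (insert x X)
  then obtain f where f: "rat_linear f" "\<forall>x\<in>X. f x \<noteq> 0" by auto
  obtain g where g: "rat_linear g" "g x \<noteq> 0" using rat_linear_separates[of x] insert.prems by auto
  \<comment> \<open>Only finitely many t make f + t g vanish somewhere on the set: where g y is
    nonzero the bad value is - f y / g y, and where g y = 0 the value f y is already
    nonzero.\<close>
  have "finite (insert 0 ((\<lambda>y. - f y / g y) ` insert x X))" using insert.hyps by simp
  then obtain t where t: "t \<notin> insert 0 ((\<lambda>y. - f y / g y) ` insert x X)"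
    using ex_new_if_finite[OF infinite_UNIV_char_0] by blast
  have ne: "f y + t * g y \<noteq> 0" if "y \<in> insert x X" for y
  proof
    assume z: "f y + t * g y = 0"
    show False
    proof (cases "g y = 0")
      case True
      then show False using z f(2) g(2) that by auto
    next
      case False
      then have "t = - f y / g y" using z by (simp add: field_simps eq_neg_iff_add_eq_0)
      then show False using t that by auto
    qed
  qed
  have "rat_linear (\<lambda>y. f y + t * g y)"
    using f(1) g(1) by (simp add: rat_linear_def algebra_simps)
  then show ?case using ne by (intro exI[of _ "\<lambda>y. f y + t * g y"]) simp
qed

section \<open>Finite direct sums, projections and common nonzeros of functionals\<close>

context fd_space begin

lemma diagble_sq:
  assumes l: "lin D" and d: "diagble D" and z: "D (D x) = 0" shows "D x = 0"
proof -
  obtain F y where F: "finite F" "\<And>c. D (y c) = sc c (y c)" "x = sum y F"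
    using eigen_decomp[OF l, of x UNIV] d by (auto simp: diagble_def)
  have "D (y c) = 0" if "c \<in> F" for c
  proof -
    have "y c \<in> {x. D (D x) = 0}"
      by (rule eigen_component[OF F(1,2) subspace_kernel[OF lin_comp[OF l l]] l])
         (use z F that lin_0[OF l] in auto)
    then have "sc (c * c) (y c) = 0" by (simp add: F(2) lin_sc[OF l])
    then show ?thesis by (simp add: F(2))
  qed
  then show ?thesis by (simp add: F(3) lin_sum[OF l])
qed

text \<open>The vectors of a finite basis involve finitely many summands, and these already span. A
  vector of any further summand is then a sum of vectors from them, so directness makes it
  zero.\<close>

lemma finitely_many_summands:
  assumes sub: "\<And>i. i \<in> I \<Longrightarrow> subspace (W i)" and sp: "span (\<Union>i\<in>I. W i) = UNIV"
    and ind: "indep_fam I W"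
  shows "finite {i\<in>I. W i \<noteq> {0}}"
proof -
  have "\<forall>b. \<exists>F y. finite F \<and> F \<subseteq> I \<and> (\<forall>i\<in>I. y i \<in> W i) \<and> (\<forall>i. i \<notin> F \<longrightarrow> y i = 0) \<and> b = sum y F"
  proof
    fix b :: 'v
    show "\<exists>F y. finite F \<and> F \<subseteq> I \<and> (\<forall>i\<in>I. y i \<in> W i) \<and> (\<forall>i. i \<notin> F \<longrightarrow> y i = 0) \<and> b = sum y F"
      by (rule span_family_decomp[OF sub]) (simp_all add: sp)
  qed
  from choice[OF this] obtain F where
    "\<forall>b. \<exists>y. finite (F b) \<and> F b \<subseteq> I \<and> (\<forall>i\<in>I. y i \<in> W i) \<and> (\<forall>i. i \<notin> F b \<longrightarrow> y i = 0) \<and> b = sum y (F b)" ..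
  then have F: "\<And>b. finite (F b)" "\<And>b. F b \<subseteq> I" "\<And>b. \<exists>y. (\<forall>i\<in>I. y i \<in> W i) \<and> b = sum y (F b)"
    by metis+
  define G where "G = (\<Union>b\<in>fbasis. F b)"
  have G: "finite G" "G \<subseteq> I" using F(1,2) fbasis(1) by (auto simp: G_def)
  have "b \<in> span (\<Union>i\<in>G. W i)" if b: "b \<in> fbasis" for b
  proof -
    obtain y where y: "\<forall>i\<in>I. y i \<in> W i" "b = sum y (F b)" using F(3)[of b] by (elim exE conjE)
    have "y i \<in> span (\<Union>i\<in>G. W i)" if "i \<in> F b" for i
    proof (rule span_base)
      show "y i \<in> (\<Union>i\<in>G. W i)" using y(1) F(2)[of b] that b unfolding G_def by blast
    qed
    then have "sum y (F b) \<in> span (\<Union>i\<in>G. W i)" by (rule span_sum)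
    then show ?thesis by (subst y(2))
  qed
  then have "span fbasis \<subseteq> span (\<Union>i\<in>G. W i)" by (intro span_minimal) auto
  then have G': "x \<in> span (\<Union>i\<in>G. W i)" for x by (simp add: fbasis subset_iff)
  have *: "x = 0" if i: "i \<in> I" "i \<notin> G" and x: "x \<in> W i" for i x
  proof -
    have subG: "subspace (W j)" if "j \<in> G" for j using that G(2) sub by blast
    have "\<exists>E y. finite E \<and> E \<subseteq> G \<and> (\<forall>j\<in>G. y j \<in> W j) \<and> (\<forall>j. j \<notin> E \<longrightarrow> y j = 0) \<and> x = sum y E"
      by (rule span_family_decomp[OF _ G']) (rule subG)
    then obtain E y where E: "finite E" "E \<subseteq> G" "\<forall>j\<in>G. y j \<in> W j" "x = sum y E"
      by (elim exE conjE)
    define y' where "y' = y(i := - x)"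
    have iE: "i \<notin> E" using i E by blast
    have "sum y' (insert i E) = y' i + sum y' E" using E(1) iE by (rule sum.insert)
    also have "sum y' E = sum y E" by (rule sum.cong) (use iE in \<open>auto simp: y'_def\<close>)
    finally have s0: "sum y' (insert i E) = 0" using E(4) by (simp add: y'_def)
    have yW: "y' j \<in> W j" if "j \<in> insert i E" for j
    proof (cases "j = i")
      case True
      then show ?thesis using subspace_neg[OF sub[OF i(1)] x] by (simp add: y'_def)
    next
      case False
      then have "j \<in> E" using that by blast
      then have "y j \<in> W j" using E(2,3) by blast
      then show ?thesis using False by (simp add: y'_def)
    qed
    have "insert i E \<subseteq> I" using E(2) G(2) i(1) by blast
    from indep_famD[OF ind _ this yW s0] have "y' i = 0" using E(1) by simp
    then show ?thesis by (simp add: y'_def)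
  qed
  have "{i\<in>I. W i \<noteq> {0}} \<subseteq> G"
  proof clarify
    fix i assume i: "i \<in> I" "W i \<noteq> {0}"
    have "0 \<in> W i" by (rule subspace_0[OF sub[OF i(1)]])
    then obtain x where "x \<in> W i" "x \<noteq> 0" using i(2) by blast
    then show "i \<in> G" using *[OF i(1)] by blast
  qed
  then show ?thesis using G(1) by (rule finite_subset)
qed

lemma projections_exist:
  assumes I: "finite I" and sub: "\<And>i. i \<in> I \<Longrightarrow> subspace (W i)" and sp: "span (\<Union>i\<in>I. W i) = UNIV"
    and ind: "indep_fam I W"
  obtains pr where "\<And>i. lin (pr i)" "\<And>i x. i \<in> I \<Longrightarrow> pr i x \<in> W i"
    "\<And>x. (\<Sum>i\<in>I. pr i x) = x" "\<And>i j x. i \<in> I \<Longrightarrow> x \<in> W i \<Longrightarrow> pr j x = (if i = j then x else 0)"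
proof -
  have "\<forall>j. \<exists>T. lin T \<and> (\<forall>i\<in>I. \<forall>x\<in>W i. T x = sc (if i = j then 1 else 0) x)"
  proof
    fix j
    show "\<exists>T. lin T \<and> (\<forall>i\<in>I. \<forall>x\<in>W i. T x = sc (if i = j then 1 else 0) x)"
      by (rule diag_map[OF sub sp ind])
  qed
  from choice[OF this] obtain pr where
    "\<forall>j. lin (pr j) \<and> (\<forall>i\<in>I. \<forall>x\<in>W i. pr j x = sc (if i = j then 1 else 0) x)" ..
  then have pr: "\<And>j. lin (pr j)" "\<And>i j x. i \<in> I \<Longrightarrow> x \<in> W i \<Longrightarrow> pr j x = sc (if i = j then 1 else 0) x"
    by simp_all
  have p: "pr j x = (if i = j then x else 0)" if "i \<in> I" "x \<in> W i" for i j x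
    using pr(2)[OF that] by simp
  have "pr j x \<in> W j" if j: "j \<in> I" for j x
  proof -
    have "span (\<Union>i\<in>I. W i) \<subseteq> {x. pr j x \<in> W j}"
    proof (rule span_minimal)
      show "(\<Union>i\<in>I. W i) \<subseteq> {x. pr j x \<in> W j}" using subspace_0[OF sub[OF j]] by (auto simp: p)
      show "subspace {x. pr j x \<in> W j}" by (rule subspace_vimage[OF pr(1) sub[OF j]])
    qed
    then show ?thesis using sp by blast
  qed
  moreover have "(\<Sum>i\<in>I. pr i x) = x" for x
  proof (rule lin_eq_on_span[OF _ lin_id])
    show "lin (\<lambda>x. \<Sum>i\<in>I. pr i x)"
      by (rule linI) (simp_all add: lin_add[OF pr(1)] lin_sc[OF pr(1)] sum.distrib scale_sum_right)
    show "(\<Sum>i\<in>I. pr i x) = x" if "x \<in> (\<Union>i\<in>I. W i)" for x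
    proof -
      obtain i where "i \<in> I" "x \<in> W i" using \<open>x \<in> (\<Union>i\<in>I. W i)\<close> by blast
      then show ?thesis using I by (simp add: p)
    qed
  qed (simp add: sp)
  ultimately show thesis using that pr(1) p by blast
qed

text \<open>Over an infinite field, a generic point of a line through two vectors of V avoids
  finitely many zero sets. The p are linear on V only, because weights extended by 0 are not linear
  on the whole space.\<close>

lemma avoid_hyperplanes:
  assumes "finite P" "subspace V"
    and "\<And>p x y. p \<in> P \<Longrightarrow> x \<in> V \<Longrightarrow> y \<in> V \<Longrightarrow> p (x + y) = p x + (p y :: 'k)"
    and "\<And>p c x. p \<in> P \<Longrightarrow> x \<in> V \<Longrightarrow> p (sc c x) = c * p x"
    and "\<And>p. p \<in> P \<Longrightarrow> \<exists>x\<in>V. p x \<noteq> 0"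
  shows "\<exists>x\<in>V. \<forall>p\<in>P. p x \<noteq> 0"
  using assms
proof (induction P rule: finite_induct)
  case empty
  then show ?case using subspace_0 by auto
next
  case (insert q P)
  then obtain x where x: "x \<in> V" "\<forall>p\<in>P. p x \<noteq> 0" by auto
  obtain y where y: "y \<in> V" "q y \<noteq> 0" using insert.prems(4)[of q] by auto
  have "finite (insert 0 ((\<lambda>p. - p x / p y) ` insert q P))" using insert by simp
  then obtain t where t: "t \<notin> insert 0 ((\<lambda>p. - p x / p y) ` insert q P)"
    using ex_new_if_finite[OF infinite_UNIV_char_0] by blast
  have "p (x + sc t y) \<noteq> 0" if p: "p \<in> insert q P" for p
  proof
    assume "p (x + sc t y) = 0"
    then have z: "p x + t * p y = 0"
      using insert.prems(2)[OF p x(1) subspace_scale[OF insert.prems(1) y(1)]] insert.prems(3)[OF p y(1)] by simp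
    show False
    proof (cases "p y = 0")
      case True
      then show False using z x(2) y(2) p by auto
    next
      case False
      then have "t = - p x / p y" using z by (simp add: field_simps eq_neg_iff_add_eq_0)
      then show False using t p by auto
    qed
  qed
  then show ?case using subspace_add[OF insert.prems(1) x(1) subspace_scale[OF insert.prems(1) y(1)]] by blast
qed

end

section \<open>Nondegeneracy of the Killing form and innerness of derivations\<close>

context simple_lie begin

text \<open>If every ad x were nilpotent, Engel's theorem for the pair {0} \<subset> UNIV would give
  a nonzero central element.\<close>

lemma not_all_nilpotent: "\<exists>x. \<not> lnil (br x)"
proof (rule ccontr)
  assume "\<not> (\<exists>x. \<not> lnil (br x))"
  then have n: "\<exists>N. (br y ^^ N) x = 0" for x y by (simp add: lnil_def)
  have e: "engel UNIV UNIV" by (rule engel) (simp_all add: subalg_def n)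
  have "{0} \<subset> (UNIV :: 'v set)" using nonabelian by auto
  then obtain w where "w \<noteq> 0" "\<And>k. br k w = 0"
    using engelD[OF e subspace_single_0 subspace_UNIV] by auto
  then show False using center_trivial by blast
qed

text \<open>Cartan's criterion. Suppose the form vanishes and ad x is not nilpotent. Let s be the
  semisimple part of ad x, and let t have the same eigenspaces with the eigenvalues replaced by
  their rational images under f. Then t is a derivation, so its trace against every ad w vanishes.
  In particular tr (t s) = 0, and applying f gives a vanishing sum of squares of the f (e b). All
  eigenvalues of ad x are then zero.\<close>

lemma kap_nonzero: "\<exists>x y. kap x y \<noteq> 0"
proof (rule ccontr)
  assume "\<not> (\<exists>x y. kap x y \<noteq> 0)"
  then have k0: "kap x y = 0" for x y by blast
  obtain x where x: "\<not> lnil (br x)" using not_all_nilpotent by blast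
  let ?D = "br x"
  have fin: "finite {a. gspace ?D a \<noteq> {0}}"
    using finitely_many_summands[of UNIV "gspace ?D"] subspace_gspace[OF lin_ad] gspace_span[OF lin_ad]
      indep_gspace[OF lin_ad] by simp
  then obtain f :: "'k \<Rightarrow> rat" where f: "\<And>x y. f (x + y) = f x + f y" "\<And>q x. f (of_rat q * x) = q * f x"
    and fne: "\<And>a. a \<noteq> 0 \<Longrightarrow> gspace ?D a \<noteq> {0} \<Longrightarrow> f a \<noteq> 0"
  proof -
    have "finite ({a. gspace ?D a \<noteq> {0}} - {0})" "0 \<notin> {a. gspace ?D a \<noteq> {0}} - {0}" using fin by simp_all
    from rat_linear_separates_finite[OF this] obtain f :: "'k \<Rightarrow> rat" where
      "rat_linear f" "\<forall>a\<in>{a. gspace ?D a \<noteq> {0}} - {0}. f a \<noteq> 0" by (elim exE conjE)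
    then show thesis by (intro that[of f]) (simp_all add: rat_linear_def)
  qed
  obtain s where s: "lin s" "\<And>a y. y \<in> gspace ?D a \<Longrightarrow> s y = sc a y"
    using spectral_map[OF lin_ad, of x id] by auto
  \<comment> \<open>As f is additive, t is again a derivation, so \<open>tr_deriv_ad\<close> applies
    to it although it is not known to be inner.\<close>
  obtain t where t: "lin t" "\<And>a y. y \<in> gspace ?D a \<Longrightarrow> t y = sc (of_rat (f a)) y"
    using spectral_map[OF lin_ad, of x "\<lambda>a. of_rat (f a)"] by auto
  have ft: "of_rat (f (a + b)) = (of_rat (f a) + of_rat (f b) :: 'k)" for a b
    by (simp add: f(1) of_rat_add)
  have dt: "deriv_lie t" by (rule deriv_of_spectrum[where f = "\<lambda>a. of_rat (f a)", OF deriv_ad t ft])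
  have tr0: "tr (\<lambda>v. t (br w v)) = 0" for w
  proof -
    have "w \<in> span (\<Union>x. range (br x))" by (simp add: perfect)
    then show ?thesis
    proof (induction rule: span_induct_alt)
      case base
      show ?case by (simp add: lin_0[OF t(1)] tr_def trB_def representation_zero)
    next
      case (step c w z)
      then obtain y u where "w = br y u" by blast
      then have "tr (\<lambda>v. t (br w v)) = 0" using tr_deriv_ad[OF dt] k0 by simp
      then show ?case
        using step by (simp add: br_add_left br_sc_left lin_add[OF t(1)] lin_sc[OF t(1)] tr_add tr_scale)
    qed
  qed
  obtain B where B: "B \<subseteq> (\<Union>a. gspace ?D a)" "independent B" "(\<Union>a. gspace ?D a) \<subseteq> span B"
    using maximal_independent_subset by blast
  have spB: "span B = UNIV"
    using span_minimal[OF B(3) subspace_span] gspace_span[OF lin_ad, of x] by auto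
  have fB: "finite B" using B(2) finiteI_independent by blast
  have "\<forall>b\<in>B. \<exists>a. b \<in> gspace ?D a" using B(1) by blast
  from bchoice[OF this] obtain e where e: "\<And>b. b \<in> B \<Longrightarrow> b \<in> gspace ?D (e b)" by blast
  have tc: "t (?D y) = ?D (t y)" for y
  proof (rule lin_eq_on_span[where X = "\<Union>a. gspace ?D a" and f = "\<lambda>y. t (?D y)"])
    show "lin (\<lambda>y. t (?D y))" "lin (\<lambda>y. ?D (t y))" by (auto intro: lin_comp lin_ad t(1))
    show "t (?D y) = ?D (t y)" if y: "y \<in> (\<Union>a. gspace ?D a)" for y
    proof -
      obtain a where a: "y \<in> gspace ?D a" using y by blast
      have "?D y \<in> gspace ?D a" by (rule gspace_comm[OF lin_ad lin_ad _ a]) simp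
      then show ?thesis by (simp add: t(2)[OF a] t(2) br_sc_right)
    qed
  qed (simp add: gspace_span[OF lin_ad])
  have tsc: "t (s y) = s (t y)" for y
  proof (rule lin_eq_on_span[where X = "\<Union>a. gspace ?D a" and f = "\<lambda>y. t (s y)"])
    show "lin (\<lambda>y. t (s y))" "lin (\<lambda>y. s (t y))" by (auto intro: lin_comp s(1) t(1))
    show "t (s y) = s (t y)" if y: "y \<in> (\<Union>a. gspace ?D a)" for y
    proof -
      obtain a where a: "y \<in> gspace ?D a" using y by blast
      then show ?thesis by (simp add: t(2)[OF a] s(2)[OF a] lin_sc[OF s(1)] lin_sc[OF t(1)] mult.commute)
    qed
  qed (simp add: gspace_span[OF lin_ad])
  \<comment> \<open>Passing from ad x to its semisimple part does not change the trace against t,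
    since t commutes with the nilpotent part.\<close>
  have "tr (\<lambda>v. t (?D v - s v)) = 0"
  proof (rule tr_lnil)
    show "lin (\<lambda>v. t (?D v - s v))" by (rule lin_comp[OF t(1) lin_sub[OF lin_ad s(1)]])
    have nD: "lnil (\<lambda>v. ?D v - s v)" by (rule semisimple_part[OF lin_ad s])
    show "lnil (\<lambda>v. t (?D v - s v))"
      by (rule lnil_comp(2)[OF lin_sub[OF lin_ad s(1)] nD t(1)]) (simp add: lin_diff[OF t(1)] tc tsc)
  qed
  then have "tr (\<lambda>v. t (s v)) = 0" using tr0[of x] by (simp add: lin_diff[OF t(1)] tr_diff)
  also have "tr (\<lambda>v. t (s v)) = trB B (\<lambda>v. t (s v))"
    by (rule tr_basis[OF B(2) spB lin_comp[OF t(1) s(1)]])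
  also have "\<dots> = (\<Sum>b\<in>B. of_rat (f (e b)) * e b)"
    unfolding trB_def
  proof (rule sum.cong[OF refl])
    fix b assume b: "b \<in> B"
    have "t (s b) = sc (of_rat (f (e b)) * e b) b"
      using e[OF b] by (simp add: s(2) t(2) lin_sc[OF t(1)] mult.commute)
    then show "representation B (t (s b)) b = of_rat (f (e b)) * e b"
      using b by (simp add: representation_scale[OF B(2)] span_base representation_basis[OF B(2)])
  qed
  finally have z: "(\<Sum>b\<in>B. of_rat (f (e b)) * e b) = 0" by simp
  have f0: "f 0 = 0" using f(1)[of 0 0] by simp
  \<comment> \<open>Rational linearity of f turns the vanishing sum into a sum of squares of
    rational numbers.\<close>
  have "f (\<Sum>b\<in>B. of_rat (f (e b)) * e b) = (\<Sum>b\<in>B. f (e b) * f (e b))"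
    using fB by (induction B rule: finite_induct) (simp_all add: f f0)
  then have "(\<Sum>b\<in>B. f (e b) * f (e b)) = 0" using z f0 by simp
  then have fe: "f (e b) = 0" if "b \<in> B" for b
    using that fB by (subst (asm) sum_nonneg_eq_0_iff) auto
  have "s b = 0" if b: "b \<in> B" for b
  proof -
    have "b \<noteq> 0" using b B(2) dependent_zero by blast
    then have "gspace ?D (e b) \<noteq> {0}" using e[OF b] by blast
    then have "e b = 0" using fne fe[OF b] by blast
    then show ?thesis using s(2)[OF e[OF b]] by simp
  qed
  then have "s v = 0" for v
    using lin_eq_on_span[OF s(1) lin_zero, of B v] spB by simp
  then have "lnil ?D" using semisimple_part[OF lin_ad s, of x] by simp
  then show False using x by simp
qed

text \<open>By invariance the radical of the form is an ideal, and it is proper because the form is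
  nonzero.\<close>

lemma kap_nondeg: assumes "\<And>y. kap x y = 0" shows "x = 0"
proof -
  let ?Z = "{x. \<forall>y. kap x y = 0}"
  have "subspace ?Z" by (rule subspaceI) (auto simp: kap_add_left kap_sc_left)
  moreover have "br y x \<in> ?Z" if "x \<in> ?Z" for x y
    using that kap_invariant[of x y] br_anti[of y x] kap_sc_left[of "-1" "br x y"] by simp
  ultimately have "?Z = {0} \<or> ?Z = UNIV" by (rule ideal_trivial)
  moreover have "?Z \<noteq> UNIV" using kap_nonzero by auto
  ultimately have "?Z = {0}" by simp
  then show ?thesis using assms by blast
qed

text \<open>P packs the values of kap y on a basis B of S into a vector of S. Nondegeneracy on S
  makes P injective, hence onto S by dimension, so every list of values on B is attained.\<close>

lemma kap_represents:
  assumes S: "subspace S" and nd: "\<And>x. x \<in> S \<Longrightarrow> (\<And>y. y \<in> S \<Longrightarrow> kap x y = 0) \<Longrightarrow> x = 0"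
    and l: "\<And>x y. l (x + y) = l x + l y" "\<And>c x. l (sc c x) = c * (l x :: 'k)"
  shows "\<exists>y\<in>S. \<forall>x\<in>S. kap y x = l x"
proof -
  obtain B where B: "B \<subseteq> S" "independent B" "S \<subseteq> span B"
    using maximal_independent_subset by blast
  have spB: "span B = S" using span_minimal[OF B(1) S] B(3) by blast
  have fB: "finite B" using B(2) finiteI_independent by blast
  define P where "P y = (\<Sum>b\<in>B. sc (kap y b) b)" for y
  have lP: "lin P"
    by (rule linI)
       (simp_all add: P_def kap_add_left kap_sc_left scale_left_distrib sum.distrib scale_sum_right)
  have coef: "u b = 0" if "(\<Sum>b\<in>B. sc (u b) b) = 0" "b \<in> B" for u b
    using independentD[OF B(2) fB order_refl that(1,2)] .
  have sub0: "subspace {x. kap y x = l' x}"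
    if "\<And>x y. l' (x + y) = l' x + l' y" "\<And>c x. l' (sc c x) = c * (l' x)" for y l'
  proof (rule subspaceI)
    show "0 \<in> {x. kap y x = l' x}" using that(2)[of 0 0] by simp
  qed (use that in \<open>simp_all add: kap_add_right kap_sc_right\<close>)
  have ker: "y = 0" if y: "y \<in> S" and z: "P y = 0" for y
  proof (rule nd[OF y])
    fix x assume x: "x \<in> S"
    have "B \<subseteq> {x. kap y x = 0}" using coef z by (auto simp: P_def)
    then have "span B \<subseteq> {x. kap y x = 0}" by (rule span_minimal) (use sub0[of "\<lambda>_. 0"] in simp)
    then show "kap y x = 0" using x spB by blast
  qed
  have inj: "inj_on P (span S)"
  proof (rule inj_onI)
    fix x y assume xy: "x \<in> span S" "y \<in> span S" "P x = P y"
    have "x - y \<in> S" using xy S by (simp add: span_eq_iff[THEN iffD2] subspace_diff)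
    moreover have "P (x - y) = 0" using xy by (simp add: lin_diff[OF lP])
    ultimately have "x - y = 0" by (rule ker)
    then show "x = y" by simp
  qed
  interpret p: finite_dimensional_vector_space_pair_1 sc fbasis sc by unfold_locales
  have d: "dim (P ` S) = dim S" by (rule p.dim_image_eq[OF lP inj])
  have PS: "P ` S \<subseteq> S"
    unfolding P_def using B(1) by (auto intro!: subspace_sum[OF S] subspace_scale[OF S])
  have "P ` S = S"
    by (rule subspace_dim_equal[OF subspace_image[OF lP S] S PS]) (simp add: d)
  moreover have "(\<Sum>b\<in>B. sc (l b) b) \<in> S" using B(1) by (auto intro!: subspace_sum[OF S] subspace_scale[OF S])
  ultimately obtain y where y: "y \<in> S" "P y = (\<Sum>b\<in>B. sc (l b) b)" by (metis imageE)
  have z: "(\<Sum>b\<in>B. sc (kap y b - l b) b) = 0"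
    using y(2) by (simp add: P_def scale_left_diff_distrib sum_subtractf)
  have "kap y b = l b" if "b \<in> B" for b using coef[OF z that] by simp
  then have "span B \<subseteq> {x. kap y x = l x}" by (intro span_minimal sub0 l) auto
  then show ?thesis using y(1) spB by blast
qed

text \<open>Choose y representing x \<mapsto> tr (d (ad x)). Then e = d - ad y has trace zero
  against every ad x, so kap (e x) w = tr (e (ad [x, w])) = 0 for all w, and e vanishes.\<close>

lemma deriv_inner: assumes d: "deriv_lie d" shows "\<exists>y. \<forall>x. d x = br y x"
proof -
  have l: "lin d" and dd: "\<And>x y. d (br x y) = br (d x) y + br x (d y)"
    using d by (auto simp: deriv_lie_def)
  have "\<exists>y\<in>UNIV. \<forall>x\<in>UNIV. kap y x = tr (\<lambda>v. d (br x v))"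
    by (rule kap_represents) (auto simp: kap_nondeg br_add_left br_sc_left lin_add[OF l] lin_sc[OF l] tr_add tr_scale)
  then obtain y where y: "\<And>x. kap y x = tr (\<lambda>v. d (br x v))" by blast
  define e where "e x = d x - br y x" for x
  have "e x = br 0 x" for x
  proof -
    have de: "deriv_lie e"
      unfolding deriv_lie_def e_def
      using lin_sub[OF l lin_ad] jacobi[of y] by (auto simp: dd br_diff_left br_diff_right)
    have "kap (e x) w = 0" for w
    proof -
      have "kap (e x) w = tr (\<lambda>v. e (br (br x w) v))" using tr_deriv_ad[OF de] by simp
      also have "\<dots> = 0" using y[of "br x w"] by (simp add: e_def tr_diff kap_def)
      finally show ?thesis .
    qed
    then show ?thesis using kap_nondeg by simp
  qed
  then show ?thesis by (intro exI[of _ y]) (simp add: e_def)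
qed

end

section \<open>Automorphisms\<close>

context simple_lie begin

definition aut :: "('v \<Rightarrow> 'v) \<Rightarrow> bool" where "aut \<theta> \<longleftrightarrow> lie_iso sc br sc br \<theta>"

lemma
  assumes "aut \<theta>"
  shows aut_bij: "bij \<theta>" and aut_lin: "lin \<theta>" and aut_br: "\<theta> (br x y) = br (\<theta> x) (\<theta> y)"
  using assms by (auto simp: aut_def lie_iso_def intro: linI)

lemma aut_inv_right: "aut \<theta> \<Longrightarrow> \<theta> (inv \<theta> x) = x"
  by (simp add: aut_bij bij_is_surj surj_f_inv_f)

lemma aut_inv_left: "aut \<theta> \<Longrightarrow> inv \<theta> (\<theta> x) = x"
  by (simp add: aut_bij bij_is_inj)

lemma autI:
  assumes "lin \<theta>" "\<And>x y. \<theta> (br x y) = br (\<theta> x) (\<theta> y)" "bij \<theta>" shows "aut \<theta>"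
  using assms by (simp add: aut_def lie_iso_def lin_add lin_sc)

lemma aut_inv: assumes a: "aut \<theta>" shows "aut (inv \<theta>)"
proof (rule autI)
  have i: "inv \<theta> x = y" if "x = \<theta> y" for x y using that aut_inv_left[OF a] by simp
  show "lin (inv \<theta>)"
    by (rule linI) (rule i, simp add: lin_add[OF aut_lin[OF a]] lin_sc[OF aut_lin[OF a]] aut_inv_right[OF a])+
  show "inv \<theta> (br x y) = br (inv \<theta> x) (inv \<theta> y)" for x y
    by (rule i) (simp add: aut_br[OF a] aut_inv_right[OF a])
  show "bij (inv \<theta>)" by (rule bij_imp_bij_inv[OF aut_bij[OF a]])
qed

lemma aut_comp: assumes a: "aut \<theta>" and b: "aut \<eta>" shows "aut (\<lambda>x. \<theta> (\<eta> x))"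
proof (rule autI)
  show "lin (\<lambda>x. \<theta> (\<eta> x))" by (rule lin_comp) (use a b aut_lin in auto)
  show "bij (\<lambda>x. \<theta> (\<eta> x))" using bij_comp[OF aut_bij[OF b] aut_bij[OF a]] by (simp add: o_def)
qed (simp add: aut_br[OF a] aut_br[OF b])

lemma kap_aut: assumes a: "aut \<theta>" shows "kap (\<theta> x) (\<theta> y) = kap x y"
proof -
  let ?g = "\<lambda>v. br x (br y (inv \<theta> v))"
  have lg: "lin ?g" by (intro lin_comp[OF lin_ad] lin_comp[OF lin_ad] aut_lin aut_inv a)
  have "kap (\<theta> x) (\<theta> y) = tr (\<lambda>v. \<theta> (?g v))"
    by (simp add: kap_def aut_br[OF a] aut_inv_right[OF a])
  also have "\<dots> = tr (\<lambda>v. ?g (\<theta> v))" by (rule tr_commute[OF aut_lin[OF a] lg])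
  also have "\<dots> = kap x y" by (simp add: kap_def aut_inv_left[OF a])
  finally show ?thesis .
qed

section \<open>Exponentials of nilpotent elements\<close>

text \<open>The exponential series of ad u cut off at N; it is the true exponential once the N-th
  power of ad u vanishes.\<close>

definition expad :: "nat \<Rightarrow> 'v \<Rightarrow> 'v \<Rightarrow> 'v" where
  "expad N u x = (\<Sum>k<N. sc (1 / fact k) ((br u ^^ k) x))"

lemma lin_expad: "lin (expad N u)"
  unfolding expad_def
  by (rule linI) (simp_all add: lin_add[OF lin_pow[OF lin_ad]] lin_sc[OF lin_pow[OF lin_ad]]
      scale_right_distrib sum.distrib scale_sum_right mult.commute)

lemma expad_mono:
  assumes "\<And>x. (br u ^^ N) x = 0" "N \<le> M" shows "expad M u x = expad N u x"
  unfolding expad_def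
proof (rule sum.mono_neutral_right)
  show "\<forall>i\<in>{..<M} - {..<N}. sc (1 / fact i) ((br u ^^ i) x) = 0"
    using pow_zero_mono[OF lin_ad assms(1)] by auto
qed (use assms(2) in auto)

lemma leibniz_power:
  "(br u ^^ k) (br x y) = (\<Sum>i\<le>k. sc (of_nat (k choose i)) (br ((br u ^^ i) x) ((br u ^^ (k - i)) y)))"
proof (induction k arbitrary: x y)
  case (Suc k)
  let ?f = "\<lambda>i j. br ((br u ^^ i) x) ((br u ^^ j) y)"
  have "(br u ^^ Suc k) (br x y) = (br u ^^ k) (br (br u x) y) + (br u ^^ k) (br x (br u y))"
    by (simp only: funpow_Suc_right o_apply jacobi[of u x y] lin_add[OF lin_pow[OF lin_ad]])
  also have "\<dots> = (\<Sum>i\<le>k. sc (of_nat (k choose i)) (?f (Suc i) (k - i))) + (\<Sum>i\<le>k. sc (of_nat (k choose i)) (?f i (Suc (k - i))))"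
    unfolding Suc by (simp only: funpow_Suc_right o_apply)
  also have "(\<Sum>i\<le>k. sc (of_nat (k choose i)) (?f (Suc i) (k - i)))
      = (\<Sum>i\<in>{1..Suc k}. sc (of_nat (k choose (i - 1))) (?f i (Suc k - i)))"
    by (rule sum.reindex_bij_witness[of _ "\<lambda>i. i - 1" Suc]) auto
  also have "\<dots> = (\<Sum>i\<le>Suc k. sc (if i = 0 then 0 else of_nat (k choose (i - 1))) (?f i (Suc k - i)))"
    by (rule sum.mono_neutral_cong_left) auto
  also have "(\<Sum>i\<le>k. sc (of_nat (k choose i)) (?f i (Suc (k - i))))
      = (\<Sum>i\<le>Suc k. sc (of_nat (k choose i)) (?f i (Suc k - i)))"
    by (rule sum.mono_neutral_cong_left) (auto simp: Suc_diff_le)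
  finally have "(br u ^^ Suc k) (br x y) = (\<Sum>i\<le>Suc k.
      sc (if i = 0 then 0 else of_nat (k choose (i - 1))) (?f i (Suc k - i)) + sc (of_nat (k choose i)) (?f i (Suc k - i)))"
    by (simp only: sum.distrib)
  also have "\<dots> = (\<Sum>i\<le>Suc k. sc (of_nat (Suc k choose i)) (?f i (Suc k - i)))"
  proof (rule sum.cong[OF refl])
    fix i
    show "sc (if i = 0 then 0 else of_nat (k choose (i - 1))) (?f i (Suc k - i)) + sc (of_nat (k choose i)) (?f i (Suc k - i))
      = sc (of_nat (Suc k choose i)) (?f i (Suc k - i))"
      unfolding scale_left_distrib[symmetric] by (cases i) (simp_all add: add.commute)
  qed
  finally show ?case .
qed simp

lemma expad_br:
  assumes nil: "\<And>x. (br u ^^ N) x = 0"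
  shows "expad N u (br x y) = br (expad N u x) (expad N u y)"
proof -
  let ?f = "\<lambda>i j. sc (1 / (fact i * fact j)) (br ((br u ^^ i) x) ((br u ^^ j) y))"
  \<comment> \<open>With 2 N in place of N, the triangle i + j < 2 N contains the whole square of
    pairs below N; pairs outside the square contribute zero, and the square is the product of the
    two exponentials.\<close>
  have "expad N u (br x y) = expad (2 * N) u (br x y)"
    using expad_mono[OF nil, of "2 * N" "br x y"] by simp
  also have "\<dots> = (\<Sum>k<2*N. \<Sum>i\<le>k. ?f i (k - i))"
    unfolding expad_def leibniz_power scale_sum_right
  proof (intro sum.cong refl)
    fix k i :: nat assume "i \<in> {..k}"
    then have "(of_nat (k choose i) :: 'k) / fact k = 1 / (fact i * fact (k - i))"
      by (subst binomial_fact) auto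
    then show "sc (1 / fact k) (sc (of_nat (k choose i)) (br ((br u ^^ i) x) ((br u ^^ (k - i)) y))) = ?f i (k - i)"
      by simp
  qed
  also have "\<dots> = (\<Sum>(i,j)\<in>{(i,j). i + j < 2*N}. ?f i j)"
    by (rule sum.triangle_reindex[symmetric])
  also have "\<dots> = (\<Sum>(i,j)\<in>{..<N} \<times> {..<N}. ?f i j)"
  proof (rule sum.mono_neutral_right)
    show "finite {(i, j). i + j < 2 * N}"
      by (rule finite_subset[of _ "{..<2*N} \<times> {..<2*N}"]) auto
    show "\<forall>p\<in>{(i, j). i + j < 2 * N} - {..<N} \<times> {..<N}. (case p of (i, j) \<Rightarrow> ?f i j) = 0"
    proof
      fix p assume p: "p \<in> {(i, j). i + j < 2 * N} - {..<N} \<times> {..<N}"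
      obtain i j where ij: "p = (i, j)" by (cases p)
      have "N \<le> i \<or> N \<le> j" using p ij by auto
      then have "(br u ^^ i) x = 0 \<or> (br u ^^ j) y = 0"
        using pow_zero_mono[OF lin_ad nil] by blast
      then show "(case p of (i, j) \<Rightarrow> ?f i j) = 0" using ij by auto
    qed
  qed auto
  also have "\<dots> = (\<Sum>i<N. \<Sum>j<N. ?f i j)" by (rule sum.cartesian_product[symmetric])
  also have "\<dots> = (\<Sum>j<N. \<Sum>i<N. ?f i j)" by (rule sum.swap)
  also have "\<dots> = br (expad N u x) (expad N u y)"
    unfolding expad_def br_sum_left br_sum_right br_sc_left br_sc_right
    by (simp add: scale_sum_right mult.commute)
  finally show ?thesis .
qed

text \<open>Bijectivity comes from simplicity: the kernel is an ideal, and it is not everything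
  because the last nonzero iterate of any vector under ad u is fixed by the exponential.\<close>

lemma expad_aut:
  assumes nil: "\<And>x. (br u ^^ N) x = 0"
  shows "aut (expad N u)"
proof (rule autI[OF lin_expad expad_br[OF nil]])
  let ?Z = "{x. expad N u x = 0}"
  have "?Z = {0} \<or> ?Z = UNIV"
  proof (rule ideal_trivial)
    show "subspace ?Z" by (rule subspace_kernel[OF lin_expad])
    show "br x i \<in> ?Z" if "i \<in> ?Z" for x i using that by (simp add: expad_br[OF nil])
  qed
  moreover have "?Z \<noteq> UNIV"
  proof
    assume z: "?Z = UNIV"
    obtain v0 :: 'v where v0: "v0 \<noteq> 0" using nonabelian by auto
    define k where "k = (LEAST k. (br u ^^ k) v0 = 0)"
    have k: "(br u ^^ k) v0 = 0" unfolding k_def using nil[of v0] by (rule LeastI)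
    obtain l where l: "k = Suc l" using k v0 by (cases k) auto
    define v where "v = (br u ^^ l) v0"
    have v: "v \<noteq> 0" using not_less_Least[of l "\<lambda>k. (br u ^^ k) v0 = 0"] l by (auto simp: k_def v_def)
    have uv: "br u v = 0" using k l by (simp add: v_def)
    have up: "(br u ^^ Suc j) v = 0" for j
      by (simp only: funpow_Suc_right o_apply uv lin_0[OF lin_pow[OF lin_ad]])
    have N: "N \<noteq> 0" using nil[of v0] v0 by (cases N) auto
    have "expad N u v = (\<Sum>k\<in>{0}. sc (1 / fact k) ((br u ^^ k) v))"
      unfolding expad_def
    proof (rule sum.mono_neutral_right)
      show "\<forall>i\<in>{..<N} - {0}. sc (1 / fact i) ((br u ^^ i) v) = 0"
      proof
        fix i assume "i \<in> {..<N} - {0}"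
        then obtain j where "i = Suc j" by (cases i) auto
        then show "sc (1 / fact i) ((br u ^^ i) v) = 0" using up by simp
      qed
    qed (use N in auto)
    then have "expad N u v = v" by simp
    moreover have "v \<in> ?Z" unfolding z by (rule UNIV_I)
    ultimately show False using v by simp
  qed
  ultimately have Z: "?Z = {0}" by simp
  have inj0: "x = 0" if "expad N u x = 0" for x using Z that by blast
  have "inj (expad N u)"
  proof (rule injI)
    fix x y assume "expad N u x = expad N u y"
    then have "expad N u (x - y) = 0" by (simp add: lin_diff[OF lin_expad])
    then show "x = y" using inj0[of "x - y"] by simp
  qed
  then show "bij (expad N u)" using lin_inj_surj[OF lin_expad inj0] by (simp add: bij_def)
qed

end

section \<open>Fixed points of commuting automorphisms of finite order\<close>

locale lie_fixed = simple_lie sc br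
  for sc :: "'k::field_char_0 \<Rightarrow> 'v::ab_group_add \<Rightarrow> 'v" and br +
  fixes \<sigma> :: "'n::finite \<Rightarrow> 'v \<Rightarrow> 'v" and m :: "'n \<Rightarrow> nat"
  assumes cfo: "cfo_tuple sc br \<sigma> m"
begin

lemma \<sigma>_aut: "aut (\<sigma> i)" using cfo by (simp add: cfo_tuple_def aut_def)

lemma \<sigma>_comm: "\<sigma> i (\<sigma> j x) = \<sigma> j (\<sigma> i x)"
  using cfo by (metis cfo_tuple_def comp_apply)

lemma \<sigma>_order: "0 < m i" "(\<sigma> i ^^ m i) = id"
  using cfo by (simp_all add: cfo_tuple_def)

lemmas \<sigma>_lin = aut_lin[OF \<sigma>_aut] and \<sigma>_br = aut_br[OF \<sigma>_aut]

definition S :: "'v set" where "S = {x. \<forall>i. \<sigma> i x = x}"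

lemma subspace_S: "subspace S"
  unfolding S_def by (rule subspaceI) (auto simp: lin_add[OF \<sigma>_lin] lin_sc[OF \<sigma>_lin] lin_0[OF \<sigma>_lin])

lemma S_br: "x \<in> S \<Longrightarrow> y \<in> S \<Longrightarrow> br x y \<in> S"
  by (simp add: S_def \<sigma>_br)

lemma \<sigma>_span: "span {x. \<forall>i. \<exists>c. \<sigma> i x = sc c x} = UNIV"
proof -
  have "span {x. \<forall>j\<in>UNIV. \<exists>c. \<sigma> j x = sc c x} = UNIV"
    by (rule simultaneous_diag)
       (use \<sigma>_lin \<sigma>_comm finite_order_diagble[OF \<sigma>_lin \<sigma>_order] in auto)
  then show ?thesis by simp
qed

text \<open>The form is invariant under each \<sigma> i, so a joint eigenvector with some eigenvalue
  other than 1 is orthogonal to S. An element of S orthogonal to S is therefore orthogonal to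
  everything.\<close>

lemma kap_nondeg_S:
  assumes x: "x \<in> S" and z: "\<And>y. y \<in> S \<Longrightarrow> kap x y = 0" shows "x = 0"
proof (rule kap_nondeg)
  have sub: "subspace {y. kap x y = 0}"
    by (rule subspaceI) (simp_all add: kap_add_right kap_sc_right)
  have "{y. \<forall>i. \<exists>c. \<sigma> i y = sc c y} \<subseteq> {y. kap x y = 0}"
  proof clarify
    fix y assume y: "\<forall>i. \<exists>c. \<sigma> i y = sc c y"
    show "kap x y = 0"
    proof (cases "y \<in> S")
      case False
      then obtain i where i: "\<sigma> i y \<noteq> y" by (auto simp: S_def)
      obtain c where c: "\<sigma> i y = sc c y" using y by blast
      have "c \<noteq> 1" using i c by auto
      have "kap x y = kap (\<sigma> i x) (\<sigma> i y)" by (rule kap_aut[OF \<sigma>_aut, symmetric])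
      also have "\<dots> = c * kap x y" using x by (simp add: S_def c kap_sc_right)
      finally have "(1 - c) * kap x y = 0" by (simp add: algebra_simps)
      then show ?thesis using \<open>c \<noteq> 1\<close> by simp
    qed (rule z)
  qed
  then have "span {y. \<forall>i. \<exists>c. \<sigma> i y = sc c y} \<subseteq> {y. kap x y = 0}" by (rule span_minimal[OF _ sub])
  then show "kap x y = 0" for y using \<sigma>_span by blast
qed

text \<open>The semisimple part of ad x is a derivation, hence equal to some ad d. Each \<sigma> i
  fixes x and so preserves the generalised eigenspaces of ad x; therefore it commutes with ad d, and
  the trivial centre gives \<sigma> i d = d.\<close>

lemma jordan:
  assumes x: "x \<in> S"
  shows "\<exists>d\<in>S. (\<forall>a. \<forall>y\<in>gspace (br x) a. br d y = sc a y)"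
proof -
  obtain s where s: "lin s" "\<And>a y. y \<in> gspace (br x) a \<Longrightarrow> s y = sc a y"
    using spectral_map[OF lin_ad, of x id] by auto
  have "deriv_lie s" by (rule deriv_of_spectrum[where f = id, OF deriv_ad[of x] s(1)]) (simp_all add: s(2))
  from deriv_inner[OF this] obtain d where d: "\<And>y. s y = br d y" by blast
  have ds: "br d y = sc a y" if "y \<in> gspace (br x) a" for a y using s(2)[OF that] d by simp
  have "\<sigma> i d = d" for i
  proof -
    have xi: "\<sigma> i x = x" using x by (simp add: S_def)
    have c: "\<sigma> i (br d y) = br d (\<sigma> i y)" for y
    proof (rule lin_eq_on_span[where X = "\<Union>a. gspace (br x) a" and f = "\<lambda>y. \<sigma> i (br d y)"])
      show "lin (\<lambda>y. \<sigma> i (br d y))" by (rule lin_comp[OF \<sigma>_lin lin_ad])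
      show "lin (\<lambda>y. br d (\<sigma> i y))" by (rule lin_comp[OF lin_ad \<sigma>_lin])
      show "\<sigma> i (br d y) = br d (\<sigma> i y)" if y: "y \<in> (\<Union>a. gspace (br x) a)" for y
      proof -
        obtain a where a: "y \<in> gspace (br x) a" using y by blast
        have "\<sigma> i y \<in> gspace (br x) a"
          by (rule gspace_comm[OF lin_ad \<sigma>_lin _ a]) (simp add: \<sigma>_br xi)
        then show ?thesis using ds a by (simp add: lin_sc[OF \<sigma>_lin])
      qed
    qed (simp add: gspace_span[OF lin_ad])
    have "br w (\<sigma> i d - d) = 0" for w
    proof -
      have "br (\<sigma> i d) w = br d w"
        using c[of "inv (\<sigma> i) w"] by (simp add: \<sigma>_br aut_inv_right[OF \<sigma>_aut])
      then show ?thesis using br_anti[of w "\<sigma> i d - d"] by (simp add: br_diff_left)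
    qed
    then have "\<sigma> i d - d = 0" by (rule center_trivial)
    then show ?thesis by simp
  qed
  then show ?thesis using ds by (auto simp: S_def)
qed

lemma jordan_diagble:
  assumes "\<forall>a. \<forall>y\<in>gspace (br x) a. br d y = sc a y" shows "diagble (br d)"
proof -
  have "(\<Union>a. gspace (br x) a) \<subseteq> {y. \<exists>c. br d y = sc c y}" using assms by blast
  then have "span (\<Union>a. gspace (br x) a) \<subseteq> span {y. \<exists>c. br d y = sc c y}" by (rule span_mono)
  then show ?thesis using gspace_span[OF lin_ad, of x] by (auto simp: diagble_def)
qed

lemma jordan_lnil:
  assumes "\<forall>a. \<forall>y\<in>gspace (br x) a. br d y = sc a y" shows "lnil (br (x - d))"
proof -
  have "br (x - d) = (\<lambda>y. br x y - br d y)" by (simp add: fun_eq_iff br_diff_left)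
  then show ?thesis using semisimple_part[OF lin_ad lin_ad, of x d] assms by simp
qed

text \<open>Here ad e commutes with ad y, so their product is nilpotent and has trace zero.\<close>

lemma kap_central_nilpotent:
  assumes "lnil (br e)" "br e y = 0" shows "kap e y = 0"
  unfolding kap_def
proof (rule tr_lnil)
  show "lin (\<lambda>v. br e (br y v))" by (rule lin_comp[OF lin_ad lin_ad])
  show "lnil (\<lambda>v. br e (br y v))"
    by (rule lnil_comp(1)[OF lin_ad assms(1) lin_ad]) (simp add: jacobi[of e y] assms(2))
qed

lemma eigen_gspace: "D x = sc a x \<Longrightarrow> x \<in> gspace D a"
  unfolding gspace_def by (intro CollectI exI[of _ 1]) simp

text \<open>The definition of a Cartan subalgebra speaks of diagonalizability on S only. The
  nilpotent part x - d kills every eigenvector of ad x in S, hence centralises S and is orthogonal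
  to it; nondegeneracy on S makes it zero, so x is diagonalizable on the whole algebra.\<close>

lemma ad_diag_diagble:
  assumes x: "x \<in> S" and d: "ad_diag_on sc br S x" shows "diagble (br x)"
proof -
  obtain d where d': "d \<in> S" "\<forall>a. \<forall>y\<in>gspace (br x) a. br d y = sc a y" using jordan[OF x] by blast
  have nil: "lnil (br (x - d))" by (rule jordan_lnil[OF d'(2)])
  have z: "br (x - d) y = 0" if y: "y \<in> S" for y
  proof (rule lin_eq_on_span[OF lin_ad lin_zero])
    show "y \<in> span {y \<in> S. \<exists>c. br x y = sc c y}" using d y by (simp add: ad_diag_on_def)
    show "br (x - d) y = 0" if y: "y \<in> {y \<in> S. \<exists>c. br x y = sc c y}" for y
    proof -
      obtain c where c: "br x y = sc c y" using y by blast
      then have "br d y = sc c y" using d'(2) eigen_gspace by blast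
      then show ?thesis using c by (simp add: br_diff_left)
    qed
  qed
  have "x - d = 0"
    by (rule kap_nondeg_S)
       (use x d'(1) subspace_S kap_central_nilpotent[OF nil z] in \<open>auto intro: subspace_diff\<close>)
  then have "x = d" by simp
  then show ?thesis using jordan_diagble[OF d'(2)] by simp
qed

lemma diagble_ad_diag: "x \<in> S \<Longrightarrow> diagble (br x) \<Longrightarrow> ad_diag_on sc br S x"
  unfolding ad_diag_on_def
  by (rule diagble_invariant[OF lin_ad]) (auto simp: diagble_def subspace_S S_br)

text \<open>If [t, u] = c u then (ad u)^2 kills t, and so does ad u because it is diagonalizable.
  The eigenvectors of ad t inside T thus all commute with t.\<close>

lemma toral_abelian:
  assumes T: "ad_diag_subalg sc br S T" and t: "t \<in> T" and u: "u \<in> T" shows "br t u = 0"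
proof -
  have TS: "T \<subseteq> S" and sT: "subspace T" and Tb: "\<And>x y. x \<in> T \<Longrightarrow> y \<in> T \<Longrightarrow> br x y \<in> T"
    using T by (auto simp: ad_diag_subalg_def)
  have dg: "diagble (br x)" if "x \<in> T" for x
    using that T TS by (intro ad_diag_diagble) (auto simp: ad_diag_subalg_def)
  have "u \<in> span {u \<in> T. \<exists>c. br t u = sc c u}"
    using diagble_invariant[OF lin_ad, of t T] dg[OF t] sT Tb[OF t] u by (simp add: diagble_def)
  then show ?thesis
  proof (rule lin_eq_on_span[OF lin_ad lin_zero, rotated])
    show "br t u = 0" if v: "u \<in> {u \<in> T. \<exists>c. br t u = sc c u}" for u
    proof -
      obtain c where u: "u \<in> T" and c: "br t u = sc c u" using v by blast
      have "br u (br u t) = 0" using br_anti[of u t] c by (simp add: br_neg_right br_sc_right)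
      then have "br u t = 0" by (rule diagble_sq[OF lin_ad dg[OF u]])
      then show ?thesis using br_anti[of t u] by simp
    qed
  qed
qed

end

section \<open>Weights of a Cartan subalgebra\<close>

locale cartan = lie_fixed sc br \<sigma> m
  for sc :: "'k::field_char_0 \<Rightarrow> 'v::ab_group_add \<Rightarrow> 'v" and br
    and \<sigma> :: "'n::finite \<Rightarrow> 'v \<Rightarrow> 'v" and m +
  fixes H :: "'v set"
  assumes cartan: "cartan_sub sc br S H"
begin

abbreviation W :: "('v \<Rightarrow> 'k) \<Rightarrow> 'v set" where "W \<equiv> wspace sc br H"

lemma H_toral: "ad_diag_subalg sc br S H"
  using cartan by (simp add: cartan_sub_def)

lemma subspace_H: "subspace H" and H_S: "H \<subseteq> S"
  using H_toral by (simp_all add: ad_diag_subalg_def)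

lemma H_maximal: "ad_diag_subalg sc br S T \<Longrightarrow> H \<subseteq> T \<Longrightarrow> T = H"
  using cartan by (simp add: cartan_sub_def)

lemma H_diagble: "h \<in> H \<Longrightarrow> diagble (br h)"
  using H_toral H_S by (intro ad_diag_diagble) (auto simp: ad_diag_subalg_def)

lemma H_abelian: "h \<in> H \<Longrightarrow> h' \<in> H \<Longrightarrow> br h h' = 0"
  by (rule toral_abelian[OF H_toral])

lemma H_comm:
  assumes "h \<in> H" "h' \<in> H" shows "br h (br h' x) = br h' (br h x)"
  using jacobi[of h h' x] H_abelian[OF assms] by simp

lemma subspace_W: "subspace (W \<alpha>)"
  unfolding wspace_def
  by (rule subspaceI) (auto simp: br_add_right br_sc_right scale_right_distrib mult.commute)

lemma W_span: "span (\<Union>\<alpha>\<in>hdual sc H. W \<alpha>) = UNIV"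
proof -
  obtain B where B: "B \<subseteq> H" "independent B" "H \<subseteq> span B"
    using maximal_independent_subset by blast
  have fB: "finite B" using B(2) finiteI_independent by blast
  have "span {x. \<forall>b\<in>B. \<exists>c. br b x = sc c x} = UNIV"
  proof (rule simultaneous_diag[OF fB])
    show "diagble (br b)" if "b \<in> B" for b using that B(1) by (intro H_diagble) blast
    show "br b (br b' x) = br b' (br b x)" if "b \<in> B" "b' \<in> B" for b b' x
      using that B(1) by (intro H_comm) auto
  qed (rule lin_ad)
  moreover have "{x. \<forall>b\<in>B. \<exists>c. br b x = sc c x} \<subseteq> span (\<Union>\<alpha>\<in>hdual sc H. W \<alpha>)"
  proof
    fix x assume x: "x \<in> {x. \<forall>b\<in>B. \<exists>c. br b x = sc c x}"
    show "x \<in> span (\<Union>\<alpha>\<in>hdual sc H. W \<alpha>)"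
    proof (cases "x = 0")
      case False
      have sub: "subspace {h. \<exists>c. br h x = sc c x}"
      proof (rule subspaceI)
        show "0 \<in> {h. \<exists>c. br h x = sc c x}" by (auto intro: exI[of _ 0])
      qed (auto simp: br_add_left br_sc_left simp flip: scale_left_distrib)
      have "span B \<subseteq> {h. \<exists>c. br h x = sc c x}" by (rule span_minimal[OF _ sub]) (use x in blast)
      then have ex: "\<forall>h\<in>H. \<exists>c. br h x = sc c x" using B(3) by blast
      from bchoice[OF ex] obtain a where a: "\<forall>h\<in>H. br h x = sc (a h) x" by blast
      \<comment> \<open>Extension by 0 gives the representative prescribed by \<open>hdual\<close>.
        Linearity on H follows from x being nonzero, which makes eigenvalues unique.\<close>
      define \<alpha> where "\<alpha> h = (if h \<in> H then a h else 0)" for h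
      have \<alpha>: "br h x = sc (\<alpha> h) x" if "h \<in> H" for h using a that by (simp add: \<alpha>_def)
      have uniq: "c = d" if "sc c x = sc d x" for c d using that False by simp
      have "\<alpha> \<in> hdual sc H"
        unfolding hdual_def
      proof (intro CollectI conjI ballI allI impI)
        show "\<alpha> y = 0" if "y \<notin> H" for y using that by (simp add: \<alpha>_def)
        show "\<alpha> (y + z) = \<alpha> y + \<alpha> z" if "y \<in> H" "z \<in> H" for y z
          using that \<alpha>[OF subspace_add[OF subspace_H that]] \<alpha>[OF that(1)] \<alpha>[OF that(2)]
          by (intro uniq) (simp add: br_add_left scale_left_distrib)
        show "\<alpha> (sc c y) = c * \<alpha> y" if "y \<in> H" for c y
          using \<alpha>[OF subspace_scale[OF subspace_H that, of c]] \<alpha>[OF that]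
          by (intro uniq) (metis br_sc_left scale_scale)
      qed
      moreover have "x \<in> W \<alpha>" using \<alpha> by (simp add: wspace_def)
      ultimately show ?thesis by (intro span_base) blast
    qed (simp add: span_zero)
  qed
  ultimately show ?thesis using span_minimal[OF _ subspace_span] by blast
qed

lemma hdual_eqI: "\<alpha> \<in> hdual sc H \<Longrightarrow> \<beta> \<in> hdual sc H \<Longrightarrow> (\<And>h. h \<in> H \<Longrightarrow> \<alpha> h = \<beta> h) \<Longrightarrow> \<alpha> = \<beta>"
proof
  assume *: "\<alpha> \<in> hdual sc H" "\<beta> \<in> hdual sc H" "\<And>h. h \<in> H \<Longrightarrow> \<alpha> h = \<beta> h"
  fix h show "\<alpha> h = \<beta> h" using * by (cases "h \<in> H") (simp_all add: hdual_def)
qed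

lemma W_indep: "indep_fam (hdual sc H) W"
proof (rule indep_fam_separated[where J = H and D = br and c = "\<lambda>\<alpha> h. \<alpha> h"])
  show "\<exists>h\<in>H. \<alpha> h \<noteq> \<beta> h" if "\<alpha> \<in> hdual sc H" "\<beta> \<in> hdual sc H" "\<alpha> \<noteq> \<beta>" for \<alpha> \<beta>
    using hdual_eqI[OF that(1,2)] that(3) by blast
qed (simp_all add: lin_ad wspace_def)

text \<open>Unlike \<open>roots\<close>, this keeps the weight 0 whenever its space is nonzero, so
  that the spaces W over R decompose the whole algebra, also when H = {0}.\<close>

definition R :: "('v \<Rightarrow> 'k) set" where "R = {\<alpha>\<in>hdual sc H. W \<alpha> \<noteq> {0}}"

lemma finite_R: "finite R"
  unfolding R_def by (rule finitely_many_summands[OF subspace_W W_span W_indep])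

lemma R_hdual: "\<alpha> \<in> R \<Longrightarrow> \<alpha> \<in> hdual sc H" by (simp add: R_def)

lemma W_R: "\<alpha> \<in> hdual sc H \<Longrightarrow> x \<in> W \<alpha> \<Longrightarrow> x \<noteq> 0 \<Longrightarrow> \<alpha> \<in> R"
  by (auto simp: R_def)

lemma R_W: "\<alpha> \<in> R \<Longrightarrow> \<exists>x\<in>W \<alpha>. x \<noteq> 0"
  using subspace_0[OF subspace_W[of \<alpha>]] unfolding R_def by blast

lemma roots_R: "roots sc br H = R - {0}"
  by (auto simp: roots_def R_def)

lemma R_span: "span (\<Union>\<alpha>\<in>R. W \<alpha>) = UNIV"
proof -
  have "(\<Union>\<alpha>\<in>hdual sc H. W \<alpha>) \<subseteq> span (\<Union>\<alpha>\<in>R. W \<alpha>)"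
  proof
    fix x assume "x \<in> (\<Union>\<alpha>\<in>hdual sc H. W \<alpha>)"
    then obtain \<alpha> where \<alpha>: "\<alpha> \<in> hdual sc H" "x \<in> W \<alpha>" by blast
    show "x \<in> span (\<Union>\<alpha>\<in>R. W \<alpha>)"
    proof (cases "x = 0")
      case False
      then have "\<alpha> \<in> R" using W_R \<alpha> by blast
      then show ?thesis using \<alpha>(2) by (intro span_base) blast
    qed (simp add: span_zero)
  qed
  then show ?thesis using W_span span_minimal[OF _ subspace_span] by blast
qed

lemma R_indep: "indep_fam R W"
  unfolding indep_fam_def
proof (intro allI impI ballI)
  fix F x i assume F: "finite F" "F \<subseteq> R" "\<forall>i\<in>F. x i \<in> W i" "sum x F = 0" "i \<in> F"
  have "F \<subseteq> hdual sc H" using F(2) R_hdual by blast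
  from indep_famD[OF W_indep F(1) this _ F(4,5)] show "x i = 0" using F(3) by simp
qed

definition pr :: "('v \<Rightarrow> 'k) \<Rightarrow> 'v \<Rightarrow> 'v" where
  "pr = (SOME pr. (\<forall>i. lin (pr i)) \<and> (\<forall>i x. i \<in> R \<longrightarrow> pr i x \<in> W i) \<and>
     (\<forall>x. (\<Sum>i\<in>R. pr i x) = x) \<and> (\<forall>i j x. i \<in> R \<longrightarrow> x \<in> W i \<longrightarrow> pr j x = (if i = j then x else 0)))"

lemma lin_pr: "lin (pr \<alpha>)"
  and pr_W: "\<alpha> \<in> R \<Longrightarrow> pr \<alpha> x \<in> W \<alpha>"
  and pr_sum: "(\<Sum>\<alpha>\<in>R. pr \<alpha> x) = x"
  and pr_on: "\<alpha> \<in> R \<Longrightarrow> x \<in> W \<alpha> \<Longrightarrow> pr \<beta> x = (if \<alpha> = \<beta> then x else 0)"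
proof -
  have "\<exists>pr. (\<forall>i. lin (pr i)) \<and> (\<forall>i x. i \<in> R \<longrightarrow> pr i x \<in> W i) \<and>
     (\<forall>x. (\<Sum>i\<in>R. pr i x) = x) \<and> (\<forall>i j x. i \<in> R \<longrightarrow> x \<in> W i \<longrightarrow> pr j x = (if i = j then x else 0))"
  proof (rule projections_exist[OF finite_R subspace_W R_span R_indep])
    fix p assume p: "\<And>i. lin (p i)" "\<And>i x. i \<in> R \<Longrightarrow> p i x \<in> W i"
      "\<And>x. (\<Sum>i\<in>R. p i x) = x" "\<And>i j x. i \<in> R \<Longrightarrow> x \<in> W i \<Longrightarrow> p j x = (if i = j then x else 0)"
    show ?thesis by (intro exI[of _ p] conjI allI impI p)
  qed
  from someI_ex[OF this] show "lin (pr \<alpha>)" "\<alpha> \<in> R \<Longrightarrow> pr \<alpha> x \<in> W \<alpha>" "(\<Sum>\<alpha>\<in>R. pr \<alpha> x) = x"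
    "\<alpha> \<in> R \<Longrightarrow> x \<in> W \<alpha> \<Longrightarrow> pr \<beta> x = (if \<alpha> = \<beta> then x else 0)"
    unfolding pr_def[symmetric] by blast+
qed

text \<open>Subspaces stable under ad H split into weight components. This is applied to S, to the
  eigenspaces G l and to preimages of eigenspaces of the second tuple.\<close>

lemma pr_invariant:
  assumes T: "subspace T" "\<And>h x. h \<in> H \<Longrightarrow> x \<in> T \<Longrightarrow> br h x \<in> T" and x: "x \<in> T" and \<alpha>: "\<alpha> \<in> R"
  shows "pr \<alpha> x \<in> T"
proof (rule separated_invariant[OF finite_R T(1), where J = H and D = br and c = "\<lambda>\<alpha> h. \<alpha> h" and x = "\<lambda>\<alpha>. pr \<alpha> x"])
  show "br h y \<in> T" if "h \<in> H" "y \<in> T" for h y using T(2) that by blast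
  show "br h (pr \<beta> x) = sc (\<beta> h) (pr \<beta> x)" if "\<beta> \<in> R" "h \<in> H" for \<beta> h
    using pr_W[OF that(1), of x] that(2) by (simp add: wspace_def)
  show "\<exists>h\<in>H. \<alpha> h \<noteq> \<beta> h" if "\<alpha> \<in> R" "\<beta> \<in> R" "\<alpha> \<noteq> \<beta>" for \<alpha> \<beta>
    using hdual_eqI[OF R_hdual[OF that(1)] R_hdual[OF that(2)]] that(3) by blast
qed (use x \<alpha> in \<open>simp_all add: lin_ad pr_sum\<close>)

lemma pr_S: "x \<in> S \<Longrightarrow> \<alpha> \<in> R \<Longrightarrow> pr \<alpha> x \<in> S"
  by (rule pr_invariant[OF subspace_S]) (use S_br H_S in auto)

lemma br_W: assumes "x \<in> W \<alpha>" "y \<in> W \<beta>" shows "br x y \<in> W (\<alpha> + \<beta>)"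
  unfolding wspace_def
proof (intro CollectI ballI)
  fix h assume h: "h \<in> H"
  have "br h x = sc (\<alpha> h) x" "br h y = sc (\<beta> h) y" using assms h by (auto simp: wspace_def)
  then show "br h (br x y) = sc ((\<alpha> + \<beta>) h) (br x y)"
    by (simp add: jacobi[of h] br_sc_left br_sc_right scale_left_distrib)
qed

lemma hdual_add: "\<alpha> \<in> hdual sc H \<Longrightarrow> \<beta> \<in> hdual sc H \<Longrightarrow> \<alpha> + \<beta> \<in> hdual sc H"
  by (auto simp: hdual_def algebra_simps)

lemma hdual_diff: "\<alpha> \<in> hdual sc H \<Longrightarrow> \<beta> \<in> hdual sc H \<Longrightarrow> \<alpha> - \<beta> \<in> hdual sc H"
  by (auto simp: hdual_def algebra_simps)

lemma hdual_0: "0 \<in> hdual sc H"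
  by (auto simp: hdual_def)

lemma kap_W:
  assumes "x \<in> W \<alpha>" "y \<in> W \<beta>" "h \<in> H" "\<alpha> h + \<beta> h \<noteq> 0" shows "kap x y = 0"
proof -
  have hx: "br h x = sc (\<alpha> h) x" and hy: "br h y = sc (\<beta> h) y" using assms by (auto simp: wspace_def)
  have "\<alpha> h * kap x y = kap (br h x) y" by (simp add: hx kap_sc_left)
  also have "\<dots> = - kap (br x h) y" using br_anti[of h x] kap_sc_left[of "-1" "br x h"] by simp
  also have "kap (br x h) y = kap x (br h y)" by (rule kap_invariant)
  also have "\<dots> = \<beta> h * kap x y" by (simp add: hy kap_sc_right)
  finally have "(\<alpha> h + \<beta> h) * kap x y = 0" by (simp add: algebra_simps)
  then show ?thesis using assms(4) by simp
qed

lemma kap_W_opp: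
  assumes "\<alpha> \<in> hdual sc H" "\<beta> \<in> hdual sc H" "x \<in> W \<alpha>" "y \<in> W \<beta>" "\<alpha> + \<beta> \<noteq> 0"
  shows "kap x y = 0"
proof -
  obtain h where "h \<in> H" "(\<alpha> + \<beta>) h \<noteq> 0"
    using hdual_eqI[OF hdual_add[OF assms(1,2)] hdual_0] assms(5) by auto
  then show ?thesis using kap_W[OF assms(3,4)] by simp
qed

section \<open>A Cartan subalgebra is its own centraliser\<close>

lemma H_W0: "H \<subseteq> W 0"
  by (auto simp: wspace_def H_abelian)

definition C :: "'v set" where "C = S \<inter> W 0"

lemma C_iff: "x \<in> C \<longleftrightarrow> x \<in> S \<and> (\<forall>h\<in>H. br h x = 0)"
  by (simp add: C_def wspace_def)

lemma subspace_C: "subspace C"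
  unfolding C_def by (rule subspace_inter[OF subspace_S subspace_W])

lemma C_br: "x \<in> C \<Longrightarrow> y \<in> C \<Longrightarrow> br x y \<in> C"
  by (auto simp: C_iff S_br jacobi)

lemma H_C: "H \<subseteq> C" using H_S H_W0 by (auto simp: C_def)

text \<open>Adjoining to H a diagonalizable d that commutes with it gives a larger ad-diagonalizable
  subalgebra, since commuting diagonalizable maps are simultaneously diagonalizable. Maximality of H
  then absorbs d.\<close>

lemma C_diagble_H:
  assumes d: "d \<in> C" "diagble (br d)" shows "d \<in> H"
proof -
  let ?T = "span (insert d H)"
  have eq: "?T = {h + sc c d | h c. h \<in> H}" 
  proof
    show "?T \<subseteq> {h + sc c d | h c. h \<in> H}"
    proof
      fix x assume "x \<in> ?T"
      then obtain c where "x - sc c d \<in> span H" by (auto simp: span_insert)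
      then have "x - sc c d \<in> H" using subspace_H by (simp add: span_eq_iff[THEN iffD2])
      then show "x \<in> {h + sc c d | h c. h \<in> H}" by (intro CollectI exI[of _ "x - sc c d"] exI[of _ c]) simp
    qed
    show "{h + sc c d | h c. h \<in> H} \<subseteq> ?T" by (auto intro!: span_add span_scale intro: span_base)
  qed
  have dh: "br h d = 0" "br d h = 0" if "h \<in> H" for h
    using d(1) that br_anti[of d h] by (auto simp: C_iff)
  have "ad_diag_subalg sc br S ?T"
    unfolding ad_diag_subalg_def
  proof (intro conjI ballI)
    show TS: "?T \<subseteq> S" using d(1) H_S by (intro span_minimal subspace_S) (auto simp: C_iff)
    show "br x y \<in> ?T" if "x \<in> ?T" "y \<in> ?T" for x y
    proof -
      obtain h c h' c' where x: "x = h + sc c d" and y: "y = h' + sc c' d" and h: "h \<in> H" "h' \<in> H"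
        using \<open>x \<in> ?T\<close> \<open>y \<in> ?T\<close> unfolding eq by blast
      have "br x y = 0"
        unfolding x y by (simp add: br_add_left br_add_right br_sc_left br_sc_right dh h H_abelian[OF h])
      then show ?thesis by (simp add: span_zero)
    qed
    show "ad_diag_on sc br S x" if x: "x \<in> ?T" for x
    proof (rule diagble_ad_diag)
      show "x \<in> S" using x TS by blast
      obtain h c where xe: "x = h + sc c d" and h: "h \<in> H" using x unfolding eq by blast
      have "span {y. \<forall>b\<in>{h, d}. \<exists>c. br b y = sc c y} = UNIV"
        by (rule simultaneous_diag)
           (use h d(2) H_diagble lin_ad jacobi[of h d] jacobi[of d h] dh[OF h] in auto)
      moreover have "{y. \<forall>b\<in>{h, d}. \<exists>c. br b y = sc c y} \<subseteq> {y. \<exists>c. br x y = sc c y}"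
        by (auto simp: xe br_add_left br_sc_left simp flip: scale_left_distrib)
      ultimately show "diagble (br x)"
        unfolding diagble_def using span_mono by blast
    qed
  qed simp
  then have "?T = H" by (rule H_maximal) (auto intro: span_base)
  then show ?thesis using span_base[of d "insert d H"] by simp
qed

text \<open>The semisimple part d of ad x kills whatever ad x kills, in particular H. So d
  centralises H, and being diagonalizable it lies in H.\<close>

lemma C_jordan:
  assumes x: "x \<in> C"
  shows "\<exists>d\<in>H. lnil (br (x - d)) \<and> (\<forall>y. br x y = 0 \<longrightarrow> br d y = 0)"
proof -
  obtain d where d: "d \<in> S" "\<forall>a. \<forall>y\<in>gspace (br x) a. br d y = sc a y"
    using jordan[of x] x by (auto simp: C_iff)
  have z: "br d y = 0" if "br x y = 0" for y
  proof -
    have "y \<in> gspace (br x) 0" by (rule eigen_gspace) (simp add: that)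
    then have "br d y = sc 0 y" using d(2) by blast
    then show ?thesis by simp
  qed
  have "br h d = 0" if h: "h \<in> H" for h
  proof -
    have "br x h = 0" using x h br_anti[of x h] by (auto simp: C_iff)
    then have "br d h = 0" by (rule z)
    then show ?thesis using br_anti[of h d] by simp
  qed
  then have "d \<in> C" using d(1) by (simp add: C_iff)
  then have "d \<in> H" by (rule C_diagble_H[OF _ jordan_diagble[OF d(2)]])
  then show ?thesis using jordan_lnil[OF d(2)] z by blast
qed

text \<open>Elements of weight 0 are orthogonal to all nonzero weights, so within S only the weight
  0 part, which is C, can pair with z.\<close>

lemma kap_C_nondeg:
  assumes z: "z \<in> C" and kz: "\<And>c. c \<in> C \<Longrightarrow> kap z c = 0" shows "z = 0"
proof (rule kap_nondeg_S)
  show "z \<in> S" using z by (simp add: C_iff)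
  show "kap z y = 0" if y: "y \<in> S" for y
  proof -
    have "kap z (pr \<alpha> y) = 0" if \<alpha>: "\<alpha> \<in> R" for \<alpha>
    proof (cases "\<alpha> = 0")
      case True
      then have "pr \<alpha> y \<in> C" using pr_S[OF y \<alpha>] pr_W[OF \<alpha>, of y] by (simp add: C_def)
      then show ?thesis by (rule kz)
    next
      case False
      have "z \<in> W 0" using z by (simp add: C_def)
      then show ?thesis
        using kap_W_opp[OF hdual_0 R_hdual[OF \<alpha>] _ pr_W[OF \<alpha>]] False by simp
    qed
    then have "(\<Sum>\<alpha>\<in>R. kap z (pr \<alpha> y)) = 0" by simp
    then show ?thesis using kap_sum_right[of z "\<lambda>\<alpha>. pr \<alpha> y" R] by (simp add: pr_sum)
  qed
qed

text \<open>An element y of C differs from some d in H by an element with nilpotent ad that commutes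
  with h and is thus orthogonal to h. Orthogonality to H therefore implies orthogonality to
  C.\<close>

lemma kap_H_nondeg:
  assumes h: "h \<in> H" and z: "\<And>h'. h' \<in> H \<Longrightarrow> kap h h' = 0" shows "h = 0"
proof (rule kap_C_nondeg)
  show "h \<in> C" using h H_C by blast
  show "kap h y = 0" if y: "y \<in> C" for y
  proof -
    obtain d where d: "d \<in> H" "lnil (br (y - d))" using C_jordan[OF y] by blast
    have "br h (y - d) = 0" using y d(1) h by (simp add: C_iff br_diff_right H_abelian)
    then have "br (y - d) h = 0" using br_anti[of "y - d" h] by simp
    then have "kap (y - d) h = 0" by (rule kap_central_nilpotent[OF d(2)])
    then show ?thesis using z[OF d(1)] by (simp add: kap_sym[of h] kap_diff_left)
  qed
qed

text \<open>The semisimple part of y lies in H and acts as zero on C, so on C the map ad y agrees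
  with the nilpotent ad (y - d).\<close>

lemma C_nil_ad:
  assumes x: "x \<in> C" and y: "y \<in> C" shows "\<exists>N. (br y ^^ N) x = 0"
proof -
  obtain d where d: "d \<in> H" "lnil (br (y - d))" using C_jordan[OF y] by blast
  have "(br (y - d) ^^ N) x = (br y ^^ N) x \<and> (br y ^^ N) x \<in> C" for N
  proof (induction N)
    case (Suc N)
    let ?w = "(br y ^^ N) x"
    have w: "?w \<in> C" using Suc by (rule conjunct2)
    have "br d ?w = 0" using w d(1) by (simp add: C_iff)
    then have "br (y - d) ?w = br y ?w" by (simp add: br_diff_left)
    then show ?case using Suc C_br[OF y w] by simp
  qed (use x in simp)
  moreover obtain N where "(br (y - d) ^^ N) x = 0" using d(2) by (auto simp: lnil_def)
  ultimately show ?thesis by metis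
qed

text \<open>Otherwise Engel's theorem for {0} \<subset> [C, C] gives a nonzero z in [C, C] that is
  central in C. Invariance makes z orthogonal to H. Its nilpotent part z - d commutes with C, hence
  is orthogonal to C; so d is orthogonal to H and vanishes. Then z itself is orthogonal to C, a
  contradiction.\<close>

lemma C_abelian: assumes "x \<in> C" "y \<in> C" shows "br x y = 0"
proof (rule ccontr)
  assume ne: "br x y \<noteq> 0"
  let ?D = "span (\<Union>x\<in>C. br x ` C)"
  have DC: "?D \<subseteq> C" by (rule span_minimal[OF _ subspace_C]) (use C_br in auto)
  have brD: "br c d \<in> ?D" if "c \<in> C" "d \<in> C" for c d
    using that by (intro span_base) auto
  have e: "engel C C"
    by (rule engel) (use C_nil_ad subspace_C C_br in \<open>auto simp: subalg_def\<close>)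
  have "br x y \<in> ?D" by (rule brD[OF assms])
  then have "{0} \<subset> ?D" using ne by (auto simp: span_zero)
  then obtain z where z: "z \<in> ?D" "z \<noteq> 0" "\<And>c. c \<in> C \<Longrightarrow> br c z = 0"
  proof (rule engelD[OF e subspace_single_0 subspace_span _ DC])
    show "br k w \<in> ?D" if "k \<in> C" "w \<in> ?D" for k w using brD that DC by blast
  qed auto
  have zC: "z \<in> C" using z(1) DC by blast
  have kHD: "kap h w = 0" if h: "h \<in> H" and w: "w \<in> ?D" for h w
  proof -
    have "?D \<subseteq> {w. kap h w = 0}"
    proof (rule span_minimal)
      show "subspace {w. kap h w = 0}" by (rule subspaceI) (simp_all add: kap_add_right kap_sc_right)
      show "(\<Union>x\<in>C. br x ` C) \<subseteq> {w. kap h w = 0}"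
        using h by (auto simp: C_iff kap_invariant[symmetric])
    qed
    then show ?thesis using w by blast
  qed
  obtain d where d: "d \<in> H" "lnil (br (z - d))" "\<forall>y. br z y = 0 \<longrightarrow> br d y = 0"
    using C_jordan[OF zC] by blast
  have zc: "br z c = 0" if "c \<in> C" for c using z(3)[OF that] br_anti[of z c] by simp
  have kn: "kap (z - d) c = 0" if "c \<in> C" for c
    by (rule kap_central_nilpotent[OF d(2)]) (use zc d(3) that in \<open>simp add: br_diff_left\<close>)
  have "d = 0"
  proof (rule kap_H_nondeg[OF d(1)])
    fix h assume h: "h \<in> H"
    have "kap z h = 0" using kHD[OF h z(1)] by (simp add: kap_sym)
    then show "kap d h = 0" using kn[of h] h H_C by (auto simp: kap_diff_left)
  qed
  have "z = 0" by (rule kap_C_nondeg[OF zC]) (use kn \<open>d = 0\<close> in simp)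
  then show False using z(2) by simp
qed

text \<open>For x in the abelian C, the nilpotent part x - d commutes with C, so it is orthogonal to
  C and zero.\<close>

lemma C_eq_H: "C = H"
proof
  show "C \<subseteq> H"
  proof
    fix x assume x: "x \<in> C"
    obtain d where d: "d \<in> H" "lnil (br (x - d))" using C_jordan[OF x] by blast
    have xd: "x - d \<in> C" using x d(1) H_C subspace_C by (auto intro: subspace_diff)
    have kn: "kap (x - d) c = 0" if "c \<in> C" for c
      by (rule kap_central_nilpotent[OF d(2) C_abelian[OF xd that]])
    have "x - d = 0" by (rule kap_C_nondeg[OF xd kn])
    then show "x \<in> H" using d(1) by simp
  qed
qed (rule H_C)

end

lemma common_denominator:
  assumes "finite (X :: rat set)" shows "\<exists>D::nat. 0 < D \<and> (\<forall>x\<in>X. of_nat D * x \<in> \<int>)"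
  using assms
proof (induction X rule: finite_induct)
  case empty
  show ?case by (intro exI[of _ 1]) simp
next
  case (insert x X)
  then obtain D where D: "0 < D" "\<forall>x\<in>X. of_nat D * x \<in> \<int>" by blast
  obtain a b where "x = Fract a b" and b: "0 < b" by (cases x)
  then have ab: "x = of_int a / of_int b" by (simp add: Fract_of_int_quotient)
  have nb: "(of_nat (nat b) :: rat) = of_int b" using b by simp
  have "of_nat (D * nat b) * x = of_int (int D * a)"
    using b unfolding ab of_nat_mult nb of_int_mult of_int_of_nat_eq by simp
  then have 1: "of_nat (D * nat b) * x \<in> \<int>" by (simp only: Ints_of_int)
  have 2: "of_nat (D * nat b) * y \<in> \<int>" if y: "y \<in> X" for y
  proof -
    have "of_nat (D * nat b) * y = of_int b * (of_nat D * y)" unfolding of_nat_mult nb by simp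
    also have "\<dots> \<in> \<int>" using D(2) y by (intro Ints_mult[OF Ints_of_int]) blast
    finally show ?thesis .
  qed
  have "0 < D * nat b" using D(1) b by simp
  then show ?case using 1 2 by (intro exI[of _ "D * nat b"] conjI ballI) (auto simp only: insert_iff)
qed

section \<open>Automorphisms commuting with the tuple; orthogonality inside S\<close>

context lie_fixed begin

text \<open>Conjugation by these automorphisms leaves the tuple unchanged, so they can move a Cartan
  subalgebra of S without disturbing the identity in (b).\<close>

definition saut :: "('v \<Rightarrow> 'v) \<Rightarrow> bool" where
  "saut \<theta> \<longleftrightarrow> aut \<theta> \<and> (\<forall>i x. \<theta> (\<sigma> i x) = \<sigma> i (\<theta> x))"

lemma saut_comp: "saut \<theta> \<Longrightarrow> saut \<eta> \<Longrightarrow> saut (\<lambda>x. \<theta> (\<eta> x))"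
  by (simp add: saut_def aut_comp)

lemma saut_inv: assumes "saut \<theta>" shows "saut (inv \<theta>)"
  unfolding saut_def
proof (intro conjI allI)
  have a: "aut \<theta>" using assms by (simp add: saut_def)
  show "aut (inv \<theta>)" by (rule aut_inv[OF a])
  fix i x
  have "\<sigma> i x = \<theta> (\<sigma> i (inv \<theta> x))" using assms aut_inv_right[OF a] by (simp add: saut_def)
  then show "inv \<theta> (\<sigma> i x) = \<sigma> i (inv \<theta> x)" using aut_inv_left[OF a] by simp
qed

lemma saut_id: "saut (\<lambda>x. x)"
  by (simp add: saut_def aut_def lie_iso_def bij_def surj_def)

lemma saut_S: assumes "saut \<theta>" "x \<in> S" shows "\<theta> x \<in> S"
proof -
  have "\<sigma> i (\<theta> x) = \<theta> (\<sigma> i x)" for i using assms(1) by (simp add: saut_def)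
  then show ?thesis using assms(2) by (simp add: S_def)
qed

lemma \<sigma>_power_ad: "u \<in> S \<Longrightarrow> \<sigma> i ((br u ^^ k) x) = (br u ^^ k) (\<sigma> i x)"
  by (induction k) (simp_all add: \<sigma>_br S_def)

lemma expad_saut:
  assumes u: "u \<in> S" and nil: "\<And>x. (br u ^^ N) x = 0" shows "saut (expad N u)"
  unfolding saut_def
  by (simp add: expad_aut[OF nil] expad_def lin_sum[OF \<sigma>_lin] lin_sc[OF \<sigma>_lin] \<sigma>_power_ad[OF u])

text \<open>A linear functional that vanishes on U but not at w is represented by an element of S,
  because the form is nondegenerate there.\<close>

lemma kap_separates:
  assumes U: "subspace U" "U \<subseteq> S" and w: "w \<in> S" "w \<notin> U"
  shows "\<exists>y\<in>S. (\<forall>u\<in>U. kap y u = 0) \<and> kap y w \<noteq> 0"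
proof -
  obtain A where A: "A \<subseteq> U" "independent A" "U \<subseteq> span A"
    using maximal_independent_subset by blast
  have spA: "span A = U" using span_minimal[OF A(1) U(1)] A(3) by blast
  have iw: "independent (insert w A)" by (rule independent_insertI[OF _ A(2)]) (simp add: w(2) spA)
  obtain B where B: "insert w A \<subseteq> B" "independent B" "UNIV \<subseteq> span B"
    by (rule maximal_independent_subset_extend[OF subset_UNIV iw])
  have sp: "x \<in> span B" for x using B(3) by blast
  define l where "l x = representation B x w" for x
  obtain y where y: "y \<in> S" "\<forall>x\<in>S. kap y x = l x"
  proof -
    have "\<exists>y\<in>S. \<forall>x\<in>S. kap y x = l x"
      by (rule kap_represents[OF subspace_S kap_nondeg_S])
         (simp_all add: l_def representation_add[OF B(2) sp sp] representation_scale[OF B(2) sp])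
    then show thesis using that by blast
  qed
  have "l w = 1" using B(1,2) by (simp add: l_def representation_basis)
  moreover have "l u = 0" if u: "u \<in> U" for u
  proof -
    have "representation B u = representation A u"
      by (rule representation_extend[OF B(2)]) (use u spA B(1) in auto)
    moreover have "w \<notin> A" using w(2) A(1) by blast
    ultimately show ?thesis using representation_ne_zero[of A u w] by (auto simp: l_def)
  qed
  ultimately show ?thesis using y U(2) w(1) by (intro bexI[of _ y]) auto
qed

end

section \<open>Heights and Borel-like subalgebras\<close>

context cartan begin

lemma hdual_additive: "\<alpha> \<in> hdual sc H \<Longrightarrow> x \<in> H \<Longrightarrow> y \<in> H \<Longrightarrow> \<alpha> (x + y) = \<alpha> x + \<alpha> y"
  by (simp add: hdual_def)

lemma hdual_homogeneous: "\<alpha> \<in> hdual sc H \<Longrightarrow> x \<in> H \<Longrightarrow> \<alpha> (sc c x) = c * \<alpha> x"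
  by (simp add: hdual_def)

lemma R_nonzero_on_H: assumes "\<alpha> \<in> R - {0}" shows "\<exists>h\<in>H. \<alpha> h \<noteq> 0"
  using hdual_eqI[OF R_hdual hdual_0, of \<alpha>] assms by auto

lemma regular_exists: "\<exists>h\<in>H. \<forall>\<alpha>\<in>R - {0}. \<alpha> h \<noteq> 0"
proof (rule avoid_hyperplanes[OF _ subspace_H])
  show "finite (R - {0})" using finite_R by simp
  show "p (x + y) = p x + p y" if "p \<in> R - {0}" "x \<in> H" "y \<in> H" for p x y
    using that hdual_additive[OF R_hdual] by simp
  show "p (sc c x) = c * p x" if "p \<in> R - {0}" "x \<in> H" for p c x
    using that hdual_homogeneous[OF R_hdual] by simp
qed (rule R_nonzero_on_H)

text \<open>A height replaces a choice of positive roots: it is nonzero on nonzero weights, and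
  integrality makes every positive value on R at least 1.\<close>

definition is_height :: "(('v \<Rightarrow> 'k) \<Rightarrow> rat) \<Rightarrow> bool" where
  "is_height f \<longleftrightarrow> (\<forall>\<alpha> \<beta>. f (\<alpha> + \<beta>) = f \<alpha> + f \<beta>) \<and> (\<forall>\<alpha>\<in>R. f \<alpha> \<in> \<int>) \<and> (\<forall>\<alpha>\<in>R - {0}. f \<alpha> \<noteq> 0)"

text \<open>Weights are evaluated at an element h where no nonzero weight vanishes, then sent to the
  rationals by a functional that is nonzero on these values; D clears the denominators.\<close>

lemma height_exists: "\<exists>f. is_height f"
proof -
  obtain h where h: "h \<in> H" "\<forall>\<alpha>\<in>R - {0}. \<alpha> h \<noteq> 0" using regular_exists by blast
  have "finite ((\<lambda>\<alpha>. \<alpha> h) ` (R - {0}))" "0 \<notin> (\<lambda>\<alpha>. \<alpha> h) ` (R - {0})" using finite_R h(2) by auto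
  from rat_linear_separates_finite[OF this] obtain f :: "'k \<Rightarrow> rat" where
    f: "rat_linear f" "\<forall>x\<in>(\<lambda>\<alpha>. \<alpha> h) ` (R - {0}). f x \<noteq> 0" by (elim exE conjE)
  obtain D :: nat where D: "0 < D" "\<forall>x\<in>(\<lambda>\<alpha>. f (\<alpha> h)) ` R. of_nat D * x \<in> \<int>"
    using common_denominator[of "(\<lambda>\<alpha>. f (\<alpha> h)) ` R"] finite_R by blast
  have "is_height (\<lambda>\<alpha>. of_nat D * f (\<alpha> h))"
    using f D by (auto simp: is_height_def rat_linear_def distrib_left)
  then show ?thesis by blast
qed

definition ht :: "('v \<Rightarrow> 'k) \<Rightarrow> rat" where "ht = (SOME f. is_height f)"

lemma ht: "is_height ht" unfolding ht_def by (rule someI_ex[OF height_exists])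

lemma ht_add: "ht (\<alpha> + \<beta>) = ht \<alpha> + ht \<beta>" using ht by (simp add: is_height_def)

lemma ht_zero: "ht 0 = 0" using ht_add[of 0 0] by simp

lemma ht_ne: "\<alpha> \<in> R \<Longrightarrow> \<alpha> \<noteq> 0 \<Longrightarrow> ht \<alpha> \<noteq> 0" using ht by (simp add: is_height_def)

lemma ht_pos: assumes "\<alpha> \<in> R" "0 < ht \<alpha>" shows "1 \<le> ht \<alpha>"
proof -
  obtain a :: int where "ht \<alpha> = of_int a"
    using ht assms(1) unfolding is_height_def by (metis Ints_cases)
  then show ?thesis using assms(2) by simp
qed

lemma pr_pr: "\<beta> \<in> R \<Longrightarrow> pr \<alpha> (pr \<beta> x) = (if \<beta> = \<alpha> then pr \<beta> x else 0)"
  using pr_on[OF _ pr_W] by blast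

lemma pr_notin: assumes "\<alpha> \<notin> R" shows "pr \<alpha> x = 0"
proof -
  have "pr \<alpha> x = pr \<alpha> (\<Sum>\<beta>\<in>R. pr \<beta> x)" by (simp add: pr_sum)
  also have "\<dots> = (\<Sum>\<beta>\<in>R. pr \<alpha> (pr \<beta> x))" by (rule lin_sum[OF lin_pr])
  also have "\<dots> = 0" using assms by (intro sum.neutral) (auto simp: pr_pr)
  finally show ?thesis .
qed

lemma pr_zero_H: "x \<in> S \<Longrightarrow> pr 0 x \<in> H"
proof (cases "0 \<in> R")
  case True
  assume "x \<in> S"
  then have "pr 0 x \<in> C" using True pr_S pr_W[OF True, of x] by (simp add: C_def)
  then show ?thesis by (simp add: C_eq_H)
qed (simp add: pr_notin subspace_0[OF subspace_H])

lemma W_eq: "\<alpha> \<in> R \<Longrightarrow> x \<in> W \<beta> \<Longrightarrow> \<beta> \<in> hdual sc H \<Longrightarrow> \<alpha> \<noteq> \<beta> \<Longrightarrow> pr \<alpha> x = 0"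
  using W_R[of \<beta> x] pr_on[of \<beta> x \<alpha>] lin_0[OF lin_pr] by (cases "x = 0") auto

text \<open>The sum of the weight spaces of height at least c: a decreasing filtration compatible
  with the bracket.\<close>

definition P :: "rat \<Rightarrow> 'v set" where "P c = {x. \<forall>\<alpha>\<in>R. ht \<alpha> < c \<longrightarrow> pr \<alpha> x = 0}"

lemma subspace_P: "subspace (P c)"
  unfolding P_def by (rule subspaceI) (auto simp: lin_add[OF lin_pr] lin_sc[OF lin_pr] lin_0[OF lin_pr])

lemma P_mono: "c \<le> d \<Longrightarrow> P d \<subseteq> P c"
  by (auto simp: P_def)

lemma W_P: assumes "\<alpha> \<in> hdual sc H" "x \<in> W \<alpha>" "c \<le> ht \<alpha>" shows "x \<in> P c"
  unfolding P_def
proof (intro CollectI ballI impI)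
  fix \<beta> assume \<beta>: "\<beta> \<in> R" "ht \<beta> < c"
  then have "\<beta> \<noteq> \<alpha>" using assms(3) by auto
  then show "pr \<beta> x = 0" by (rule W_eq[OF \<beta>(1) assms(2,1)])
qed

lemma P_br: assumes x: "x \<in> P c" and y: "y \<in> P d" shows "br x y \<in> P (c + d)"
proof -
  have "br x y = br (\<Sum>\<alpha>\<in>R. pr \<alpha> x) (\<Sum>\<beta>\<in>R. pr \<beta> y)" by (simp add: pr_sum)
  also have "\<dots> = (\<Sum>\<alpha>\<in>R. \<Sum>\<beta>\<in>R. br (pr \<alpha> x) (pr \<beta> y))" by (simp only: br_sum_left br_sum_right) (rule sum.swap)
  also have "\<dots> \<in> P (c + d)"
  proof (intro subspace_sum subspace_P)
    fix \<alpha> \<beta> assume R: "\<alpha> \<in> R" "\<beta> \<in> R"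
    show "br (pr \<alpha> x) (pr \<beta> y) \<in> P (c + d)"
    proof (cases "ht \<alpha> < c \<or> ht \<beta> < d")
      case True
      then have "br (pr \<alpha> x) (pr \<beta> y) = 0" using x y R by (auto simp: P_def)
      then show ?thesis using subspace_0[OF subspace_P] by simp
    next
      case False
      then show ?thesis
        by (intro W_P[OF hdual_add[OF R_hdual[OF R(1)] R_hdual[OF R(2)]] br_W[OF pr_W[OF R(1)] pr_W[OF R(2)]]])
           (simp add: ht_add)
    qed
  qed
  finally show ?thesis .
qed

lemma P_top: "\<exists>M. \<forall>c\<ge>M. P c = {0}"
proof -
  define M where "M = Max (insert 0 (ht ` R)) + 1"
  have M: "ht \<alpha> < M" if "\<alpha> \<in> R" for \<alpha>
  proof -
    have "ht \<alpha> \<le> Max (insert 0 (ht ` R))" using that finite_R by (intro Max_ge) auto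
    then show ?thesis by (simp add: M_def)
  qed
  have "P c = {0}" if c: "M \<le> c" for c
  proof -
    have "x = 0" if "x \<in> P c" for x
    proof -
      have "pr \<alpha> x = 0" if "\<alpha> \<in> R" for \<alpha> using \<open>x \<in> P c\<close> M[OF that] c that by (auto simp: P_def)
      then have "(\<Sum>\<alpha>\<in>R. pr \<alpha> x) = 0" by simp
      then show ?thesis by (simp add: pr_sum)
    qed
    then show ?thesis using subspace_0[OF subspace_P] by blast
  qed
  then show ?thesis by blast
qed

lemma P_bot: "\<exists>b. P b = UNIV"
proof -
  define b where "b = Min (insert 0 (ht ` R))"
  have "b \<le> ht \<alpha>" if "\<alpha> \<in> R" for \<alpha> using that finite_R unfolding b_def by (intro Min_le) auto
  then have "P b = UNIV" by (fastforce simp: P_def)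
  then show ?thesis by blast
qed

text \<open>Each application of ad n raises the height by at least 1, and the filtration is
  eventually zero.\<close>

lemma lnil_P1: assumes n: "n \<in> P 1" shows "lnil (br n)"
  unfolding lnil_def
proof
  fix x
  obtain b where b: "P b = UNIV" using P_bot by blast
  obtain M where M: "\<forall>c\<ge>M. P c = {0}" using P_top by blast
  have k: "(br n ^^ k) x \<in> P (b + of_nat k)" for k
  proof (induction k)
    case (Suc k)
    have "br n ((br n ^^ k) x) \<in> P (1 + (b + of_nat k))" by (rule P_br[OF n Suc])
    then show ?case by (simp add: algebra_simps)
  qed (simp add: b)
  obtain k :: nat where "M - b < of_nat k" using reals_Archimedean2 by blast
  then have "P (b + of_nat k) = {0}" using M by (simp add: algebra_simps)
  then show "\<exists>N. (br n ^^ N) x = 0" using k[of k] by blast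
qed

text \<open>N and B are the strictly positive and the nonnegative part of S, in the roles of the
  nilradical and of a Borel subalgebra; B is the direct sum of H and N by
  \<open>B_decomp\<close>.\<close>

definition N :: "'v set" where "N = S \<inter> P 1"
definition B :: "'v set" where "B = S \<inter> P 0"

lemma subspace_N: "subspace N" and subspace_B: "subspace B"
  unfolding N_def B_def by (intro subspace_inter subspace_S subspace_P)+

lemma N_B: "N \<subseteq> B" using P_mono[of 0 1] by (auto simp: N_def B_def)

lemma H_B: "H \<subseteq> B"
proof
  fix h assume h: "h \<in> H"
  then have "h \<in> P 0" using W_P[OF hdual_0, of h 0] H_W0 ht_zero by auto
  then show "h \<in> B" using h H_S by (auto simp: B_def)
qed

lemma B_decomp: assumes x: "x \<in> B" shows "pr 0 x \<in> H" "x - pr 0 x \<in> N"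
proof -
  have xS: "x \<in> S" and xP: "x \<in> P 0" using x by (auto simp: B_def)
  show h: "pr 0 x \<in> H" by (rule pr_zero_H[OF xS])
  have "pr \<alpha> (x - pr 0 x) = 0" if \<alpha>: "\<alpha> \<in> R" "ht \<alpha> < 1" for \<alpha>
  proof (cases "\<alpha> = 0")
    case True
    then show ?thesis using \<alpha> by (simp add: lin_diff[OF lin_pr] pr_pr)
  next
    case False
    \<comment> \<open>Heights of nonzero weights are nonzero integers, so a height below 1 is
      negative.\<close>
    then have "ht \<alpha> < 0" using \<alpha> ht_pos[OF \<alpha>(1)] ht_ne[OF \<alpha>(1)] by force
    then have "pr \<alpha> x = 0" using xP \<alpha>(1) by (auto simp: P_def)
    moreover have "pr \<alpha> (pr 0 x) = 0"
      using False by (cases "0 \<in> R") (auto simp: pr_pr pr_notin lin_0[OF lin_pr])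
    ultimately show ?thesis by (simp add: lin_diff[OF lin_pr])
  qed
  then have "x - pr 0 x \<in> P 1" by (auto simp: P_def)
  then show "x - pr 0 x \<in> N" using subspace_diff[OF subspace_S xS] h H_S by (auto simp: N_def)
qed

lemma pr_zero_N: assumes n: "n \<in> N" shows "pr 0 n = 0"
proof (cases "0 \<in> R")
  case True
  then show ?thesis using n ht_zero by (auto simp: N_def P_def)
qed (rule pr_notin)

lemma pr_zero_on_H: assumes h: "h \<in> H" shows "pr 0 h = h"
proof (cases "h = 0")
  case False
  then have "0 \<in> R" using W_R[OF hdual_0, of h] H_W0 h by blast
  then show ?thesis using pr_on[of 0 h 0] h H_W0 by auto
qed (simp add: lin_0[OF lin_pr])

text \<open>Weights of height at least 0 and at least 1 have a sum of positive height, so they are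
  never opposite.\<close>

lemma kap_B_N: assumes b: "b \<in> B" and n: "n \<in> N" shows "kap b n = 0"
proof -
  have "kap b n = kap (\<Sum>\<alpha>\<in>R. pr \<alpha> b) (\<Sum>\<beta>\<in>R. pr \<beta> n)" by (simp add: pr_sum)
  also have "\<dots> = (\<Sum>\<alpha>\<in>R. \<Sum>\<beta>\<in>R. kap (pr \<alpha> b) (pr \<beta> n))" by (simp only: kap_sum_left kap_sum_right) (rule sum.swap)
  also have "\<dots> = 0"
  proof (intro sum.neutral ballI)
    fix \<alpha> \<beta> assume R: "\<alpha> \<in> R" "\<beta> \<in> R"
    show "kap (pr \<alpha> b) (pr \<beta> n) = 0"
    proof (cases "ht \<alpha> < 0 \<or> ht \<beta> < 1")
      case True
      then show ?thesis using b n R by (auto simp: B_def N_def P_def)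
    next
      case False
      then have "ht (\<alpha> + \<beta>) \<noteq> 0" by (simp add: ht_add)
      then have "\<alpha> + \<beta> \<noteq> 0" using ht_zero by auto
      then show ?thesis by (rule kap_W_opp[OF R_hdual[OF R(1)] R_hdual[OF R(2)] pr_W[OF R(1)] pr_W[OF R(2)]])
    qed
  qed
  finally show ?thesis .
qed

text \<open>A component of y of negative height could pair only with the opposite weight, whose
  component in S lies in N. Orthogonality to N thus removes all negative heights.\<close>

lemma N_perp: assumes y: "y \<in> S" and z: "\<And>n. n \<in> N \<Longrightarrow> kap y n = 0" shows "y \<in> B"
proof -
  have "pr \<alpha> y = 0" if \<alpha>: "\<alpha> \<in> R" "ht \<alpha> < 0" for \<alpha>
  proof (rule kap_nondeg_S)
    show "pr \<alpha> y \<in> S" by (rule pr_S[OF y \<alpha>(1)])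
    show "kap (pr \<alpha> y) s = 0" if s: "s \<in> S" for s
    proof -
      have "kap (pr \<alpha> y) (pr \<beta> s) = 0" if \<beta>: "\<beta> \<in> R" for \<beta>
      proof (cases "\<alpha> + \<beta> = 0")
        case False
        then show ?thesis by (rule kap_W_opp[OF R_hdual[OF \<alpha>(1)] R_hdual[OF \<beta>] pr_W[OF \<alpha>(1)] pr_W[OF \<beta>]])
      next
        case True
        then have "0 < ht \<beta>" using ht_add[of \<alpha> \<beta>] ht_zero \<alpha>(2) by simp
        then have "1 \<le> ht \<beta>" by (rule ht_pos[OF \<beta>])
        then have "pr \<beta> s \<in> N" using W_P[OF R_hdual[OF \<beta>] pr_W[OF \<beta>]] pr_S[OF s \<beta>] by (simp add: N_def)
        then have "kap y (pr \<beta> s) = 0" by (rule z)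
        moreover have "kap y (pr \<beta> s) = (\<Sum>\<gamma>\<in>R. kap (pr \<gamma> y) (pr \<beta> s))"
          using kap_sum_left[of "\<lambda>\<gamma>. pr \<gamma> y" R "pr \<beta> s"] by (simp add: pr_sum)
        moreover have "(\<Sum>\<gamma>\<in>R. kap (pr \<gamma> y) (pr \<beta> s)) = (\<Sum>\<gamma>\<in>{\<alpha>}. kap (pr \<gamma> y) (pr \<beta> s))"
        proof (rule sum.mono_neutral_right[OF finite_R])
          show "\<forall>\<gamma>\<in>R - {\<alpha>}. kap (pr \<gamma> y) (pr \<beta> s) = 0"
          proof
            fix \<gamma> assume \<gamma>: "\<gamma> \<in> R - {\<alpha>}"
            then have "\<gamma> + \<beta> \<noteq> 0" using True by (metis DiffE add_right_imp_eq singletonI)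
            then show "kap (pr \<gamma> y) (pr \<beta> s) = 0"
              using kap_W_opp[OF R_hdual R_hdual[OF \<beta>] pr_W pr_W[OF \<beta>]] \<gamma> by blast
          qed
        qed (use \<alpha> in auto)
        ultimately show ?thesis by simp
      qed
      then have "(\<Sum>\<beta>\<in>R. kap (pr \<alpha> y) (pr \<beta> s)) = 0" by simp
      then show ?thesis using kap_sum_right[of "pr \<alpha> y" "\<lambda>\<beta>. pr \<beta> s" R] by (simp add: pr_sum)
    qed
  qed
  then show ?thesis using y by (auto simp: B_def P_def)
qed

text \<open>Modulo greater height, y acts on W \<alpha> as the scalar \<alpha> h, where h is the
  weight 0 part of y. Nilpotency forces \<alpha> h = 0 for all weights, so h is central and hence
  zero.\<close>

lemma nilpotent_B_N: assumes y: "y \<in> B" and nil: "lnil (br y)" shows "y \<in> N"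
proof -
  define h where "h = pr 0 y"
  define n where "n = y - h"
  have h: "h \<in> H" and n: "n \<in> N" using B_decomp[OF y] by (auto simp: h_def n_def)
  have yP: "y \<in> P 0" and nP: "n \<in> P 1" using y n by (auto simp: B_def N_def)
  have "br h x = 0" if x: "x \<in> W \<alpha>" and \<alpha>: "\<alpha> \<in> R" for x \<alpha>
  proof (cases "x = 0")
    case False
    have bhx: "br h x = sc (\<alpha> h) x" using x h by (simp add: wspace_def)
    have "(br y ^^ k) x - sc (\<alpha> h ^ k) x \<in> P (ht \<alpha> + 1)" for k
    proof (induction k)
      case 0
      show ?case using subspace_0[OF subspace_P] by simp
    next
      case (Suc k)
      define p where "p = (br y ^^ k) x - sc (\<alpha> h ^ k) x"
      have e: "(br y ^^ Suc k) x = br y p + sc (\<alpha> h ^ k) (br h x + br n x)"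
        by (simp add: p_def n_def br_diff_right br_diff_left br_sc_right)
      have "(br y ^^ Suc k) x - sc (\<alpha> h ^ Suc k) x = br y p + sc (\<alpha> h ^ k) (br n x)"
        unfolding e bhx by (simp add: scale_right_distrib mult.commute)
      moreover have "br y p \<in> P (0 + (ht \<alpha> + 1))" by (rule P_br[OF yP]) (use Suc in \<open>simp add: p_def\<close>)
      moreover have "br n x \<in> P (1 + ht \<alpha>)" by (rule P_br[OF nP W_P[OF R_hdual[OF \<alpha>] x order_refl]])
      ultimately show ?case
        by (simp add: add.commute subspace_add[OF subspace_P] subspace_scale[OF subspace_P])
    qed
    moreover obtain k where "(br y ^^ k) x = 0" using nil by (auto simp: lnil_def)
    ultimately have "- sc (\<alpha> h ^ k) x \<in> P (ht \<alpha> + 1)" by (metis diff_0)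
    then have "pr \<alpha> (- sc (\<alpha> h ^ k) x) = 0" using \<alpha> by (simp add: P_def)
    then have "sc (\<alpha> h ^ k) x = 0" using pr_on[OF \<alpha> x, of \<alpha>] by (simp add: lin_neg[OF lin_pr] lin_sc[OF lin_pr])
    then show ?thesis using False bhx by simp
  qed simp
  then have "(\<Union>\<alpha>\<in>R. W \<alpha>) \<subseteq> {x. br h x = 0}" by blast
  then have "span (\<Union>\<alpha>\<in>R. W \<alpha>) \<subseteq> {x. br h x = 0}" by (rule span_minimal[OF _ subspace_kernel[OF lin_ad]])
  then have "br h x = 0" for x using R_span by blast
  then have "br x h = 0" for x using br_anti[of x h] by simp
  then have "h = 0" by (rule center_trivial)
  then show ?thesis using n by (simp add: n_def)
qed

definition regular :: "'v \<Rightarrow> bool" where "regular h \<longleftrightarrow> h \<in> H \<and> (\<forall>\<alpha>\<in>R - {0}. \<alpha> h \<noteq> 0)"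

text \<open>A single regular element recovers its Cartan subalgebra, so conjugating regular elements
  suffices to conjugate Cartan subalgebras.\<close>

lemma regular_centralizer: assumes h: "regular h" shows "H = {y \<in> S. br h y = 0}"
proof
  show "H \<subseteq> {y \<in> S. br h y = 0}" using h H_S H_abelian by (auto simp: regular_def)
  show "{y \<in> S. br h y = 0} \<subseteq> H"
  proof clarify
    fix y assume y: "y \<in> S" "br h y = 0"
    have "pr \<alpha> y = 0" if \<alpha>: "\<alpha> \<in> R" "\<alpha> \<noteq> 0" for \<alpha>
    proof -
      have "pr \<alpha> y \<in> {y. br h y = 0}"
        by (rule pr_invariant[OF subspace_kernel[OF lin_ad] _ _ \<alpha>(1)])
           (use y(2) h in \<open>auto simp: H_comm regular_def\<close>)
      moreover have "br h (pr \<alpha> y) = sc (\<alpha> h) (pr \<alpha> y)"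
        using pr_W[OF \<alpha>(1), of y] h by (simp add: wspace_def regular_def)
      ultimately show ?thesis using h \<alpha> by (auto simp: regular_def)
    qed
    then have "(\<Sum>\<alpha>\<in>R. pr \<alpha> y) = (\<Sum>\<alpha>\<in>R. if \<alpha> = 0 then pr 0 y else 0)"
      by (intro sum.cong) auto
    then have "y = pr 0 y" using finite_R pr_notin[of 0 y] by (simp add: pr_sum split: if_splits)
    then show "y \<in> H" using pr_zero_H[OF y(1)] by simp
  qed
qed

text \<open>With [h, u] = n, the exponential of ad u cancels n to first order, and what remains has
  height at least 2 c. The number k bounds the rounds left before the heights reach M, where the
  filtration vanishes.\<close>

lemma eliminate:
  assumes h: "regular h" and M: "\<forall>c\<ge>M. P c = {0}"
  shows "n \<in> S \<inter> P c \<Longrightarrow> 1 \<le> c \<Longrightarrow> M \<le> c + of_nat k \<Longrightarrow> \<exists>\<theta>. saut \<theta> \<and> \<theta> (h + n) = h"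
proof (induction k arbitrary: n c)
  case 0
  then have "n = 0" using M by auto
  then show ?case using saut_id by (intro exI[of _ "\<lambda>x. x"]) simp
next
  case (Suc k)
  have nS: "n \<in> S" and nP: "n \<in> P c" and cge: "1 \<le> c" using Suc.prems by auto
  have hH: "h \<in> H" using h by (simp add: regular_def)
  \<comment> \<open>The equation [h, u] = n is solved weight by weight; division by \<alpha> h is
    possible as h is regular, and n has no component of weight 0.\<close>
  define u where "u = (\<Sum>\<alpha>\<in>R - {0}. sc (1 / \<alpha> h) (pr \<alpha> n))"
  have uS: "u \<in> S" unfolding u_def
    by (intro subspace_sum subspace_scale subspace_S) (use pr_S[OF nS] in auto)
  have uP: "u \<in> P c" unfolding u_def
  proof (intro subspace_sum subspace_scale subspace_P)
    fix \<alpha> assume \<alpha>: "\<alpha> \<in> R - {0}"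
    show "pr \<alpha> n \<in> P c" using nP \<alpha> by (auto simp: P_def pr_pr)
  qed
  have "br h u = (\<Sum>\<alpha>\<in>R - {0}. sc (1 / \<alpha> h) (br h (pr \<alpha> n)))"
    by (simp add: u_def br_sum_right br_sc_right)
  also have "\<dots> = (\<Sum>\<alpha>\<in>R - {0}. pr \<alpha> n)"
  proof (rule sum.cong[OF refl])
    fix \<alpha> assume \<alpha>: "\<alpha> \<in> R - {0}"
    then have "br h (pr \<alpha> n) = sc (\<alpha> h) (pr \<alpha> n)" using pr_W[of \<alpha> n] hH by (auto simp: wspace_def)
    then show "sc (1 / \<alpha> h) (br h (pr \<alpha> n)) = pr \<alpha> n" using h \<alpha> by (simp add: regular_def)
  qed
  also have "\<dots> = (\<Sum>\<alpha>\<in>R. pr \<alpha> n)"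
  proof (rule sum.mono_neutral_left[OF finite_R])
    have "n \<in> N" using nS nP P_mono[OF Suc.prems(2)] by (auto simp: N_def)
    then show "\<forall>i\<in>R - (R - {0}). pr i n = 0" using pr_zero_N by auto
  qed auto
  finally have hu: "br h u = n" by (simp add: pr_sum)
  have uh: "br u h = - n" using br_anti[of u h] hu by simp
  have nil: "lnil (br u)" by (rule lnil_P1) (use uP P_mono[OF Suc.prems(2)] in blast)
  obtain K0 where K0: "\<forall>x. (br u ^^ K0) x = 0" using lnil_uniform[OF lin_ad nil] by blast
  \<comment> \<open>Two extra terms let the orders 0 and 1 of the exponential be split off whatever
    K0 is.\<close>
  have K: "(br u ^^ Suc (Suc K0)) x = 0" for x using K0 by (simp add: lin_0[OF lin_ad])
  let ?e = "expad (Suc (Suc K0)) u"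
  have se: "saut ?e" by (rule expad_saut[OF uS K])
  define w where "w = - n + br u n"
  have wP: "w \<in> P c" and wS: "w \<in> S"
  proof -
    have "br u n \<in> P (c + c)" by (rule P_br[OF uP nP])
    then have "br u n \<in> P c" using P_mono[of c "c + c"] Suc.prems(2) by auto
    then show "w \<in> P c" unfolding w_def by (intro subspace_add subspace_neg subspace_P nP)
    show "w \<in> S" unfolding w_def by (intro subspace_add subspace_neg subspace_S nS S_br uS)
  qed
  have pw: "(br u ^^ Suc j) w \<in> P (c + c) \<inter> S" for j
  proof (induction j)
    case 0
    show ?case using P_br[OF uP wP] S_br[OF uS wS] by simp
  next
    case (Suc j)
    have "br u ((br u ^^ Suc j) w) \<in> P (c + (c + c))" using P_br[OF uP] Suc by blast
    then have "br u ((br u ^^ Suc j) w) \<in> P (c + c)"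
      using P_mono[of "c + c" "c + (c + c)"] cge by auto
    then show ?case using S_br[OF uS] Suc by simp
  qed
  define n' where "n' = br u n + (\<Sum>j<K0. sc (1 / fact (Suc (Suc j))) ((br u ^^ Suc j) w))"
  have uhn: "br u (h + n) = w" by (simp add: w_def br_add_right uh)
  have "?e (h + n) = (h + n) + (w + (\<Sum>j<K0. sc (1 / fact (Suc (Suc j))) ((br u ^^ Suc (Suc j)) (h + n))))"
    unfolding expad_def by (simp only: sum.lessThan_Suc_shift) (simp add: uhn)
  also have "(\<Sum>j<K0. sc (1 / fact (Suc (Suc j))) ((br u ^^ Suc (Suc j)) (h + n)))
     = (\<Sum>j<K0. sc (1 / fact (Suc (Suc j))) ((br u ^^ Suc j) w))"
    by (simp only: funpow_Suc_right[of "Suc _"] o_apply uhn)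
  finally have e: "?e (h + n) = h + n'" by (simp add: n'_def w_def)
  have "n' \<in> P (c + c) \<inter> S" unfolding n'_def
    by (intro subspace_add subspace_sum subspace_scale subspace_inter subspace_P subspace_S pw)
       (use P_br[OF uP nP] S_br[OF uS nS] in auto)
  \<comment> \<open>As c is at least 1, doubling the height gains at least one step.\<close>
  then have n': "n' \<in> S \<inter> P (c + 1)" using P_mono[of "c + 1" "c + c"] Suc.prems(2) by auto
  obtain \<theta> where \<theta>: "saut \<theta>" "\<theta> (h + n') = h"
    using Suc.IH[OF n'] Suc.prems(2,3) by (auto simp: algebra_simps)
  then show ?case using saut_comp[OF \<theta>(1) se] e by (intro exI[of _ "\<lambda>x. \<theta> (?e x)"]) simp
qed

lemma eliminate_N: assumes h: "regular h" and n: "n \<in> N" shows "\<exists>\<theta>. saut \<theta> \<and> \<theta> (h + n) = h"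
proof -
  obtain M where M: "\<forall>c\<ge>M. P c = {0}" using P_top by blast
  obtain k :: nat where "M - 1 < of_nat k" using reals_Archimedean2 by blast
  then have "M \<le> 1 + of_nat k" by simp
  then show ?thesis using eliminate[OF h M, of n 1 k] n by (simp add: N_def)
qed

end

section \<open>Conjugacy of Cartan subalgebras\<close>

context lie_fixed begin

text \<open>The crux is that B1 \<inter> B2 projects onto H1 and onto H2. If some h in H1 were
  outside (B1 \<inter> B2) + N1, some y orthogonal to that sum would pair with h. Being orthogonal
  to N1, y lies in B1; being orthogonal to B1 \<inter> B2, it lies in N1 + N2. Its N2-part lies in
  B1 and has nilpotent ad, hence is in N1. So y lies in N1, which is orthogonal to H1, a
  contradiction. The case of H2 is symmetric.\<close>

theorem cartan_conjugate:
  assumes H1: "cartan_sub sc br S H1" and H2: "cartan_sub sc br S H2"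
  shows "\<exists>\<theta>. saut \<theta> \<and> \<theta> ` H1 = H2"
proof -
  interpret c1: cartan sc br \<sigma> m H1 by unfold_locales (rule H1)
  interpret c2: cartan sc br \<sigma> m H2 by unfold_locales (rule H2)
  have 12: "c1.B \<inter> c2.N \<subseteq> c1.N"
    using c1.nilpotent_B_N c2.lnil_P1 by (auto simp: c2.N_def)
  have 21: "c2.B \<inter> c1.N \<subseteq> c2.N"
    using c2.nilpotent_B_N c1.lnil_P1 by (auto simp: c1.N_def)
  have B12: "subspace (c1.B \<inter> c2.B)" by (rule subspace_inter[OF c1.subspace_B c2.subspace_B])
  \<comment> \<open>Double orthogonality inside S: what is orthogonal to N1 + N2 lies in both
    Borel-like subalgebras, so the orthogonal of their intersection is contained in N1 + N2.\<close>
  have sumN: "y \<in> {x + y |x y. x \<in> c1.N \<and> y \<in> c2.N}"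
    if y: "y \<in> S" and z: "\<And>b. b \<in> c1.B \<Longrightarrow> b \<in> c2.B \<Longrightarrow> kap y b = 0" for y
  proof (rule ccontr)
    let ?U = "{x + y |x y. x \<in> c1.N \<and> y \<in> c2.N}"
    assume n: "y \<notin> ?U"
    have US: "?U \<subseteq> S" using subspace_add[OF subspace_S] by (auto simp: c1.N_def c2.N_def)
    obtain b where b: "b \<in> S" "\<forall>u\<in>?U. kap b u = 0" "kap b y \<noteq> 0"
      using kap_separates[OF subspace_sums[OF c1.subspace_N c2.subspace_N] US y n] by blast
    have "x \<in> ?U" if "x \<in> c1.N" for x
      using that subspace_0[OF c2.subspace_N] by (intro CollectI exI[of _ x] exI[of _ 0]) simp
    then have "b \<in> c1.B" using b by (intro c1.N_perp) auto
    have "x \<in> ?U" if "x \<in> c2.N" for x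
      using that subspace_0[OF c1.subspace_N] by (intro CollectI exI[of _ 0] exI[of _ x]) simp
    then have "b \<in> c2.B" using b by (intro c2.N_perp) auto
    then show False using z[OF \<open>b \<in> c1.B\<close>] b(3) by (simp add: kap_sym)
  qed
  have lift1: "\<exists>b\<in>c1.B \<inter> c2.B. c1.pr 0 b = h" if h: "h \<in> H1" for h
  proof -
    let ?U = "{x + y |x y. x \<in> c1.B \<inter> c2.B \<and> y \<in> c1.N}"
    have "h \<in> ?U"
    proof (rule ccontr)
      assume n: "h \<notin> ?U"
      have US: "?U \<subseteq> S" using subspace_add[OF subspace_S] by (auto simp: c1.N_def c1.B_def)
      have hS: "h \<in> S" using h c1.H_S by blast
      obtain y where y: "y \<in> S" "\<forall>u\<in>?U. kap y u = 0" "kap y h \<noteq> 0"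
        using kap_separates[OF subspace_sums[OF B12 c1.subspace_N] US hS n] by blast
      have "x \<in> ?U" if "x \<in> c1.N" for x
        using that subspace_0[OF B12] by (intro CollectI exI[of _ 0] exI[of _ x]) simp
      then have yB: "y \<in> c1.B" using y by (intro c1.N_perp) auto
      have "x \<in> ?U" if "x \<in> c1.B" "x \<in> c2.B" for x
        using that subspace_0[OF c1.subspace_N] by (intro CollectI exI[of _ x] exI[of _ 0]) simp
      then have "y \<in> {x + y |x y. x \<in> c1.N \<and> y \<in> c2.N}" using y by (intro sumN) auto
      then obtain n1 n2 where n12: "y = n1 + n2" "n1 \<in> c1.N" "n2 \<in> c2.N" by blast
      have "n2 = y - n1" using n12(1) by simp
      then have "n2 \<in> c1.B" using yB n12(2) c1.N_B subspace_diff[OF c1.subspace_B] by blast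
      then have "n2 \<in> c1.N" using 12 n12(3) by blast
      then have "y \<in> c1.N" using n12 subspace_add[OF c1.subspace_N] by blast
      then have "kap h y = 0" using c1.kap_B_N c1.H_B h by blast
      then show False using y(3) by (simp add: kap_sym)
    qed
    then obtain b n where bn: "h = b + n" "b \<in> c1.B \<inter> c2.B" "n \<in> c1.N" by blast
    have "c1.pr 0 h = c1.pr 0 b" using bn by (simp add: lin_add[OF c1.lin_pr] c1.pr_zero_N)
    then show ?thesis using bn(2) c1.pr_zero_on_H[OF h] by (intro bexI[of _ b]) auto
  qed
  have lift2: "\<exists>b\<in>c1.B \<inter> c2.B. c2.pr 0 b = h" if h: "h \<in> H2" for h
  proof -
    let ?U = "{x + y |x y. x \<in> c1.B \<inter> c2.B \<and> y \<in> c2.N}"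
    have "h \<in> ?U"
    proof (rule ccontr)
      assume n: "h \<notin> ?U"
      have US: "?U \<subseteq> S" using subspace_add[OF subspace_S] by (auto simp: c2.N_def c1.B_def)
      have hS: "h \<in> S" using h c2.H_S by blast
      obtain y where y: "y \<in> S" "\<forall>u\<in>?U. kap y u = 0" "kap y h \<noteq> 0"
        using kap_separates[OF subspace_sums[OF B12 c2.subspace_N] US hS n] by blast
      have "x \<in> ?U" if "x \<in> c2.N" for x
        using that subspace_0[OF B12] by (intro CollectI exI[of _ 0] exI[of _ x]) simp
      then have yB: "y \<in> c2.B" using y by (intro c2.N_perp) auto
      have "x \<in> ?U" if "x \<in> c1.B" "x \<in> c2.B" for x
        using that subspace_0[OF c2.subspace_N] by (intro CollectI exI[of _ x] exI[of _ 0]) simp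
      then have "y \<in> {x + y |x y. x \<in> c1.N \<and> y \<in> c2.N}" using y by (intro sumN) auto
      then obtain n1 n2 where n12: "y = n1 + n2" "n1 \<in> c1.N" "n2 \<in> c2.N" by blast
      have "n1 = y - n2" using n12(1) by simp
      then have "n1 \<in> c2.B" using yB n12(3) c2.N_B subspace_diff[OF c2.subspace_B] by blast
      then have "n1 \<in> c2.N" using 21 n12(2) by blast
      then have "y \<in> c2.N" using n12 subspace_add[OF c2.subspace_N] by blast
      then have "kap h y = 0" using c2.kap_B_N c2.H_B h by blast
      then show False using y(3) by (simp add: kap_sym)
    qed
    then obtain b n where bn: "h = b + n" "b \<in> c1.B \<inter> c2.B" "n \<in> c2.N" by blast
    have "c2.pr 0 h = c2.pr 0 b" using bn by (simp add: lin_add[OF c2.lin_pr] c2.pr_zero_N)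
    then show ?thesis using bn(2) c2.pr_zero_on_H[OF h] by (intro bexI[of _ b]) auto
  qed
  \<comment> \<open>By the two lifts, no nonzero weight of either Cartan subalgebra, composed with
    its projection, vanishes identically on the intersection; a common nonzero point projects to
    regular elements on both sides.\<close>
  let ?F = "(\<lambda>\<alpha> x. \<alpha> (c1.pr 0 x)) ` (c1.R - {0}) \<union> (\<lambda>\<alpha> x. \<alpha> (c2.pr 0 x)) ` (c2.R - {0})"
  have p1: "c1.pr 0 x \<in> H1" if "x \<in> c1.B \<inter> c2.B" for x using that c1.B_decomp(1) by blast
  have p2: "c2.pr 0 x \<in> H2" if "x \<in> c1.B \<inter> c2.B" for x using that c2.B_decomp(1) by blast
  have "\<exists>x\<in>c1.B \<inter> c2.B. \<forall>p\<in>?F. p x \<noteq> 0"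
  proof (rule avoid_hyperplanes[OF _ B12])
    show "finite ?F" using c1.finite_R c2.finite_R by simp
    show "p (x + y) = p x + p y" if "p \<in> ?F" "x \<in> c1.B \<inter> c2.B" "y \<in> c1.B \<inter> c2.B" for p x y
      using that(1) c1.hdual_additive[OF c1.R_hdual p1[OF that(2)] p1[OF that(3)]]
        c2.hdual_additive[OF c2.R_hdual p2[OF that(2)] p2[OF that(3)]]
      by (auto simp: lin_add[OF c1.lin_pr] lin_add[OF c2.lin_pr])
    show "p (sc c x) = c * p x" if "p \<in> ?F" "x \<in> c1.B \<inter> c2.B" for p c x
      using that(1) c1.hdual_homogeneous[OF c1.R_hdual p1[OF that(2)]]
        c2.hdual_homogeneous[OF c2.R_hdual p2[OF that(2)]]
      by (auto simp: lin_sc[OF c1.lin_pr] lin_sc[OF c2.lin_pr])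
    show "\<exists>x\<in>c1.B \<inter> c2.B. p x \<noteq> 0" if p: "p \<in> ?F" for p
    proof -
      consider \<alpha> where "\<alpha> \<in> c1.R - {0}" "p = (\<lambda>x. \<alpha> (c1.pr 0 x))"
        | \<alpha> where "\<alpha> \<in> c2.R - {0}" "p = (\<lambda>x. \<alpha> (c2.pr 0 x))" using p by blast
      then show ?thesis
      proof cases
        case 1
        then obtain h where "h \<in> H1" "\<alpha> h \<noteq> 0" using c1.R_nonzero_on_H by blast
        then show ?thesis using lift1[of h] 1(2) by auto
      next
        case 2
        then obtain h where "h \<in> H2" "\<alpha> h \<noteq> 0" using c2.R_nonzero_on_H by blast
        then show ?thesis using lift2[of h] 2(2) by auto
      qed
    qed
  qed
  then obtain x where x: "x \<in> c1.B \<inter> c2.B" "\<forall>p\<in>?F. p x \<noteq> 0" by blast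
  define h1 where "h1 = c1.pr 0 x"
  define h2 where "h2 = c2.pr 0 x"
  have r1: "c1.regular h1" and r2: "c2.regular h2"
    using x p1[OF x(1)] p2[OF x(1)] by (auto simp: c1.regular_def c2.regular_def h1_def h2_def)
  obtain \<theta>1 where t1: "saut \<theta>1" "\<theta>1 x = h1"
    using c1.eliminate_N[OF r1, of "x - h1"] c1.B_decomp(2)[of x] x(1) by (auto simp: h1_def)
  obtain \<theta>2 where t2: "saut \<theta>2" "\<theta>2 x = h2"
    using c2.eliminate_N[OF r2, of "x - h2"] c2.B_decomp(2)[of x] x(1) by (auto simp: h2_def)
  \<comment> \<open>Both automorphisms start from the shared element x, so going back along the
    first and on along the second takes h1 to h2.\<close>
  define \<theta> where "\<theta> y = \<theta>2 (inv \<theta>1 y)" for y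
  have s\<theta>: "saut \<theta>" unfolding \<theta>_def by (rule saut_comp[OF t2(1) saut_inv[OF t1(1)]])
  have a: "aut \<theta>" and a1: "aut \<theta>1" using s\<theta> t1(1) by (simp_all add: saut_def)
  have \<theta>h: "\<theta> h1 = h2" using t1(2) t2(2) aut_inv_left[OF a1, of x] by (simp add: \<theta>_def)
  have "\<theta> ` {y \<in> S. br h1 y = 0} = {y \<in> S. br h2 y = 0}"
  proof
    show "\<theta> ` {y \<in> S. br h1 y = 0} \<subseteq> {y \<in> S. br h2 y = 0}"
    proof clarify
      fix y assume y: "y \<in> S" "br h1 y = 0"
      have "br h2 (\<theta> y) = \<theta> (br h1 y)" by (simp add: aut_br[OF a] \<theta>h)
      then show "\<theta> y \<in> S \<and> br h2 (\<theta> y) = 0" using y saut_S[OF s\<theta>] lin_0[OF aut_lin[OF a]] by simp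
    qed
    show "{y \<in> S. br h2 y = 0} \<subseteq> \<theta> ` {y \<in> S. br h1 y = 0}"
    proof clarify
      fix y assume y: "y \<in> S" "br h2 y = 0"
      let ?z = "inv \<theta> y"
      have z: "\<theta> ?z = y" by (rule aut_inv_right[OF a])
      have "\<theta> (br h1 ?z) = \<theta> 0" by (simp add: aut_br[OF a] \<theta>h z y(2) lin_0[OF aut_lin[OF a]])
      then have "br h1 ?z = 0" using bij_is_inj[OF aut_bij[OF a]] by (simp add: inj_eq)
      then show "y \<in> \<theta> ` {y \<in> S. br h1 y = 0}"
        using saut_S[OF saut_inv[OF s\<theta>] y(1)] z by (intro image_eqI[of _ _ ?z]) auto
    qed
  qed
  then have "\<theta> ` H1 = H2" using c1.regular_centralizer[OF r1] c2.regular_centralizer[OF r2] by simp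
  then show ?thesis using s\<theta> by blast
qed

end

section \<open>Roots of unity\<close>

lemma root_system_power: "root_system z \<Longrightarrow> 0 < n \<Longrightarrow> z n ^ n = (1::'k::field)"
  and root_system_primitive: "root_system z \<Longrightarrow> 0 < d \<Longrightarrow> d < n \<Longrightarrow> z n ^ d \<noteq> (1::'k::field)"
  and root_system_mult: "root_system z \<Longrightarrow> 0 < k \<Longrightarrow> 0 < n \<Longrightarrow> z (k * n) ^ k = (z n :: 'k::field)"
  by (simp_all add: root_system_def)

lemma root_system_nonzero:
  assumes "root_system z" "0 < n" shows "z n \<noteq> (0::'k::field)"
proof
  assume "z n = 0"
  then show False using root_system_power[OF assms] assms(2) by (simp add: power_0_left)
qed

text \<open>\<open>zpow\<close> reduces its argument to lowest terms. Compatibility of the chosen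
  roots of unity makes any other denominator give the same value.\<close>

lemma zpow_fraction:
  fixes z :: "nat \<Rightarrow> 'k::field"
  assumes z: "root_system z" and b: "0 < b"
  shows "zpow z (of_int a / of_nat b) = power_int (z b) a"
proof -
  obtain p q where pq: "quotient_of (of_int a / of_nat b) = (p, q)" by fastforce
  have q: "0 < q" using quotient_of_denom_pos[OF pq] .
  have cop: "coprime p q" using quotient_of_coprime[OF pq] .
  have "of_int a / of_nat b = (of_int p / of_int q :: rat)" using quotient_of_div[OF pq] .
  then have "of_int (a * q) = (of_int (p * int b) :: rat)" using q b by (simp add: field_simps)
  then have e: "a * q = p * int b" by (simp only: of_int_eq_iff)
  have "q dvd p * int b" unfolding e[symmetric] by simp
  then have "q dvd int b" using cop by (simp add: coprime_commute coprime_dvd_mult_right_iff)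
  then obtain d where d: "int b = q * d" by (rule dvdE)
  have "0 < q * d" using b unfolding d[symmetric] by simp
  then have d0: "0 < d" using q by (simp add: zero_less_mult_iff)
  have "a * q = (p * d) * q" using e d by simp
  then have a: "a = d * p" using q by simp
  have bn: "b = nat d * nat q" 
  proof -
    have "int b = int (nat d * nat q)" using d d0 q by simp
    then show ?thesis by (simp only: of_nat_eq_iff)
  qed
  have "power_int (z b) a = power_int (power_int (z b) d) p" by (simp add: a power_int_mult)
  also have "power_int (z b) d = z b ^ nat d" using d0 by (simp add: power_int_def)
  also have "\<dots> = z (nat q)" unfolding bn by (rule root_system_mult[OF z]) (use d0 q in simp_all)
  finally show ?thesis by (simp add: zpow_def pq)
qed

lemma rat_fractions:
  fixes p q :: rat
  obtains n a b where "0 < n" "p = of_int a / of_nat n" "q = of_int b / of_nat n"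
proof -
  obtain n :: nat where n: "0 < n" "\<forall>x\<in>{p, q}. of_nat n * x \<in> \<int>"
    using common_denominator[of "{p, q}"] by auto
  obtain a b where "of_nat n * p = of_int a" "of_nat n * q = of_int b"
    using n(2) by (auto elim!: Ints_cases)
  then show thesis using that[OF n(1), of a b] n(1) by (simp add: field_simps)
qed

context
  fixes z :: "nat \<Rightarrow> 'k::field"
  assumes z: "root_system z"
begin

lemma zpow_nonzero: "zpow z q \<noteq> 0"
proof -
  obtain n a b where n: "0 < n" "q = of_int a / of_nat n" "q = of_int b / of_nat n" by (rule rat_fractions)
  have "zpow z q = power_int (z n) a" unfolding n(2) by (rule zpow_fraction[OF z n(1)])
  then show ?thesis using root_system_nonzero[OF z n(1)] by simp
qed

lemma zpow_add: "zpow z (p + q) = zpow z p * zpow z q"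
proof -
  obtain n a b where n: "0 < n" "p = of_int a / of_nat n" "q = of_int b / of_nat n" by (rule rat_fractions)
  have "p + q = of_int (a + b) / of_nat n" using n by (simp add: add_divide_distrib)
  then have "zpow z (p + q) = power_int (z n) (a + b)" by (simp only: zpow_fraction[OF z n(1)])
  also have "\<dots> = zpow z p * zpow z q"
    unfolding n(2,3) using root_system_nonzero[OF z n(1)] by (simp add: zpow_fraction[OF z n(1)] power_int_add)
  finally show ?thesis .
qed

lemma zpow_0: "zpow z 0 = 1"
  using zpow_add[of 0 0] zpow_nonzero[of 0] by simp

lemma zpow_of_int_mult: "zpow z (of_int k * q) = power_int (zpow z q) k"
proof -
  obtain n a b where n: "0 < n" "q = of_int a / of_nat n" "q = of_int b / of_nat n" by (rule rat_fractions)
  have "of_int k * q = of_int (a * k) / of_nat n" using n by simp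
  then have "zpow z (of_int k * q) = power_int (z n) (a * k)" by (simp only: zpow_fraction[OF z n(1)])
  then show ?thesis unfolding n(2) by (simp add: zpow_fraction[OF z n(1)] power_int_mult)
qed

lemma zpow_sum: "zpow z (\<Sum>i\<in>A. f i) = (\<Prod>i\<in>A. zpow z (f i))"
  by (induction A rule: infinite_finite_induct) (simp_all add: zpow_0 zpow_add)

lemma zpow_eq_1_iff: "zpow z q = 1 \<longleftrightarrow> q \<in> \<int>"
proof -
  obtain n a b where n: "0 < n" "q = of_int a / of_nat n" "q = of_int b / of_nat n" by (rule rat_fractions)
  have zn: "z n ^ n = 1" "z n \<noteq> 0" using root_system_power[OF z n(1)] root_system_nonzero[OF z n(1)] by simp_all
  define r where "r = nat (a mod int n)"
  have r: "r < n" "int r = a mod int n" using n(1) by (simp_all add: r_def nat_less_iff)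
  have "a = int n * (a div int n) + int r" using r(2) by simp
  then have "power_int (z n) a = power_int (z n) (int n * (a div int n) + int r)" by simp
  also have "\<dots> = z n ^ r" using zn by (simp add: power_int_add power_int_mult)
  finally have e: "zpow z q = z n ^ r" unfolding n(2) by (simp add: zpow_fraction[OF z n(1)])
  have "z n ^ r = 1 \<longleftrightarrow> r = 0" using root_system_primitive[OF z _ r(1)] by (cases "r = 0") auto
  also have "\<dots> \<longleftrightarrow> int n dvd a" using r(2) by (auto simp: dvd_eq_mod_eq_0)
  also have "\<dots> \<longleftrightarrow> q \<in> \<int>"
  proof
    assume "int n dvd a"
    then show "q \<in> \<int>" using n(1) unfolding n(2) by (auto elim!: dvdE)
  next
    assume "q \<in> \<int>"
    then obtain c where "q = of_int c" by (auto elim: Ints_cases)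
    then have "of_int a = (of_int (c * int n) :: rat)" using n(1) unfolding n(2) by (simp add: field_simps)
    then show "int n dvd a" by (simp only: of_int_eq_iff) simp
  qed
  finally show ?thesis using e by simp
qed

lemma zpow_eq_iff: "zpow z p = zpow z q \<longleftrightarrow> p - q \<in> \<int>"
proof -
  have "zpow z p = zpow z (p - q) * zpow z q" using zpow_add[of "p - q" q] by simp
  then show ?thesis using zpow_nonzero[of q] zpow_eq_1_iff[of "p - q"] by auto
qed

text \<open>The powers of z m already supply m distinct roots of X^m - 1, which has no more than
  m.\<close>

lemma root_of_unity_power:
  assumes m: "0 < m" and c: "c ^ m = 1" shows "\<exists>l::int. c = power_int (z m) l"
proof -
  let ?p = "monom 1 m - 1 :: 'k poly"
  have cf: "coeff ?p m = 1" using m by (cases m) (simp_all add: one_pCons)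
  then have p0: "?p \<noteq> 0" by force
  have dg: "degree ?p \<le> m" by (intro degree_diff_le degree_monom_le) simp_all
  have roots: "poly ?p x = 0 \<longleftrightarrow> x ^ m = 1" for x by (simp add: poly_monom)
  have inj: "inj_on (\<lambda>l. z m ^ l) {..<m}"
  proof (rule linorder_inj_onI)
    fix i j assume ij: "i < j" "i \<in> {..<m}" "j \<in> {..<m}"
    show "z m ^ i \<noteq> z m ^ j"
    proof
      assume "z m ^ i = z m ^ j"
      also have "z m ^ j = z m ^ i * z m ^ (j - i)" using ij(1) by (simp flip: power_add)
      finally have "z m ^ (j - i) = 1" using root_system_nonzero[OF z m] by simp
      moreover have "0 < j - i" "j - i < m" using ij by auto
      ultimately show False using root_system_primitive[OF z] by blast
    qed
  qed auto
  have sub: "(\<lambda>l. z m ^ l) ` {..<m} \<subseteq> {x. poly ?p x = 0}"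
  proof clarify
    fix l
    have "(z m ^ l) ^ m = (z m ^ m) ^ l" by (simp only: power_mult[symmetric] mult.commute)
    then show "poly ?p (z m ^ l) = 0" unfolding roots by (simp add: root_system_power[OF z m])
  qed
  have "card {x. poly ?p x = 0} \<le> card ((\<lambda>l. z m ^ l) ` {..<m})"
    using card_poly_roots_bound[OF p0] dg card_image[OF inj] by simp
  then have "(\<lambda>l. z m ^ l) ` {..<m} = {x. poly ?p x = 0}"
    by (rule card_seteq[OF poly_roots_finite[OF p0] sub])
  then obtain l where "c = z m ^ l" using c roots by blast
  then show ?thesis by (intro exI[of _ "int l"]) simp
qed

end

section \<open>Finitely supported functions\<close>

text \<open>\<open>single l x\<close> is the monomial x \<otimes> t^l.\<close>

definition single :: "'i \<Rightarrow> 'v::zero \<Rightarrow> 'i \<Rightarrow> 'v" where "single l x = (\<lambda>\<nu>. if \<nu> = l then x else 0)"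

lemma single_apply: "single l x \<nu> = (if \<nu> = l then x else 0)" by (simp add: single_def)

lemma single_0 [simp]: "single l 0 = 0" by (simp add: fun_eq_iff single_apply)

lemma single_eq_0_iff [simp]: "single l x = 0 \<longleftrightarrow> x = 0" by (auto simp: fun_eq_iff single_apply)

lemma single_add: "single l (x + y) = single l x + single l (y::'v::ab_group_add)" by (simp add: fun_eq_iff single_apply)

lemma single_sum: "single l (sum f A) = (\<Sum>a\<in>A. single l (f a :: 'v::ab_group_add))"
  by (induction A rule: infinite_finite_induct) (simp_all add: single_add)

lemma single_eq_iff: "single l x = single k y \<longleftrightarrow> x = y \<and> (l = k \<or> x = 0)"
  by (auto simp: fun_eq_iff single_apply split: if_splits)

lemma sum_apply: "(\<Sum>a\<in>A. f a) \<nu> = (\<Sum>a\<in>A. (f a \<nu> :: 'v::ab_group_add))"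
  by (induction A rule: infinite_finite_induct) simp_all

lemma single_decomp:
  assumes "finite {l. f l \<noteq> (0::'v::ab_group_add)}" shows "(\<Sum>l\<in>{l. f l \<noteq> 0}. single l (f l)) = f"
proof
  fix \<nu>
  have "(\<Sum>l\<in>{l. f l \<noteq> 0}. single l (f l)) \<nu> = (\<Sum>l\<in>{l. f l \<noteq> 0}. if l = \<nu> then f l else 0)"
    unfolding sum_apply by (rule sum.cong) (auto simp: single_apply)
  also have "\<dots> = f \<nu>" using assms by simp
  finally show "(\<Sum>l\<in>{l. f l \<noteq> 0}. single l (f l)) \<nu> = f \<nu>" .
qed

definition rv :: "int^'n \<Rightarrow> rat^'n" where "rv l = (\<chi> i. of_int (l $ i))"

lemma rv_nth [simp]: "rv l $ i = of_int (l $ i)" by (simp add: rv_def)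

lemma rv_add: "rv (l + k) = rv l + rv k" and rv_diff: "rv (l - k) = rv l - rv k"
  and rv_0: "rv 0 = 0" and rv_inj: "rv l = rv k \<longleftrightarrow> l = k"
  by (auto simp: vec_eq_iff)

text \<open>The vectors \<open>rscale m \<kappa>\<close> form the lattice m Z^n of exponents whose
  monomials are invariant under the tuple.\<close>

definition rscale :: "('n \<Rightarrow> nat) \<Rightarrow> int^'n \<Rightarrow> int^'n" where
  "rscale m \<kappa> = (\<chi> i. int (m i) * \<kappa> $ i)"

lemma rscale_nth [simp]: "rscale m \<kappa> $ i = int (m i) * \<kappa> $ i" by (simp add: rscale_def)

lemma rscale_add: "rscale m (\<kappa> + \<kappa>') = rscale m \<kappa> + rscale m \<kappa>'"
  and rscale_0: "rscale m 0 = 0" and rscale_minus: "rscale m (- \<kappa>) = - rscale m \<kappa>"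
  by (auto simp: vec_eq_iff algebra_simps)

context ac_space begin

lemma eigenvector_exists:
  assumes l: "lin D" and v: "(v::'b) \<noteq> 0" shows "\<exists>c x. x \<noteq> 0 \<and> D x = sc c x"
proof -
  have "\<exists>c. gspace D c \<noteq> {0}"
  proof (rule ccontr)
    assume "\<nexists>c. gspace D c \<noteq> {0}"
    then have "(\<Union>c. gspace D c) = {0}" by blast
    then have "span (\<Union>c. gspace D c) = {0}" by simp
    then show False using gspace_span[OF l] v by auto
  qed
  then obtain c x where x: "x \<in> gspace D c" "x \<noteq> 0" using subspace_0[OF subspace_gspace[OF l]] by blast
  then obtain N where "((\<lambda>y. D y - sc c y) ^^ N) x = 0" by (auto simp: gspace_def)
  then show ?thesis using x(2)
  proof (induction N arbitrary: x)
    case (Suc N)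
    show ?case
    proof (cases "D x - sc c x = 0")
      case True
      then show ?thesis using Suc.prems(2) by (intro exI[of _ c] exI[of _ x]) simp
    next
      case False
      have "((\<lambda>y. D y - sc c y) ^^ N) (D x - sc c x) = 0"
        using Suc.prems(1) by (simp only: funpow_Suc_right o_apply)
      then show ?thesis using Suc.IH False by blast
    qed
  qed simp
qed

end

section \<open>Joint eigenspaces of the tuple\<close>

locale loop_alg = lie_fixed sc br \<sigma> m
  for sc :: "'k::field_char_0 \<Rightarrow> 'v::ab_group_add \<Rightarrow> 'v" and br
    and \<sigma> :: "'n::finite \<Rightarrow> 'v \<Rightarrow> 'v" and m +
  fixes z :: "nat \<Rightarrow> 'k"
  assumes z: "root_system z"
begin

abbreviation G :: "int^'n \<Rightarrow> 'v set" where "G \<equiv> gbar sc z \<sigma> m"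
abbreviation L :: "(int^'n \<Rightarrow> 'v) set" where "L \<equiv> mloop sc z \<sigma> m"
abbreviation lb :: "(int^'n \<Rightarrow> 'v) \<Rightarrow> (int^'n \<Rightarrow> 'v) \<Rightarrow> int^'n \<Rightarrow> 'v" where "lb \<equiv> lbr br"

lemma z_power: "power_int (z (m i)) l = zpow z (of_int l / of_nat (m i))"
  by (rule zpow_fraction[OF z \<sigma>_order(1), symmetric])

lemma G_iff: "x \<in> G l \<longleftrightarrow> (\<forall>i. \<sigma> i x = sc (zpow z (of_int (l $ i) / of_nat (m i))) x)"
  by (simp add: gbar_def z_power)

lemma G_zero: "G 0 = S"
  by (simp add: gbar_def S_def)

lemma subspace_G: "subspace (G l)"
  unfolding gbar_def
  by (rule subspaceI) (auto simp: lin_add[OF \<sigma>_lin] lin_sc[OF \<sigma>_lin] lin_0[OF \<sigma>_lin] scale_right_distrib mult.commute)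

lemma br_G: assumes "x \<in> G l" "y \<in> G k" shows "br x y \<in> G (l + k)"
  unfolding G_iff
proof
  fix i
  have "\<sigma> i x = sc (zpow z (of_int (l $ i) / of_nat (m i))) x"
    "\<sigma> i y = sc (zpow z (of_int (k $ i) / of_nat (m i))) y" using assms by (simp_all add: G_iff)
  then show "\<sigma> i (br x y) = sc (zpow z (of_int ((l + k) $ i) / of_nat (m i))) (br x y)"
    by (simp add: \<sigma>_br br_sc_left br_sc_right add_divide_distrib zpow_add[OF z])
qed

text \<open>Since z (m i) is a primitive root of unity, the eigenvalues of a nonzero x determine
  each exponent modulo m i.\<close>

lemma G_eq_iff:
  assumes x: "x \<in> G l" "x \<noteq> 0"
  shows "x \<in> G k \<longleftrightarrow> (\<exists>\<kappa>. k = l + rscale m \<kappa>)"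
proof -
  have \<sigma>x: "\<sigma> i x = sc (zpow z (of_int (l $ i) / of_nat (m i))) x" for i using x(1) by (simp add: G_iff)
  have "x \<in> G k \<longleftrightarrow> (\<forall>i. zpow z (of_int (l $ i) / of_nat (m i)) = zpow z (of_int (k $ i) / of_nat (m i)))"
    unfolding G_iff \<sigma>x using x(2) by simp
  also have "\<dots> \<longleftrightarrow> (\<forall>i. zpow z (of_int (k $ i) / of_nat (m i)) = zpow z (of_int (l $ i) / of_nat (m i)))"
    by (intro all_cong1) (rule eq_commute)
  also have "\<dots> \<longleftrightarrow> (\<forall>i. of_int (k $ i) / of_nat (m i) - of_int (l $ i) / of_nat (m i) \<in> (\<int>::rat set))"
    by (simp only: zpow_eq_iff[OF z])
  also have "\<dots> \<longleftrightarrow> (\<forall>i. \<exists>a. k $ i = l $ i + int (m i) * a)"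
  proof (intro all_cong1)
    fix i
    have mi: "(of_nat (m i) :: rat) \<noteq> 0" using \<sigma>_order(1)[of i] by simp
    have "of_int (k $ i) / of_nat (m i) - of_int (l $ i) / of_nat (m i) \<in> (\<int>::rat set)
      \<longleftrightarrow> (\<exists>a. of_int (k $ i) / of_nat (m i) - of_int (l $ i) / of_nat (m i) = (of_int a :: rat))"
      by (auto elim: Ints_cases)
    also have "\<dots> \<longleftrightarrow> (\<exists>a. (of_int (k $ i) :: rat) = of_int (l $ i + int (m i) * a))"
      using mi by (simp add: field_simps)
    finally show "of_int (k $ i) / of_nat (m i) - of_int (l $ i) / of_nat (m i) \<in> (\<int>::rat set)
      \<longleftrightarrow> (\<exists>a. k $ i = l $ i + int (m i) * a)" by (simp only: of_int_eq_iff)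
  qed
  also have "\<dots> \<longleftrightarrow> (\<exists>\<kappa>. k = l + rscale m \<kappa>)"
  proof
    assume "\<forall>i. \<exists>a. k $ i = l $ i + int (m i) * a"
    from choice[OF this] obtain a where "\<forall>i. k $ i = l $ i + int (m i) * a i" ..
    then show "\<exists>\<kappa>. k = l + rscale m \<kappa>" by (intro exI[of _ "\<chi> i. a i"]) (simp add: vec_eq_iff)
  qed auto
  finally show ?thesis .
qed

lemma G_shift: "G (l + rscale m \<kappa>) = G l"
proof -
  have "x \<in> G (l + rscale m \<kappa>)" if "x \<in> G l" for x l \<kappa>
    using that G_eq_iff[OF that] subspace_0[OF subspace_G] by (cases "x = 0") auto
  note a = this
  have "G (l + rscale m \<kappa>) \<subseteq> G l" using a[of _ "l + rscale m \<kappa>" "- \<kappa>"] by (auto simp: rscale_minus)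
  then show ?thesis using a by blast
qed

text \<open>Representatives of Z^n modulo m Z^n, so that each joint eigenvalue of the tuple is
  listed once.\<close>

definition Box :: "(int^'n) set" where "Box = {l. \<forall>i. 0 \<le> l $ i \<and> l $ i < int (m i)}"

lemma finite_Box: "finite Box"
proof -
  have "finite (PiE UNIV (\<lambda>i. {0..<int (m i)}))" by (rule finite_PiE) auto
  moreover have "Box \<subseteq> vec_lambda ` PiE UNIV (\<lambda>i. {0..<int (m i)})"
  proof
    fix l assume "l \<in> Box"
    then have "(\<lambda>i. l $ i) \<in> PiE UNIV (\<lambda>i. {0..<int (m i)})" by (auto simp: Box_def)
    then show "l \<in> vec_lambda ` PiE UNIV (\<lambda>i. {0..<int (m i)})" by (intro image_eqI[of _ _ "\<lambda>i. l $ i"]) auto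
  qed
  ultimately show ?thesis by (rule finite_surj)
qed

lemma Box_rep: "\<exists>l0\<in>Box. \<exists>\<kappa>. l = l0 + rscale m \<kappa>"
proof (intro bexI exI)
  show "l = (\<chi> i. l $ i mod int (m i)) + rscale m (\<chi> i. l $ i div int (m i))"
    by (simp add: vec_eq_iff)
  show "(\<chi> i. l $ i mod int (m i)) \<in> Box" using \<sigma>_order(1) by (simp add: Box_def)
qed

lemma eigen_G:
  assumes x: "\<forall>i. \<exists>c. \<sigma> i x = sc c x" shows "\<exists>l\<in>Box. x \<in> G l"
proof (cases "x = 0")
  case True
  obtain l where "l \<in> Box" using Box_rep by blast
  then show ?thesis using True subspace_0[OF subspace_G] by blast
next
  case False
  have "\<forall>i. \<exists>l. \<sigma> i x = sc (power_int (z (m i)) l) x"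
  proof
    fix i
    obtain c where c: "\<sigma> i x = sc c x" using x by blast
    have "(\<sigma> i ^^ n) x = sc (c ^ n) x" for n
      by (induction n) (simp_all add: lin_sc[OF \<sigma>_lin] c mult.commute)
    from this[of "m i"] have "sc (c ^ m i) x = sc 1 x" using \<sigma>_order(2)[of i] by simp
    then have "c ^ m i = 1" by (rule scale_right_imp_eq[OF False])
    then show "\<exists>l. \<sigma> i x = sc (power_int (z (m i)) l) x"
      using root_of_unity_power[OF z \<sigma>_order(1)] c by blast
  qed
  from choice[OF this] obtain l where "\<forall>i. \<sigma> i x = sc (power_int (z (m i)) (l i)) x" ..
  then have xl: "x \<in> G (\<chi> i. l i)" by (simp add: gbar_def)
  obtain l0 \<kappa> where l0: "l0 \<in> Box" "(\<chi> i. l i) = l0 + rscale m \<kappa>" using Box_rep by blast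
  then show ?thesis using xl G_shift by auto
qed

lemma G_span: "span (\<Union>l\<in>Box. G l) = UNIV"
proof -
  have "{x. \<forall>i. \<exists>c. \<sigma> i x = sc c x} \<subseteq> (\<Union>l\<in>Box. G l)" using eigen_G by blast
  then have "span {x. \<forall>i. \<exists>c. \<sigma> i x = sc c x} \<subseteq> span (\<Union>l\<in>Box. G l)" by (rule span_mono)
  then show ?thesis using \<sigma>_span by auto
qed

lemma Box_separated:
  assumes lk: "l \<in> Box" "k \<in> Box" "l \<noteq> k"
  shows "\<exists>j\<in>UNIV. zpow z (of_int (l $ j) / of_nat (m j)) \<noteq> zpow z (of_int (k $ j) / of_nat (m j))"
proof (rule ccontr)
  assume "\<not> ?thesis"
  then have e: "zpow z (of_int (l $ j) / of_nat (m j)) = zpow z (of_int (k $ j) / of_nat (m j))" for j by blast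
  have "l $ j = k $ j" for j
  proof -
    have mj: "(0::rat) < of_nat (m j)" using \<sigma>_order(1) by simp
    obtain a where "of_int (l $ j) / of_nat (m j) - of_int (k $ j) / of_nat (m j) = (of_int a :: rat)"
      using e[of j] zpow_eq_iff[OF z] by (auto elim: Ints_cases)
    then have "(of_int (l $ j) :: rat) = of_int (k $ j + int (m j) * a)" using mj by (simp add: field_simps)
    then have "l $ j = k $ j + int (m j) * a" by (simp only: of_int_eq_iff)
    then have "l $ j mod int (m j) = k $ j mod int (m j)" by simp
    then show ?thesis using lk(1,2) by (simp add: Box_def)
  qed
  then show False using lk(3) by (simp add: vec_eq_iff)
qed

lemma G_indep: "indep_fam Box G"
  by (rule indep_fam_separated[where J = UNIV and D = \<sigma> and c = "\<lambda>l i. zpow z (of_int (l $ i) / of_nat (m i))"])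
     (simp_all only: \<sigma>_lin G_iff Box_separated not_False_eq_True)

definition prG :: "int^'n \<Rightarrow> 'v \<Rightarrow> 'v" where
  "prG = (SOME pr. (\<forall>i. lin (pr i)) \<and> (\<forall>i x. i \<in> Box \<longrightarrow> pr i x \<in> G i) \<and>
     (\<forall>x. (\<Sum>i\<in>Box. pr i x) = x) \<and> (\<forall>i j x. i \<in> Box \<longrightarrow> x \<in> G i \<longrightarrow> pr j x = (if i = j then x else 0)))"

lemma lin_prG: "lin (prG l)"
  and prG_G: "l \<in> Box \<Longrightarrow> prG l x \<in> G l"
  and prG_sum: "(\<Sum>l\<in>Box. prG l x) = x"
  and prG_on: "l \<in> Box \<Longrightarrow> x \<in> G l \<Longrightarrow> prG k x = (if l = k then x else 0)"
proof -
  have "\<exists>pr. (\<forall>i. lin (pr i)) \<and> (\<forall>i x. i \<in> Box \<longrightarrow> pr i x \<in> G i) \<and>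
     (\<forall>x. (\<Sum>i\<in>Box. pr i x) = x) \<and> (\<forall>i j x. i \<in> Box \<longrightarrow> x \<in> G i \<longrightarrow> pr j x = (if i = j then x else 0))"
  proof (rule projections_exist[OF finite_Box subspace_G G_span G_indep])
    fix p assume p: "\<And>i. lin (p i)" "\<And>i x. i \<in> Box \<Longrightarrow> p i x \<in> G i"
      "\<And>x. (\<Sum>i\<in>Box. p i x) = x" "\<And>i j x. i \<in> Box \<Longrightarrow> x \<in> G i \<Longrightarrow> p j x = (if i = j then x else 0)"
    show ?thesis by (intro exI[of _ p] conjI allI impI p)
  qed
  from someI_ex[OF this] show "lin (prG l)" "l \<in> Box \<Longrightarrow> prG l x \<in> G l" "(\<Sum>l\<in>Box. prG l x) = x"
    "l \<in> Box \<Longrightarrow> x \<in> G l \<Longrightarrow> prG k x = (if l = k then x else 0)"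
    unfolding prG_def[symmetric] by blast+
qed

text \<open>G l depends only on l modulo m Z^n, so a family of maps that is constant along m Z^n
  descends to one linear map on the Lie algebra. This serves both the centroid and the evaluation at
  a torus point.\<close>

lemma glue_maps:
  assumes lin: "\<And>l x y. x \<in> G l \<Longrightarrow> y \<in> G l \<Longrightarrow> u l (x + y) = u l x + (u l y :: 'w::ab_group_add)"
    and sc: "\<And>l c x. x \<in> G l \<Longrightarrow> u l (sc c x) = sc' c (u l x)"
    and sh: "\<And>l \<kappa> x. x \<in> G l \<Longrightarrow> u (l + rscale m \<kappa>) x = u l x"
    and sc'0: "\<And>c x y. sc' c (x + y) = sc' c x + sc' c y" "\<And>c. sc' c 0 = 0"
  shows "\<exists>U. (\<forall>x y. U (x + y) = U x + U y) \<and> (\<forall>c x. U (sc c x) = sc' c (U x)) \<and> (\<forall>l. \<forall>x\<in>G l. U x = u l x)"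
proof (intro exI conjI allI ballI)
  let ?U = "\<lambda>x. \<Sum>l\<in>Box. u l (prG l x)"
  show "?U (x + y) = ?U x + ?U y" for x y
    by (simp add: lin_add[OF lin_prG] lin prG_G sum.distrib)
  have "sc' c (sum f A) = (\<Sum>a\<in>A. sc' c (f a))" for c f and A :: "(int^'n) set"
    by (induction A rule: infinite_finite_induct) (simp_all add: sc'0)
  then show "?U (sc c x) = sc' c (?U x)" for c x
    by (simp add: lin_sc[OF lin_prG] sc prG_G)
  fix l x assume x: "x \<in> G l"
  obtain l0 \<kappa> where l0: "l0 \<in> Box" "l = l0 + rscale m \<kappa>" using Box_rep by blast
  have x0: "x \<in> G l0" using x l0(2) G_shift by simp
  have u0: "u k 0 = 0" for k using lin[of 0 k 0] subspace_0[OF subspace_G] by simp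
  have "?U x = (\<Sum>k\<in>Box. if k = l0 then u l0 x else 0)"
    using prG_on[OF l0(1) x0] u0 by (intro sum.cong) auto
  then show "?U x = u l x" using finite_Box l0 sh[OF x0] by simp
qed

section \<open>The multiloop algebra\<close>

lemma L_iff: "f \<in> L \<longleftrightarrow> finite {l. f l \<noteq> 0} \<and> (\<forall>l. f l \<in> G l)"
  by (simp add: mloop_def)

lemma L_0: "0 \<in> L" by (simp add: L_iff subspace_0[OF subspace_G])

lemma L_add: assumes "f \<in> L" "g \<in> L" shows "f + g \<in> L"
proof -
  have "{l. (f + g) l \<noteq> 0} \<subseteq> {l. f l \<noteq> 0} \<union> {l. g l \<noteq> 0}" by auto
  then show ?thesis using assms subspace_add[OF subspace_G]
    by (auto simp: L_iff intro: finite_subset[OF _ finite_UnI])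
qed

lemma L_sc: assumes "f \<in> L" shows "lsc sc c f \<in> L"
proof -
  have "{l. sc c (f l) \<noteq> 0} \<subseteq> {l. f l \<noteq> 0}" by auto
  then show ?thesis using assms subspace_scale[OF subspace_G]
    by (auto simp: L_iff lsc_def intro: finite_subset)
qed

lemma L_sum: "(\<And>a. a \<in> A \<Longrightarrow> f a \<in> L) \<Longrightarrow> (\<Sum>a\<in>A. f a) \<in> L"
  by (induction A rule: infinite_finite_induct) (auto simp: L_0 L_add)

lemma L_single: assumes "x \<in> G l" shows "single l x \<in> L"
proof -
  have "{k. single l x k \<noteq> 0} \<subseteq> {l}" by (auto simp: single_apply)
  then show ?thesis using assms subspace_0[OF subspace_G]
    by (auto simp: L_iff single_apply intro: finite_subset)
qed

lemma L_decomp: "f \<in> L \<Longrightarrow> (\<Sum>l\<in>{l. f l \<noteq> 0}. single l (f l)) = f"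
  by (rule single_decomp) (simp add: L_iff)

lemma L_G: "f \<in> L \<Longrightarrow> f l \<in> G l" by (simp add: L_iff)

lemma lb_eq: "finite F \<Longrightarrow> {l. f l \<noteq> 0} \<subseteq> F \<Longrightarrow> lb f g \<nu> = (\<Sum>l\<in>F. br (f l) (g (\<nu> - l)))"
  unfolding lbr_def by (rule sum.mono_neutral_left) auto

lemma lb_add_left:
  assumes "f \<in> L" "f' \<in> L" shows "lb (f + f') g = lb f g + lb f' g"
proof
  fix \<nu>
  let ?F = "{l. f l \<noteq> 0} \<union> {l. f' l \<noteq> 0}"
  have F: "finite ?F" using assms by (simp add: L_iff)
  have "{l. (f + f') l \<noteq> 0} \<subseteq> ?F" by auto
  then show "lb (f + f') g \<nu> = (lb f g + lb f' g) \<nu>"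
    by (simp add: lb_eq[OF F] br_add_left sum.distrib)
qed

lemma lb_add_right: "lb f (g + g') = lb f g + lb f g'"
  by (simp add: fun_eq_iff lbr_def br_add_right sum.distrib)

lemma lb_0_left [simp]: "lb 0 g = 0" and lb_0_right [simp]: "lb f 0 = 0"
  by (simp_all add: fun_eq_iff lbr_def)

lemma lb_sum_left: "(\<And>a. a \<in> A \<Longrightarrow> f a \<in> L) \<Longrightarrow> lb (\<Sum>a\<in>A. f a) g = (\<Sum>a\<in>A. lb (f a) g)"
  by (induction A rule: infinite_finite_induct) (simp_all add: lb_add_left L_sum)

lemma lb_sum_right: "lb f (\<Sum>a\<in>A. g a) = (\<Sum>a\<in>A. lb f (g a))"
  by (induction A rule: infinite_finite_induct)
     (simp_all only: sum.infinite sum.empty sum.insert lb_add_right lb_0_right not_False_eq_True)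

lemma lb_single: "lb (single l x) (single k y) = single (l + k) (br x y)"
proof
  fix \<nu>
  have "lb (single l x) (single k y) \<nu> = (\<Sum>j\<in>{l}. br (single l x j) (single k y (\<nu> - j)))"
    by (rule lb_eq) (auto simp: single_apply)
  also have "\<dots> = single (l + k) (br x y) \<nu>" by (auto simp: single_apply algebra_simps)
  finally show "lb (single l x) (single k y) \<nu> = single (l + k) (br x y) \<nu>" .
qed

lemma lb_decomp:
  assumes "f \<in> L" "g \<in> L"
  shows "lb f g = (\<Sum>l\<in>{l. f l \<noteq> 0}. \<Sum>k\<in>{k. g k \<noteq> 0}. single (l + k) (br (f l) (g k)))"
proof -
  have "lb f g = lb (\<Sum>l\<in>{l. f l \<noteq> 0}. single l (f l)) (\<Sum>k\<in>{k. g k \<noteq> 0}. single k (g k))"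
    by (simp add: L_decomp assms)
  also have "\<dots> = (\<Sum>l\<in>{l. f l \<noteq> 0}. \<Sum>k\<in>{k. g k \<noteq> 0}. single (l + k) (br (f l) (g k)))"
    by (subst lb_sum_left) (simp_all add: L_single L_G assms lb_sum_right lb_single)
  finally show ?thesis .
qed

lemma L_lb: assumes "f \<in> L" "g \<in> L" shows "lb f g \<in> L"
  unfolding lb_decomp[OF assms] by (intro L_sum) (rule L_single, rule br_G; rule L_G, rule assms)

lemma nonzero_G: "\<exists>l x. x \<in> G l \<and> x \<noteq> 0"
proof (rule ccontr)
  assume "\<not> ?thesis"
  then have "(\<Union>l\<in>Box. G l) \<subseteq> {0}" by blast
  then have "span (\<Union>l\<in>Box. G l) \<subseteq> {0}" by (intro span_minimal) auto
  then have "(UNIV :: 'v set) \<subseteq> {0}" by (simp only: G_span)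
  then have "br x y = 0" for x y by blast
  then show False using nonabelian by blast
qed

text \<open>The coefficient maps u l of a homogeneous centroid element glue to a linear map V that
  commutes with all ad x, so V is a scalar c by simplicity. As c is nonzero, a vector of degree l1
  also lies in the eigenspace of degree l1 + \<delta>, which forces \<delta> into m Z^n.\<close>

theorem homogeneous_centroid:
  assumes UL: "\<And>f. f \<in> L \<Longrightarrow> U f \<in> L"
    and Uadd: "\<And>f g. f \<in> L \<Longrightarrow> g \<in> L \<Longrightarrow> U (f + g) = U f + U g"
    and Usc: "\<And>c f. f \<in> L \<Longrightarrow> U (lsc sc c f) = lsc sc c (U f)"
    and Ul: "\<And>f g. f \<in> L \<Longrightarrow> g \<in> L \<Longrightarrow> U (lb f g) = lb (U f) g"
    and Ur: "\<And>f g. f \<in> L \<Longrightarrow> g \<in> L \<Longrightarrow> U (lb f g) = lb f (U g)"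
    and Uhom: "\<And>l x. x \<in> G l \<Longrightarrow> \<exists>y. U (single l x) = single (l + \<delta>) y"
    and Uinj: "\<And>f. f \<in> L \<Longrightarrow> U f = 0 \<Longrightarrow> f = 0"
  shows "\<exists>c \<kappa>. c \<noteq> 0 \<and> \<delta> = rscale m \<kappa> \<and> (\<forall>l. \<forall>x\<in>G l. U (single l x) = single (l + \<delta>) (sc c x))"
proof -
  define u where "u l x = U (single l x) (l + \<delta>)" for l x
  have U: "U (single l x) = single (l + \<delta>) (u l x)" if "x \<in> G l" for l x
    using Uhom[OF that] by (auto simp: u_def single_apply)
  have uG: "u l x \<in> G (l + \<delta>)" if "x \<in> G l" for l x
    unfolding u_def by (rule L_G[OF UL[OF L_single[OF that]]])
  have ua: "u l (x + y) = u l x + u l y" if "x \<in> G l" "y \<in> G l" for l x y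
    using that by (simp add: u_def single_add Uadd L_single)
  have us: "u l (sc c x) = sc c (u l x)" if "x \<in> G l" for l c x
  proof -
    have "single l (sc c x) = lsc sc c (single l x)" by (auto simp: lsc_def fun_eq_iff single_apply)
    then show ?thesis using that by (simp add: u_def Usc L_single) (simp add: lsc_def)
  qed
  have b1: "u (l + k) (br x y) = br (u l x) y" and b2: "u (l + k) (br x y) = br x (u k y)"
    if x: "x \<in> G l" and y: "y \<in> G k" for l k x y
  proof -
    have "single (l + k + \<delta>) (u (l + k) (br x y)) = U (lb (single l x) (single k y))"
      by (simp add: lb_single U[OF br_G[OF x y]])
    moreover have "\<dots> = single (l + \<delta> + k) (br (u l x) y)"
      using Ul[OF L_single[OF x] L_single[OF y]] by (simp add: U[OF x] lb_single)
    moreover have "U (lb (single l x) (single k y)) = single (l + (k + \<delta>)) (br x (u k y))"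
      using Ur[OF L_single[OF x] L_single[OF y]] by (simp add: U[OF y] lb_single)
    ultimately show "u (l + k) (br x y) = br (u l x) y" "u (l + k) (br x y) = br x (u k y)"
      by (simp_all only: single_eq_iff)
  qed
  \<comment> \<open>Both sides have the same bracket with every homogeneous x, namely [u l x, y],
    and the centre is trivial.\<close>
  have sh: "u (k + rscale m \<kappa>) y = u k y" if y: "y \<in> G k" for k \<kappa> y
  proof -
    let ?d = "u (k + rscale m \<kappa>) y - u k y"
    have y': "y \<in> G (k + rscale m \<kappa>)" using y G_shift by simp
    have "br x ?d = 0" for x
    proof (rule lin_eq_on_span[OF lin_br_left lin_zero])
      show "x \<in> span (\<Union>l\<in>Box. G l)" by (simp add: G_span)
      show "br x ?d = 0" if "x \<in> (\<Union>l\<in>Box. G l)" for x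
      proof -
        obtain l where x: "x \<in> G l" using \<open>x \<in> (\<Union>l\<in>Box. G l)\<close> by blast
        have "br x (u k y) = br (u l x) y" using b1[OF x y] b2[OF x y] by simp
        moreover have "br x (u (k + rscale m \<kappa>) y) = br (u l x) y" using b1[OF x y'] b2[OF x y'] by simp
        ultimately show ?thesis by (simp add: br_diff_right)
      qed
    qed
    then have "?d = 0" by (rule center_trivial)
    then show ?thesis by simp
  qed
  have "\<exists>V. (\<forall>x y. V (x + y) = V x + V y) \<and> (\<forall>c x. V (sc c x) = sc c (V x)) \<and> (\<forall>l. \<forall>x\<in>G l. V x = u l x)"
    by (rule glue_maps) (simp_all add: ua us sh scale_right_distrib)
  then obtain V where V0: "\<forall>x y. V (x + y) = V x + V y" "\<forall>c x. V (sc c x) = sc c (V x)"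
    "\<forall>l. \<forall>x\<in>G l. V x = u l x" by (elim exE conjE)
  have V: "lin V" "\<And>l x. x \<in> G l \<Longrightarrow> V x = u l x" by (rule linI) (simp_all add: V0)
  have Vbr: "V (br x y) = br x (V y)" for x y
  proof (rule lin_eq_on_span[where f = "\<lambda>x. V (br x y)"])
    show "lin (\<lambda>x. V (br x y))" "lin (\<lambda>x. br x (V y))" by (intro lin_comp[OF V(1) lin_br_left] lin_br_left)+
    show "x \<in> span (\<Union>l\<in>Box. G l)" by (simp add: G_span)
    show "V (br x y) = br x (V y)" if "x \<in> (\<Union>l\<in>Box. G l)" for x
    proof (rule lin_eq_on_span[where f = "\<lambda>y. V (br x y)"])
      show "lin (\<lambda>y. V (br x y))" "lin (\<lambda>y. br x (V y))"
        by (rule lin_comp[OF V(1) lin_ad], rule lin_comp[OF lin_ad V(1)])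
      show "y \<in> span (\<Union>l\<in>Box. G l)" by (simp add: G_span)
      obtain l where x: "x \<in> G l" using \<open>x \<in> (\<Union>l\<in>Box. G l)\<close> by blast
      show "V (br x y) = br x (V y)" if "y \<in> (\<Union>l\<in>Box. G l)" for y
      proof -
        obtain k where y: "y \<in> G k" using \<open>y \<in> (\<Union>l\<in>Box. G l)\<close> by blast
        show ?thesis using b2[OF x y] V(2)[OF br_G[OF x y]] V(2)[OF y] by simp
      qed
    qed
  qed
  obtain l1 x1 where x1: "x1 \<in> G l1" "x1 \<noteq> 0" using nonzero_G by blast
  obtain c v where cv: "v \<noteq> 0" "V v = sc c v" using eigenvector_exists[OF V(1) x1(2)] by blast
  \<comment> \<open>An eigenspace of a map commuting with all ad x is an ideal.\<close>
  have "{x. V x = sc c x} = {0} \<or> {x. V x = sc c x} = UNIV"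
    by (rule ideal_trivial) (use subspace_eigen[OF V(1)] in \<open>auto simp: Vbr br_sc_right\<close>)
  moreover have "{x. V x = sc c x} \<noteq> {0}" using cv by blast
  ultimately have "{x. V x = sc c x} = UNIV" by blast
  then have Vc: "V x = sc c x" for x by blast
  have Uc: "U (single l x) = single (l + \<delta>) (sc c x)" if "x \<in> G l" for l x
    using U[OF that] V(2)[OF that] Vc by simp
  have c0: "c \<noteq> 0"
  proof
    assume "c = 0"
    then have "U (single l1 x1) = 0" using Uc[OF x1(1)] by simp
    then show False using Uinj[OF L_single[OF x1(1)]] x1(2) by simp
  qed
  have "u l1 x1 = sc c x1" using V(2)[OF x1(1)] Vc by simp
  then have "sc (1 / c) (sc c x1) \<in> G (l1 + \<delta>)"
    using uG[OF x1(1)] subspace_scale[OF subspace_G] by metis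
  then have "x1 \<in> G (l1 + \<delta>)" using c0 by simp
  then obtain \<kappa> where "l1 + \<delta> = l1 + rscale m \<kappa>" using G_eq_iff[OF x1] by blast
  then show ?thesis using c0 Uc by auto
qed

end

section \<open>Generated subgroups and homomorphisms on them\<close>

lemma gen_subgroup_base: "x \<in> S \<Longrightarrow> x \<in> gen_subgroup S"
  and gen_subgroup_0: "0 \<in> gen_subgroup S"
  and gen_subgroup_diff: "x \<in> gen_subgroup S \<Longrightarrow> y \<in> gen_subgroup S \<Longrightarrow> x - y \<in> gen_subgroup S"
  by (auto simp: gen_subgroup_def)

lemma gen_subgroup_minus: "x \<in> gen_subgroup S \<Longrightarrow> - x \<in> gen_subgroup S"
  using gen_subgroup_diff[OF gen_subgroup_0] by fastforce

lemma gen_subgroup_add: "x \<in> gen_subgroup S \<Longrightarrow> y \<in> gen_subgroup S \<Longrightarrow> x + y \<in> gen_subgroup S"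
  using gen_subgroup_diff[of x S "- y"] gen_subgroup_minus[of y S] by simp

lemma gen_subgroup_subset:
  assumes "S \<subseteq> K" "0 \<in> K" "\<And>x y. x \<in> K \<Longrightarrow> y \<in> K \<Longrightarrow> x - y \<in> K"
  shows "gen_subgroup S \<subseteq> K"
  unfolding gen_subgroup_def by (rule Inter_lower) (use assms in blast)

lemma group_hom_on_0:
  assumes "group_hom_on (gen_subgroup S) f" shows "f 0 = 0"
  using assms gen_subgroup_0[of S] unfolding group_hom_on_def by (metis add.right_neutral add_cancel_right_right)

lemma group_hom_on_add:
  "group_hom_on (gen_subgroup S) f \<Longrightarrow> x \<in> gen_subgroup S \<Longrightarrow> y \<in> gen_subgroup S \<Longrightarrow> f (x + y) = f x + f y"
  unfolding group_hom_on_def by blast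

lemma group_hom_on_diff:
  assumes f: "group_hom_on (gen_subgroup S) f" and x: "x \<in> gen_subgroup S" and y: "y \<in> gen_subgroup S"
  shows "f (x - y) = f x - f y"
  using group_hom_on_add[OF f gen_subgroup_diff[OF x y] y] by simp

section \<open>The loop algebra graded by weights and degrees\<close>

locale multiloop = cartan sc br \<sigma> m H + loop_alg sc br \<sigma> m z
  for sc :: "'k::field_char_0 \<Rightarrow> 'v::ab_group_add \<Rightarrow> 'v" and br
    and \<sigma> :: "'n::finite \<Rightarrow> 'v \<Rightarrow> 'v" and m H and z :: "nat \<Rightarrow> 'k"
begin

abbreviation Q :: "('v \<Rightarrow> 'k) set" where "Q \<equiv> root_lattice sc br H"
abbreviation cmp :: "('v \<Rightarrow> 'k) \<times> (int^'n) \<Rightarrow> (int^'n \<Rightarrow> 'v) set" where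
  "cmp \<equiv> mloop_comp sc br z \<sigma> m H"

lemma Q_hdual: "Q \<subseteq> hdual sc H"
  unfolding root_lattice_def
  by (rule gen_subgroup_subset) (auto simp: roots_def hdual_0 hdual_diff)

lemma Q_0: "0 \<in> Q" by (simp add: root_lattice_def gen_subgroup_0)

lemma R_Q: "R \<subseteq> Q"
proof
  fix \<alpha> assume "\<alpha> \<in> R"
  then show "\<alpha> \<in> Q"
  proof (cases "\<alpha> = 0")
    case False
    then show ?thesis using \<open>\<alpha> \<in> R\<close> unfolding root_lattice_def by (intro gen_subgroup_base) (simp add: roots_R)
  qed (simp add: Q_0)
qed

lemma Q_add: "\<alpha> \<in> Q \<Longrightarrow> \<beta> \<in> Q \<Longrightarrow> \<alpha> + \<beta> \<in> Q"
  and Q_diff: "\<alpha> \<in> Q \<Longrightarrow> \<beta> \<in> Q \<Longrightarrow> \<alpha> - \<beta> \<in> Q"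
  by (simp_all add: root_lattice_def gen_subgroup_add gen_subgroup_diff)

lemma Q_W: "\<alpha> \<in> Q \<Longrightarrow> x \<in> W \<alpha> \<Longrightarrow> x \<noteq> 0 \<Longrightarrow> \<alpha> \<in> R"
  using W_R Q_hdual by blast

lemma br_H_G: assumes "h \<in> H" "x \<in> G l" shows "br h x \<in> G l"
  using br_G[of h 0 x l] assms H_S G_zero by auto

lemma pr_G: "x \<in> G l \<Longrightarrow> \<alpha> \<in> R \<Longrightarrow> pr \<alpha> x \<in> G l"
  by (rule pr_invariant[OF subspace_G]) (use br_H_G in auto)

text \<open>The tuple fixes H pointwise, hence preserves weight spaces, and so do the projections to
  its eigenspaces.\<close>

lemma prG_W: assumes x: "x \<in> W \<alpha>" and l: "l \<in> Box" shows "prG l x \<in> W \<alpha>"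
proof -
  have inv: "\<sigma> i y \<in> W \<alpha>" if y: "y \<in> W \<alpha>" for i y
    unfolding wspace_def
  proof (intro CollectI ballI)
    fix h assume h: "h \<in> H"
    then have "\<sigma> i h = h" using H_S by (auto simp: S_def)
    then have "br h (\<sigma> i y) = \<sigma> i (br h y)" by (simp add: \<sigma>_br)
    then show "br h (\<sigma> i y) = sc (\<alpha> h) (\<sigma> i y)" using y h by (simp add: wspace_def lin_sc[OF \<sigma>_lin])
  qed
  show ?thesis
  proof (rule separated_invariant[OF finite_Box subspace_W, where J = UNIV and D = \<sigma>
        and c = "\<lambda>l i. zpow z (of_int (l $ i) / of_nat (m i))" and x = "\<lambda>l. prG l x"])
    show "\<sigma> i (prG l x) = sc (zpow z (of_int (l $ i) / of_nat (m i))) (prG l x)" if "l \<in> Box" for l i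
      using prG_G[OF that, of x] by (simp add: G_iff)
    show "\<exists>j\<in>UNIV. zpow z (of_int (l $ j) / of_nat (m j)) \<noteq> zpow z (of_int (k $ j) / of_nat (m j))"
      if "l \<in> Box" "k \<in> Box" "l \<noteq> k" for l k by (rule Box_separated[OF that])
  qed (use x l \<sigma>_lin inv in \<open>simp_all add: prG_sum\<close>)
qed

lemma cmp_iff: "f \<in> cmp (\<alpha>, l) \<longleftrightarrow> (\<exists>x\<in>W \<alpha> \<inter> G l. f = single l x)"
proof
  assume f: "f \<in> cmp (\<alpha>, l)"
  then have "f = single l (f l)" by (auto simp: mloop_comp_def fun_eq_iff single_apply)
  moreover have "f l \<in> W \<alpha> \<inter> G l" using f L_G by (auto simp: mloop_comp_def)
  ultimately show "\<exists>x\<in>W \<alpha> \<inter> G l. f = single l x" by blast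
next
  assume "\<exists>x\<in>W \<alpha> \<inter> G l. f = single l x"
  then show "f \<in> cmp (\<alpha>, l)" by (auto simp: mloop_comp_def L_single single_apply)
qed

lemma cmp_L: "f \<in> cmp (\<alpha>, l) \<Longrightarrow> f \<in> L"
  by (simp add: mloop_comp_def)

lemma cmp_0: "0 \<in> cmp (\<alpha>, l)"
  unfolding cmp_iff using subspace_0[OF subspace_W] subspace_0[OF subspace_G] by (intro bexI[of _ 0]) auto

lemma cmp_nonzero_iff: "cmp (\<alpha>, l) \<noteq> {0} \<longleftrightarrow> (\<exists>x\<in>W \<alpha> \<inter> G l. x \<noteq> 0)"
proof
  assume "cmp (\<alpha>, l) \<noteq> {0}"
  then obtain f where "f \<in> cmp (\<alpha>, l)" "f \<noteq> 0" using cmp_0 by blast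
  then show "\<exists>x\<in>W \<alpha> \<inter> G l. x \<noteq> 0" unfolding cmp_iff by auto
next
  assume "\<exists>x\<in>W \<alpha> \<inter> G l. x \<noteq> 0"
  then obtain x where x: "x \<in> W \<alpha> \<inter> G l" "x \<noteq> 0" by blast
  then have "single l x \<in> cmp (\<alpha>, l)" unfolding cmp_iff by blast
  moreover have "single l x \<noteq> 0" using x(2) by simp
  ultimately show "cmp (\<alpha>, l) \<noteq> {0}" by blast
qed

lemma L_hom_decomp:
  assumes "f \<in> L"
  shows "f = (\<Sum>l\<in>{l. f l \<noteq> 0}. \<Sum>\<alpha>\<in>R. single l (pr \<alpha> (f l)))"
  using L_decomp[OF assms] by (simp add: single_sum[symmetric] pr_sum)

lemma L_induct [consumes 1, case_names zero add single]:
  assumes f: "f \<in> L" and z: "Pr 0" and a: "\<And>f g. f \<in> L \<Longrightarrow> g \<in> L \<Longrightarrow> Pr f \<Longrightarrow> Pr g \<Longrightarrow> Pr (f + g)"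
    and s: "\<And>\<alpha> l x. \<alpha> \<in> R \<Longrightarrow> x \<in> W \<alpha> \<Longrightarrow> x \<in> G l \<Longrightarrow> Pr (single l x)"
  shows "Pr f"
proof -
  have sum: "Pr (\<Sum>a\<in>A. g a)" if "\<And>a. a \<in> A \<Longrightarrow> g a \<in> L \<and> Pr (g a)" for A :: "'x set" and g
    using that by (induction A rule: infinite_finite_induct) (auto intro!: z a L_sum)
  have 1: "single l (pr \<alpha> (f l)) \<in> L \<and> Pr (single l (pr \<alpha> (f l)))" if "\<alpha> \<in> R" for l \<alpha>
    using pr_G[OF L_G[OF f] that] pr_W[OF that] that by (auto intro: L_single s)
  have 2: "(\<Sum>\<alpha>\<in>R. single l (pr \<alpha> (f l))) \<in> L \<and> Pr (\<Sum>\<alpha>\<in>R. single l (pr \<alpha> (f l)))" for l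
    using 1 by (intro conjI L_sum sum) auto
  have "Pr (\<Sum>l\<in>{l. f l \<noteq> 0}. \<Sum>\<alpha>\<in>R. single l (pr \<alpha> (f l)))"
    using 2 by (rule sum)
  then show ?thesis using L_hom_decomp[OF f] by simp
qed

text \<open>Forgetting the weights loses nothing: G l is stable under ad H, so it is the sum of its
  weight components.\<close>

lemma zn_comp_cmp: "zn_comp Q cmp l = single l ` G l"
proof
  show "zn_comp Q cmp l \<subseteq> single l ` G l"
  proof
    fix f assume "f \<in> zn_comp Q cmp l"
    then obtain S g where g: "f = sum g S" "finite S" "\<forall>\<alpha>\<in>S. g \<alpha> \<in> cmp (\<alpha>, l)" by (auto simp: zn_comp_def)
    have "\<forall>\<alpha>\<in>S. \<exists>x. x \<in> G l \<and> g \<alpha> = single l x" using g(3) cmp_iff by blast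
    from bchoice[OF this] obtain x where x: "\<forall>\<alpha>\<in>S. x \<alpha> \<in> G l \<and> g \<alpha> = single l (x \<alpha>)" ..
    then have "f = single l (\<Sum>\<alpha>\<in>S. x \<alpha>)" by (simp add: g(1) single_sum)
    moreover have "(\<Sum>\<alpha>\<in>S. x \<alpha>) \<in> G l" using x by (intro subspace_sum[OF subspace_G]) auto
    ultimately show "f \<in> single l ` G l" by blast
  qed
  show "single l ` G l \<subseteq> zn_comp Q cmp l"
  proof clarify
    fix x assume x: "x \<in> G l"
    have "single l x = (\<Sum>\<alpha>\<in>R. single l (pr \<alpha> x))" by (simp add: single_sum[symmetric] pr_sum)
    moreover have "\<forall>\<alpha>\<in>R. single l (pr \<alpha> x) \<in> cmp (\<alpha>, l)" using pr_W pr_G[OF x] cmp_iff by blast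
    ultimately show "single l x \<in> zn_comp Q cmp l"
      unfolding zn_comp_def using finite_R R_Q
      by (intro CollectI exI[of _ R] exI[of _ "\<lambda>\<alpha>. single l (pr \<alpha> x)"]) auto
  qed
qed

definition \<Lambda> :: "(('v \<Rightarrow> 'k) \<times> (int^'n)) set" where
  "\<Lambda> = gen_subgroup (gsupp (Q \<times> UNIV) cmp)"

lemma \<Lambda>_base: "\<alpha> \<in> Q \<Longrightarrow> x \<in> W \<alpha> \<Longrightarrow> x \<in> G l \<Longrightarrow> x \<noteq> 0 \<Longrightarrow> (\<alpha>, l) \<in> \<Lambda>"
  unfolding \<Lambda>_def gsupp_def using cmp_nonzero_iff by (intro gen_subgroup_base) auto

lemma \<Lambda>_add: "p \<in> \<Lambda> \<Longrightarrow> q \<in> \<Lambda> \<Longrightarrow> p + q \<in> \<Lambda>"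
  and \<Lambda>_diff: "p \<in> \<Lambda> \<Longrightarrow> q \<in> \<Lambda> \<Longrightarrow> p - q \<in> \<Lambda>"
  and \<Lambda>_0: "0 \<in> \<Lambda>"
  by (simp_all add: \<Lambda>_def gen_subgroup_add gen_subgroup_diff gen_subgroup_0)

lemma nonzero_hom: "\<exists>\<alpha>\<in>R. \<exists>l x. x \<in> W \<alpha> \<and> x \<in> G l \<and> x \<noteq> 0"
proof -
  obtain l x where x: "x \<in> G l" "x \<noteq> 0" using nonzero_G by blast
  have "\<exists>\<alpha>\<in>R. pr \<alpha> x \<noteq> 0"
  proof (rule ccontr)
    assume "\<not> ?thesis"
    then have "(\<Sum>\<alpha>\<in>R. pr \<alpha> x) = 0" by simp
    then show False using x(2) by (simp add: pr_sum)
  qed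
  then show ?thesis using pr_W pr_G[OF x(1)] by blast
qed

text \<open>One nonzero x of some weight occurs in degrees l and l + m \<kappa>, and the difference
  of the two degrees is (0, m \<kappa>).\<close>

lemma \<Lambda>_shift: "(0, rscale m \<kappa>) \<in> \<Lambda>"
proof -
  obtain \<alpha> l x where x: "\<alpha> \<in> R" "x \<in> W \<alpha>" "x \<in> G l" "x \<noteq> 0" using nonzero_hom by blast
  have "x \<in> G (l + rscale m \<kappa>)" using x(3) G_shift by simp
  then have "(\<alpha>, l + rscale m \<kappa>) \<in> \<Lambda>" "(\<alpha>, l) \<in> \<Lambda>" using x R_Q by (auto intro!: \<Lambda>_base)
  then have "(\<alpha>, l + rscale m \<kappa>) - (\<alpha>, l) \<in> \<Lambda>" by (rule \<Lambda>_diff)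
  then show ?thesis by simp
qed

lemma \<Lambda>_Q: assumes "\<alpha> \<in> Q" shows "\<exists>l. (\<alpha>, l) \<in> \<Lambda>"
proof -
  have "Q \<subseteq> {\<alpha>. \<exists>l. (\<alpha>, l) \<in> \<Lambda>}"
    unfolding root_lattice_def
  proof (rule gen_subgroup_subset)
    show "roots sc br H \<subseteq> {\<alpha>. \<exists>l. (\<alpha>, l) \<in> \<Lambda>}"
    proof
      fix \<alpha> assume "\<alpha> \<in> roots sc br H"
      then have \<alpha>: "\<alpha> \<in> R" by (simp add: roots_R)
      obtain y where y: "y \<in> W \<alpha>" "y \<noteq> 0" using R_W[OF \<alpha>] by blast
      have "\<exists>l\<in>Box. prG l y \<noteq> 0"
      proof (rule ccontr)
        assume "\<not> ?thesis"
        then have "(\<Sum>l\<in>Box. prG l y) = 0" by simp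
        then show False using y(2) by (simp add: prG_sum)
      qed
      then obtain l where l: "l \<in> Box" "prG l y \<noteq> 0" by blast
      then have "(\<alpha>, l) \<in> \<Lambda>" using \<Lambda>_base[OF _ prG_W[OF y(1) l(1)] prG_G[OF l(1)] l(2)] \<alpha> R_Q by blast
      then show "\<alpha> \<in> {\<alpha>. \<exists>l. (\<alpha>, l) \<in> \<Lambda>}" by blast
    qed
    show "0 \<in> {\<alpha>. \<exists>l. (\<alpha>, l) \<in> \<Lambda>}" using \<Lambda>_0 by (auto simp: zero_prod_def)
    show "\<alpha> - \<beta> \<in> {\<alpha>. \<exists>l. (\<alpha>, l) \<in> \<Lambda>}" if ab: "\<alpha> \<in> {\<alpha>. \<exists>l. (\<alpha>, l) \<in> \<Lambda>}" "\<beta> \<in> {\<alpha>. \<exists>l. (\<alpha>, l) \<in> \<Lambda>}" for \<alpha> \<beta>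
    proof -
      obtain l k where "(\<alpha>, l) \<in> \<Lambda>" "(\<beta>, k) \<in> \<Lambda>" using ab by blast
      then have "(\<alpha>, l) - (\<beta>, k) \<in> \<Lambda>" by (rule \<Lambda>_diff)
      then show ?thesis by auto
    qed
  qed
  then show ?thesis using assms by blast
qed

text \<open>Since \<open>\<Lambda>\<close> contains the lattice \<open>0 \<times> m\<int>\<^sup>n\<close>, homomorphisms from it are affine in the second argument.\<close>

lemma affine_hom:
  fixes F :: "('v \<Rightarrow> 'k) \<times> (int^'n) \<Rightarrow> int^'n"
  assumes F: "\<And>p q. p \<in> \<Lambda> \<Longrightarrow> q \<in> \<Lambda> \<Longrightarrow> F (p + q) = F p + F q"
  shows "\<exists>(A :: rat^'n^'n) s. group_hom_on Q s \<and> (\<forall>\<alpha> l. (\<alpha>, l) \<in> \<Lambda> \<longrightarrow> rv (F (\<alpha>, l)) = A *v rv l - s \<alpha>)"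
proof -
  \<comment> \<open>E is F restricted to the lattice 0 \<times> m Z^n, where it is an additive map
    on all of Z^n.\<close>
  define E where "E \<kappa> = rv (F (0, rscale m \<kappa>))" for \<kappa>
  have E_add: "E (\<kappa> + \<kappa>') = E \<kappa> + E \<kappa>'" for \<kappa> \<kappa>'
    using F[OF \<Lambda>_shift[of \<kappa>] \<Lambda>_shift[of \<kappa>']] by (simp add: E_def rscale_add rv_add)
  have E_0: "E 0 = 0" using E_add[of 0 0] by simp
  have E_minus: "E (- \<kappa>) = - E \<kappa>" for \<kappa> using E_add[of \<kappa> "- \<kappa>"] E_0 by (simp add: eq_neg_iff_add_eq_0 add.commute)
  have E_nat: "E (axis i (int n)) = of_nat n *s E (axis i 1)" for i n
  proof (induction n)
    case 0
    have a0: "axis i (int 0) = 0" by (simp add: vec_eq_iff axis_def)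
    show ?case unfolding a0 by (simp add: E_0 vec_eq_iff)
  next
    case (Suc n)
    have e: "axis i (int (Suc n)) = axis i (int n) + axis i (1::int)" by (simp add: vec_eq_iff axis_def)
    show ?case unfolding e E_add Suc by (simp add: vec_eq_iff algebra_simps)
  qed
  have E_int: "E (axis i a) = of_int a *s E (axis i 1)" for i a
  proof (cases "0 \<le> a")
    case True
    then show ?thesis using E_nat[of i "nat a"] by simp
  next
    case False
    have e: "axis i a = - axis i (int (nat (- a)))" using False by (simp add: vec_eq_iff axis_def)
    have "E (axis i a) = - (of_nat (nat (- a)) *s E (axis i 1))" by (simp only: e E_minus E_nat)
    then show ?thesis using False by (simp add: vec_eq_iff)
  qed
  have E_sum: "E (\<Sum>i\<in>I. f i) = (\<Sum>i\<in>I. E (f i))" for I and f :: "'n \<Rightarrow> int^'n"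
    by (induction I rule: infinite_finite_induct) (simp_all add: E_add E_0)
  \<comment> \<open>Column i of A is the image of m i times the i-th unit vector divided by m i, so
    A agrees with F on that lattice.\<close>
  define A :: "rat^'n^'n" where "A = (\<chi> j i. E (axis i 1) $ j / of_nat (m i))"
  have m0: "(of_nat (m i) :: rat) \<noteq> 0" for i using \<sigma>_order(1)[of i] by simp
  have EA: "E \<kappa> = A *v rv (rscale m \<kappa>)" for \<kappa>
  proof -
    have "(\<Sum>i\<in>UNIV. axis i (\<kappa> $ i)) = \<kappa>" by (simp add: vec_eq_iff axis_def)
    then have "E \<kappa> = E (\<Sum>i\<in>UNIV. axis i (\<kappa> $ i))" by simp
    also have "\<dots> = (\<Sum>i\<in>UNIV. E (axis i (\<kappa> $ i)))" by (rule E_sum)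
    also have "\<dots> = (\<Sum>i\<in>UNIV. of_int (\<kappa> $ i) *s E (axis i 1))" by (intro sum.cong refl E_int)
    also have "\<dots> = A *v rv (rscale m \<kappa>)"
      using m0 by (simp add: vec_eq_iff A_def matrix_vector_mult_def mult.commute del: of_nat_eq_0_iff)
    finally show ?thesis .
  qed
  \<comment> \<open>M annihilates Z^n modulo m Z^n, so M \<delta> lies in the lattice where F is
    known; dividing by M extends the formula to every (0, \<delta>) in \<Lambda>.\<close>
  define M where "M = (\<Prod>i\<in>UNIV. m i)"
  have M0: "0 < M" unfolding M_def using \<sigma>_order(1) by (simp add: prod_pos)
  have F0: "rv (F (0, \<delta>)) = A *v rv \<delta>" if \<delta>: "(0, \<delta>) \<in> \<Lambda>" for \<delta>
  proof -
    let ?r = "\<lambda>n::nat. (\<chi> i. int n * \<delta> $ i) :: int^'n"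
    have n: "(0, ?r n) \<in> \<Lambda> \<and> rv (F (0, ?r n)) = of_nat n *s rv (F (0, \<delta>))" for n
    proof (induction n)
      case 0
      have r0: "(0, ?r 0) = (0 :: ('v \<Rightarrow> 'k) \<times> (int^'n))" by (simp add: prod_eq_iff vec_eq_iff zero_prod_def)
      have F00: "F 0 = 0" using F[OF \<Lambda>_0 \<Lambda>_0] by simp
      show ?case unfolding r0 F00 rv_0 using \<Lambda>_0 by (simp add: vec_eq_iff)
    next
      case (Suc n)
      have "?r (Suc n) = ?r n + \<delta>" by (simp add: vec_eq_iff algebra_simps)
      then have e: "(0 :: 'v \<Rightarrow> 'k, ?r (Suc n)) = (0, ?r n) + (0, \<delta>)" by (simp only: add_Pair add_0)
      note IH = conjunct1[OF Suc] conjunct2[OF Suc]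
      have 1: "F (0, ?r (Suc n)) = F (0, ?r n) + F (0, \<delta>)" unfolding e by (rule F[OF IH(1) \<delta>])
      have 2: "(0, ?r (Suc n)) \<in> \<Lambda>" unfolding e by (rule \<Lambda>_add[OF IH(1) \<delta>])
      have "rv (F (0, ?r (Suc n))) = of_nat n *s rv (F (0, \<delta>)) + rv (F (0, \<delta>))"
        by (simp only: 1 rv_add IH(2))
      also have "\<dots> = of_nat (Suc n) *s rv (F (0, \<delta>))" by (simp add: vec_eq_iff algebra_simps)
      finally show ?case using 2 by blast
    qed
    have "int M = int (m i) * int (M div m i)" for i
    proof -
      have "m i dvd M" unfolding M_def by (rule dvd_prodI) simp_all
      then have "M = m i * (M div m i)" by simp
      then show ?thesis by (metis of_nat_mult)
    qed
    then have e: "rscale m (\<chi> i. int (M div m i) * \<delta> $ i) = ?r M"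
      by (simp add: vec_eq_iff mult.assoc[symmetric])
    have "rv (F (0, ?r M)) = A *v rv (?r M)"
      using EA[of "\<chi> i. int (M div m i) * \<delta> $ i"] unfolding E_def e .
    also have "\<dots> = of_nat M *s (A *v rv \<delta>)"
      by (simp add: vec_eq_iff matrix_vector_mult_def sum_distrib_left mult.left_commute)
    finally have "of_nat M *s rv (F (0, \<delta>)) = of_nat M *s (A *v rv \<delta>)" using n[of M] by simp
    then show ?thesis using M0 by (simp add: vec_eq_iff)
  qed
  have "\<forall>\<alpha>\<in>Q. \<exists>l. (\<alpha>, l) \<in> \<Lambda>" using \<Lambda>_Q by blast
  from bchoice[OF this] obtain e where e: "\<And>\<alpha>. \<alpha> \<in> Q \<Longrightarrow> (\<alpha>, e \<alpha>) \<in> \<Lambda>" by blast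
  \<comment> \<open>Two lifts of \<alpha> to \<Lambda> differ by an element of weight 0, on which F
    agrees with A, so s does not depend on the chosen lift e.\<close>
  define s where "s \<alpha> = A *v rv (e \<alpha>) - rv (F (\<alpha>, e \<alpha>))" for \<alpha>
  have \<Lambda>Q: "\<alpha> \<in> Q" if "(\<alpha>, l) \<in> \<Lambda>" for \<alpha> l
  proof -
    have "\<Lambda> \<subseteq> Q \<times> UNIV"
      unfolding \<Lambda>_def
    proof (rule gen_subgroup_subset)
      show "p - q \<in> Q \<times> UNIV" if "p \<in> Q \<times> UNIV" "q \<in> Q \<times> UNIV" for p q :: "('v \<Rightarrow> 'k) \<times> (int^'n)"
        using that Q_diff by (cases p, cases q) auto
    qed (auto simp: gsupp_def zero_prod_def Q_0)
    then show ?thesis using that by blast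
  qed
  have main: "rv (F (\<alpha>, l)) = A *v rv l - s \<alpha>" if p: "(\<alpha>, l) \<in> \<Lambda>" for \<alpha> l
  proof -
    have p0: "(\<alpha>, e \<alpha>) \<in> \<Lambda>" by (rule e[OF \<Lambda>Q[OF p]])
    have d: "(0, l - e \<alpha>) \<in> \<Lambda>" using \<Lambda>_diff[OF p p0] by simp
    have "F (\<alpha>, l) = F (0, l - e \<alpha>) + F (\<alpha>, e \<alpha>)" using F[OF d p0] by simp
    then have "rv (F (\<alpha>, l)) = A *v rv (l - e \<alpha>) + rv (F (\<alpha>, e \<alpha>))" by (simp add: rv_add F0[OF d])
    then show ?thesis by (simp add: s_def rv_diff matrix_vector_mult_diff_distrib)
  qed
  have "group_hom_on Q s"
    unfolding group_hom_on_def
  proof (intro ballI)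
    fix \<alpha> \<beta> assume ab: "\<alpha> \<in> Q" "\<beta> \<in> Q"
    have sum: "(\<alpha> + \<beta>, e \<alpha> + e \<beta>) \<in> \<Lambda>" using \<Lambda>_add[OF e[OF ab(1)] e[OF ab(2)]] by simp
    have "F (\<alpha> + \<beta>, e \<alpha> + e \<beta>) = F (\<alpha>, e \<alpha>) + F (\<beta>, e \<beta>)" using F[OF e[OF ab(1)] e[OF ab(2)]] by simp
    then have "A *v rv (e \<alpha> + e \<beta>) - s (\<alpha> + \<beta>) = (A *v rv (e \<alpha>) - s \<alpha>) + (A *v rv (e \<beta>) - s \<beta>)"
      using main[OF sum] main[OF e[OF ab(1)]] main[OF e[OF ab(2)]] by (simp add: rv_add)
    then show "s (\<alpha> + \<beta>) = s \<alpha> + s \<beta>" by (simp add: rv_add matrix_vector_right_distrib algebra_simps)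
  qed
  then show ?thesis using main by blast
qed

end

section \<open>Products of powers of commuting maps\<close>

context fd_space begin

lemma comm_inv:
  assumes "bij f" "\<And>x. f (g x) = g (f x)" shows "inv f (g x) = g (inv f x)"
proof -
  have "f (g (inv f x)) = g x" unfolding assms(2) surj_f_inv_f[OF bij_is_surj[OF assms(1)]] ..
  then show ?thesis by (rule inv_f_eq[OF bij_is_inj[OF assms(1)]])
qed

lemma fpow_comm1:
  assumes "bij f" "\<And>x. f (g x) = g (f x)" shows "fpow f k (g x) = g (fpow f k x)"
proof -
  have 1: "g ((f ^^ n) x) = (f ^^ n) (g x)" for n by (rule comm_pow) (rule assms(2)[symmetric])
  have 2: "g ((inv f ^^ n) x) = (inv f ^^ n) (g x)" for n
    by (rule comm_pow, rule comm_inv[where f = f, OF assms(1), symmetric]) (rule assms(2))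
  show ?thesis by (simp add: fpow_def 1 2)
qed

lemma fpow_comm:
  assumes f: "bij f" and g: "bij g" and c: "\<And>x. f (g x) = g (f x)"
  shows "fpow f k (fpow g l x) = fpow g l (fpow f k x)"
proof (rule fpow_comm1[OF f])
  show "f (fpow g l x) = fpow g l (f x)" for x
    by (rule fpow_comm1[OF g, symmetric]) (rule c[symmetric])
qed

lemma lin_inv: assumes l: "lin f" and b: "bij f" shows "lin (inv f)"
proof (rule linI)
  have i: "inv f x = y" if "x = f y" for x y unfolding that by (rule inv_f_f[OF bij_is_inj[OF b]])
  have r: "f (inv f x) = x" for x by (rule surj_f_inv_f[OF bij_is_surj[OF b]])
  show "inv f (x + y) = inv f x + inv f y" for x y by (rule i) (simp add: lin_add[OF l] r)
  show "inv f (sc c x) = sc c (inv f x)" for c x by (rule i) (simp add: lin_sc[OF l] r)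
qed

lemma lin_fpow: "lin f \<Longrightarrow> bij f \<Longrightarrow> lin (fpow f k)"
  unfolding fpow_def by (simp add: lin_pow lin_inv)

lemma fpow_eigen:
  assumes l: "lin f" and b: "bij f" and c: "c \<noteq> 0" "f x = sc c x"
  shows "fpow f k x = sc (power_int c k) x"
proof -
  have p: "(g ^^ n) x = sc (d ^ n) x" if "lin g" "g x = sc d x" for g d n
    using that by (induction n) (simp_all add: lin_sc mult.commute)
  have "f (sc (inverse c) x) = x" using c by (simp add: lin_sc[OF l])
  then have "inv f x = sc (inverse c) x" by (rule inv_f_eq[OF bij_is_inj[OF b]])
  then show ?thesis using p[OF l c(2)] p[OF lin_inv[OF l b], of "inverse c"]
    by (auto simp: fpow_def power_int_def power_inverse)
qed

context
  fixes F :: "'n::finite \<Rightarrow> 'v \<Rightarrow> 'v"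
  assumes Flin: "\<And>i. lin (F i)" and Fbij: "\<And>i. bij (F i)" and Fcomm: "\<And>i j x. F i (F j x) = F j (F i x)"
begin

text \<open>The product over a subset of the indices, so that facts about \<open>tuple_pow\<close>
  can be proved by induction on the index set.\<close>

definition partial_pow :: "int^'n^'n \<Rightarrow> 'n \<Rightarrow> 'n set \<Rightarrow> 'v \<Rightarrow> 'v" where
  "partial_pow P j = Finite_Set.fold (\<lambda>i acc. fpow (F i) (P $ i $ j) \<circ> acc) id"

lemma partial_pow_insert:
  assumes "finite I" "i \<notin> I"
  shows "partial_pow P j (insert i I) x = fpow (F i) (P $ i $ j) (partial_pow P j I x)"
proof -
  have comm: "fpow (F a) k (fpow (F b) l y) = fpow (F b) l (fpow (F a) k y)" for a b k l y
    by (rule fpow_comm[OF Fbij Fbij]) (rule Fcomm)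
  interpret c: comp_fun_commute_on UNIV "\<lambda>i acc. fpow (F i) (P $ i $ j) \<circ> acc"
    by (rule comp_fun_commute_on.intro, rule ext, rule ext) (simp only: comp_apply, rule comm)
  from fun_cong[OF c.fold_insert[OF subset_UNIV assms, of id], of x] show ?thesis
    by (simp only: partial_pow_def comp_apply[of "fpow (F i) (P $ i $ j)"])
qed

lemma partial_pow_empty: "partial_pow P j {} x = x" by (simp add: partial_pow_def)

lemma tuple_pow_partial: "tuple_pow F P j = partial_pow P j UNIV"
  by (simp add: tuple_pow_def partial_pow_def)

lemma tuple_pow_lin: "lin (tuple_pow F P j)"
proof -
  have "lin (partial_pow P j I)" if "finite I" for I
    using that
  proof (induction I rule: finite_induct)
    case empty
    show ?case by (rule linI) (simp_all only: partial_pow_empty)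
  next
    case (insert i I)
    note l = lin_fpow[OF Flin Fbij]
    show ?case
      by (rule linI) (simp_all only: partial_pow_insert[OF insert.hyps] lin_add[OF insert.IH]
          lin_add[OF l] lin_sc[OF insert.IH] lin_sc[OF l])
  qed
  then show ?thesis by (simp add: tuple_pow_partial)
qed

lemma tuple_pow_eigen:
  assumes c: "\<And>i. c i \<noteq> 0" "\<And>i. F i x = sc (c i) x"
  shows "tuple_pow F P j x = sc (\<Prod>i\<in>UNIV. power_int (c i) (P $ i $ j)) x"
proof -
  have "partial_pow P j I x = sc (\<Prod>i\<in>I. power_int (c i) (P $ i $ j)) x" if "finite I" for I
    using that
  proof (induction I rule: finite_induct)
    case empty
    show ?case by (simp add: partial_pow_empty)
  next
    case (insert i I)
    show ?case
      by (simp only: partial_pow_insert[OF insert.hyps] insert.IH lin_sc[OF lin_fpow[OF Flin Fbij]]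
          fpow_eigen[OF Flin Fbij c] scale_scale prod.insert[OF insert.hyps] mult.commute)
  qed
  then show ?thesis by (simp add: tuple_pow_partial)
qed

end

end

section \<open>Centroidal maps\<close>

context loop_alg begin

text \<open>The injective elements of the centroid, with all conditions restricted to the carrier
  L.\<close>

definition centr :: "((int^'n \<Rightarrow> 'v) \<Rightarrow> int^'n \<Rightarrow> 'v) \<Rightarrow> bool" where
  "centr U \<longleftrightarrow> (\<forall>f\<in>L. U f \<in> L) \<and> (\<forall>f\<in>L. \<forall>g\<in>L. U (f + g) = U f + U g) \<and>
    (\<forall>c. \<forall>f\<in>L. U (lsc sc c f) = lsc sc c (U f)) \<and>
    (\<forall>f\<in>L. \<forall>g\<in>L. U (lb f g) = lb (U f) g \<and> U (lb f g) = lb f (U g)) \<and> (\<forall>f\<in>L. U f = 0 \<longrightarrow> f = 0)"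

lemma centr_L: "centr U \<Longrightarrow> f \<in> L \<Longrightarrow> U f \<in> L"
  unfolding centr_def by (elim conjE, erule(1) bspec)

lemma centr_add: "centr U \<Longrightarrow> f \<in> L \<Longrightarrow> g \<in> L \<Longrightarrow> U (f + g) = U f + U g"
  unfolding centr_def by (elim conjE, drule(1) bspec, erule(1) bspec)

lemma centr_sc: "centr U \<Longrightarrow> f \<in> L \<Longrightarrow> U (lsc sc c f) = lsc sc c (U f)"
  unfolding centr_def by (elim conjE, drule spec[of _ c], erule(1) bspec)

lemma
  assumes U: "centr U" and f: "f \<in> L" and g: "g \<in> L"
  shows centr_left: "U (lb f g) = lb (U f) g" and centr_right: "U (lb f g) = lb f (U g)"
proof -
  have "\<forall>f\<in>L. \<forall>g\<in>L. U (lb f g) = lb (U f) g \<and> U (lb f g) = lb f (U g)"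
    using U unfolding centr_def by (elim conjE)
  from bspec[OF bspec[OF this f] g] show "U (lb f g) = lb (U f) g" "U (lb f g) = lb f (U g)"
    by (rule conjunct1, rule conjunct2)
qed

lemma centr_inj: "centr U \<Longrightarrow> f \<in> L \<Longrightarrow> U f = 0 \<Longrightarrow> f = 0"
  unfolding centr_def by (elim conjE, drule(1) bspec, erule(1) mp)

lemma centr_homogeneous:
  assumes U: "centr U" and hom: "\<And>l x. x \<in> G l \<Longrightarrow> \<exists>y. U (single l x) = single (l + \<delta>) y"
  shows "\<exists>c \<kappa>. c \<noteq> 0 \<and> \<delta> = rscale m \<kappa> \<and> (\<forall>l. \<forall>x\<in>G l. U (single l x) = single (l + \<delta>) (sc c x))"
  by (rule homogeneous_centroid[OF centr_L[OF U] centr_add[OF U] centr_sc[OF U] centr_left[OF U]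
      centr_right[OF U] hom centr_inj[OF U]])

lemma centr_sum:
  assumes U: "centr U" and f: "\<And>a. a \<in> A \<Longrightarrow> f a \<in> L"
  shows "U (\<Sum>a\<in>A. f a) = (\<Sum>a\<in>A. U (f a))"
proof -
  have U0: "U 0 = 0"
  proof -
    have "U (0 + 0) = U 0 + U 0" by (rule centr_add[OF U L_0 L_0])
    then show ?thesis by simp
  qed
  show ?thesis using f
  proof (induction A rule: infinite_finite_induct)
    case (insert a A)
    have "U (f a + (\<Sum>a\<in>A. f a)) = U (f a) + U (\<Sum>a\<in>A. f a)"
      by (rule centr_add[OF U insert.prems L_sum]) (use insert.prems in auto)
    also have "U (\<Sum>a\<in>A. f a) = (\<Sum>a\<in>A. U (f a))" by (rule insert.IH) (use insert.prems in auto)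
    finally show ?case by (simp only: sum.insert[OF insert.hyps])
  qed (simp_all add: U0)
qed

text \<open>Multiplication by the monomial t^(m \<kappa>).\<close>

definition shift :: "int^'n \<Rightarrow> (int^'n \<Rightarrow> 'v) \<Rightarrow> int^'n \<Rightarrow> 'v" where
  "shift \<kappa> f = (\<lambda>\<nu>. f (\<nu> - rscale m \<kappa>))"

lemma shift_single: "shift \<kappa> (single l x) = single (l + rscale m \<kappa>) x"
  by (auto simp: shift_def single_apply fun_eq_iff algebra_simps)

lemma shift_add: "shift \<kappa> (f + g) = shift \<kappa> f + shift \<kappa> g"
  by (simp add: shift_def fun_eq_iff)

lemma shift_L: assumes f: "f \<in> L" shows "shift \<kappa> f \<in> L"
proof -
  have "{l. shift \<kappa> f l \<noteq> 0} \<subseteq> (\<lambda>l. l + rscale m \<kappa>) ` {l. f l \<noteq> 0}"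
  proof
    fix l assume "l \<in> {l. shift \<kappa> f l \<noteq> 0}"
    then show "l \<in> (\<lambda>l. l + rscale m \<kappa>) ` {l. f l \<noteq> 0}"
      by (intro image_eqI[of _ _ "l - rscale m \<kappa>"]) (simp_all add: shift_def)
  qed
  moreover have "shift \<kappa> f l \<in> G l" for l
    using L_G[OF f, of "l - rscale m \<kappa>"] G_shift[of "l - rscale m \<kappa>" \<kappa>] by (simp add: shift_def)
  ultimately show ?thesis using f by (auto simp: L_iff intro: finite_surj)
qed

lemma centr_shift: "centr (shift \<kappa>)"
  unfolding centr_def
proof (intro conjI ballI allI impI)
  fix f g assume f: "f \<in> L" and g: "g \<in> L"
  show "shift \<kappa> f \<in> L" by (rule shift_L[OF f])
  show "shift \<kappa> (f + g) = shift \<kappa> f + shift \<kappa> g" by (rule shift_add)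
  show "shift \<kappa> (lb f g) = lb f (shift \<kappa> g)"
    by (simp add: shift_def lbr_def fun_eq_iff algebra_simps)
  show "shift \<kappa> (lb f g) = lb (shift \<kappa> f) g"
  proof
    fix \<nu>
    have "lb (shift \<kappa> f) g \<nu> = (\<Sum>l | f (l - rscale m \<kappa>) \<noteq> 0. br (f (l - rscale m \<kappa>)) (g (\<nu> - l)))"
      by (simp add: lbr_def shift_def)
    also have "\<dots> = (\<Sum>l | f l \<noteq> 0. br (f l) (g (\<nu> - rscale m \<kappa> - l)))"
      by (rule sum.reindex_bij_witness[of _ "\<lambda>l. l + rscale m \<kappa>" "\<lambda>l. l - rscale m \<kappa>"])
         (auto simp: algebra_simps)
    finally show "shift \<kappa> (lb f g) \<nu> = lb (shift \<kappa> f) g \<nu>" by (simp add: shift_def lbr_def)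
  qed
next
  fix c f show "shift \<kappa> (lsc sc c f) = lsc sc c (shift \<kappa> f)" by (simp add: shift_def lsc_def)
next
  fix f assume z: "shift \<kappa> f = 0"
  show "f = 0"
  proof
    fix l show "f l = 0 l" using fun_cong[OF z, of "l + rscale m \<kappa>"] by (simp add: shift_def)
  qed
qed

end

lemma alg_iso_inv:
  assumes \<phi>: "alg_iso A sc br A' sc' br' \<phi>"
    and cl: "\<And>x y. x \<in> A \<Longrightarrow> y \<in> A \<Longrightarrow> x + y \<in> A" "\<And>c x. x \<in> A \<Longrightarrow> sc c x \<in> A"
      "\<And>x y. x \<in> A \<Longrightarrow> y \<in> A \<Longrightarrow> br x y \<in> A"
  shows "alg_iso A' sc' br' A sc br (the_inv_into A \<phi>)"
proof -
  let ?i = "the_inv_into A \<phi>"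
  have b: "bij_betw \<phi> A A'" using \<phi> by (simp add: alg_iso_def)
  have inj: "inj_on \<phi> A" using b by (simp add: bij_betw_def)
  have iA: "?i y \<in> A" and \<phi>i: "\<phi> (?i y) = y" if "y \<in> A'" for y
    using that b by (auto simp: bij_betw_def the_inv_into_into f_the_inv_into_f)
  have eq: "?i y = x" if "x \<in> A" "\<phi> x = y" for x y using the_inv_into_f_f[OF inj that(1)] that(2) by simp
  show ?thesis
    unfolding alg_iso_def
  proof (intro conjI ballI allI)
    show "bij_betw ?i A' A" by (rule bij_betw_the_inv_into[OF b])
    fix x y assume xy: "x \<in> A'" "y \<in> A'"
    show "?i (x + y) = ?i x + ?i y"
      by (rule eq) (use cl(1) iA \<phi>i xy \<phi> in \<open>simp_all add: alg_iso_def\<close>)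
    show "?i (br' x y) = br (?i x) (?i y)"
      by (rule eq) (use cl(3) iA \<phi>i xy \<phi> in \<open>simp_all add: alg_iso_def\<close>)
  next
    fix c x assume x: "x \<in> A'"
    show "?i (sc' c x) = sc c (?i x)"
      by (rule eq) (use cl(2) iA \<phi>i x \<phi> in \<open>simp_all add: alg_iso_def\<close>)
  qed
qed

text \<open>Carrying the inverse \<phi>i as a parameter makes the situation symmetric, so that
  \<open>swap\<close> lets centroid elements be transported in both directions.\<close>

locale loop_pair = a: loop_alg sc br \<sigma> m z + b: loop_alg sc' br' \<sigma>' m' z
  for sc :: "'k::field_char_0 \<Rightarrow> 'v::ab_group_add \<Rightarrow> 'v" and br
    and \<sigma> :: "'n::finite \<Rightarrow> 'v \<Rightarrow> 'v" and m
    and sc' :: "'k \<Rightarrow> 'w::ab_group_add \<Rightarrow> 'w" and br'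
    and \<sigma>' :: "'n \<Rightarrow> 'w \<Rightarrow> 'w" and m' and z +
  fixes \<phi> \<phi>i
  assumes iso: "alg_iso a.L (lsc sc) a.lb b.L (lsc sc') b.lb \<phi>"
    and iso_inv: "alg_iso b.L (lsc sc') b.lb a.L (lsc sc) a.lb \<phi>i"
    and inv1: "\<And>f. f \<in> a.L \<Longrightarrow> \<phi>i (\<phi> f) = f" and inv2: "\<And>g. g \<in> b.L \<Longrightarrow> \<phi> (\<phi>i g) = g"
begin

lemma \<phi>_L: "f \<in> a.L \<Longrightarrow> \<phi> f \<in> b.L" and \<phi>i_L: "g \<in> b.L \<Longrightarrow> \<phi>i g \<in> a.L"
  using iso iso_inv by (auto simp: alg_iso_def bij_betw_def)

lemma \<phi>_add: "f \<in> a.L \<Longrightarrow> g \<in> a.L \<Longrightarrow> \<phi> (f + g) = \<phi> f + \<phi> g"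
  and \<phi>_sc: "f \<in> a.L \<Longrightarrow> \<phi> (lsc sc c f) = lsc sc' c (\<phi> f)"
  and \<phi>_lb: "f \<in> a.L \<Longrightarrow> g \<in> a.L \<Longrightarrow> \<phi> (a.lb f g) = b.lb (\<phi> f) (\<phi> g)"
  using iso by (simp_all add: alg_iso_def)

lemma \<phi>i_add: "f \<in> b.L \<Longrightarrow> g \<in> b.L \<Longrightarrow> \<phi>i (f + g) = \<phi>i f + \<phi>i g"
  and \<phi>i_sc: "f \<in> b.L \<Longrightarrow> \<phi>i (lsc sc' c f) = lsc sc c (\<phi>i f)"
  and \<phi>i_lb: "f \<in> b.L \<Longrightarrow> g \<in> b.L \<Longrightarrow> \<phi>i (b.lb f g) = a.lb (\<phi>i f) (\<phi>i g)"
  using iso_inv by (simp_all add: alg_iso_def)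

lemma \<phi>_0: "\<phi> 0 = 0"
  using \<phi>_add[OF a.L_0 a.L_0] by simp

lemma \<phi>i_0: "\<phi>i 0 = 0"
  using \<phi>i_add[OF b.L_0 b.L_0] by simp

lemma \<phi>_inj: "f \<in> a.L \<Longrightarrow> \<phi> f = 0 \<Longrightarrow> f = 0"
  using inv1[of f] \<phi>i_0 by simp

lemma \<phi>i_inj: "f \<in> b.L \<Longrightarrow> \<phi>i f = 0 \<Longrightarrow> f = 0"
  using inv2[of f] \<phi>_0 by simp

lemma \<phi>_sum: "(\<And>a. a \<in> A \<Longrightarrow> f a \<in> a.L) \<Longrightarrow> \<phi> (\<Sum>a\<in>A. f a) = (\<Sum>a\<in>A. \<phi> (f a))"
  by (induction A rule: infinite_finite_induct) (simp_all add: \<phi>_0 \<phi>_add a.L_sum)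

lemma centr_transport:
  assumes U: "a.centr U" shows "b.centr (\<lambda>g. \<phi> (U (\<phi>i g)))"
proof -
  note UL = a.centr_L[OF U] and Uadd = a.centr_add[OF U] and Usc = a.centr_sc[OF U]
    and Ul = a.centr_left[OF U] and Ur = a.centr_right[OF U] and Ui = a.centr_inj[OF U]
  show ?thesis
    unfolding b.centr_def
  proof (intro conjI ballI allI impI)
    fix f g assume f: "f \<in> b.L" and g: "g \<in> b.L"
    show "\<phi> (U (\<phi>i f)) \<in> b.L" by (intro \<phi>_L UL \<phi>i_L f)
    show "\<phi> (U (\<phi>i (f + g))) = \<phi> (U (\<phi>i f)) + \<phi> (U (\<phi>i g))"
      by (simp only: \<phi>i_add f g Uadd \<phi>i_L \<phi>_add UL)
    have "\<phi> (U (\<phi>i (b.lb f g))) = \<phi> (a.lb (U (\<phi>i f)) (\<phi>i g))" by (simp add: \<phi>i_lb f g Ul \<phi>i_L)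
    also have "\<dots> = b.lb (\<phi> (U (\<phi>i f))) g" by (simp add: \<phi>_lb UL \<phi>i_L f g inv2)
    finally show "\<phi> (U (\<phi>i (b.lb f g))) = b.lb (\<phi> (U (\<phi>i f))) g" .
    have "\<phi> (U (\<phi>i (b.lb f g))) = \<phi> (a.lb (\<phi>i f) (U (\<phi>i g)))" by (simp add: \<phi>i_lb f g Ur \<phi>i_L)
    also have "\<dots> = b.lb f (\<phi> (U (\<phi>i g)))" by (simp add: \<phi>_lb UL \<phi>i_L f g inv2)
    finally show "\<phi> (U (\<phi>i (b.lb f g))) = b.lb f (\<phi> (U (\<phi>i g)))" .
  next
    fix c f assume f: "f \<in> b.L"
    show "\<phi> (U (\<phi>i (lsc sc' c f))) = lsc sc' c (\<phi> (U (\<phi>i f)))"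
      by (simp add: \<phi>i_sc f Usc \<phi>i_L \<phi>_sc UL)
  next
    fix f assume f: "f \<in> b.L" and z: "\<phi> (U (\<phi>i f)) = 0"
    have "U (\<phi>i f) = 0" by (rule \<phi>_inj[OF UL[OF \<phi>i_L[OF f]] z])
    then have "\<phi>i f = 0" by (rule Ui[OF \<phi>i_L[OF f]])
    then show "f = 0" by (rule \<phi>i_inj[OF f])
  qed
qed

lemma swap: "loop_pair sc' br' \<sigma>' m' sc br \<sigma> m z \<phi>i \<phi>"
  by unfold_locales (rule iso_inv iso inv1 inv2; assumption?)+

end

section \<open>Additive maps and characters of Z^n in coordinates\<close>

lemma rscale_eq_0: assumes "\<And>i. 0 < m i" shows "rscale m \<kappa> = 0 \<longleftrightarrow> \<kappa> = 0"
proof -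
  have n: "m i \<noteq> 0" for i using assms[of i] by simp
  show ?thesis by (simp add: vec_eq_iff n)
qed

lemma rscale_inj: assumes "\<And>i. 0 < m i" shows "rscale m \<kappa> = rscale m \<kappa>' \<longleftrightarrow> \<kappa> = \<kappa>'"
proof -
  have n: "m i \<noteq> 0" for i using assms[of i] by simp
  show ?thesis by (simp add: vec_eq_iff n)
qed

lemma additive_coordinates:
  fixes f :: "int^'n \<Rightarrow> int"
  assumes f: "\<And>x y. f (x + y) = f x + f y"
  shows "f x = (\<Sum>i\<in>UNIV. x $ i * f (axis i 1))"
proof -
  have f0: "f 0 = 0" using f[of 0 0] by simp
  have ax: "f (axis i a) = a * f (axis i 1)" for i a
  proof (induction a rule: int_induct[where k = 0])
    case base
    have a0: "axis i (0::int) = 0" by (simp add: vec_eq_iff axis_def)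
    show ?case unfolding a0 by (simp add: f0)
  next
    case (step1 a)
    have "axis i (a + 1) = axis i a + axis i (1::int)" by (simp add: vec_eq_iff axis_def)
    then have "f (axis i (a + 1)) = f (axis i a) + f (axis i 1)" by (simp only: f)
    then show ?case using step1 by (simp add: algebra_simps)
  next
    case (step2 a)
    have "axis i a = axis i (a - 1) + axis i (1::int)" by (simp add: vec_eq_iff axis_def)
    then have "f (axis i a) = f (axis i (a - 1)) + f (axis i 1)" by (simp only: f)
    then show ?case using step2 by (simp add: algebra_simps)
  qed
  have s: "f (\<Sum>i\<in>I. g i) = (\<Sum>i\<in>I. f (g i))" for I and g :: "'n \<Rightarrow> int^'n"
    by (induction I rule: infinite_finite_induct) (simp_all add: f f0)
  have "(\<Sum>i\<in>UNIV. axis i (x $ i)) = x" by (simp add: vec_eq_iff axis_def)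
  then have "f x = f (\<Sum>i\<in>UNIV. axis i (x $ i))" by simp
  also have "\<dots> = (\<Sum>i\<in>UNIV. x $ i * f (axis i 1))" unfolding s by (intro sum.cong refl ax)
  finally show ?thesis .
qed

text \<open>Multiplicative counterpart of \<open>additive_coordinates\<close>; it expresses the
  scalars picked up by the transported shifts through their values at the unit vectors.\<close>

lemma character_coordinates:
  fixes d :: "int^'n \<Rightarrow> 'k::field"
  assumes d: "\<And>x y. d (x + y) = d x * d y" and d1: "\<And>x. d x \<noteq> 0"
  shows "d x = (\<Prod>i\<in>UNIV. power_int (d (axis i 1)) (x $ i))"
proof -
  have d0: "d 0 = 1" using d[of 0 0] d1[of 0] by simp
  have ax: "d (axis i a) = power_int (d (axis i 1)) a" for i a
  proof (induction a rule: int_induct[where k = 0])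
    case base
    have a0: "axis i (0::int) = 0" by (simp add: vec_eq_iff axis_def)
    show ?case unfolding a0 by (simp add: d0)
  next
    case (step1 a)
    have "axis i (a + 1) = axis i a + axis i (1::int)" by (simp add: vec_eq_iff axis_def)
    then have "d (axis i (a + 1)) = d (axis i a) * d (axis i 1)" by (simp only: d)
    then show ?case using step1 d1 by (simp add: power_int_add)
  next
    case (step2 a)
    have "axis i a = axis i (a - 1) + axis i (1::int)" by (simp add: vec_eq_iff axis_def)
    then have "d (axis i a) = d (axis i (a - 1)) * d (axis i 1)" by (simp only: d)
    then show ?case using step2 d1[of "axis i 1"] by (simp add: power_int_diff field_simps)
  qed
  have s: "d (\<Sum>i\<in>I. g i) = (\<Prod>i\<in>I. d (g i))" for I and g :: "'n \<Rightarrow> int^'n"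
    by (induction I rule: infinite_finite_induct) (simp_all add: d d0)
  have "(\<Sum>i\<in>UNIV. axis i (x $ i)) = x" by (simp add: vec_eq_iff axis_def)
  then have "d x = d (\<Sum>i\<in>UNIV. axis i (x $ i))" by simp
  also have "\<dots> = (\<Prod>i\<in>UNIV. power_int (d (axis i 1)) (x $ i))" unfolding s by (intro prod.cong refl ax)
  finally show ?thesis .
qed

definition coord_matrix :: "(int^'n \<Rightarrow> int^'n) \<Rightarrow> int^'n^'n" where
  "coord_matrix N = (\<chi> j i. N (axis i 1) $ j)"

lemma coord_matrix_mult:
  assumes N: "\<And>x y. N (x + y) = N x + N y" shows "coord_matrix N *v x = N x"
proof -
  have "N x $ j = (\<Sum>i\<in>UNIV. x $ i * N (axis i 1) $ j)" for j
    by (rule additive_coordinates) (simp add: N)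
  then show ?thesis
    by (simp add: vec_eq_iff matrix_vector_mult_def coord_matrix_def mult.commute)
qed

context multiloop
begin

lemma L_pairs_decomp:
  assumes f: "f \<in> L"
  shows "finite {p \<in> R \<times> {l. f l \<noteq> 0}. pr (fst p) (f (snd p)) \<noteq> 0}"
    and "f = (\<Sum>p\<in>{p \<in> R \<times> {l. f l \<noteq> 0}. pr (fst p) (f (snd p)) \<noteq> 0}. single (snd p) (pr (fst p) (f (snd p))))"
proof -
  have fin: "finite (R \<times> {l. f l \<noteq> 0})" using finite_R f by (simp add: L_iff)
  then show "finite {p \<in> R \<times> {l. f l \<noteq> 0}. pr (fst p) (f (snd p)) \<noteq> 0}" by simp
  have "f = (\<Sum>l\<in>{l. f l \<noteq> 0}. \<Sum>\<alpha>\<in>R. single l (pr \<alpha> (f l)))" by (rule L_hom_decomp[OF f])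
  also have "\<dots> = (\<Sum>\<alpha>\<in>R. \<Sum>l\<in>{l. f l \<noteq> 0}. single l (pr \<alpha> (f l)))" by (rule sum.swap)
  also have "\<dots> = (\<Sum>p\<in>R \<times> {l. f l \<noteq> 0}. single (snd p) (pr (fst p) (f (snd p))))"
    unfolding sum.cartesian_product by (rule sum.cong) auto
  also have "\<dots> = (\<Sum>p\<in>{p \<in> R \<times> {l. f l \<noteq> 0}. pr (fst p) (f (snd p)) \<noteq> 0}. single (snd p) (pr (fst p) (f (snd p))))"
    by (rule sum.mono_neutral_right[OF fin]) auto
  finally show "f = (\<Sum>p\<in>{p \<in> R \<times> {l. f l \<noteq> 0}. pr (fst p) (f (snd p)) \<noteq> 0}. single (snd p) (pr (fst p) (f (snd p))))" .
qed

end

section \<open>From graded isomorphisms to conjugate tuples\<close>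

text \<open>Weights of the images are not recorded: the isomorphism in (c) respects only the
  Z^n-degree. Accordingly the second algebra enters with its tuple but without a Cartan
  subalgebra.\<close>

locale regraded_iso = a: multiloop sc br \<sigma> m H z + loop_pair sc br \<sigma> m sc' br' \<sigma>' m' z \<phi> \<phi>i
  for sc :: "'k::field_char_0 \<Rightarrow> 'v::ab_group_add \<Rightarrow> 'v" and br
    and \<sigma> :: "'n::finite \<Rightarrow> 'v \<Rightarrow> 'v" and m H
    and sc' :: "'k \<Rightarrow> 'w::ab_group_add \<Rightarrow> 'w" and br'
    and \<sigma>' :: "'n \<Rightarrow> 'w \<Rightarrow> 'w" and m' and z and \<phi> \<phi>i +
  fixes F :: "('v \<Rightarrow> 'k) \<times> (int^'n) \<Rightarrow> int^'n"
  assumes F_add: "\<And>p q. p \<in> a.\<Lambda> \<Longrightarrow> q \<in> a.\<Lambda> \<Longrightarrow> F (p + q) = F p + F q"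
    and \<phi>_hom: "\<And>\<alpha> l x. \<alpha> \<in> a.R \<Longrightarrow> x \<in> a.W \<alpha> \<Longrightarrow> x \<in> a.G l \<Longrightarrow> x \<noteq> 0 \<Longrightarrow>
      \<exists>y\<in>b.G (F (\<alpha>, l)). \<phi> (single l x) = single (F (\<alpha>, l)) y"
begin

definition \<delta> :: "int^'n \<Rightarrow> int^'n" where "\<delta> \<kappa> = F (0, rscale m \<kappa>)"

lemma F_shift: assumes p: "(\<alpha>, l) \<in> a.\<Lambda>" shows "F (\<alpha>, l + rscale m \<kappa>) = F (\<alpha>, l) + \<delta> \<kappa>"
  using F_add[OF p a.\<Lambda>_shift[of \<kappa>]] by (simp add: \<delta>_def)

lemma F_shift_hom:
  assumes "\<alpha> \<in> a.R" "x \<in> a.W \<alpha>" "x \<in> a.G l" "x \<noteq> 0"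
  shows "F (\<alpha>, l + rscale m \<kappa>) = F (\<alpha>, l) + \<delta> \<kappa>"
  by (rule F_shift, rule a.\<Lambda>_base) (use assms a.R_Q in auto)

lemma \<delta>_add: "\<delta> (\<kappa> + \<kappa>') = \<delta> \<kappa> + \<delta> \<kappa>'"
  using F_add[OF a.\<Lambda>_shift[of \<kappa>] a.\<Lambda>_shift[of \<kappa>']] by (simp add: \<delta>_def rscale_add)

lemma hom_preimage:
  assumes y: "y \<in> b.G \<mu>"
  shows "\<exists>J x. finite J \<and> (\<forall>p\<in>J. fst p \<in> a.R \<and> x p \<in> a.W (fst p) \<and> x p \<in> a.G (snd p) \<and> x p \<noteq> 0 \<and> F p = \<mu>) \<and>
    single \<mu> y = \<phi> (\<Sum>p\<in>J. single (snd p) (x p))"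
proof -
  define f where "f = \<phi>i (single \<mu> y)"
  have f: "f \<in> a.L" unfolding f_def by (rule \<phi>i_L[OF b.L_single[OF y]])
  define x where "x p = a.pr (fst p) (f (snd p))" for p
  define J0 where "J0 = {p \<in> a.R \<times> {l. f l \<noteq> 0}. x p \<noteq> 0}"
  have fJ0: "finite J0" and f_eq: "f = (\<Sum>p\<in>J0. single (snd p) (x p))"
    unfolding J0_def x_def by (rule a.L_pairs_decomp(1)[OF f], rule a.L_pairs_decomp(2)[OF f])
  have xJ: "fst p \<in> a.R \<and> x p \<in> a.W (fst p) \<and> x p \<in> a.G (snd p) \<and> x p \<noteq> 0" if "p \<in> J0" for p
    using that a.pr_W[of "fst p"] a.pr_G[OF a.L_G[OF f], of "fst p" "snd p"] by (auto simp: J0_def x_def)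
  have "\<exists>y. \<phi> (single (snd p) (x p)) = single (F p) y" if p: "p \<in> J0" for p
    using \<phi>_hom[of "fst p" "x p" "snd p"] xJ[OF p] by auto
  then have "\<forall>p\<in>J0. \<exists>y. \<phi> (single (snd p) (x p)) = single (F p) y" by blast
  from bchoice[OF this] obtain Y where Y: "\<forall>p\<in>J0. \<phi> (single (snd p) (x p)) = single (F p) (Y p)" ..
  have xL: "single (snd p) (x p) \<in> a.L" if "p \<in> J0" for p using xJ[OF that] by (intro a.L_single) blast
  have "single \<mu> y = \<phi> f" unfolding f_def by (rule inv2[OF b.L_single[OF y], symmetric])
  also have "\<dots> = (\<Sum>p\<in>J0. \<phi> (single (snd p) (x p)))" by (subst f_eq) (rule \<phi>_sum[OF xL])
  also have "\<dots> = (\<Sum>p\<in>J0. single (F p) (Y p))" by (rule sum.cong[OF refl]) (use Y in blast)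
  finally have e: "single \<mu> y = (\<Sum>p\<in>J0. single (F p) (Y p))" .
  define J where "J = {p \<in> J0. F p = \<mu>}"
  have "y = single \<mu> y \<mu>" by (simp add: single_apply)
  also have "\<dots> = (\<Sum>p\<in>J0. single (F p) (Y p) \<mu>)" unfolding e by (rule sum_apply)
  also have "\<dots> = (\<Sum>p\<in>J. Y p)"
    unfolding J_def using fJ0 by (simp add: single_apply sum.inter_filter eq_commute[of \<mu>])
  finally have y_eq: "y = (\<Sum>p\<in>J. Y p)" .
  have "single \<mu> y = (\<Sum>p\<in>J. single \<mu> (Y p))" by (subst y_eq) (rule single_sum)
  also have "\<dots> = (\<Sum>p\<in>J. \<phi> (single (snd p) (x p)))" by (rule sum.cong[OF refl]) (use Y in \<open>auto simp: J_def\<close>)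
  also have "\<dots> = \<phi> (\<Sum>p\<in>J. single (snd p) (x p))" by (rule \<phi>_sum[symmetric]) (use xL in \<open>auto simp: J_def\<close>)
  finally have fin: "single \<mu> y = \<phi> (\<Sum>p\<in>J. single (snd p) (x p))" .
  show ?thesis
  proof (intro exI[of _ J] exI[of _ x] conjI)
    show "finite J" using fJ0 by (simp add: J_def)
    show "\<forall>p\<in>J. fst p \<in> a.R \<and> x p \<in> a.W (fst p) \<and> x p \<in> a.G (snd p) \<and> x p \<noteq> 0 \<and> F p = \<mu>"
      using xJ by (auto simp: J_def)
  qed (rule fin)
qed

text \<open>Shifting by m \<kappa> moves the F-degree of every component by the same \<delta>
  \<kappa>, so the transported shift is homogeneous although the preimages need not be.\<close>

lemma transported_shift_hom:
  assumes y: "y \<in> b.G \<mu>"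
  shows "\<exists>y'. \<phi> (a.shift \<kappa> (\<phi>i (single \<mu> y))) = single (\<mu> + \<delta> \<kappa>) y'"
proof -
  obtain J x where fJ: "finite J"
    and J: "\<forall>p\<in>J. fst p \<in> a.R \<and> x p \<in> a.W (fst p) \<and> x p \<in> a.G (snd p) \<and> x p \<noteq> 0 \<and> F p = \<mu>"
    and e: "single \<mu> y = \<phi> (\<Sum>p\<in>J. single (snd p) (x p))" using hom_preimage[OF y] by (elim exE conjE)
  have xL: "single (snd p) (x p) \<in> a.L" if "p \<in> J" for p using J that by (intro a.L_single) blast
  have xL': "single (snd p + rscale m \<kappa>) (x p) \<in> a.L" if "p \<in> J" for p
    using J that by (intro a.L_single) (simp add: a.G_shift)
  have "\<exists>y. \<phi> (single (snd p + rscale m \<kappa>) (x p)) = single (\<mu> + \<delta> \<kappa>) y" if p: "p \<in> J" for p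
  proof -
    have "F (fst p, snd p + rscale m \<kappa>) = \<mu> + \<delta> \<kappa>" using J p F_shift_hom[of "fst p" "x p" "snd p" \<kappa>] by auto
    then show ?thesis
      using \<phi>_hom[of "fst p" "x p" "snd p + rscale m \<kappa>"] J p by (auto simp: a.G_shift)
  qed
  then have "\<forall>p\<in>J. \<exists>y. \<phi> (single (snd p + rscale m \<kappa>) (x p)) = single (\<mu> + \<delta> \<kappa>) y" by blast
  from bchoice[OF this] obtain Y where
    Y: "\<forall>p\<in>J. \<phi> (single (snd p + rscale m \<kappa>) (x p)) = single (\<mu> + \<delta> \<kappa>) (Y p)" ..
  have "\<phi>i (single \<mu> y) = (\<Sum>p\<in>J. single (snd p) (x p))" unfolding e by (rule inv1, rule a.L_sum, rule xL)
  then have "a.shift \<kappa> (\<phi>i (single \<mu> y)) = (\<Sum>p\<in>J. a.shift \<kappa> (single (snd p) (x p)))"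
    using a.centr_sum[OF a.centr_shift xL] by simp
  also have "\<dots> = (\<Sum>p\<in>J. single (snd p + rscale m \<kappa>) (x p))" by (simp only: a.shift_single)
  finally have "\<phi> (a.shift \<kappa> (\<phi>i (single \<mu> y))) = (\<Sum>p\<in>J. \<phi> (single (snd p + rscale m \<kappa>) (x p)))"
    using \<phi>_sum[OF xL'] by simp
  also have "\<dots> = (\<Sum>p\<in>J. single (\<mu> + \<delta> \<kappa>) (Y p))" by (rule sum.cong[OF refl]) (use Y in blast)
  also have "\<dots> = single (\<mu> + \<delta> \<kappa>) (\<Sum>p\<in>J. Y p)" by (rule single_sum[symmetric])
  finally show ?thesis by (rule exI)
qed

lemma transported_shift:
  "\<exists>c \<nu>. c \<noteq> 0 \<and> \<delta> \<kappa> = rscale m' \<nu> \<and>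
     (\<forall>\<mu>. \<forall>y\<in>b.G \<mu>. \<phi> (a.shift \<kappa> (\<phi>i (single \<mu> y))) = single (\<mu> + \<delta> \<kappa>) (sc' c y))"
  by (rule b.centr_homogeneous[OF centr_transport[OF a.centr_shift]]) (rule transported_shift_hom)

text \<open>The transported shift by m \<kappa> is the shift by m' (Nu \<kappa>) times the scalar
  \<open>cc \<kappa>\<close>.\<close>

definition cc :: "int^'n \<Rightarrow> 'k" where
  "cc \<kappa> = (SOME c. \<exists>\<nu>. c \<noteq> 0 \<and> \<delta> \<kappa> = rscale m' \<nu> \<and>
     (\<forall>\<mu>. \<forall>y\<in>b.G \<mu>. \<phi> (a.shift \<kappa> (\<phi>i (single \<mu> y))) = single (\<mu> + \<delta> \<kappa>) (sc' c y)))"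

definition Nu :: "int^'n \<Rightarrow> int^'n" where "Nu \<kappa> = (SOME \<nu>. \<delta> \<kappa> = rscale m' \<nu>)"

lemma cc_nonzero: "cc \<kappa> \<noteq> 0"
  and U_single: "y \<in> b.G \<mu> \<Longrightarrow> \<phi> (a.shift \<kappa> (\<phi>i (single \<mu> y))) = single (\<mu> + \<delta> \<kappa>) (sc' (cc \<kappa>) y)"
proof -
  from someI_ex[OF transported_shift[of \<kappa>]] obtain \<nu> where
    "cc \<kappa> \<noteq> 0 \<and> \<delta> \<kappa> = rscale m' \<nu> \<and>
     (\<forall>\<mu>. \<forall>y\<in>b.G \<mu>. \<phi> (a.shift \<kappa> (\<phi>i (single \<mu> y))) = single (\<mu> + \<delta> \<kappa>) (sc' (cc \<kappa>) y))"
    unfolding cc_def[symmetric] ..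
  then show "cc \<kappa> \<noteq> 0"
    and "y \<in> b.G \<mu> \<Longrightarrow> \<phi> (a.shift \<kappa> (\<phi>i (single \<mu> y))) = single (\<mu> + \<delta> \<kappa>) (sc' (cc \<kappa>) y)"
    by simp_all
qed

lemma \<delta>_Nu: "\<delta> \<kappa> = rscale m' (Nu \<kappa>)"
proof -
  have "\<exists>\<nu>. \<delta> \<kappa> = rscale m' \<nu>" using transported_shift[of \<kappa>] by (elim exE conjE) (rule exI)
  then show ?thesis unfolding Nu_def by (rule someI_ex)
qed

lemma Nu_add: "Nu (\<kappa> + \<kappa>') = Nu \<kappa> + Nu \<kappa>'"
  using \<delta>_add[of \<kappa> \<kappa>'] by (simp add: \<delta>_Nu rscale_add[symmetric] rscale_inj[of m', OF b.\<sigma>_order(1)])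

lemma \<phi>_shift_single:
  assumes x: "x \<in> a.G l" and y: "y \<in> b.G \<mu>" and e: "\<phi> (single l x) = single \<mu> y"
  shows "\<phi> (single (l + rscale m \<kappa>) x) = single (\<mu> + \<delta> \<kappa>) (sc' (cc \<kappa>) y)"
proof -
  have "\<phi>i (single \<mu> y) = single l x" unfolding e[symmetric] by (rule inv1[OF a.L_single[OF x]])
  then show ?thesis using U_single[OF y, of \<kappa>] by (simp add: a.shift_single)
qed

lemma nonzero_image:
  obtains \<alpha> l x y where "\<alpha> \<in> a.R" "x \<in> a.W \<alpha>" "x \<in> a.G l" "x \<noteq> 0" "y \<in> b.G (F (\<alpha>, l))"
    "\<phi> (single l x) = single (F (\<alpha>, l)) y" "y \<noteq> 0"
proof -
  obtain \<alpha> l x where x: "\<alpha> \<in> a.R" "x \<in> a.W \<alpha>" "x \<in> a.G l" "x \<noteq> 0" using a.nonzero_hom by blast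
  obtain y where y: "y \<in> b.G (F (\<alpha>, l))" "\<phi> (single l x) = single (F (\<alpha>, l)) y" using \<phi>_hom[OF x] by blast
  have "y \<noteq> 0"
  proof
    assume "y = 0"
    then have "single l x = 0" using \<phi>_inj[OF a.L_single[OF x(3)]] y(2) by simp
    then show False using x(4) by simp
  qed
  then show thesis using that x y by blast
qed

lemma cc_mult: "cc (\<kappa> + \<kappa>') = cc \<kappa> * cc \<kappa>'"
proof -
  obtain \<alpha> l x y where x: "x \<in> a.G l" and y: "y \<in> b.G (F (\<alpha>, l))"
    and e: "\<phi> (single l x) = single (F (\<alpha>, l)) y" and y0: "y \<noteq> 0" by (rule nonzero_image)
  have x': "x \<in> a.G (l + rscale m \<kappa>)" using x by (simp add: a.G_shift)
  have y': "sc' (cc \<kappa>) y \<in> b.G (F (\<alpha>, l) + \<delta> \<kappa>)"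
    unfolding \<delta>_Nu b.G_shift by (rule b.subspace_scale[OF b.subspace_G y])
  have "single (F (\<alpha>, l) + \<delta> (\<kappa> + \<kappa>')) (sc' (cc (\<kappa> + \<kappa>')) y) = \<phi> (single (l + rscale m (\<kappa> + \<kappa>')) x)"
    by (rule \<phi>_shift_single[OF x y e, symmetric])
  also have "\<dots> = \<phi> (single (l + rscale m \<kappa> + rscale m \<kappa>') x)" by (simp add: rscale_add add.assoc)
  also have "\<dots> = single (F (\<alpha>, l) + \<delta> \<kappa> + \<delta> \<kappa>') (sc' (cc \<kappa>') (sc' (cc \<kappa>) y))"
    by (rule \<phi>_shift_single[OF x' y' \<phi>_shift_single[OF x y e]])
  finally have "sc' (cc (\<kappa> + \<kappa>')) y = sc' (cc \<kappa>') (sc' (cc \<kappa>) y)" by (simp only: single_eq_iff)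
  then have "sc' (cc (\<kappa> + \<kappa>')) y = sc' (cc \<kappa> * cc \<kappa>') y" by (simp add: mult.commute)
  then show ?thesis by (rule b.scale_right_imp_eq[OF y0])
qed

text \<open>If Nu \<kappa> = 0, the transported shift is a scalar, so shifting by m \<kappa> keeps
  degrees and \<kappa> = 0.\<close>

lemma Nu_inj: assumes "Nu \<kappa> = 0" shows "\<kappa> = 0"
proof -
  obtain \<alpha> l x y where x: "x \<in> a.G l" and x0: "x \<noteq> 0" and y: "y \<in> b.G (F (\<alpha>, l))"
    and e: "\<phi> (single l x) = single (F (\<alpha>, l)) y" by (rule nonzero_image)
  have x': "x \<in> a.G (l + rscale m \<kappa>)" using x by (simp add: a.G_shift)
  have s: "lsc sc' c (single \<mu> y) = single \<mu> (sc' c y)" for c \<mu> y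
    by (auto simp: lsc_def single_apply fun_eq_iff)
  have s': "lsc sc c (single l x) = single l (sc c x)" for c l x
    by (auto simp: lsc_def single_apply fun_eq_iff)
  have "\<phi> (single (l + rscale m \<kappa>) x) = single (F (\<alpha>, l)) (sc' (cc \<kappa>) y)"
    using \<phi>_shift_single[OF x y e, of \<kappa>] by (simp add: \<delta>_Nu assms rscale_0)
  also have "\<dots> = \<phi> (single l (sc (cc \<kappa>) x))"
    using \<phi>_sc[OF a.L_single[OF x], of "cc \<kappa>"] by (simp only: e s s')
  finally have "\<phi>i (\<phi> (single (l + rscale m \<kappa>) x)) = \<phi>i (\<phi> (single l (sc (cc \<kappa>) x)))" by simp
  then have "single (l + rscale m \<kappa>) x = single l (sc (cc \<kappa>) x)"
    using inv1[OF a.L_single[OF x']] inv1[OF a.L_single[OF a.subspace_scale[OF a.subspace_G x]]] by simp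
  then have "rscale m \<kappa> = 0" using x0 by (simp add: single_eq_iff)
  then show ?thesis by (simp add: rscale_eq_0[of m, OF a.\<sigma>_order(1)])
qed

context
  fixes A :: "rat^'n^'n" and s :: "('v \<Rightarrow> 'k) \<Rightarrow> rat^'n"
  assumes s: "group_hom_on a.Q s"
    and A: "\<And>\<alpha> l. (\<alpha>, l) \<in> a.\<Lambda> \<Longrightarrow> rv (F (\<alpha>, l)) = A *v rv l - s \<alpha>"
begin

lemma s_0: "s 0 = 0"
  using group_hom_on_0 s unfolding root_lattice_def by blast

lemma A_shift: "A *v rv (rscale m \<kappa>) = rv (rscale m' (Nu \<kappa>))"
  using A[OF a.\<Lambda>_shift[of \<kappa>]] s_0 \<delta>_Nu[of \<kappa>] by (simp add: \<delta>_def)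

text \<open>A suitable multiple of d lies in m Z^n, where A is given by the injective map
  Nu.\<close>

lemma A_inj: assumes d: "A *v rv d = 0" shows "d = 0"
proof -
  define M where "M = (\<Prod>i\<in>UNIV. m i)"
  have M0: "0 < M" unfolding M_def using a.\<sigma>_order(1) by (simp add: prod_pos)
  define \<kappa> where "\<kappa> = rscale (\<lambda>i. M div m i) d"
  have "int (m i) * int (M div m i) = int M" for i
  proof -
    have "m i dvd M" unfolding M_def by (rule dvd_prodI) simp_all
    then have "m i * (M div m i) = M" by simp
    then show ?thesis by (metis of_nat_mult)
  qed
  then have "rscale m \<kappa> = rscale (\<lambda>_. M) d" by (simp add: vec_eq_iff \<kappa>_def mult.assoc[symmetric])
  moreover have "A *v rv (rscale (\<lambda>_. M) d) = of_nat M *s (A *v rv d)"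
    by (simp add: vec_eq_iff matrix_vector_mult_def sum_distrib_left mult.left_commute)
  ultimately have "rv (rscale m' (Nu \<kappa>)) = 0" using A_shift[of \<kappa>] d by simp
  then have "rscale m' (Nu \<kappa>) = 0" by (metis rv_0 rv_inj)
  then have "Nu \<kappa> = 0" by (simp add: rscale_eq_0[of m', OF b.\<sigma>_order(1)])
  then have "rscale m \<kappa> = 0" using Nu_inj[OF \<open>Nu \<kappa> = 0\<close>] by (simp add: rscale_0)
  then have "rscale (\<lambda>_. M) d = 0" using \<open>rscale m \<kappa> = rscale (\<lambda>_. M) d\<close> by simp
  then show ?thesis using M0 by (simp add: rscale_eq_0)
qed

text \<open>The shift by m' \<nu>, pulled back to the first algebra, is again centroidal and thus
  preserves the weight \<alpha>. Its value has a priori several degrees k, but \<phi> takes each of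
  them to F (\<alpha>, k), and the image is concentrated in one degree.\<close>

lemma inverse_shift_support:
  assumes \<alpha>: "\<alpha> \<in> a.R" and x: "x \<in> a.W \<alpha>" "x \<in> a.G l" "x \<noteq> 0"
    and k: "\<phi>i (b.shift \<nu> (\<phi> (single l x))) k \<noteq> 0"
  shows "A *v rv (k - l) = rv (rscale m' \<nu>)"
proof -
  interpret s: loop_pair sc' br' \<sigma>' m' sc br \<sigma> m z \<phi>i \<phi> by (rule swap)
  define V where "V f = \<phi>i (b.shift \<nu> (\<phi> f))" for f
  have V: "a.centr V" unfolding V_def by (rule s.centr_transport[OF b.centr_shift])
  define g where "g = V (single l x)"
  have gL: "g \<in> a.L" unfolding g_def by (rule a.centr_L[OF V a.L_single[OF x(2)]])
  \<comment> \<open>A centroidal map commutes with the bracket by h \<otimes> 1, whose eigenvalue on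
    x \<otimes> t^l is \<alpha> h.\<close>
  have gW: "g k \<in> a.W \<alpha>" for k
    unfolding wspace_def
  proof (intro CollectI ballI)
    fix h assume h: "h \<in> H"
    have hG: "h \<in> a.G 0" using h a.H_S by (auto simp: a.G_zero)
    have bx: "br h x = sc (\<alpha> h) x" using x(1) h by (simp add: wspace_def)
    have e: "a.lb (single 0 h) (single l x) = lsc sc (\<alpha> h) (single l x)"
      by (auto simp: a.lb_single bx lsc_def single_apply fun_eq_iff)
    have "a.lb (single 0 h) g = V (a.lb (single 0 h) (single l x))"
      unfolding g_def by (rule a.centr_right[OF V a.L_single[OF hG] a.L_single[OF x(2)], symmetric])
    also have "\<dots> = lsc sc (\<alpha> h) g" unfolding e g_def by (rule a.centr_sc[OF V a.L_single[OF x(2)]])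
    finally have "a.lb (single 0 h) g k = sc (\<alpha> h) (g k)" by (simp add: lsc_def)
    moreover have "a.lb (single 0 h) g k = (\<Sum>j\<in>{0}. br (single 0 h j) (g (k - j)))"
      by (rule a.lb_eq) (auto simp: single_apply)
    ultimately show "br h (g k) = sc (\<alpha> h) (g k)" by (simp add: single_apply)
  qed
  have \<Lambda>: "(\<alpha>, k) \<in> a.\<Lambda>" if "g k \<noteq> 0" for k
    using a.\<Lambda>_base[OF _ gW a.L_G[OF gL] that] \<alpha> a.R_Q by blast
  have "\<exists>y. y \<noteq> 0 \<and> \<phi> (single k (g k)) = single (F (\<alpha>, k)) y" if k: "g k \<noteq> 0" for k
  proof -
    obtain y where y: "\<phi> (single k (g k)) = single (F (\<alpha>, k)) y" using \<phi>_hom[OF \<alpha> gW a.L_G[OF gL] k] by blast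
    have "y \<noteq> 0"
    proof
      assume "y = 0"
      then have "single k (g k) = 0" using \<phi>_inj[OF a.L_single[OF a.L_G[OF gL]]] y by simp
      then show False using k by simp
    qed
    then show ?thesis using y by blast
  qed
  then have "\<forall>k\<in>{k. g k \<noteq> 0}. \<exists>y. y \<noteq> 0 \<and> \<phi> (single k (g k)) = single (F (\<alpha>, k)) y" by blast
  from bchoice[OF this] obtain Y where
    Y: "\<forall>k\<in>{k. g k \<noteq> 0}. Y k \<noteq> 0 \<and> \<phi> (single k (g k)) = single (F (\<alpha>, k)) (Y k)" ..
  obtain y where y: "\<phi> (single l x) = single (F (\<alpha>, l)) y" using \<phi>_hom[OF \<alpha> x] by blast
  have "\<phi> g = b.shift \<nu> (\<phi> (single l x))"
    unfolding g_def V_def by (rule inv2[OF b.shift_L[OF \<phi>_L[OF a.L_single[OF x(2)]]]])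
  also have "\<dots> = single (F (\<alpha>, l) + rscale m' \<nu>) y" unfolding y by (rule b.shift_single)
  finally have \<phi>g: "\<phi> g = single (F (\<alpha>, l) + rscale m' \<nu>) y" .
  have "\<phi> g = \<phi> (\<Sum>k\<in>{k. g k \<noteq> 0}. single k (g k))" by (simp only: a.L_decomp[OF gL])
  also have "\<dots> = (\<Sum>k\<in>{k. g k \<noteq> 0}. \<phi> (single k (g k)))"
    by (rule \<phi>_sum) (rule a.L_single[OF a.L_G[OF gL]])
  also have "\<dots> = (\<Sum>k\<in>{k. g k \<noteq> 0}. single (F (\<alpha>, k)) (Y k))" by (rule sum.cong[OF refl]) (use Y in blast)
  finally have \<phi>g': "\<phi> g = (\<Sum>k\<in>{k. g k \<noteq> 0}. single (F (\<alpha>, k)) (Y k))" .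
  have gk: "g k \<noteq> 0" using k by (simp add: g_def V_def)
  \<comment> \<open>For a fixed weight, F separates degrees, so terms of different degree cannot
    cancel in \<phi> g.\<close>
  have inj: "F (\<alpha>, k') = F (\<alpha>, k) \<longleftrightarrow> k' = k" if k': "g k' \<noteq> 0" for k'
  proof
    assume "F (\<alpha>, k') = F (\<alpha>, k)"
    then have "A *v rv (k' - k) = 0"
      using A[OF \<Lambda>[OF k']] A[OF \<Lambda>[OF gk]] by (simp add: rv_diff matrix_vector_mult_diff_distrib)
    then have "k' - k = 0" by (rule A_inj)
    then show "k' = k" by simp
  qed simp
  have "\<phi> g (F (\<alpha>, k)) = (\<Sum>k'\<in>{k. g k \<noteq> 0}. single (F (\<alpha>, k')) (Y k') (F (\<alpha>, k)))"
    unfolding \<phi>g' by (rule sum_apply)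
  also have "\<dots> = (\<Sum>k'\<in>{k. g k \<noteq> 0}. if k' = k then Y k' else 0)"
    by (rule sum.cong[OF refl]) (simp add: single_apply inj eq_commute[of "F (\<alpha>, k)"])
  also have "\<dots> = Y k" using gL gk by (simp add: a.L_iff)
  finally have "\<phi> g (F (\<alpha>, k)) \<noteq> 0" using Y gk by simp
  then have "F (\<alpha>, k) = F (\<alpha>, l) + rscale m' \<nu>" unfolding \<phi>g by (simp add: single_apply split: if_splits)
  then have "rv (F (\<alpha>, k)) = rv (F (\<alpha>, l)) + rv (rscale m' \<nu>)" by (simp add: rv_add)
  moreover have "(\<alpha>, l) \<in> a.\<Lambda>" using a.\<Lambda>_base[OF _ x] \<alpha> a.R_Q by blast
  ultimately show ?thesis
    using A[OF \<Lambda>[OF gk]] A[of \<alpha> l] by (simp add: rv_diff matrix_vector_mult_diff_distrib algebra_simps)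
qed

text \<open>All degree changes k - l of the pulled-back shift have the same image m' \<nu> under A,
  so injectivity of A makes it homogeneous of one degree \<eta>. The centroid theorem then puts
  \<eta> in m Z^n, and the corresponding \<kappa> is mapped to \<nu>.\<close>

lemma Nu_surj: "\<exists>\<kappa>. Nu \<kappa> = \<nu>"
proof -
  interpret s: loop_pair sc' br' \<sigma>' m' sc br \<sigma> m z \<phi>i \<phi> by (rule swap)
  define V where "V f = \<phi>i (b.shift \<nu> (\<phi> f))" for f
  have V: "a.centr V" unfolding V_def by (rule s.centr_transport[OF b.centr_shift])
  obtain \<alpha>0 l0 x0 where x0: "\<alpha>0 \<in> a.R" "x0 \<in> a.W \<alpha>0" "x0 \<in> a.G l0" "x0 \<noteq> 0" using a.nonzero_hom by blast
  have "V (single l0 x0) \<noteq> 0" using a.centr_inj[OF V a.L_single[OF x0(3)]] x0(4) by auto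
  then obtain k0 where k0: "V (single l0 x0) k0 \<noteq> 0" by (metis ext zero_fun_apply)
  define \<eta> where "\<eta> = k0 - l0"
  have \<eta>: "A *v rv \<eta> = rv (rscale m' \<nu>)"
    using inverse_shift_support[OF x0] k0 by (simp add: V_def \<eta>_def)
  have hom1: "\<exists>y. V (single l x) = single (l + \<eta>) y" if \<alpha>: "\<alpha> \<in> a.R" and x: "x \<in> a.W \<alpha>" "x \<in> a.G l" for \<alpha> l x
  proof (cases "x = 0")
    case True
    have "V 0 = 0" using a.centr_sum[OF V, of "{}" "\<lambda>_. 0"] by simp
    then show ?thesis using True by (intro exI[of _ 0]) simp
  next
    case False
    have "V (single l x) k = 0" if "k \<noteq> l + \<eta>" for k
    proof (rule ccontr)
      assume "V (single l x) k \<noteq> 0"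
      then have "A *v rv (k - l) = rv (rscale m' \<nu>)" unfolding V_def by (rule inverse_shift_support[OF \<alpha> x False])
      then have "A *v rv (k - l - \<eta>) = 0" using \<eta> by (simp add: rv_diff matrix_vector_mult_diff_distrib)
      then have "k - l - \<eta> = 0" by (rule A_inj)
      then show False using that by (simp add: algebra_simps)
    qed
    then have "V (single l x) = single (l + \<eta>) (V (single l x) (l + \<eta>))" by (auto simp: fun_eq_iff single_apply)
    then show ?thesis by (rule exI)
  qed
  have hom: "\<exists>y. V (single l x) = single (l + \<eta>) y" if x: "x \<in> a.G l" for l x
  proof -
    have "\<forall>\<alpha>\<in>a.R. \<exists>y. V (single l (a.pr \<alpha> x)) = single (l + \<eta>) y"
      using hom1 a.pr_W a.pr_G[OF x] by blast
    from bchoice[OF this] obtain Y where Y: "\<forall>\<alpha>\<in>a.R. V (single l (a.pr \<alpha> x)) = single (l + \<eta>) (Y \<alpha>)" ..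
    have "single l x = (\<Sum>\<alpha>\<in>a.R. single l (a.pr \<alpha> x))" by (simp only: single_sum[symmetric] a.pr_sum)
    then have "V (single l x) = (\<Sum>\<alpha>\<in>a.R. V (single l (a.pr \<alpha> x)))"
      using a.centr_sum[OF V, of a.R "\<lambda>\<alpha>. single l (a.pr \<alpha> x)"] a.L_single[OF a.pr_G[OF x]] by simp
    also have "\<dots> = (\<Sum>\<alpha>\<in>a.R. single (l + \<eta>) (Y \<alpha>))" by (rule sum.cong[OF refl]) (use Y in blast)
    also have "\<dots> = single (l + \<eta>) (\<Sum>\<alpha>\<in>a.R. Y \<alpha>)" by (rule single_sum[symmetric])
    finally show ?thesis by (rule exI)
  qed
  have "\<exists>c \<kappa>. c \<noteq> 0 \<and> \<eta> = rscale m \<kappa> \<and> (\<forall>l. \<forall>x\<in>a.G l. V (single l x) = single (l + \<eta>) (sc c x))"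
    by (rule a.centr_homogeneous[OF V]) (rule hom)
  then obtain \<kappa> where "\<eta> = rscale m \<kappa>" by (elim exE conjE)
  then have "rv (rscale m' (Nu \<kappa>)) = rv (rscale m' \<nu>)" using \<eta> A_shift by simp
  then have "Nu \<kappa> = \<nu>" by (simp add: rv_inj rscale_inj[of m', OF b.\<sigma>_order(1)])
  then show ?thesis by (rule exI)
qed

end

end

section \<open>Twisted tuples\<close>

context multiloop
begin

lemma hom_induct [case_names zero add hom]:
  assumes z: "Pr 0" and a: "\<And>x y. Pr x \<Longrightarrow> Pr y \<Longrightarrow> Pr (x + y)"
    and h: "\<And>\<alpha> l x. \<alpha> \<in> R \<Longrightarrow> x \<in> W \<alpha> \<Longrightarrow> x \<in> G l \<Longrightarrow> Pr x"
  shows "Pr x"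
proof -
  have s: "Pr (sum f A)" if "\<And>a. a \<in> A \<Longrightarrow> Pr (f a)" for f and A :: "'x set"
    using that by (induction A rule: infinite_finite_induct) (auto intro!: z a)
  have 1: "Pr y" if "y \<in> G l" for y l
  proof -
    have "Pr (\<Sum>\<alpha>\<in>R. pr \<alpha> y)" by (rule s, rule h, assumption, erule pr_W, erule pr_G[OF that])
    then show ?thesis by (simp only: pr_sum)
  qed
  have "Pr (\<Sum>l\<in>Box. prG l x)" by (rule s, rule 1, erule prG_G)
  then show ?thesis by (simp only: prG_sum)
qed

text \<open>The twisted automorphisms \<open>\<tau>\<^sub>i\<sigma>\<^sub>i\<close> of condition (b).\<close>

definition twist :: "(('v \<Rightarrow> 'k) \<Rightarrow> rat^'n) \<Rightarrow> ('n \<Rightarrow> 'v \<Rightarrow> 'v) \<Rightarrow> bool" where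
  "twist s \<tau> \<longleftrightarrow> (\<forall>i x y. \<tau> i (x + y) = \<tau> i x + \<tau> i y) \<and> (\<forall>i c x. \<tau> i (sc c x) = sc c (\<tau> i x)) \<and>
     (\<forall>i. \<forall>\<alpha>\<in>Q. \<forall>x\<in>W \<alpha>. \<tau> i x = sc (zpow z (- (s \<alpha> $ i))) x)"

lemma twist_exists: "\<exists>\<tau>. twist s \<tau>"
proof -
  have "\<forall>i. \<exists>T. lin T \<and> (\<forall>\<alpha>\<in>R. \<forall>x\<in>W \<alpha>. T x = sc (zpow z (- (s \<alpha> $ i))) x)"
    by (intro allI diag_map[OF subspace_W R_span R_indep])
  from choice[OF this] obtain \<tau> where
    \<tau>: "\<And>i. lin (\<tau> i)" "\<And>i \<alpha> x. \<alpha> \<in> R \<Longrightarrow> x \<in> W \<alpha> \<Longrightarrow> \<tau> i x = sc (zpow z (- (s \<alpha> $ i))) x" by blast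
  have "\<tau> i x = sc (zpow z (- (s \<alpha> $ i))) x" if "\<alpha> \<in> Q" "x \<in> W \<alpha>" for i \<alpha> x
  proof (cases "x = 0")
    case True
    then show ?thesis by (simp add: lin_0[OF \<tau>(1)])
  qed (use Q_W that \<tau>(2) in blast)
  then have "twist s \<tau>" unfolding twist_def by (simp add: lin_add[OF \<tau>(1)] lin_sc[OF \<tau>(1)])
  then show ?thesis by (rule exI[of _ \<tau>])
qed

context
  fixes s \<tau> assumes tw: "twist s \<tau>"
begin

lemma twist_lin: "lin (\<tau> i \<circ> \<sigma> i)"
proof -
  have "lin (\<tau> i)" by (rule linI) (use tw in \<open>simp_all add: twist_def\<close>)
  then show ?thesis using lin_comp[OF _ \<sigma>_lin] by (simp add: o_def)
qed

lemma twist_eigen: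
  assumes "\<alpha> \<in> R" "x \<in> W \<alpha>" "x \<in> G l"
  shows "(\<tau> i \<circ> \<sigma> i) x = sc (zpow z (of_int (l $ i) / of_nat (m i) - s \<alpha> $ i)) x"
proof -
  have "\<tau> i x = sc (zpow z (- (s \<alpha> $ i))) x" using tw assms R_Q unfolding twist_def by blast
  moreover have "\<tau> i (sc c x) = sc c (\<tau> i x)" for c using tw unfolding twist_def by blast
  moreover have "\<sigma> i x = sc (zpow z (of_int (l $ i) / of_nat (m i))) x" using assms(3) G_iff by blast
  ultimately show ?thesis
    using zpow_add[OF z, of "of_int (l $ i) / of_nat (m i)" "- (s \<alpha> $ i)"] by simp
qed

text \<open>Bijectivity matters because negative entries of the matrix call for inverses in
  \<open>fpow\<close>.\<close>

lemma twist_surj: "surj (\<tau> i \<circ> \<sigma> i)"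
proof -
  have "\<exists>y. (\<tau> i \<circ> \<sigma> i) y = x" for x
  proof (induction x rule: hom_induct)
    case zero
    show ?case by (rule exI[of _ 0], rule lin_0[OF twist_lin])
  next
    case (add x y)
    then obtain x' y' where "(\<tau> i \<circ> \<sigma> i) x' = x" "(\<tau> i \<circ> \<sigma> i) y' = y" by (elim exE)
    then have "(\<tau> i \<circ> \<sigma> i) (x' + y') = x + y" by (simp only: lin_add[OF twist_lin])
    then show ?case by (rule exI)
  next
    case (hom \<alpha> l x)
    let ?c = "zpow z (of_int (l $ i) / of_nat (m i) - s \<alpha> $ i)"
    have "(\<tau> i \<circ> \<sigma> i) (sc (inverse ?c) x) = sc (inverse ?c) (sc ?c x)"
      by (simp only: lin_sc[OF twist_lin] twist_eigen[OF hom])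
    also have "\<dots> = x" using zpow_nonzero[OF z] by simp
    finally show ?case by (rule exI)
  qed
  then show ?thesis unfolding surj_def by metis
qed

lemma twist_bij: "bij (\<tau> i \<circ> \<sigma> i)"
  using twist_surj linear_surj_imp_inj[OF twist_lin] by (simp add: bij_def)

lemma twist_comm: "(\<tau> i \<circ> \<sigma> i) ((\<tau> j \<circ> \<sigma> j) x) = (\<tau> j \<circ> \<sigma> j) ((\<tau> i \<circ> \<sigma> i) x)"
proof (induction x rule: hom_induct)
  case (hom \<alpha> l x)
  show ?case by (simp only: twist_eigen[OF hom] lin_sc[OF twist_lin] scale_scale mult.commute)
qed (simp_all only: lin_0[OF twist_lin] lin_add[OF twist_lin])

lemma twist_pow_lin: "lin (tuple_pow (\<lambda>i. \<tau> i \<circ> \<sigma> i) Pw j)"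
  by (rule tuple_pow_lin) (rule twist_lin twist_bij twist_comm)+

lemma twist_pow_eigen:
  assumes "\<alpha> \<in> R" "x \<in> W \<alpha>" "x \<in> G l"
  shows "tuple_pow (\<lambda>i. \<tau> i \<circ> \<sigma> i) Pw j x =
    sc (zpow z (\<Sum>i\<in>UNIV. of_int (Pw $ i $ j) * (of_int (l $ i) / of_nat (m i) - s \<alpha> $ i))) x"
proof -
  have "tuple_pow (\<lambda>i. \<tau> i \<circ> \<sigma> i) Pw j x =
    sc (\<Prod>i\<in>UNIV. power_int (zpow z (of_int (l $ i) / of_nat (m i) - s \<alpha> $ i)) (Pw $ i $ j)) x"
    by (rule tuple_pow_eigen) (rule twist_lin twist_bij twist_comm zpow_nonzero[OF z] twist_eigen[OF assms])+
  then show ?thesis by (simp add: zpow_sum[OF z] zpow_of_int_mult[OF z])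
qed

end

end

section \<open>Evaluation at a point of the torus\<close>

context regraded_iso
begin

context
  fixes A :: "rat^'n^'n" and s :: "('v \<Rightarrow> 'k) \<Rightarrow> rat^'n"
  assumes s: "group_hom_on a.Q s"
    and A: "\<And>\<alpha> l. (\<alpha>, l) \<in> a.\<Lambda> \<Longrightarrow> rv (F (\<alpha>, l)) = A *v rv l - s \<alpha>"
begin

lemma Nu_bij: "bij Nu"
proof -
  have "\<kappa> = \<kappa>'" if "Nu \<kappa> = Nu \<kappa>'" for \<kappa> \<kappa>'
  proof -
    have "Nu (\<kappa> - \<kappa>') = 0" using Nu_add[of "\<kappa> - \<kappa>'" \<kappa>'] that by simp
    from Nu_inj[OF this] show ?thesis by simp
  qed
  then show ?thesis using Nu_surj[OF s A] by (metis bijI' )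
qed

definition Kap :: "int^'n \<Rightarrow> int^'n" where "Kap = inv Nu"

lemma Nu_Kap: "Nu (Kap \<nu>) = \<nu>" and Kap_Nu: "Kap (Nu \<kappa>) = \<kappa>"
  unfolding Kap_def using Nu_bij by (simp_all add: bij_is_surj surj_f_inv_f bij_is_inj)

lemma Kap_add: "Kap (\<nu> + \<nu>') = Kap \<nu> + Kap \<nu>'"
  using Nu_add[of "Kap \<nu>" "Kap \<nu>'"] Kap_Nu[of "Kap \<nu> + Kap \<nu>'"] by (simp add: Nu_Kap)

lemma coord_Nu_Kap: "coord_matrix Nu ** coord_matrix Kap = mat 1"
  and coord_Kap_Nu: "coord_matrix Kap ** coord_matrix Nu = mat 1"
  by (simp_all add: matrix_eq matrix_vector_mul_assoc[symmetric] coord_matrix_mult Nu_add Kap_add Nu_Kap Kap_Nu)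

text \<open>The transpose reflects the convention for \<open>tuple_pow\<close>, where column j of
  the matrix gives the exponents of the j-th new automorphism.\<close>

definition Pm :: "int^'n^'n" where "Pm = transpose (coord_matrix Nu)"

lemma GL_Pm: "GL_int Pm"
  unfolding GL_int_def Pm_def
  by (rule exI[of _ "transpose (coord_matrix Kap)"])
     (simp add: matrix_transpose_mul[symmetric] coord_Nu_Kap coord_Kap_Nu transpose_mat)

text \<open>In matrix form, A is the matrix of Nu conjugated by the periods: diag m' on the left and
  the inverse of diag m on the right.\<close>

lemma A_Pm: "A $ j $ i * of_nat (m i) = of_nat (m' j) * of_int (Pm $ i $ j)"
proof -
  have "(A *v rv (rscale m (axis i 1))) $ j = A $ j $ i * of_nat (m i)"
    by (simp add: matrix_vector_mult_def axis_def if_distrib cong: if_cong)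
  moreover have "rv (rscale m' (Nu (axis i 1))) $ j = of_nat (m' j) * of_int (Pm $ i $ j)"
    by (simp add: Pm_def transpose_def coord_matrix_def)
  ultimately show ?thesis using A_shift[OF s A, of "axis i 1"] by simp
qed

text \<open>The solution of transpose Pm applied to sb = s / m', so that twisting by sb before
  taking the matrix power produces the shift s in the degrees.\<close>

definition sb :: "('v \<Rightarrow> 'k) \<Rightarrow> rat^'n" where
  "sb \<alpha> = (\<chi> i. \<Sum>j\<in>UNIV. of_int (coord_matrix Kap $ i $ j) * (s \<alpha> $ j / of_nat (m' j)))"

lemma sb_hom: "group_hom_on a.Q sb"
  using s by (simp add: group_hom_on_def sb_def vec_eq_iff add_divide_distrib distrib_left sum.distrib)

lemma sb_Pm: "(\<Sum>i\<in>UNIV. of_int (Pm $ i $ j) * sb \<alpha> $ i) = s \<alpha> $ j / of_nat (m' j)"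
proof -
  let ?N = "coord_matrix Nu" and ?K = "coord_matrix Kap" and ?s = "\<lambda>k. s \<alpha> $ k / of_nat (m' k)"
  have "(\<Sum>i\<in>UNIV. of_int (Pm $ i $ j) * sb \<alpha> $ i) =
      (\<Sum>i\<in>UNIV. \<Sum>k\<in>UNIV. of_int (?N $ j $ i * ?K $ i $ k) * ?s k)"
    by (simp add: sb_def Pm_def transpose_def sum_distrib_left mult.assoc)
  also have "\<dots> = (\<Sum>k\<in>UNIV. \<Sum>i\<in>UNIV. of_int (?N $ j $ i * ?K $ i $ k) * ?s k)" by (rule sum.swap)
  also have "\<dots> = (\<Sum>k\<in>UNIV. of_int ((?N ** ?K) $ j $ k) * ?s k)"
    by (simp add: matrix_matrix_mult_def sum_distrib_right sum_divide_distrib)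
  also have "\<dots> = (\<Sum>k\<in>UNIV. if j = k then ?s k else 0)"
    by (rule sum.cong[OF refl]) (simp add: coord_Nu_Kap mat_def)
  also have "\<dots> = ?s j" by simp
  finally show ?thesis .
qed

text \<open>Both sides are exponents of eigenvalues, of \<sigma>' on the left and of the power of
  the twisted tuple on the right; this is where (b) gets its formula.\<close>

lemma degree_relation:
  assumes "(\<alpha>, l) \<in> a.\<Lambda>"
  shows "of_int (F (\<alpha>, l) $ j) / of_nat (m' j) =
    (\<Sum>i\<in>UNIV. of_int (Pm $ i $ j) * (of_int (l $ i) / of_nat (m i) - sb \<alpha> $ i))"
proof -
  have m: "(of_nat (m i) :: rat) \<noteq> 0" "(of_nat (m' i) :: rat) \<noteq> 0" for i
    using a.\<sigma>_order(1)[of i] b.\<sigma>_order(1)[of i] by simp_all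
  have "of_int (Pm $ i $ j) * (of_int (l $ i) / of_nat (m i)) = A $ j $ i * of_int (l $ i) / of_nat (m' j)" for i
    using A_Pm[of j i] m[of i] m[of j] by (simp add: field_simps)
  then have "(\<Sum>i\<in>UNIV. of_int (Pm $ i $ j) * (of_int (l $ i) / of_nat (m i))) = (A *v rv l) $ j / of_nat (m' j)"
    by (simp add: matrix_vector_mult_def sum_divide_distrib)
  moreover have "of_int (F (\<alpha>, l) $ j) = (A *v rv l) $ j - s \<alpha> $ j"
    using A[OF assms] by (metis rv_nth vector_minus_component)
  ultimately show ?thesis by (simp add: right_diff_distrib sum_subtractf sb_Pm diff_divide_distrib)
qed

lemma root_choice: "\<exists>r. \<forall>j. r j ^ m' j = cc (Kap (axis j 1))"
proof (rule choice, rule allI)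
  fix j
  have "0 < m' j" by (rule b.\<sigma>_order(1))
  let ?p = "monom 1 (m' j) - [:cc (Kap (axis j 1)):]"
  have "coeff ?p (m' j) = 1" using \<open>0 < m' j\<close> by (simp add: coeff_pCons split: nat.split)
  then have "degree ?p \<ge> m' j" by (intro le_degree) simp
  then have "0 < degree ?p" using \<open>0 < m' j\<close> by simp
  from b.alg_closed[OF this] obtain x where "poly ?p x = 0" ..
  then show "\<exists>x. x ^ m' j = cc (Kap (axis j 1))" by (intro exI[of _ x]) (simp add: poly_monom)
qed

definition rr :: "'n \<Rightarrow> 'k" where "rr = (SOME r. \<forall>j. r j ^ m' j = cc (Kap (axis j 1)))"

lemma rr: "rr j ^ m' j = cc (Kap (axis j 1))"
  using someI_ex[OF root_choice] unfolding rr_def by blast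

lemma rr_nonzero: "rr j \<noteq> 0"
  using rr[of j] cc_nonzero[of "Kap (axis j 1)"] b.\<sigma>_order(1)[of j] by (metis power_0_left less_irrefl)

text \<open>The character \<mu> \<mapsto> r^\<mu> of the torus point r, whose coordinates are m'-th
  roots of the scalars belonging to the unit vectors.\<close>

definition ch :: "int^'n \<Rightarrow> 'k" where "ch \<mu> = (\<Prod>j\<in>UNIV. power_int (rr j) (\<mu> $ j))"

lemma ch_nonzero: "ch \<mu> \<noteq> 0" by (simp add: ch_def rr_nonzero)

lemma ch_add: "ch (\<mu> + \<nu>) = ch \<mu> * ch \<nu>"
  by (simp add: ch_def power_int_add rr_nonzero prod.distrib)

text \<open>As \<delta> \<kappa> = m' (Nu \<kappa>), the choice of the roots gives the product of
  the cc (Kap e_j) to the powers Nu \<kappa>, which is cc (Kap (Nu \<kappa>)) because cc is a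
  character.\<close>

lemma ch_\<delta>: "ch (\<delta> \<kappa>) = cc \<kappa>"
proof -
  have "ch (\<delta> \<kappa>) = (\<Prod>j\<in>UNIV. power_int (cc (Kap (axis j 1))) (Nu \<kappa> $ j))"
    by (simp add: ch_def \<delta>_Nu power_int_mult rr[symmetric])
  also have "\<dots> = cc (Kap (Nu \<kappa>))"
    by (rule character_coordinates[symmetric, where d = "\<lambda>x. cc (Kap x)"]) (simp_all add: Kap_add cc_mult cc_nonzero)
  finally show ?thesis by (simp only: Kap_Nu)
qed

text \<open>Evaluation at t = 1/r; the inverse makes the scalar \<open>cc \<kappa>\<close> of a
  shift cancel against ch (\<delta> \<kappa>).\<close>

definition ev :: "(int^'n \<Rightarrow> 'w) \<Rightarrow> 'w" where
  "ev f = (\<Sum>\<mu>\<in>{\<mu>. f \<mu> \<noteq> 0}. sc' (inverse (ch \<mu>)) (f \<mu>))"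

lemma ev_eq: "finite I \<Longrightarrow> {\<mu>. f \<mu> \<noteq> 0} \<subseteq> I \<Longrightarrow> ev f = (\<Sum>\<mu>\<in>I. sc' (inverse (ch \<mu>)) (f \<mu>))"
  unfolding ev_def by (rule sum.mono_neutral_left) auto

lemma ev_add: assumes "f \<in> b.L" "g \<in> b.L" shows "ev (f + g) = ev f + ev g"
proof -
  let ?I = "{\<mu>. f \<mu> \<noteq> 0} \<union> {\<mu>. g \<mu> \<noteq> 0}"
  have I: "finite ?I" using assms by (simp add: b.L_iff)
  have "{\<mu>. (f + g) \<mu> \<noteq> 0} \<subseteq> ?I" by auto
  then show ?thesis by (simp add: ev_eq[OF I] b.scale_right_distrib sum.distrib)
qed

lemma ev_sum: "(\<And>a. a \<in> I \<Longrightarrow> f a \<in> b.L) \<Longrightarrow> ev (\<Sum>a\<in>I. f a) = (\<Sum>a\<in>I. ev (f a))"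
  by (induction I rule: infinite_finite_induct) (simp_all add: ev_add b.L_sum, simp_all add: ev_def)

lemma ev_sc: assumes "f \<in> b.L" shows "ev (lsc sc' c f) = sc' c (ev f)"
proof -
  have I: "finite {\<mu>. f \<mu> \<noteq> 0}" using assms by (simp add: b.L_iff)
  have "{\<mu>. lsc sc' c f \<mu> \<noteq> 0} \<subseteq> {\<mu>. f \<mu> \<noteq> 0}" by (auto simp: lsc_def)
  then show ?thesis by (simp add: ev_eq[OF I] lsc_def b.scale_sum_right mult.commute)
qed

lemma ev_single: "ev (single \<mu> y) = sc' (inverse (ch \<mu>)) y"
proof -
  have "{\<nu>. single \<mu> y \<nu> \<noteq> 0} \<subseteq> {\<mu>}" by (auto simp: single_apply)
  from ev_eq[OF _ this] have "ev (single \<mu> y) = (\<Sum>\<nu>\<in>{\<mu>}. sc' (inverse (ch \<nu>)) (single \<mu> y \<nu>))" by simp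
  then show ?thesis by (simp only: sum.insert sum.empty single_apply simp_thms if_True finite.emptyI empty_iff not_False_eq_True add_0_right)
qed

definition uu :: "int^'n \<Rightarrow> 'v \<Rightarrow> 'w" where "uu l x = ev (\<phi> (single l x))"

lemma uu_add: "x \<in> a.G l \<Longrightarrow> y \<in> a.G l \<Longrightarrow> uu l (x + y) = uu l x + uu l y"
  by (simp only: uu_def single_add \<phi>_add a.L_single ev_add \<phi>_L)

lemma uu_sc: assumes "x \<in> a.G l" shows "uu l (sc c x) = sc' c (uu l x)"
proof -
  have "single l (sc c x) = lsc sc c (single l x)" by (auto simp: lsc_def single_apply fun_eq_iff)
  then show ?thesis by (simp only: uu_def \<phi>_sc a.L_single assms ev_sc \<phi>_L)
qed

lemma \<phi>_hom0:
  assumes "\<alpha> \<in> a.R" "x \<in> a.W \<alpha>" "x \<in> a.G l"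
  shows "\<exists>y\<in>b.G (F (\<alpha>, l)). \<phi> (single l x) = single (F (\<alpha>, l)) y"
proof (cases "x = 0")
  case True
  then show ?thesis using b.subspace_0[OF b.subspace_G] by (intro bexI[of _ 0]) (simp_all add: \<phi>_0)
qed (use \<phi>_hom assms in blast)

text \<open>Shifting by m \<kappa> multiplies the image by cc \<kappa> and raises its degree by
  \<delta> \<kappa>; evaluation divides by ch (\<delta> \<kappa>) = cc \<kappa>. So the maps uu l
  glue to one map on the Lie algebra.\<close>

lemma uu_shift: assumes x: "x \<in> a.G l" shows "uu (l + rscale m \<kappa>) x = uu l x"
proof -
  have x': "x \<in> a.G (l + rscale m \<kappa>)" using x by (simp add: a.G_shift)
  have sum: "uu k x = (\<Sum>\<alpha>\<in>a.R. uu k (a.pr \<alpha> x))" if "x \<in> a.G k" for k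
  proof -
    have L: "\<And>\<alpha>. \<alpha> \<in> a.R \<Longrightarrow> single k (a.pr \<alpha> x) \<in> a.L" using a.pr_G[OF that] by (rule a.L_single)
    have "single k x = (\<Sum>\<alpha>\<in>a.R. single k (a.pr \<alpha> x))" by (simp only: single_sum[symmetric] a.pr_sum)
    then show ?thesis by (simp add: uu_def \<phi>_sum L ev_sum \<phi>_L)
  qed
  have hom: "uu (l + rscale m \<kappa>) y = uu l y" if \<alpha>: "\<alpha> \<in> a.R" "y \<in> a.W \<alpha>" "y \<in> a.G l" for \<alpha> y
  proof -
    obtain y' where y': "y' \<in> b.G (F (\<alpha>, l))" "\<phi> (single l y) = single (F (\<alpha>, l)) y'" using \<phi>_hom0[OF \<alpha>] by blast
    show ?thesis
      unfolding uu_def \<phi>_shift_single[OF \<alpha>(3) y'] y'(2) ev_single ch_add ch_\<delta>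
      using cc_nonzero[of \<kappa>] by (simp add: mult.assoc)
  qed
  show ?thesis unfolding sum[OF x] sum[OF x']
    by (rule sum.cong[OF refl], rule hom, assumption, erule a.pr_W, erule a.pr_G[OF x])
qed

text \<open>The glued map respects brackets because evaluation is multiplicative on monomials. It is
  onto by \<open>hom_preimage\<close>, and injective because its kernel is an ideal other than the
  whole algebra.\<close>

lemma specialization:
  "\<exists>h. lie_iso sc br sc' br' h \<and> (\<forall>l. \<forall>x\<in>a.G l. h x = uu l x)"
proof -
  obtain h where h: "\<And>x y. h (x + y) = h x + h y" "\<And>c x. h (sc c x) = sc' c (h x)"
    and hu: "\<And>l x. x \<in> a.G l \<Longrightarrow> h x = uu l x"
    using a.glue_maps[of uu sc', OF uu_add uu_sc uu_shift b.scale_right_distrib b.scale_zero_right] by blast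
  have h0: "h 0 = 0" using h(1)[of 0 0] by simp
  have hs: "h (sum f I) = (\<Sum>a\<in>I. h (f a))" for f and I :: "'x set"
    by (induction I rule: infinite_finite_induct) (simp_all add: h h0)
  have br1: "h (br x y) = br' (h x) (h y)"
    if x: "\<alpha> \<in> a.R" "x \<in> a.W \<alpha>" "x \<in> a.G l" and y: "\<beta> \<in> a.R" "y \<in> a.W \<beta>" "y \<in> a.G k" for x y \<alpha> \<beta> l k
  proof -
    obtain x' where x': "\<phi> (single l x) = single (F (\<alpha>, l)) x'" using \<phi>_hom0[OF x] by blast
    obtain y' where y': "\<phi> (single k y) = single (F (\<beta>, k)) y'" using \<phi>_hom0[OF y] by blast
    have "h (br x y) = ev (\<phi> (a.lb (single l x) (single k y)))"
      by (simp only: hu[OF a.br_G[OF x(3) y(3)]] uu_def a.lb_single)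
    also have "\<dots> = ev (single (F (\<alpha>, l) + F (\<beta>, k)) (br' x' y'))"
      by (simp only: \<phi>_lb[OF a.L_single[OF x(3)] a.L_single[OF y(3)]] x' y' b.lb_single)
    also have "\<dots> = br' (h x) (h y)"
      by (simp add: hu[OF x(3)] hu[OF y(3)] uu_def x' y' ev_single ch_add b.br_sc_left b.br_sc_right mult.commute)
    finally show ?thesis .
  qed
  have hbr: "h (br x y) = br' (h x) (h y)" for x y
  proof (induction x rule: a.hom_induct)
    case (hom \<alpha> l x)
    show ?case
    proof (induction y rule: a.hom_induct)
      case (hom \<beta> k y)
      then show ?case by (rule br1[OF \<open>\<alpha> \<in> a.R\<close> \<open>x \<in> a.W \<alpha>\<close> \<open>x \<in> a.G l\<close>])
    qed (simp_all add: h h0 a.br_add_right b.br_add_right)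
  qed (simp_all add: h h0 a.br_add_left b.br_add_left)
  have sur1: "\<exists>x. h x = y" if y: "y \<in> b.G \<mu>" for y \<mu>
  proof -
    obtain J x where J: "\<forall>p\<in>J. fst p \<in> a.R \<and> x p \<in> a.W (fst p) \<and> x p \<in> a.G (snd p) \<and> x p \<noteq> 0 \<and> F p = \<mu>"
      and e: "single \<mu> y = \<phi> (\<Sum>p\<in>J. single (snd p) (x p))" using hom_preimage[OF y] by (elim exE conjE)
    have L: "single (snd p) (x p) \<in> a.L" if "p \<in> J" for p using J that by (intro a.L_single) blast
    have "sc' (inverse (ch \<mu>)) y = ev (\<phi> (\<Sum>p\<in>J. single (snd p) (x p)))" by (simp only: e[symmetric] ev_single)
    also have "\<dots> = (\<Sum>p\<in>J. uu (snd p) (x p))" by (simp add: \<phi>_sum L ev_sum \<phi>_L uu_def)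
    also have "\<dots> = h (\<Sum>p\<in>J. x p)" unfolding hs by (rule sum.cong[OF refl], rule hu[symmetric]) (use J in blast)
    finally have "h (sc (ch \<mu>) (\<Sum>p\<in>J. x p)) = sc' (ch \<mu>) (sc' (inverse (ch \<mu>)) y)" by (simp only: h(2))
    then have "h (sc (ch \<mu>) (\<Sum>p\<in>J. x p)) = y" using ch_nonzero[of \<mu>] by simp
    then show ?thesis by (rule exI)
  qed
  have sur: "\<exists>x. h x = y" for y
  proof -
    have "\<forall>l\<in>b.Box. \<exists>x. h x = b.prG l y" using sur1 b.prG_G by blast
    from bchoice[OF this] obtain t where t: "\<forall>l\<in>b.Box. h (t l) = b.prG l y" ..
    have "h (\<Sum>l\<in>b.Box. t l) = (\<Sum>l\<in>b.Box. b.prG l y)" unfolding hs by (rule sum.cong[OF refl]) (use t in blast)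
    then have "h (\<Sum>l\<in>b.Box. t l) = y" by (simp only: b.prG_sum)
    then show ?thesis by (rule exI)
  qed
  have "{x. h x = 0} = {0} \<or> {x. h x = 0} = UNIV"
  proof (rule a.ideal_trivial)
    show "a.subspace {x. h x = 0}" by (rule a.subspaceI) (simp_all add: h h0)
  qed (simp add: hbr b.br_0_right)
  moreover have "{x. h x = 0} \<noteq> UNIV"
  proof
    assume u: "{x. h x = 0} = UNIV"
    have "y = 0" for y :: 'w using sur[of y] u by blast
    then have "br' x y = 0" for x y by blast
    then show False using b.nonabelian by blast
  qed
  ultimately have k: "{x. h x = 0} = {0}" by blast
  have "inj h"
  proof (rule injI)
    fix x y assume "h x = h y"
    then have "h (x - y) = 0" using h(1)[of "x - y" y] by simp
    then have "x - y = 0" using k by blast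
    then show "x = y" by simp
  qed
  then have "lie_iso sc br sc' br' h"
    unfolding lie_iso_def bij_def surj_def using h hbr sur by metis
  then show ?thesis using hu by blast
qed

text \<open>Both sides of the conjugation identity are diagonal on homogeneous weight vectors, and
  \<open>degree_relation\<close> equates the eigenvalues.\<close>

lemma conjugate_tuples:
  "\<exists>s P h. group_hom_on a.Q s \<and> GL_int P \<and> lie_iso sc br sc' br' h \<and>
     (\<exists>\<tau>. a.twist s \<tau> \<and> (\<forall>j. \<sigma>' j = h \<circ> tuple_pow (\<lambda>i. \<tau> i \<circ> \<sigma> i) P j \<circ> inv h))"
proof -
  obtain h where h: "lie_iso sc br sc' br' h" and hu: "\<And>l x. x \<in> a.G l \<Longrightarrow> h x = uu l x"
    using specialization by blast
  obtain \<tau> where tw: "a.twist sb \<tau>" using a.twist_exists by blast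
  have hadd: "h (x + y) = h x + h y" and hsc: "h (sc c x) = sc' c (h x)" for c x y
    using h by (simp_all add: lie_iso_def)
  have h0: "h 0 = 0" using hadd[of 0 0] by simp
  note T = a.twist_pow_lin[OF tw, of Pm]
  have "\<sigma>' j (h x) = h (tuple_pow (\<lambda>i. \<tau> i \<circ> \<sigma> i) Pm j x)" for j x
  proof (induction x rule: a.hom_induct)
    case zero
    show ?case by (simp only: h0 a.lin_0[OF T] b.lin_0[OF b.\<sigma>_lin])
  next
    case (add x y)
    then show ?case by (simp only: hadd a.lin_add[OF T] b.lin_add[OF b.\<sigma>_lin])
  next
    case (hom \<alpha> l x)
    show ?case
    proof (cases "x = 0")
      case True
      show ?thesis by (simp only: True h0 a.lin_0[OF T] b.lin_0[OF b.\<sigma>_lin])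
    next
      case False
      have \<Lambda>: "(\<alpha>, l) \<in> a.\<Lambda>" using hom False a.R_Q by (intro a.\<Lambda>_base) auto
      obtain y where y: "y \<in> b.G (F (\<alpha>, l))" "\<phi> (single l x) = single (F (\<alpha>, l)) y" using \<phi>_hom0[OF hom] by blast
      have "h x = sc' (inverse (ch (F (\<alpha>, l)))) y" by (simp only: hu[OF hom(3)] uu_def y(2) ev_single)
      then have "h x \<in> b.G (F (\<alpha>, l))" by (simp only: b.subspace_scale[OF b.subspace_G y(1)])
      then have "\<sigma>' j (h x) = sc' (zpow z (of_int (F (\<alpha>, l) $ j) / of_nat (m' j))) (h x)" by (simp add: b.G_iff)
      then show ?thesis by (simp only: a.twist_pow_eigen[OF tw hom] hsc degree_relation[OF \<Lambda>])
    qed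
  qed
  moreover have "h (inv h y) = y" for y using h by (simp add: lie_iso_def bij_is_surj surj_f_inv_f)
  ultimately have "\<sigma>' j y = (h \<circ> tuple_pow (\<lambda>i. \<tau> i \<circ> \<sigma> i) Pm j \<circ> inv h) y" for j y
    by (metis comp_apply)
  then have "\<forall>j. \<sigma>' j = h \<circ> tuple_pow (\<lambda>i. \<tau> i \<circ> \<sigma> i) Pm j \<circ> inv h" by (intro allI ext)
  then show ?thesis using sb_hom GL_Pm h tw by blast
qed

end

theorem regraded_imp_conjugate:
  "\<exists>s P h. group_hom_on a.Q s \<and> GL_int P \<and> lie_iso sc br sc' br' h \<and>
     (\<exists>\<tau>. a.twist s \<tau> \<and> (\<forall>j. \<sigma>' j = h \<circ> tuple_pow (\<lambda>i. \<tau> i \<circ> \<sigma> i) P j \<circ> inv h))"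
proof -
  obtain A s where "group_hom_on a.Q s" "\<And>\<alpha> l. (\<alpha>, l) \<in> a.\<Lambda> \<Longrightarrow> rv (F (\<alpha>, l)) = A *v rv l - s \<alpha>"
    using a.affine_hom[of F] F_add by blast
  from conjugate_tuples[OF this] show ?thesis .
qed

end

section \<open>From conjugate tuples to graded isomorphisms\<close>

text \<open>Condition (b) for two loop algebras; \<open>M\<close> is the matrix called P
  there.\<close>

locale conj_pair = a: multiloop sc br \<sigma> m H z + b: multiloop sc' br' \<sigma>' m' H' z
  for sc :: "'k::field_char_0 \<Rightarrow> 'v::ab_group_add \<Rightarrow> 'v" and br
    and \<sigma> :: "'n::finite \<Rightarrow> 'v \<Rightarrow> 'v" and m H
    and sc' :: "'k \<Rightarrow> 'w::ab_group_add \<Rightarrow> 'w" and br'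
    and \<sigma>' :: "'n \<Rightarrow> 'w \<Rightarrow> 'w" and m' H' and z +
  fixes s :: "('v \<Rightarrow> 'k) \<Rightarrow> rat^'n" and M :: "int^'n^'n" and \<phi> :: "'v \<Rightarrow> 'w" and \<tau> :: "'n \<Rightarrow> 'v \<Rightarrow> 'v"
  assumes s: "group_hom_on a.Q s" and GL: "GL_int M" and iso: "lie_iso sc br sc' br' \<phi>"
    and tw: "a.twist s \<tau>" and conj: "\<And>j. \<sigma>' j = \<phi> \<circ> tuple_pow (\<lambda>i. \<tau> i \<circ> \<sigma> i) M j \<circ> inv \<phi>"
begin

lemma \<phi>_add: "\<phi> (x + y) = \<phi> x + \<phi> y" and \<phi>_sc: "\<phi> (sc c x) = sc' c (\<phi> x)"
  and \<phi>_br: "\<phi> (br x y) = br' (\<phi> x) (\<phi> y)" and \<phi>_bij: "bij \<phi>"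
  using iso by (simp_all add: lie_iso_def)

lemma \<phi>_inv [simp]: "\<phi> (inv \<phi> y) = y" and inv_\<phi> [simp]: "inv \<phi> (\<phi> x) = x"
  using \<phi>_bij by (simp_all add: bij_is_surj surj_f_inv_f bij_is_inj)

lemma \<phi>_eq: "\<phi> x = \<phi> y \<longleftrightarrow> x = y" using inv_\<phi> by metis

lemma \<phi>_0: "\<phi> 0 = 0" using \<phi>_add[of 0 0] by simp

lemma \<phi>_eq_0: "\<phi> x = 0 \<longleftrightarrow> x = 0" using \<phi>_eq[of x 0] by (simp add: \<phi>_0)

lemma \<phi>_sum: "\<phi> (sum f I) = (\<Sum>a\<in>I. \<phi> (f a))"
  by (induction I rule: infinite_finite_induct) (simp_all add: \<phi>_add \<phi>_0)

lemma inv_\<phi>_add: "inv \<phi> (x + y) = inv \<phi> x + inv \<phi> y"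
  using inv_\<phi>[of "inv \<phi> x + inv \<phi> y"] by (simp add: \<phi>_add)

lemma inv_\<phi>_0: "inv \<phi> 0 = 0" using inv_\<phi>[of 0] by (simp add: \<phi>_0)

lemma inv_\<phi>_sum: "inv \<phi> (sum f I) = (\<Sum>a\<in>I. inv \<phi> (f a))"
  by (induction I rule: infinite_finite_induct) (simp_all add: inv_\<phi>_add inv_\<phi>_0)

lemma \<sigma>_\<phi>: "\<sigma>' j (\<phi> x) = \<phi> (tuple_pow (\<lambda>i. \<tau> i \<circ> \<sigma> i) M j x)"
  by (simp only: conj comp_apply inv_\<phi>)

lemma pairing_inj:
  fixes d :: "'n \<Rightarrow> rat"
  assumes d: "\<And>j. (\<Sum>i\<in>UNIV. of_int (M $ i $ j) * d i) = 0" shows "d k = 0"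
proof -
  obtain R where R: "M ** R = mat 1" using GL by (auto simp: GL_int_def)
  have "0 = (\<Sum>j\<in>UNIV. (\<Sum>i\<in>UNIV. of_int (M $ i $ j) * d i) * of_int (R $ j $ k))" by (simp add: d)
  also have "\<dots> = (\<Sum>j\<in>UNIV. \<Sum>i\<in>UNIV. of_int (M $ i $ j * R $ j $ k) * d i)"
    by (simp add: sum_distrib_left mult.assoc mult.commute[of _ "of_int (R $ _ $ k)"] mult.left_commute[of "of_int (R $ _ $ k)"])
  also have "\<dots> = (\<Sum>i\<in>UNIV. \<Sum>j\<in>UNIV. of_int (M $ i $ j * R $ j $ k) * d i)" by (rule sum.swap)
  also have "\<dots> = (\<Sum>i\<in>UNIV. of_int ((M ** R) $ i $ k) * d i)"
    by (simp add: matrix_matrix_mult_def sum_distrib_right)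
  also have "\<dots> = (\<Sum>i\<in>UNIV. if i = k then d i else 0)"
    by (rule sum.cong[OF refl]) (simp add: R mat_def)
  also have "\<dots> = d k" by simp
  finally show ?thesis by simp
qed

lemma pairing_surj: "\<exists>\<kappa> :: int^'n. \<forall>j. (\<Sum>i\<in>UNIV. M $ i $ j * \<kappa> $ i) = k j"
proof -
  obtain R where R: "R ** M = mat 1" using GL by (auto simp: GL_int_def)
  define \<kappa> :: "int^'n" where "\<kappa> = (\<chi> i. \<Sum>j\<in>UNIV. k j * R $ j $ i)"
  have "(\<Sum>i\<in>UNIV. M $ i $ j * \<kappa> $ i) = k j" for j
  proof -
    have "(\<Sum>i\<in>UNIV. M $ i $ j * \<kappa> $ i) = (\<Sum>i\<in>UNIV. \<Sum>j'\<in>UNIV. k j' * (R $ j' $ i * M $ i $ j))"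
      by (simp add: \<kappa>_def sum_distrib_left mult.assoc mult.commute[of "M $ _ $ j"])
    also have "\<dots> = (\<Sum>j'\<in>UNIV. \<Sum>i\<in>UNIV. k j' * (R $ j' $ i * M $ i $ j))" by (rule sum.swap)
    also have "\<dots> = (\<Sum>j'\<in>UNIV. k j' * (R ** M) $ j' $ j)"
      by (simp add: matrix_matrix_mult_def sum_distrib_left)
    also have "\<dots> = (\<Sum>j'\<in>UNIV. if j' = j then k j' else 0)"
      by (rule sum.cong[OF refl]) (simp add: R mat_def)
    also have "\<dots> = k j" by simp
    finally show ?thesis .
  qed
  then show ?thesis by blast
qed

text \<open>The degree in which \<open>\<phi>(x) \<otimes> t\<^sup>\<mu>\<close> corresponds to \<open>x \<otimes> t\<^sup>l\<close> for \<open>x\<close> of weight \<open>\<alpha>\<close>.\<close>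

definition deg :: "('v \<Rightarrow> 'k) \<Rightarrow> int^'n \<Rightarrow> rat^'n" where
  "deg \<alpha> l = (\<chi> j. of_nat (m' j) * (\<Sum>i\<in>UNIV. of_int (M $ i $ j) * (of_int (l $ i) / of_nat (m i) - s \<alpha> $ i)))"

lemma m_nonzero: "(of_nat (m i) :: rat) \<noteq> 0" and m'_nonzero: "(of_nat (m' i) :: rat) \<noteq> 0"
  using a.\<sigma>_order(1)[of i] b.\<sigma>_order(1)[of i] by simp_all

lemma deg_quotient: "deg \<alpha> l $ j / of_nat (m' j) =
    (\<Sum>i\<in>UNIV. of_int (M $ i $ j) * (of_int (l $ i) / of_nat (m i) - s \<alpha> $ i))"
  using m'_nonzero[of j] by (simp add: deg_def)

lemma s_add: "\<alpha> \<in> a.Q \<Longrightarrow> \<beta> \<in> a.Q \<Longrightarrow> s (\<alpha> + \<beta>) = s \<alpha> + s \<beta>" using s by (simp add: group_hom_on_def)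

lemma s_diff: "\<alpha> \<in> a.Q \<Longrightarrow> \<beta> \<in> a.Q \<Longrightarrow> s (\<alpha> - \<beta>) = s \<alpha> - s \<beta>"
  using s unfolding root_lattice_def by (rule group_hom_on_diff)

lemma deg_add: "\<alpha> \<in> a.Q \<Longrightarrow> \<beta> \<in> a.Q \<Longrightarrow> deg (\<alpha> + \<beta>) (l + k) = deg \<alpha> l + deg \<beta> k"
  by (simp add: vec_eq_iff deg_def s_add distrib_left[symmetric] sum.distrib[symmetric] add_divide_distrib algebra_simps)

lemma deg_diff: "\<alpha> \<in> a.Q \<Longrightarrow> \<beta> \<in> a.Q \<Longrightarrow> deg (\<alpha> - \<beta>) (l - k) = deg \<alpha> l - deg \<beta> k"
  using deg_add[of "\<alpha> - \<beta>" \<beta> "l - k" k] by (simp add: a.Q_diff)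

lemma deg_0: "deg 0 0 = 0"
  using deg_diff[OF a.Q_0 a.Q_0, of 0 0] by simp

lemma deg_inj: assumes "deg \<alpha> l = deg \<alpha> k" shows "l = k"
proof -
  have e: "of_int (l $ i) / of_nat (m i) - of_int (k $ i) / of_nat (m i) = (0::rat)" for i
  proof (rule pairing_inj[of "\<lambda>i. of_int (l $ i) / of_nat (m i) - of_int (k $ i) / of_nat (m i)"])
    fix j
    have "deg \<alpha> l $ j / of_nat (m' j) - deg \<alpha> k $ j / of_nat (m' j) = 0" using assms by simp
    then show "(\<Sum>i\<in>UNIV. of_int (M $ i $ j) * (of_int (l $ i) / of_nat (m i) - of_int (k $ i) / of_nat (m i))) = (0::rat)"
      unfolding deg_quotient sum_subtractf[symmetric] by (simp add: right_diff_distrib)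
  qed
  have "rat_of_int (l $ i) = of_int (k $ i)" for i
    using e[of i] m_nonzero[of i] unfolding diff_divide_distrib[symmetric] divide_eq_0_iff by simp
  then show ?thesis by (simp add: vec_eq_iff)
qed

lemma \<sigma>_deg:
  assumes "\<alpha> \<in> a.R" "x \<in> a.W \<alpha>" "x \<in> a.G l"
  shows "\<sigma>' j (\<phi> x) = sc' (zpow z (deg \<alpha> l $ j / of_nat (m' j))) (\<phi> x)"
  by (simp only: \<sigma>_\<phi> a.twist_pow_eigen[OF tw assms] \<phi>_sc deg_quotient)

lemma deg_G:
  assumes "\<alpha> \<in> a.R" "x \<in> a.W \<alpha>" "x \<in> a.G l" "deg \<alpha> l = rv \<mu>" shows "\<phi> x \<in> b.G \<mu>"
  using \<sigma>_deg[OF assms(1-3)] by (simp add: b.G_iff assms(4))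

text \<open>The m' j-th power of \<sigma>' j is the identity, so its eigenvalue on the nonzero
  \<phi> x has that order dividing m' j; by the formula for the eigenvalue, deg is then
  integral.\<close>

lemma deg_integral:
  assumes x: "\<alpha> \<in> a.R" "x \<in> a.W \<alpha>" "x \<in> a.G l" "x \<noteq> 0" shows "\<exists>\<mu>. deg \<alpha> l = rv \<mu>"
proof -
  have "deg \<alpha> l $ j \<in> \<int>" for j
  proof -
    let ?c = "zpow z (deg \<alpha> l $ j / of_nat (m' j))"
    have "(\<sigma>' j ^^ n) (\<phi> x) = sc' (?c ^ n) (\<phi> x)" for n
      by (induction n) (simp_all add: \<sigma>_deg[OF x(1-3)] b.lin_sc[OF b.\<sigma>_lin] mult.commute)
    from this[of "m' j"] have "sc' (?c ^ m' j) (\<phi> x) = sc' 1 (\<phi> x)" by (simp add: b.\<sigma>_order(2))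
    then have "?c ^ m' j = 1" by (rule b.scale_right_imp_eq[rotated]) (simp add: \<phi>_eq_0 x(4))
    moreover have "zpow z (deg \<alpha> l $ j) = ?c ^ m' j"
      using zpow_of_int_mult[OF b.z, of "int (m' j)" "deg \<alpha> l $ j / of_nat (m' j)"] m'_nonzero[of j] by simp
    ultimately show ?thesis by (simp add: zpow_eq_1_iff[OF b.z])
  qed
  then have "\<forall>j. \<exists>k. deg \<alpha> l $ j = of_int k" by (auto elim: Ints_cases)
  from choice[OF this] obtain k where "\<forall>j. deg \<alpha> l $ j = of_int (k j)" ..
  then show ?thesis by (intro exI[of _ "\<chi> j. k j"]) (simp add: vec_eq_iff)
qed

text \<open>Each nonzero eigencomponent of x has the same eigenvalues under the twisted powers as x.
  Its degree l can thus be corrected within l + m Z^n to one with deg = \<mu>. As deg is injective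
  for a fixed weight, all components share that degree, so x itself is homogeneous.\<close>

lemma deg_lift:
  assumes \<alpha>: "\<alpha> \<in> a.R" and x: "x \<in> a.W \<alpha>" and g: "\<phi> x \<in> b.G \<mu>" and x0: "x \<noteq> 0"
  shows "\<exists>l. deg \<alpha> l = rv \<mu> \<and> x \<in> a.G l"
proof -
  let ?T = "\<lambda>j. tuple_pow (\<lambda>i. \<tau> i \<circ> \<sigma> i) M j"
  define c where "c l j = zpow z (deg \<alpha> l $ j / of_nat (m' j))" for l j
  define d where "d j = zpow z (of_int (\<mu> $ j) / of_nat (m' j))" for j
  have xW: "a.prG l x \<in> a.W \<alpha>" "a.prG l x \<in> a.G l" if "l \<in> a.Box" for l
    using a.prG_W[OF x that] a.prG_G[OF that] by auto
  have T1: "?T j x = sc (d j) x" for j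
  proof -
    have "\<sigma>' j (\<phi> x) = sc' (d j) (\<phi> x)" using g by (simp add: b.G_iff d_def)
    then show ?thesis by (simp only: \<sigma>_\<phi> \<phi>_sc[symmetric] \<phi>_eq)
  qed
  have Tl: "?T j (a.prG l x) = sc (c l j) (a.prG l x)" if l: "l \<in> a.Box" for l j
    using a.twist_pow_eigen[OF tw \<alpha> xW[OF l], of M j] by (simp only: c_def deg_quotient)
  have lift: "\<exists>l'. deg \<alpha> l' = rv \<mu> \<and> a.prG l x \<in> a.G l'" if l: "l \<in> a.Box" and ne: "a.prG l x \<noteq> 0" for l
  proof -
    have "c l j = d j" for j
    proof -
      have "?T j x = ?T j (\<Sum>k\<in>a.Box. a.prG k x)" by (simp only: a.prG_sum)
      also have "\<dots> = (\<Sum>k\<in>a.Box. sc (c k j) (a.prG k x))"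
        unfolding a.lin_sum[OF a.twist_pow_lin[OF tw]] by (rule sum.cong[OF refl], rule Tl)
      finally have "a.prG l (sc (d j) x) = a.prG l (\<Sum>k\<in>a.Box. sc (c k j) (a.prG k x))" by (simp only: T1)
      also have "\<dots> = (\<Sum>k\<in>a.Box. sc (c k j) (a.prG l (a.prG k x)))"
        by (simp only: a.lin_sum[OF a.lin_prG] a.lin_sc[OF a.lin_prG])
      also have "\<dots> = (\<Sum>k\<in>a.Box. if k = l then sc (c l j) (a.prG l x) else 0)"
        by (rule sum.cong[OF refl]) (simp add: a.prG_on[OF _ a.prG_G])
      also have "\<dots> = sc (c l j) (a.prG l x)" using l by (simp add: a.finite_Box)
      finally have "sc (c l j) (a.prG l x) = sc (d j) (a.prG l x)" by (simp only: a.lin_sc[OF a.lin_prG])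
      then show ?thesis by (rule a.scale_right_imp_eq[OF ne])
    qed
    then have "\<forall>j. \<exists>k. deg \<alpha> l $ j / of_nat (m' j) - of_int (\<mu> $ j) / of_nat (m' j) = of_int k"
      by (auto simp: c_def d_def zpow_eq_iff[OF b.z] elim: Ints_cases)
    from choice[OF this] obtain k where
      k: "\<And>j. deg \<alpha> l $ j / of_nat (m' j) - of_int (\<mu> $ j) / of_nat (m' j) = of_int (k j)" by blast
    \<comment> \<open>The degrees differ from \<mu> by m' j times integers k j. Unimodularity of M
      solves for \<kappa>, and lowering l by m \<kappa> subtracts exactly these integers.\<close>
    obtain \<kappa> :: "int^'n" where \<kappa>: "\<And>j. (\<Sum>i\<in>UNIV. M $ i $ j * \<kappa> $ i) = k j" using pairing_surj by blast
    define l' where "l' = l - rscale m \<kappa>"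
    have "deg \<alpha> l' $ j = rv \<mu> $ j" for j
    proof -
      have 1: "rat_of_int (l' $ i) / of_nat (m i) = of_int (l $ i) / of_nat (m i) - of_int (\<kappa> $ i)" for i
        using m_nonzero[of i] by (simp add: l'_def diff_divide_distrib)
      have "deg \<alpha> l' $ j / of_nat (m' j) =
          (\<Sum>i\<in>UNIV. of_int (M $ i $ j) * (of_int (l $ i) / of_nat (m i) - s \<alpha> $ i) - of_int (M $ i $ j * \<kappa> $ i))"
        unfolding deg_quotient 1 by (rule sum.cong[OF refl]) (simp add: algebra_simps)
      also have "\<dots> = deg \<alpha> l $ j / of_nat (m' j) - of_int (k j)"
        unfolding sum_subtractf deg_quotient of_int_sum[symmetric] \<kappa> ..
      also have "\<dots> = of_int (\<mu> $ j) / of_nat (m' j)" unfolding k[of j, symmetric] by simp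
      finally show ?thesis using m'_nonzero[of j] by simp
    qed
    then have "deg \<alpha> l' = rv \<mu>" by (simp add: vec_eq_iff)
    moreover have "a.G l = a.G l'" using a.G_shift[of l' \<kappa>] by (simp add: l'_def)
    ultimately show ?thesis using xW(2)[OF l] by blast
  qed
  have "\<exists>l\<in>a.Box. a.prG l x \<noteq> 0"
  proof (rule ccontr)
    assume "\<not> ?thesis"
    then have "(\<Sum>l\<in>a.Box. a.prG l x) = 0" by simp
    then show False using x0 by (simp add: a.prG_sum)
  qed
  then obtain l0 where l0: "deg \<alpha> l0 = rv \<mu>" using lift by blast
  have "a.prG l x \<in> a.G l0" if l: "l \<in> a.Box" for l
  proof (cases "a.prG l x = 0")
    case True
    then show ?thesis by (simp add: a.subspace_0[OF a.subspace_G])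
  next
    case False
    obtain l' where l': "deg \<alpha> l' = rv \<mu>" "a.prG l x \<in> a.G l'" using lift[OF l False] by blast
    have "l' = l0" by (rule deg_inj[of \<alpha>]) (simp only: l'(1) l0)
    then show ?thesis using l'(2) by simp
  qed
  then have "(\<Sum>l\<in>a.Box. a.prG l x) \<in> a.G l0" by (rule a.subspace_sum[OF a.subspace_G])
  then show ?thesis using l0 by (auto simp: a.prG_sum)
qed

lemma \<phi>_H: assumes h: "h \<in> H" shows "\<phi> h \<in> b.G 0"
proof (cases "h = 0")
  case True
  then show ?thesis by (simp add: \<phi>_0 b.subspace_0[OF b.subspace_G])
next
  case False
  have W: "h \<in> a.W 0" using h a.H_W0 by blast
  have G: "h \<in> a.G 0" using h a.H_S by (auto simp: a.G_zero)
  show ?thesis by (rule deg_G[OF a.Q_W[OF a.Q_0 W False] W G]) (simp add: deg_0 rv_0)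
qed

text \<open>The map \<phi> does not intertwine the two tuples, but \<phi> H is fixed by \<sigma>';
  so preimages of eigenspaces of \<sigma>' are stable under ad H and split into weight
  components.\<close>

lemma pr_b_G: assumes x: "\<phi> x \<in> b.G \<mu>" and \<alpha>: "\<alpha> \<in> a.R" shows "\<phi> (a.pr \<alpha> x) \<in> b.G \<mu>"
proof -
  have "a.pr \<alpha> x \<in> {x. \<phi> x \<in> b.G \<mu>}"
  proof (rule a.pr_invariant)
    show "a.subspace {x. \<phi> x \<in> b.G \<mu>}"
      by (rule a.subspaceI) (simp_all add: \<phi>_0 \<phi>_add \<phi>_sc b.subspace_0[OF b.subspace_G]
          b.subspace_add[OF b.subspace_G] b.subspace_scale[OF b.subspace_G])
    show "br h y \<in> {x. \<phi> x \<in> b.G \<mu>}" if "h \<in> H" "y \<in> {x. \<phi> x \<in> b.G \<mu>}" for h y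
      using b.br_G[OF \<phi>_H[OF that(1)], of "\<phi> y" \<mu>] that(2) by (simp add: \<phi>_br)
  qed (use x \<alpha> in auto)
  then show ?thesis by simp
qed

lemma diagble_\<phi>: assumes d: "b.diagble (br' (\<phi> x))" shows "a.diagble (br x)"
proof -
  let ?E = "{v. \<exists>c. br x v = sc c v}"
  have "b.span {u. \<exists>c. br' (\<phi> x) u = sc' c u} \<subseteq> \<phi> ` a.span ?E"
  proof (rule b.span_minimal)
    show "{u. \<exists>c. br' (\<phi> x) u = sc' c u} \<subseteq> \<phi> ` a.span ?E"
    proof
      fix u assume "u \<in> {u. \<exists>c. br' (\<phi> x) u = sc' c u}"
      then obtain c where "br' (\<phi> x) u = sc' c u" by blast
      then have "\<phi> (br x (inv \<phi> u)) = \<phi> (sc c (inv \<phi> u))" by (simp add: \<phi>_br \<phi>_sc)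
      then have "inv \<phi> u \<in> ?E" by (auto simp: \<phi>_eq)
      then have "inv \<phi> u \<in> a.span ?E" by (rule a.span_base)
      then show "u \<in> \<phi> ` a.span ?E" by (intro image_eqI[of _ _ "inv \<phi> u"]) simp_all
    qed
    show "b.subspace (\<phi> ` a.span ?E)"
    proof (rule b.subspaceI)
      show "0 \<in> \<phi> ` a.span ?E" by (rule image_eqI[of _ _ 0]) (simp_all add: \<phi>_0 a.span_zero)
      fix u v assume u: "u \<in> \<phi> ` a.span ?E"
      show "u + v \<in> \<phi> ` a.span ?E" if v: "v \<in> \<phi> ` a.span ?E"
      proof -
        obtain u' v' where "u' \<in> a.span ?E" "v' \<in> a.span ?E" "u = \<phi> u'" "v = \<phi> v'" using u v by blast
        then show ?thesis by (intro image_eqI[of _ _ "u' + v'"]) (simp_all add: \<phi>_add a.span_add)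
      qed
      show "sc' c u \<in> \<phi> ` a.span ?E" for c
      proof -
        obtain u' where "u' \<in> a.span ?E" "u = \<phi> u'" using u by blast
        then show ?thesis by (intro image_eqI[of _ _ "sc c u'"]) (simp_all add: \<phi>_sc a.span_scale)
      qed
    qed
  qed
  then have u: "UNIV \<subseteq> \<phi> ` a.span ?E" by (simp only: d[unfolded b.diagble_def])
  have "\<phi> v \<in> \<phi> ` a.span ?E" for v by (rule subsetD[OF u UNIV_I])
  then have "v \<in> a.span ?E" for v using \<phi>_eq by (metis (no_types, lifting) imageE)
  then show ?thesis by (auto simp: a.diagble_def)
qed

text \<open>Diagonalizability follows by splitting the preimage of the fixed points of \<sigma>'
  into weight spaces. For maximality, a toral T containing \<phi> H is abelian, so its preimage has
  weight 0; twisting is trivial there, so the preimage lies in the fixed points of \<sigma> and is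
  absorbed by H.\<close>

lemma image_cartan: "cartan_sub sc' br' b.S (\<phi> ` H)"
  unfolding cartan_sub_def
proof (intro conjI allI impI)
  show "ad_diag_subalg sc' br' b.S (\<phi> ` H)"
    unfolding ad_diag_subalg_def
  proof (intro conjI ballI)
    show "b.subspace (\<phi> ` H)"
    proof (rule b.subspaceI)
      show "0 \<in> \<phi> ` H" using a.subspace_0[OF a.subspace_H] \<phi>_0 by (metis image_eqI)
      show "x + y \<in> \<phi> ` H" if "x \<in> \<phi> ` H" "y \<in> \<phi> ` H" for x y
      proof -
        obtain u v where "u \<in> H" "v \<in> H" "x = \<phi> u" "y = \<phi> v" using \<open>x \<in> \<phi> ` H\<close> \<open>y \<in> \<phi> ` H\<close> by blast
        then show ?thesis by (intro image_eqI[of _ _ "u + v"]) (simp_all add: \<phi>_add a.subspace_add[OF a.subspace_H])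
      qed
      show "sc' c x \<in> \<phi> ` H" if "x \<in> \<phi> ` H" for c x
      proof -
        obtain u where "u \<in> H" "x = \<phi> u" using \<open>x \<in> \<phi> ` H\<close> by blast
        then show ?thesis by (intro image_eqI[of _ _ "sc c u"]) (simp_all add: \<phi>_sc a.subspace_scale[OF a.subspace_H])
      qed
    qed
    show "\<phi> ` H \<subseteq> b.S" using \<phi>_H by (auto simp: b.G_zero)
    show "br' x y \<in> \<phi> ` H" if xy: "x \<in> \<phi> ` H" "y \<in> \<phi> ` H" for x y
    proof -
      obtain u v where uv: "u \<in> H" "v \<in> H" "x = \<phi> u" "y = \<phi> v" using xy by blast
      then have "br' x y = \<phi> 0" by (simp add: \<phi>_br[symmetric] a.H_abelian)
      then show ?thesis using a.subspace_0[OF a.subspace_H] by (metis image_eqI)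
    qed
    fix t assume "t \<in> \<phi> ` H"
    then obtain h where h: "h \<in> H" "t = \<phi> h" by blast
    show "ad_diag_on sc' br' b.S t"
      unfolding ad_diag_on_def
    proof
      show "b.span {x \<in> b.S. \<exists>c. br' t x = sc' c x} \<subseteq> b.S" by (rule b.span_minimal[OF _ b.subspace_S]) auto
      show "b.S \<subseteq> b.span {x \<in> b.S. \<exists>c. br' t x = sc' c x}"
      proof
        fix y assume y: "y \<in> b.S"
        have yG: "\<phi> (inv \<phi> y) \<in> b.G 0" using y by (simp add: b.G_zero)
        have "y = (\<Sum>\<alpha>\<in>a.R. \<phi> (a.pr \<alpha> (inv \<phi> y)))" by (simp only: \<phi>_sum[symmetric] a.pr_sum \<phi>_inv)
        moreover have "\<phi> (a.pr \<alpha> (inv \<phi> y)) \<in> {x \<in> b.S. \<exists>c. br' t x = sc' c x}" if \<alpha>: "\<alpha> \<in> a.R" for \<alpha>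
        proof -
          have "\<phi> (a.pr \<alpha> (inv \<phi> y)) \<in> b.S" using pr_b_G[OF yG \<alpha>] by (simp add: b.G_zero)
          moreover have "br h (a.pr \<alpha> (inv \<phi> y)) = sc (\<alpha> h) (a.pr \<alpha> (inv \<phi> y))"
            using a.pr_W[OF \<alpha>] h(1) by (simp add: wspace_def)
          then have "br' t (\<phi> (a.pr \<alpha> (inv \<phi> y))) = sc' (\<alpha> h) (\<phi> (a.pr \<alpha> (inv \<phi> y)))"
            by (simp only: h(2) \<phi>_br[symmetric] \<phi>_sc)
          ultimately show ?thesis by blast
        qed
        ultimately show "y \<in> b.span {x \<in> b.S. \<exists>c. br' t x = sc' c x}"
          by (metis (no_types, lifting) b.span_sum b.span_base)
      qed
    qed
  qed
next
  fix T assume T: "ad_diag_subalg sc' br' b.S T \<and> \<phi> ` H \<subseteq> T"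
  then have Ts: "b.subspace T" "T \<subseteq> b.S" and HT: "\<phi> ` H \<subseteq> T" and T1: "ad_diag_subalg sc' br' b.S T"
    by (simp_all add: ad_diag_subalg_def)
  define T0 where "T0 = {x. \<phi> x \<in> T}"
  \<comment> \<open>On weight 0 the degree map sends only l = 0 to 0, so vectors fixed by \<sigma>'
    come from vectors fixed by \<sigma>.\<close>
  have T0S: "x \<in> a.S" if x: "x \<in> T0" for x
  proof (cases "x = 0")
    case True
    then show ?thesis by (simp add: a.subspace_0[OF a.subspace_S])
  next
    case False
    have "br h x = 0" if "h \<in> H" for h
    proof -
      have "br' (\<phi> h) (\<phi> x) = 0" by (rule b.toral_abelian[OF T1]) (use HT x that in \<open>auto simp: T0_def\<close>)
      then show ?thesis by (simp add: \<phi>_br[symmetric] \<phi>_eq_0)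
    qed
    then have W: "x \<in> a.W 0" by (simp add: wspace_def)
    have "\<phi> x \<in> b.G 0" using x Ts(2) by (auto simp: T0_def b.G_zero)
    then obtain l where l: "deg 0 l = rv 0" "x \<in> a.G l"
      using deg_lift[OF a.Q_W[OF a.Q_0 W False] W _ False] by blast
    have "l = 0" by (rule deg_inj[of 0]) (simp add: l(1) deg_0 rv_0)
    then show ?thesis using l(2) by (simp add: a.G_zero)
  qed
  have T0b: "br x y = 0" if "x \<in> T0" "y \<in> T0" for x y
  proof -
    have "br' (\<phi> x) (\<phi> y) = 0" by (rule b.toral_abelian[OF T1]) (use that in \<open>auto simp: T0_def\<close>)
    then show ?thesis by (simp add: \<phi>_br[symmetric] \<phi>_eq_0)
  qed
  have T0s: "a.subspace T0"
    unfolding T0_def by (rule a.subspaceI) (simp_all add: \<phi>_0 \<phi>_add \<phi>_sc b.subspace_0[OF Ts(1)]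
        b.subspace_add[OF Ts(1)] b.subspace_scale[OF Ts(1)])
  have "ad_diag_subalg sc br a.S T0"
    unfolding ad_diag_subalg_def
  proof (intro conjI ballI)
    show "a.subspace T0" by (rule T0s)
    show "T0 \<subseteq> a.S" using T0S by blast
    show "br x y \<in> T0" if "x \<in> T0" "y \<in> T0" for x y using T0b[OF that] a.subspace_0[OF T0s] by simp
    fix t assume t: "t \<in> T0"
    have "b.diagble (br' (\<phi> t))"
      by (rule b.ad_diag_diagble) (use t T Ts(2) in \<open>auto simp: T0_def ad_diag_subalg_def\<close>)
    then show "ad_diag_on sc br a.S t" by (intro a.diagble_ad_diag T0S[OF t] diagble_\<phi>)
  qed
  moreover have "H \<subseteq> T0" using HT by (auto simp: T0_def)
  ultimately have TH: "T0 = H" by (rule a.H_maximal)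
  have "y \<in> \<phi> ` H" if "y \<in> T" for y
  proof -
    have "inv \<phi> y \<in> H" using that TH by (auto simp: T0_def)
    then show ?thesis by (intro image_eqI[of _ _ "inv \<phi> y"]) simp_all
  qed
  then show "T = \<phi> ` H" using HT by blast
qed

text \<open>Composing with an automorphism that commutes with \<sigma>' leaves the conjugation
  identity intact, and conjugacy provides one that carries \<phi> H to H'.\<close>

lemma adjust_cartan: "\<exists>\<phi>'. conj_pair sc br \<sigma> m H sc' br' \<sigma>' m' H' z s M \<phi>' \<tau> \<and> \<phi>' ` H = H'"
proof -
  obtain \<theta> where \<theta>: "b.saut \<theta>" "\<theta> ` (\<phi> ` H) = H'" using b.cartan_conjugate[OF image_cartan b.cartan] by blast
  have \<theta>a: "b.aut \<theta>" and \<theta>\<sigma>: "\<And>i x. \<theta> (\<sigma>' i x) = \<sigma>' i (\<theta> x)" using \<theta>(1) by (auto simp: b.saut_def)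
  define \<phi>' where "\<phi>' = \<theta> \<circ> \<phi>"
  have bij: "bij \<phi>'" unfolding \<phi>'_def by (rule bij_comp[OF \<phi>_bij b.aut_bij[OF \<theta>a]])
  have iso': "lie_iso sc br sc' br' \<phi>'"
    unfolding lie_iso_def using bij
    by (simp add: \<phi>'_def \<phi>_add \<phi>_sc \<phi>_br b.lin_add[OF b.aut_lin[OF \<theta>a]] b.lin_sc[OF b.aut_lin[OF \<theta>a]] b.aut_br[OF \<theta>a])
  have "\<sigma>' j y = (\<phi>' \<circ> tuple_pow (\<lambda>i. \<tau> i \<circ> \<sigma> i) M j \<circ> inv \<phi>') y" for j y
  proof -
    have y: "\<phi>' (inv \<phi>' y) = y" using bij by (simp add: bij_is_surj surj_f_inv_f)
    have "\<sigma>' j y = \<sigma>' j (\<theta> (\<phi> (inv \<phi>' y)))" using y by (simp add: \<phi>'_def)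
    then show ?thesis by (simp add: \<theta>\<sigma>[symmetric] \<sigma>_\<phi> \<phi>'_def)
  qed
  then have "conj_pair sc br \<sigma> m H sc' br' \<sigma>' m' H' z s M \<phi>' \<tau>"
    using s GL iso' tw by unfold_locales (auto simp: fun_eq_iff)
  moreover have "\<phi>' ` H = H'" using \<theta>(2) by (simp add: \<phi>'_def image_comp)
  ultimately show ?thesis by blast
qed

end

lemma gen_subgroup_image:
  assumes f: "\<And>x y. x \<in> gen_subgroup S \<Longrightarrow> y \<in> gen_subgroup S \<Longrightarrow> f (x - y) = f x - f y"
  shows "f ` gen_subgroup S = gen_subgroup (f ` S)"
proof
  have f0: "f 0 = 0" using f[OF gen_subgroup_0 gen_subgroup_0] by simp
  have "gen_subgroup S \<subseteq> {x \<in> gen_subgroup S. f x \<in> gen_subgroup (f ` S)}"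
    by (rule gen_subgroup_subset) (auto simp: f f0 gen_subgroup_base gen_subgroup_0 gen_subgroup_diff)
  then show "f ` gen_subgroup S \<subseteq> gen_subgroup (f ` S)" by blast
  show "gen_subgroup (f ` S) \<subseteq> f ` gen_subgroup S"
  proof (rule gen_subgroup_subset)
    show "f ` S \<subseteq> f ` gen_subgroup S" using gen_subgroup_base by blast
    show "0 \<in> f ` gen_subgroup S" using f0 gen_subgroup_0 by (metis image_eqI)
    fix x y assume "x \<in> f ` gen_subgroup S" "y \<in> f ` gen_subgroup S"
    then obtain u v where "u \<in> gen_subgroup S" "v \<in> gen_subgroup S" "x = f u" "y = f v" by blast
    then show "x - y \<in> f ` gen_subgroup S"
      by (intro image_eqI[of _ _ "u - v"]) (simp_all add: f gen_subgroup_diff)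
  qed
qed

section \<open>The graded isomorphism of loop algebras\<close>

locale conj_cartan = conj_pair sc br \<sigma> m H sc' br' \<sigma>' m' H' z s M \<phi> \<tau>
  for sc :: "'k::field_char_0 \<Rightarrow> 'v::ab_group_add \<Rightarrow> 'v" and br
    and \<sigma> :: "'n::finite \<Rightarrow> 'v \<Rightarrow> 'v" and m H
    and sc' :: "'k \<Rightarrow> 'w::ab_group_add \<Rightarrow> 'w" and br'
    and \<sigma>' :: "'n \<Rightarrow> 'w \<Rightarrow> 'w" and m' H' and z and s and M and \<phi> and \<tau> +
  assumes image_H: "\<phi> ` H = H'"
begin

text \<open>Transport of weights along \<phi>, extended by 0 outside H' as \<open>hdual\<close>
  demands; in this locale the name no longer means the trace.\<close>

definition tr :: "('v \<Rightarrow> 'k) \<Rightarrow> 'w \<Rightarrow> 'k" where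
  "tr \<alpha> = (\<lambda>y. if y \<in> H' then \<alpha> (inv \<phi> y) else 0)"

lemma inv_H: "y \<in> H' \<Longrightarrow> inv \<phi> y \<in> H" and \<phi>_H': "h \<in> H \<Longrightarrow> \<phi> h \<in> H'"
  using image_H by auto

lemma inv_\<phi>_sc: "inv \<phi> (sc' c y) = sc c (inv \<phi> y)"
  using inv_\<phi>[of "sc c (inv \<phi> y)"] by (simp add: \<phi>_sc)

lemma inv_\<phi>_nonzero: assumes "y \<noteq> 0" shows "inv \<phi> y \<noteq> 0"
proof
  assume "inv \<phi> y = 0"
  then have "\<phi> (inv \<phi> y) = \<phi> 0" by (simp only:)
  then show False using assms by (simp add: \<phi>_0)
qed

lemma tr_\<phi>: "h \<in> H \<Longrightarrow> tr \<alpha> (\<phi> h) = \<alpha> h"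
  by (simp add: tr_def \<phi>_H')

lemma tr_W: "\<phi> x \<in> b.W (tr \<alpha>) \<longleftrightarrow> x \<in> a.W \<alpha>"
proof -
  have e: "br' (\<phi> h) (\<phi> x) = sc' (\<alpha> h) (\<phi> x) \<longleftrightarrow> br h x = sc (\<alpha> h) x" for h
    by (simp only: \<phi>_br[symmetric] \<phi>_sc[symmetric] \<phi>_eq)
  have "\<phi> x \<in> b.W (tr \<alpha>) \<longleftrightarrow> (\<forall>h\<in>H. br' (\<phi> h) (\<phi> x) = sc' (tr \<alpha> (\<phi> h)) (\<phi> x))"
    unfolding wspace_def image_H[symmetric] by blast
  also have "\<dots> \<longleftrightarrow> (\<forall>h\<in>H. br h x = sc (\<alpha> h) x)" by (rule ball_cong[OF refl]) (simp only: tr_\<phi> e)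
  finally show ?thesis by (simp add: wspace_def)
qed

lemma tr_hdual: "\<alpha> \<in> hdual sc H \<Longrightarrow> tr \<alpha> \<in> hdual sc' H'"
  unfolding hdual_def tr_def
  by (auto simp: inv_\<phi>_add inv_\<phi>_sc inv_H b.subspace_add[OF b.subspace_H] b.subspace_scale[OF b.subspace_H])

lemma tr_add: "tr (\<alpha> + \<beta>) = tr \<alpha> + tr \<beta>"
  by (simp add: tr_def fun_eq_iff)

lemma tr_diff: "tr (\<alpha> - \<beta>) = tr \<alpha> - tr \<beta>"
  by (simp add: tr_def fun_eq_iff)

lemma tr_inj: assumes "\<alpha> \<in> hdual sc H" "\<beta> \<in> hdual sc H" "tr \<alpha> = tr \<beta>" shows "\<alpha> = \<beta>"
proof (rule a.hdual_eqI[OF assms(1,2)])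
  fix h assume "h \<in> H"
  then show "\<alpha> h = \<beta> h" using tr_\<phi>[of h \<alpha>] tr_\<phi>[of h \<beta>] assms(3) by simp
qed

lemma tr_R: assumes "\<alpha> \<in> a.R" shows "tr \<alpha> \<in> b.R"
proof -
  obtain x where "x \<in> a.W \<alpha>" "x \<noteq> 0" using a.R_W[OF assms] by blast
  then show ?thesis using b.W_R[OF tr_hdual[OF a.R_hdual[OF assms]], of "\<phi> x"] by (simp add: tr_W \<phi>_eq_0)
qed

lemma tr_R_surj: assumes \<beta>: "\<beta> \<in> b.R" shows "\<exists>\<alpha>\<in>a.R. tr \<alpha> = \<beta>"
proof -
  define \<alpha> where "\<alpha> = (\<lambda>x. if x \<in> H then \<beta> (\<phi> x) else 0)"
  have \<beta>h: "\<beta> \<in> hdual sc' H'" by (rule b.R_hdual[OF \<beta>])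
  have \<alpha>h: "\<alpha> \<in> hdual sc H"
    using \<beta>h unfolding hdual_def \<alpha>_def
    by (auto simp: \<phi>_add \<phi>_sc \<phi>_H' a.subspace_add[OF a.subspace_H] a.subspace_scale[OF a.subspace_H])
  have t: "tr \<alpha> = \<beta>"
    by (rule b.hdual_eqI[OF tr_hdual[OF \<alpha>h] \<beta>h]) (simp add: tr_def \<alpha>_def inv_H)
  obtain y where y: "y \<in> b.W \<beta>" "y \<noteq> 0" using b.R_W[OF \<beta>] by blast
  have "inv \<phi> y \<in> a.W \<alpha>" using y(1) tr_W[of "inv \<phi> y" \<alpha>] by (simp add: t)
  moreover have "inv \<phi> y \<noteq> 0" by (rule inv_\<phi>_nonzero[OF y(2)])
  ultimately show ?thesis using a.W_R[OF \<alpha>h] t by blast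
qed

text \<open>The floor only brings \<open>deg\<close> into the integers; the two agree on \<Lambda>,
  where \<open>deg\<close> is integral.\<close>

definition dg :: "('v \<Rightarrow> 'k) \<Rightarrow> int^'n \<Rightarrow> int^'n" where "dg \<alpha> l = (\<chi> i. \<lfloor>deg \<alpha> l $ i\<rfloor>)"

lemma dg_eq: "deg \<alpha> l = rv \<mu> \<Longrightarrow> dg \<alpha> l = \<mu>"
  by (simp add: dg_def vec_eq_iff)

lemma dg_hom:
  assumes "\<alpha> \<in> a.R" "x \<in> a.W \<alpha>" "x \<in> a.G l" "x \<noteq> 0" shows "rv (dg \<alpha> l) = deg \<alpha> l"
proof -
  obtain \<mu> where \<mu>: "deg \<alpha> l = rv \<mu>" using deg_integral[OF assms] ..
  show ?thesis by (simp only: dg_eq[OF \<mu>] \<mu>)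
qed

lemma dg_G:
  assumes x: "\<alpha> \<in> a.R" "x \<in> a.W \<alpha>" "x \<in> a.G l" shows "\<phi> x \<in> b.G (dg \<alpha> l)"
proof (cases "x = 0")
  case True
  then show ?thesis by (simp add: \<phi>_0 b.subspace_0[OF b.subspace_G])
next
  case False
  then show ?thesis by (intro deg_G[OF x]) (simp add: dg_hom[OF x])
qed

text \<open>The degree of the image depends on the weight, so each coefficient is split by the
  weight projections before it is placed.\<close>

definition \<Phi> :: "(int^'n \<Rightarrow> 'v) \<Rightarrow> int^'n \<Rightarrow> 'w" where
  "\<Phi> f = (\<Sum>l\<in>{l. f l \<noteq> 0}. \<Sum>\<alpha>\<in>a.R. single (dg \<alpha> l) (\<phi> (a.pr \<alpha> (f l))))"

lemma pr0: "a.pr \<alpha> 0 = 0" by (rule a.lin_0[OF a.lin_pr])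

lemma \<Phi>_eq: "finite I \<Longrightarrow> {l. f l \<noteq> 0} \<subseteq> I \<Longrightarrow>
    \<Phi> f = (\<Sum>l\<in>I. \<Sum>\<alpha>\<in>a.R. single (dg \<alpha> l) (\<phi> (a.pr \<alpha> (f l))))"
  unfolding \<Phi>_def by (rule sum.mono_neutral_left) (auto simp: pr0 \<phi>_0)

lemma \<Phi>_add: assumes "f \<in> a.L" "g \<in> a.L" shows "\<Phi> (f + g) = \<Phi> f + \<Phi> g"
proof -
  let ?I = "{l. f l \<noteq> 0} \<union> {l. g l \<noteq> 0}"
  have I: "finite ?I" using assms by (simp add: a.L_iff)
  have s: "{l. (f + g) l \<noteq> 0} \<subseteq> ?I" by auto
  show ?thesis
    unfolding \<Phi>_eq[OF I s] \<Phi>_eq[OF I Un_upper1] \<Phi>_eq[OF I Un_upper2] sum.distrib[symmetric]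
    by (intro sum.cong refl) (simp only: plus_fun_apply a.lin_add[OF a.lin_pr] \<phi>_add single_add)
qed

lemma \<Phi>_sc: assumes "f \<in> a.L" shows "\<Phi> (lsc sc c f) = lsc sc' c (\<Phi> f)"
proof -
  have I: "finite {l. f l \<noteq> 0}" using assms by (simp add: a.L_iff)
  have s: "{l. lsc sc c f l \<noteq> 0} \<subseteq> {l. f l \<noteq> 0}" by (auto simp: lsc_def)
  have "\<Phi> (lsc sc c f) \<mu> = sc' c (\<Phi> f \<mu>)" for \<mu>
    unfolding \<Phi>_eq[OF I s] \<Phi>_def[of f] sum_apply b.scale_sum_right
    by (intro sum.cong refl) (simp add: single_apply lsc_def a.lin_sc[OF a.lin_pr] \<phi>_sc)
  then show ?thesis by (simp add: lsc_def fun_eq_iff)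
qed

lemma \<Phi>_0: "\<Phi> 0 = 0" by (simp add: \<Phi>_def)

lemma \<Phi>_sum: "(\<And>a. a \<in> I \<Longrightarrow> f a \<in> a.L) \<Longrightarrow> \<Phi> (\<Sum>a\<in>I. f a) = (\<Sum>a\<in>I. \<Phi> (f a))"
  by (induction I rule: infinite_finite_induct) (simp_all add: \<Phi>_0 \<Phi>_add a.L_sum)

lemma \<Phi>_single: assumes \<alpha>: "\<alpha> \<in> a.R" and x: "x \<in> a.W \<alpha>" shows "\<Phi> (single l x) = single (dg \<alpha> l) (\<phi> x)"
proof -
  have I: "finite {l}" and s: "{k. single l x k \<noteq> 0} \<subseteq> {l}" by (auto simp: single_apply)
  have "\<Phi> (single l x) = (\<Sum>\<beta>\<in>a.R. single (dg \<beta> l) (\<phi> (a.pr \<beta> (single l x l))))"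
    unfolding \<Phi>_eq[OF I s] by simp
  also have "single l x l = x" by (simp add: single_apply)
  also have "(\<Sum>\<beta>\<in>a.R. single (dg \<beta> l) (\<phi> (a.pr \<beta> x))) = (\<Sum>\<beta>\<in>a.R. if \<beta> = \<alpha> then single (dg \<alpha> l) (\<phi> x) else 0)"
    by (rule sum.cong[OF refl]) (auto simp: a.pr_on[OF \<alpha> x] \<phi>_0)
  also have "\<dots> = single (dg \<alpha> l) (\<phi> x)" using \<alpha> a.finite_R by simp
  finally show ?thesis .
qed

lemma \<Phi>_L: assumes f: "f \<in> a.L" shows "\<Phi> f \<in> b.L"
  unfolding \<Phi>_def
  by (intro b.L_sum b.L_single) (rule dg_G, assumption, erule a.pr_W, erule a.pr_G[OF a.L_G[OF f]])

text \<open>Additivity of \<open>dg\<close> in weight and degree is available when the bracket is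
  nonzero, because then all three degrees are integral; otherwise both sides vanish.\<close>

lemma dg_br:
  assumes x: "\<alpha> \<in> a.R" "x \<in> a.W \<alpha>" "x \<in> a.G l" and y: "\<beta> \<in> a.R" "y \<in> a.W \<beta>" "y \<in> a.G k"
  shows "\<Phi> (a.lb (single l x) (single k y)) = b.lb (\<Phi> (single l x)) (\<Phi> (single k y))"
proof (cases "br x y = 0")
  case True
  then have "br' (\<phi> x) (\<phi> y) = 0" by (simp add: \<phi>_br[symmetric] \<phi>_0)
  then show ?thesis
    by (simp only: a.lb_single True single_0 \<Phi>_0 \<Phi>_single[OF x(1,2)] \<Phi>_single[OF y(1,2)] b.lb_single)
next
  case False
  then have x0: "x \<noteq> 0" and y0: "y \<noteq> 0" by (auto simp: a.br_0_left a.br_0_right)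
  have Q: "\<alpha> \<in> a.Q" "\<beta> \<in> a.Q" using x(1) y(1) a.R_Q by auto
  have xy: "br x y \<in> a.W (\<alpha> + \<beta>)" by (rule a.br_W[OF x(2) y(2)])
  have R: "\<alpha> + \<beta> \<in> a.R" by (rule a.Q_W[OF a.Q_add[OF Q] xy False])
  have "deg (\<alpha> + \<beta>) (l + k) = rv (dg \<alpha> l + dg \<beta> k)"
    by (simp only: deg_add[OF Q] rv_add dg_hom[OF x x0] dg_hom[OF y y0])
  then have "dg (\<alpha> + \<beta>) (l + k) = dg \<alpha> l + dg \<beta> k" by (rule dg_eq)
  then show ?thesis
    by (simp only: a.lb_single \<Phi>_single[OF R xy] \<Phi>_single[OF x(1,2)] \<Phi>_single[OF y(1,2)] b.lb_single \<phi>_br)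
qed

lemma \<Phi>_lb: assumes f: "f \<in> a.L" and g: "g \<in> a.L" shows "\<Phi> (a.lb f g) = b.lb (\<Phi> f) (\<Phi> g)"
  using f
proof (induction f rule: a.L_induct)
  case zero
  show ?case by (simp only: a.lb_0_left \<Phi>_0 b.lb_0_left)
next
  case (add f f')
  then show ?case by (simp only: a.lb_add_left \<Phi>_add a.L_lb g b.lb_add_left \<Phi>_L)
next
  case (single \<alpha> l x)
  note x = single and xL = a.L_single[OF single(3)]
  show ?case using g
  proof (induction g rule: a.L_induct)
    case zero
    show ?case by (simp only: a.lb_0_right \<Phi>_0 b.lb_0_right)
  next
    case (add g g')
    then show ?case by (simp only: a.lb_add_right \<Phi>_add a.L_lb xL b.lb_add_right)
  next
    case (single \<beta> k y)
    show ?case by (rule dg_br[OF x single])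
  qed
qed

text \<open>Within a weight, distinct degrees with nonzero components have distinct images, so the
  weight \<alpha> part of the coefficient at dg \<alpha> l comes from degree l alone.\<close>

lemma \<Phi>_inj: assumes f: "f \<in> a.L" and z: "\<Phi> f = 0" shows "f = 0"
proof -
  have "a.pr \<alpha> (f l) = 0" if \<alpha>: "\<alpha> \<in> a.R" for \<alpha> l
  proof (rule ccontr)
    assume ne: "a.pr \<alpha> (f l) \<noteq> 0"
    have hom: "a.pr \<alpha> (f k) \<in> a.W \<alpha>" "a.pr \<alpha> (f k) \<in> a.G k" for k
      using a.pr_W[OF \<alpha>] a.pr_G[OF a.L_G[OF f] \<alpha>] by auto
    have "f l \<noteq> 0" using ne by (auto simp: pr0)
    have "0 = a.pr \<alpha> (inv \<phi> (\<Phi> f (dg \<alpha> l)))" by (simp add: z inv_\<phi>_0 pr0)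
    also have "\<dots> = (\<Sum>k\<in>{k. f k \<noteq> 0}. \<Sum>\<beta>\<in>a.R. a.pr \<alpha> (inv \<phi> (single (dg \<beta> k) (\<phi> (a.pr \<beta> (f k))) (dg \<alpha> l))))"
      by (simp only: \<Phi>_def sum_apply inv_\<phi>_sum a.lin_sum[OF a.lin_pr])
    also have "\<dots> = (\<Sum>k\<in>{k. f k \<noteq> 0}. if k = l then a.pr \<alpha> (f l) else 0)"
    proof (rule sum.cong[OF refl])
      fix k
      have "(\<Sum>\<beta>\<in>a.R. a.pr \<alpha> (inv \<phi> (single (dg \<beta> k) (\<phi> (a.pr \<beta> (f k))) (dg \<alpha> l)))) =
          (\<Sum>\<beta>\<in>a.R. if \<beta> = \<alpha> then (if dg \<alpha> k = dg \<alpha> l then a.pr \<alpha> (f k) else 0) else 0)"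
      proof (rule sum.cong[OF refl])
        fix \<beta> assume \<beta>: "\<beta> \<in> a.R"
        have "a.pr \<alpha> (inv \<phi> (single (dg \<beta> k) (\<phi> (a.pr \<beta> (f k))) (dg \<alpha> l))) =
            (if dg \<alpha> l = dg \<beta> k then a.pr \<alpha> (a.pr \<beta> (f k)) else 0)"
          by (simp add: single_apply inv_\<phi>_0 pr0)
        then show "a.pr \<alpha> (inv \<phi> (single (dg \<beta> k) (\<phi> (a.pr \<beta> (f k))) (dg \<alpha> l))) =
            (if \<beta> = \<alpha> then (if dg \<alpha> k = dg \<alpha> l then a.pr \<alpha> (f k) else 0) else 0)"
          using a.pr_on[OF \<beta> a.pr_W[OF \<beta>], of \<alpha> "f k"] by (cases "dg \<alpha> l = dg \<beta> k"; cases "\<beta> = \<alpha>") simp_all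
      qed
      also have "\<dots> = (if dg \<alpha> k = dg \<alpha> l then a.pr \<alpha> (f k) else 0)" using \<alpha> a.finite_R by simp
      also have "\<dots> = (if k = l then a.pr \<alpha> (f l) else 0)"
      proof (cases "k = l \<or> a.pr \<alpha> (f k) = 0")
        case True
        then show ?thesis using ne by auto
      next
        case False
        have "dg \<alpha> k \<noteq> dg \<alpha> l"
        proof
          assume "dg \<alpha> k = dg \<alpha> l"
          then have "deg \<alpha> k = deg \<alpha> l" using dg_hom[OF \<alpha> hom, of k] dg_hom[OF \<alpha> hom, of l] ne False by simp
          then show False using deg_inj False by blast
        qed
        then show ?thesis using False by simp
      qed
      finally show "(\<Sum>\<beta>\<in>a.R. a.pr \<alpha> (inv \<phi> (single (dg \<beta> k) (\<phi> (a.pr \<beta> (f k))) (dg \<alpha> l)))) =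
          (if k = l then a.pr \<alpha> (f l) else 0)" .
    qed
    also have "\<dots> = a.pr \<alpha> (f l)" using f \<open>f l \<noteq> 0\<close> by (simp add: a.L_iff)
    finally show False using ne by simp
  qed
  then have "(\<Sum>\<alpha>\<in>a.R. a.pr \<alpha> (f l)) = 0" for l by simp
  then show ?thesis by (simp add: a.pr_sum fun_eq_iff)
qed

lemma \<Phi>_surj: assumes g: "g \<in> b.L" shows "\<exists>f\<in>a.L. \<Phi> f = g"
  using g
proof (induction g rule: b.L_induct)
  case zero
  show ?case using \<Phi>_0 a.L_0 by blast
next
  case (add g g')
  then obtain f f' where "f \<in> a.L" "f' \<in> a.L" "\<Phi> f = g" "\<Phi> f' = g'" by blast
  then show ?case by (intro bexI[of _ "f + f'"]) (simp_all only: \<Phi>_add a.L_add)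
next
  case (single \<beta> \<mu> y)
  show ?case
  proof (cases "y = 0")
    case True
    then show ?thesis using \<Phi>_0 a.L_0 by (metis single_0)
  next
    case False
    obtain \<alpha> where \<alpha>: "\<alpha> \<in> a.R" "tr \<alpha> = \<beta>" using tr_R_surj[OF single(1)] by blast
    have W: "inv \<phi> y \<in> a.W \<alpha>" using single(2) tr_W[of "inv \<phi> y" \<alpha>] by (simp add: \<alpha>)
    note ne = inv_\<phi>_nonzero[OF False]
    obtain l where l: "deg \<alpha> l = rv \<mu>" "inv \<phi> y \<in> a.G l" using deg_lift[OF \<alpha>(1) W _ ne, of \<mu>] single(3) by auto
    have "\<Phi> (single l (inv \<phi> y)) = single \<mu> y" by (simp add: \<Phi>_single[OF \<alpha>(1) W] dg_eq[OF l(1)])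
    then show ?thesis using a.L_single[OF l(2)] by blast
  qed
qed

lemma \<Phi>_iso: "alg_iso a.L (lsc sc) a.lb b.L (lsc sc') b.lb \<Phi>"
  unfolding alg_iso_def
proof (intro conjI ballI allI)
  show "bij_betw \<Phi> a.L b.L"
  proof (rule bij_betw_imageI)
    show "inj_on \<Phi> a.L"
    proof (rule inj_onI)
      fix f g assume f: "f \<in> a.L" and g: "g \<in> a.L" and e: "\<Phi> f = \<Phi> g"
      have g': "lsc sc (- 1) g \<in> a.L" by (rule a.L_sc[OF g])
      have "\<Phi> (f + lsc sc (- 1) g) = \<Phi> g + lsc sc' (- 1) (\<Phi> g)"
        by (simp only: \<Phi>_add[OF f g'] \<Phi>_sc[OF g] e)
      also have "\<dots> = 0" by (simp add: lsc_def fun_eq_iff)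
      finally have "\<Phi> (f + lsc sc (- 1) g) = 0" .
      then have "f + lsc sc (- 1) g = 0" by (rule \<Phi>_inj[OF a.L_add[OF f g']])
      then show "f = g" by (simp add: lsc_def fun_eq_iff)
    qed
    show "\<Phi> ` a.L = b.L" using \<Phi>_L \<Phi>_surj by blast
  qed
qed (simp_all only: \<Phi>_add \<Phi>_sc \<Phi>_lb)

text \<open>Integrality of \<open>deg\<close> holds on the support by \<open>deg_integral\<close>
  and passes to the generated group by additivity.\<close>

lemma \<Lambda>_dg: assumes "p \<in> a.\<Lambda>" shows "fst p \<in> a.Q \<and> rv (dg (fst p) (snd p)) = deg (fst p) (snd p)"
proof -
  have "a.\<Lambda> \<subseteq> {p. fst p \<in> a.Q \<and> rv (dg (fst p) (snd p)) = deg (fst p) (snd p)}"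
    unfolding a.\<Lambda>_def
  proof (rule gen_subgroup_subset)
    show "gsupp (a.Q \<times> UNIV) a.cmp \<subseteq> {p. fst p \<in> a.Q \<and> rv (dg (fst p) (snd p)) = deg (fst p) (snd p)}"
    proof
      fix p assume p: "p \<in> gsupp (a.Q \<times> UNIV) a.cmp"
      obtain \<alpha> l where pe: "p = (\<alpha>, l)" by (cases p)
      then have Q: "\<alpha> \<in> a.Q" and "a.cmp (\<alpha>, l) \<noteq> {0}" using p by (auto simp: gsupp_def)
      then have "\<exists>x\<in>a.W \<alpha> \<inter> a.G l. x \<noteq> 0" by (simp only: a.cmp_nonzero_iff)
      then obtain x where x: "x \<in> a.W \<alpha>" "x \<in> a.G l" "x \<noteq> 0" by blast
      then show "p \<in> {p. fst p \<in> a.Q \<and> rv (dg (fst p) (snd p)) = deg (fst p) (snd p)}"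
        using dg_hom[OF a.Q_W[OF Q x(1,3)] x] Q by (simp add: pe)
    qed
    show "0 \<in> {p. fst p \<in> a.Q \<and> rv (dg (fst p) (snd p)) = deg (fst p) (snd p)}"
      using dg_eq[of 0 0 0] by (simp add: a.Q_0 deg_0 rv_0)
    fix p q assume p: "p \<in> {p. fst p \<in> a.Q \<and> rv (dg (fst p) (snd p)) = deg (fst p) (snd p)}"
      and q: "q \<in> {p. fst p \<in> a.Q \<and> rv (dg (fst p) (snd p)) = deg (fst p) (snd p)}"
    have d: "deg (fst p - fst q) (snd p - snd q) = rv (dg (fst p) (snd p) - dg (fst q) (snd q))"
      using p q by (simp add: deg_diff rv_diff)
    show "p - q \<in> {p. fst p \<in> a.Q \<and> rv (dg (fst p) (snd p)) = deg (fst p) (snd p)}"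
      using p q by (simp add: a.Q_diff dg_eq[OF d] d)
  qed
  from subsetD[OF this assms] show ?thesis by (rule CollectD)
qed

definition \<psi> :: "('v \<Rightarrow> 'k) \<times> (int^'n) \<Rightarrow> ('w \<Rightarrow> 'k) \<times> (int^'n)" where
  "\<psi> p = (tr (fst p), dg (fst p) (snd p))"

lemma \<psi>_diff: assumes p: "p \<in> a.\<Lambda>" and q: "q \<in> a.\<Lambda>" shows "\<psi> (p - q) = \<psi> p - \<psi> q"
proof -
  have "deg (fst p - fst q) (snd p - snd q) = rv (dg (fst p) (snd p) - dg (fst q) (snd q))"
    using \<Lambda>_dg[OF p] \<Lambda>_dg[OF q] by (simp add: deg_diff rv_diff)
  from dg_eq[OF this] show ?thesis by (simp add: \<psi>_def tr_diff)
qed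

lemma \<Phi>_cmp:
  assumes Q: "\<alpha> \<in> a.Q" and d: "rv (dg \<alpha> l) = deg \<alpha> l" shows "\<Phi> ` a.cmp (\<alpha>, l) = b.cmp (tr \<alpha>, dg \<alpha> l)"
proof
  show "\<Phi> ` a.cmp (\<alpha>, l) \<subseteq> b.cmp (tr \<alpha>, dg \<alpha> l)"
  proof
    fix g assume "g \<in> \<Phi> ` a.cmp (\<alpha>, l)"
    then obtain f where f: "g = \<Phi> f" "f \<in> a.cmp (\<alpha>, l)" by (rule imageE)
    from f(2)[unfolded a.cmp_iff] obtain x where x': "x \<in> a.W \<alpha> \<inter> a.G l" "f = single l x" by (rule bexE)
    then have x: "x \<in> a.W \<alpha>" "x \<in> a.G l" and g: "g = \<Phi> (single l x)" by (simp_all add: f(1))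
    show "g \<in> b.cmp (tr \<alpha>, dg \<alpha> l)"
    proof (cases "x = 0")
      case True
      then show ?thesis by (simp add: g \<Phi>_0 b.cmp_0)
    next
      case False
      have R: "\<alpha> \<in> a.R" by (rule a.Q_W[OF Q x(1) False])
      have "\<phi> x \<in> b.W (tr \<alpha>) \<inter> b.G (dg \<alpha> l)" using dg_G[OF R x] x(1) by (simp add: tr_W)
      then show ?thesis unfolding g \<Phi>_single[OF R x(1)] b.cmp_iff by (rule rev_bexI) (rule refl)
    qed
  qed
  show "b.cmp (tr \<alpha>, dg \<alpha> l) \<subseteq> \<Phi> ` a.cmp (\<alpha>, l)"
  proof
    fix g assume "g \<in> b.cmp (tr \<alpha>, dg \<alpha> l)"
    from this[unfolded b.cmp_iff] obtain y where y': "y \<in> b.W (tr \<alpha>) \<inter> b.G (dg \<alpha> l)"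
      and g: "g = single (dg \<alpha> l) y" by (rule bexE)
    then have y: "y \<in> b.W (tr \<alpha>)" "y \<in> b.G (dg \<alpha> l)" by simp_all
    show "g \<in> \<Phi> ` a.cmp (\<alpha>, l)"
    proof (cases "y = 0")
      case True
      then have "g = \<Phi> 0" by (simp add: g \<Phi>_0)
      then show ?thesis by (rule image_eqI[OF _ a.cmp_0])
    next
      case False
      have W: "inv \<phi> y \<in> a.W \<alpha>" using y(1) tr_W[of "inv \<phi> y" \<alpha>] by simp
      note ne = inv_\<phi>_nonzero[OF False]
      have R: "\<alpha> \<in> a.R" by (rule a.Q_W[OF Q W ne])
      obtain l' where l': "deg \<alpha> l' = rv (dg \<alpha> l)" "inv \<phi> y \<in> a.G l'"
        using deg_lift[OF R W _ ne, of "dg \<alpha> l"] y(2) by auto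
      have "l' = l" by (rule deg_inj[of \<alpha>]) (simp only: l'(1) d)
      then have c: "single l (inv \<phi> y) \<in> a.cmp (\<alpha>, l)" using W l'(2) a.cmp_iff by blast
      have e: "g = \<Phi> (single l (inv \<phi> y))" by (simp add: \<Phi>_single[OF R W] g)
      show ?thesis unfolding e by (rule imageI[OF c])
    qed
  qed
qed

lemma \<psi>_gsupp: "\<psi> ` gsupp (a.Q \<times> UNIV) a.cmp = gsupp (b.Q \<times> UNIV) b.cmp"
proof
  show "\<psi> ` gsupp (a.Q \<times> UNIV) a.cmp \<subseteq> gsupp (b.Q \<times> UNIV) b.cmp"
  proof
    fix q assume "q \<in> \<psi> ` gsupp (a.Q \<times> UNIV) a.cmp"
    then obtain \<alpha> l where q: "q = \<psi> (\<alpha>, l)" and Q: "\<alpha> \<in> a.Q" and "a.cmp (\<alpha>, l) \<noteq> {0}" by (auto simp: gsupp_def)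
    then have "\<exists>x\<in>a.W \<alpha> \<inter> a.G l. x \<noteq> 0" by (simp only: a.cmp_nonzero_iff)
    then obtain x where x: "x \<in> a.W \<alpha>" "x \<in> a.G l" "x \<noteq> 0" by blast
    have R: "\<alpha> \<in> a.R" by (rule a.Q_W[OF Q x(1,3)])
    have "\<phi> x \<in> b.W (tr \<alpha>) \<inter> b.G (dg \<alpha> l)" "\<phi> x \<noteq> 0" using dg_G[OF R x(1,2)] x by (simp_all add: tr_W \<phi>_eq_0)
    then have "\<exists>y\<in>b.W (tr \<alpha>) \<inter> b.G (dg \<alpha> l). y \<noteq> 0" by (intro bexI)
    then have "b.cmp (tr \<alpha>, dg \<alpha> l) \<noteq> {0}" by (simp only: b.cmp_nonzero_iff)
    then show "q \<in> gsupp (b.Q \<times> UNIV) b.cmp" using tr_R[OF R] b.R_Q by (auto simp: gsupp_def q \<psi>_def)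
  qed
  show "gsupp (b.Q \<times> UNIV) b.cmp \<subseteq> \<psi> ` gsupp (a.Q \<times> UNIV) a.cmp"
  proof
    fix q assume q: "q \<in> gsupp (b.Q \<times> UNIV) b.cmp"
    obtain \<beta> \<mu> where qe: "q = (\<beta>, \<mu>)" by (cases q)
    then have Q: "\<beta> \<in> b.Q" and "b.cmp (\<beta>, \<mu>) \<noteq> {0}" using q by (auto simp: gsupp_def)
    then have "\<exists>y\<in>b.W \<beta> \<inter> b.G \<mu>. y \<noteq> 0" by (simp only: b.cmp_nonzero_iff)
    then obtain y where y: "y \<in> b.W \<beta>" "y \<in> b.G \<mu>" "y \<noteq> 0" by blast
    obtain \<alpha> where \<alpha>: "\<alpha> \<in> a.R" "tr \<alpha> = \<beta>" using tr_R_surj[OF b.Q_W[OF Q y(1,3)]] by blast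
    have W: "inv \<phi> y \<in> a.W \<alpha>" using y(1) tr_W[of "inv \<phi> y" \<alpha>] by (simp add: \<alpha>)
    note ne = inv_\<phi>_nonzero[OF y(3)]
    obtain l where l: "deg \<alpha> l = rv \<mu>" "inv \<phi> y \<in> a.G l" using deg_lift[OF \<alpha>(1) W _ ne, of \<mu>] y(2) by auto
    have "(\<alpha>, l) \<in> gsupp (a.Q \<times> UNIV) a.cmp"
      using W l(2) ne \<alpha>(1) a.R_Q a.cmp_nonzero_iff[of \<alpha> l] by (auto simp: gsupp_def)
    moreover have "q = \<psi> (\<alpha>, l)" by (simp add: qe \<psi>_def \<alpha>(2) dg_eq[OF l(1)])
    ultimately show "q \<in> \<psi> ` gsupp (a.Q \<times> UNIV) a.cmp" by (rule image_eqI[rotated])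
  qed
qed

theorem conjugate_imp_support_iso:
  "support_iso a.L (lsc sc) a.lb (a.Q \<times> UNIV) a.cmp b.L (lsc sc') b.lb (b.Q \<times> UNIV) b.cmp"
  unfolding support_iso_def a.\<Lambda>_def[symmetric] b.\<Lambda>_def[symmetric]
proof (intro exI conjI ballI)
  show "alg_iso a.L (lsc sc) a.lb b.L (lsc sc') b.lb \<Phi>" by (rule \<Phi>_iso)
  show "group_iso_on a.\<Lambda> b.\<Lambda> \<psi>"
    unfolding group_iso_on_def
  proof
    have "inj_on \<psi> a.\<Lambda>"
    proof (rule inj_onI)
      fix p q assume p: "p \<in> a.\<Lambda>" and q: "q \<in> a.\<Lambda>" and e: "\<psi> p = \<psi> q"
      have f: "fst p = fst q"
        by (rule tr_inj) (use \<Lambda>_dg[OF p] \<Lambda>_dg[OF q] e a.Q_hdual in \<open>auto simp: \<psi>_def\<close>)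
      have "snd p = snd q"
        by (rule deg_inj[of "fst q"]) (use \<Lambda>_dg[OF p] \<Lambda>_dg[OF q] e f in \<open>simp add: \<psi>_def\<close>)
      then show "p = q" using f by (simp add: prod_eq_iff)
    qed
    moreover have "\<psi> ` a.\<Lambda> = b.\<Lambda>"
      unfolding a.\<Lambda>_def b.\<Lambda>_def \<psi>_gsupp[symmetric]
      by (rule gen_subgroup_image) (rule \<psi>_diff[unfolded a.\<Lambda>_def])
    ultimately show "bij_betw \<psi> a.\<Lambda> b.\<Lambda>" by (simp add: bij_betw_def)
    show "group_hom_on a.\<Lambda> \<psi>"
      unfolding group_hom_on_def
    proof (intro ballI)
      fix p q assume p: "p \<in> a.\<Lambda>" and q: "q \<in> a.\<Lambda>"
      show "\<psi> (p + q) = \<psi> p + \<psi> q" using \<psi>_diff[OF a.\<Lambda>_add[OF p q] q] by simp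
    qed
  qed
  fix p assume p: "p \<in> a.\<Lambda>"
  show "\<Phi> ` a.cmp p = b.cmp (\<psi> p)"
    using \<Phi>_cmp[of "fst p" "snd p"] \<Lambda>_dg[OF p] by (simp add: \<psi>_def)
qed

text \<open>This isolates what a regrading \<open>cmp3\<close> must satisfy for \<Phi> to become
  Z^n-graded: its nonzero elements of degree (\<alpha>, \<mu>) are those of original degree
  (\<alpha>, l) with deg \<alpha> l = \<mu>.\<close>

lemma \<Phi>_zn_comp:
  assumes P1: "\<And>\<alpha> f. \<alpha> \<in> a.Q \<Longrightarrow> f \<in> cmp3 (\<alpha>, \<mu>) \<Longrightarrow> f \<noteq> 0 \<Longrightarrow> \<exists>l. deg \<alpha> l = rv \<mu> \<and> f \<in> a.cmp (\<alpha>, l)"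
    and P2: "\<And>\<alpha> l f. \<alpha> \<in> a.Q \<Longrightarrow> deg \<alpha> l = rv \<mu> \<Longrightarrow> f \<in> a.cmp (\<alpha>, l) \<Longrightarrow> f \<noteq> 0 \<Longrightarrow> f \<in> cmp3 (\<alpha>, \<mu>)"
    and P0: "\<And>\<alpha>. \<alpha> \<in> a.Q \<Longrightarrow> 0 \<in> cmp3 (\<alpha>, \<mu>)"
  shows "\<Phi> ` zn_comp a.Q cmp3 \<mu> = zn_comp b.Q b.cmp \<mu>"
  unfolding b.zn_comp_cmp
proof
  show "\<Phi> ` zn_comp a.Q cmp3 \<mu> \<subseteq> single \<mu> ` b.G \<mu>"
  proof
    fix h assume "h \<in> \<Phi> ` zn_comp a.Q cmp3 \<mu>"
    then obtain k where k: "h = \<Phi> k" "k \<in> zn_comp a.Q cmp3 \<mu>" by (rule imageE)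
    from k(2) obtain g I where "k = sum g I" and I: "I \<subseteq> a.Q" "\<forall>\<alpha>\<in>I. g \<alpha> \<in> cmp3 (\<alpha>, \<mu>)"
      by (auto simp: zn_comp_def)
    then have h: "h = \<Phi> (sum g I)" by (simp only: k(1))
    have g: "g \<alpha> \<in> a.L \<and> (\<exists>y. y \<in> b.G \<mu> \<and> \<Phi> (g \<alpha>) = single \<mu> y)" if \<alpha>: "\<alpha> \<in> I" for \<alpha>
    proof (cases "g \<alpha> = 0")
      case True
      then show ?thesis
        by (intro conjI exI[of _ 0]) (simp_all only: a.L_0 \<Phi>_0 single_0 b.subspace_0[OF b.subspace_G])
    next
      case False
      have Q: "\<alpha> \<in> a.Q" using \<alpha> I(1) by blast
      obtain l where l: "deg \<alpha> l = rv \<mu>" "g \<alpha> \<in> a.cmp (\<alpha>, l)" using P1[OF Q _ False] I(2) \<alpha> by blast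
      from l(2)[unfolded a.cmp_iff] obtain x where x': "x \<in> a.W \<alpha> \<inter> a.G l" "g \<alpha> = single l x" by (rule bexE)
      then have x: "x \<in> a.W \<alpha>" "x \<in> a.G l" "g \<alpha> = single l x" by simp_all
      have R: "\<alpha> \<in> a.R" using a.Q_W[OF Q x(1)] False x(3) by auto
      have "\<Phi> (g \<alpha>) = single \<mu> (\<phi> x)" by (simp only: x(3) \<Phi>_single[OF R x(1)] dg_eq[OF l(1)])
      moreover have "\<phi> x \<in> b.G \<mu>" by (rule deg_G[OF R x(1,2) l(1)])
      ultimately show ?thesis using a.cmp_L[OF l(2)] by blast
    qed
    have "\<forall>\<alpha>\<in>I. \<exists>y. y \<in> b.G \<mu> \<and> \<Phi> (g \<alpha>) = single \<mu> y" by (intro ballI conjunct2[OF g])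
    from bchoice[OF this] obtain y where y: "\<forall>\<alpha>\<in>I. y \<alpha> \<in> b.G \<mu> \<and> \<Phi> (g \<alpha>) = single \<mu> (y \<alpha>)" ..
    have "h = (\<Sum>\<alpha>\<in>I. \<Phi> (g \<alpha>))" unfolding h by (rule \<Phi>_sum, rule conjunct1[OF g])
    also have "\<dots> = (\<Sum>\<alpha>\<in>I. single \<mu> (y \<alpha>))" by (rule sum.cong[OF refl]) (use y in simp)
    also have "\<dots> = single \<mu> (sum y I)" by (rule single_sum[symmetric])
    finally have e: "h = single \<mu> (sum y I)" .
    have "sum y I \<in> b.G \<mu>" by (rule b.subspace_sum[OF b.subspace_G]) (use y in simp)
    then show "h \<in> single \<mu> ` b.G \<mu>" unfolding e by (rule imageI)
  qed
  show "single \<mu> ` b.G \<mu> \<subseteq> \<Phi> ` zn_comp a.Q cmp3 \<mu>"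
  proof clarify
    fix y assume y: "y \<in> b.G \<mu>"
    define x where "x \<alpha> = a.pr \<alpha> (inv \<phi> y)" for \<alpha>
    have xW: "x \<alpha> \<in> a.W \<alpha>" "\<phi> (x \<alpha>) \<in> b.G \<mu>" if "\<alpha> \<in> a.R" for \<alpha>
      unfolding x_def by (rule a.pr_W[OF that]) (rule pr_b_G[OF _ that], simp add: y)
    have ex: "\<exists>f. f \<in> a.L \<and> f \<in> cmp3 (\<alpha>, \<mu>) \<and> \<Phi> f = single \<mu> (\<phi> (x \<alpha>))" if \<alpha>: "\<alpha> \<in> a.R" for \<alpha>
    proof (cases "x \<alpha> = 0")
      case True
      then show ?thesis by (intro exI[of _ 0] conjI) (simp_all only: a.L_0 P0[OF subsetD[OF a.R_Q \<alpha>]] \<Phi>_0 \<phi>_0 single_0)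
    next
      case False
      obtain l where l: "deg \<alpha> l = rv \<mu>" "x \<alpha> \<in> a.G l" using deg_lift[OF \<alpha> xW[OF \<alpha>] False] by blast
      have c: "single l (x \<alpha>) \<in> a.cmp (\<alpha>, l)" using xW(1)[OF \<alpha>] l(2) a.cmp_iff by blast
      have Q: "\<alpha> \<in> a.Q" using \<alpha> a.R_Q by blast
      have "single l (x \<alpha>) \<in> cmp3 (\<alpha>, \<mu>)" by (rule P2[OF Q l(1) c]) (simp add: False)
      moreover have "\<Phi> (single l (x \<alpha>)) = single \<mu> (\<phi> (x \<alpha>))" by (simp only: \<Phi>_single[OF \<alpha> xW(1)[OF \<alpha>]] dg_eq[OF l(1)])
      ultimately show ?thesis using a.cmp_L[OF c] by blast
    qed
    have "\<forall>\<alpha>\<in>a.R. \<exists>f. f \<in> a.L \<and> f \<in> cmp3 (\<alpha>, \<mu>) \<and> \<Phi> f = single \<mu> (\<phi> (x \<alpha>))" by (intro ballI ex)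
    from bchoice[OF this] obtain f where
      f: "\<forall>\<alpha>\<in>a.R. f \<alpha> \<in> a.L \<and> f \<alpha> \<in> cmp3 (\<alpha>, \<mu>) \<and> \<Phi> (f \<alpha>) = single \<mu> (\<phi> (x \<alpha>))" ..
    have "\<Phi> (sum f a.R) = (\<Sum>\<alpha>\<in>a.R. \<Phi> (f \<alpha>))" by (rule \<Phi>_sum) (use f in simp)
    also have "\<dots> = (\<Sum>\<alpha>\<in>a.R. single \<mu> (\<phi> (x \<alpha>)))" by (rule sum.cong[OF refl]) (use f in simp)
    also have "\<dots> = single \<mu> y" by (simp only: single_sum[symmetric] \<phi>_sum[symmetric] x_def a.pr_sum \<phi>_inv)
    finally have e: "\<Phi> (sum f a.R) = single \<mu> y" .
    have "sum f a.R \<in> zn_comp a.Q cmp3 \<mu>"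
      unfolding zn_comp_def using a.finite_R a.R_Q f by (intro CollectI exI[of _ a.R] exI[of _ f] conjI refl) auto
    then show "single \<mu> y \<in> \<Phi> ` zn_comp a.Q cmp3 \<mu>" unfolding e[symmetric] by (rule imageI)
  qed
qed

end

section \<open>Chains of regradings\<close>

context multiloop
begin

lemma \<Lambda>_cmp: "\<alpha> \<in> Q \<Longrightarrow> cmp (\<alpha>, l) \<noteq> {0} \<Longrightarrow> (\<alpha>, l) \<in> \<Lambda>"
  unfolding \<Lambda>_def gsupp_def by (intro gen_subgroup_base) simp

lemma \<Lambda>_fst: assumes "p \<in> \<Lambda>" shows "fst p \<in> Q"
proof -
  have "\<Lambda> \<subseteq> {p. fst p \<in> Q}"
    unfolding \<Lambda>_def by (rule gen_subgroup_subset) (auto simp: gsupp_def Q_0 Q_diff)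
  from subsetD[OF this assms] show ?thesis by simp
qed

text \<open>\<open>c\<close> is the grading obtained from the original one by moving degree \<open>(\<alpha>, l)\<close> to \<open>(\<alpha>, F(\<alpha>, l))\<close>.
  This holds along every chain of regradings.\<close>

definition regraded :: "(('v \<Rightarrow> 'k) \<times> (int^'n) \<Rightarrow> (int^'n \<Rightarrow> 'v) set) \<Rightarrow> (('v \<Rightarrow> 'k) \<times> (int^'n) \<Rightarrow> int^'n) \<Rightarrow> bool"
  where "regraded c F \<longleftrightarrow> (\<forall>p\<in>\<Lambda>. \<forall>q\<in>\<Lambda>. F (p + q) = F p + F q) \<and>
    (\<forall>\<alpha>\<in>Q. \<forall>l. cmp (\<alpha>, l) \<noteq> {0} \<longrightarrow> c (\<alpha>, F (\<alpha>, l)) = cmp (\<alpha>, l)) \<and>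
    (\<forall>\<alpha>\<in>Q. \<forall>\<mu>. c (\<alpha>, \<mu>) \<noteq> {0} \<longrightarrow> (\<exists>l. cmp (\<alpha>, l) \<noteq> {0} \<and> F (\<alpha>, l) = \<mu>))"

lemma regradedI:
  assumes "\<And>p q. p \<in> \<Lambda> \<Longrightarrow> q \<in> \<Lambda> \<Longrightarrow> F (p + q) = F p + F q"
    and "\<And>\<alpha> l. \<alpha> \<in> Q \<Longrightarrow> cmp (\<alpha>, l) \<noteq> {0} \<Longrightarrow> c (\<alpha>, F (\<alpha>, l)) = cmp (\<alpha>, l)"
    and "\<And>\<alpha> \<mu>. \<alpha> \<in> Q \<Longrightarrow> c (\<alpha>, \<mu>) \<noteq> {0} \<Longrightarrow> \<exists>l. cmp (\<alpha>, l) \<noteq> {0} \<and> F (\<alpha>, l) = \<mu>"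
  shows "regraded c F"
  unfolding regraded_def by (intro conjI ballI allI impI assms)

lemma
  assumes "regraded c F"
  shows regraded_add: "\<And>p q. p \<in> \<Lambda> \<Longrightarrow> q \<in> \<Lambda> \<Longrightarrow> F (p + q) = F p + F q"
    and regraded_cmp: "\<And>\<alpha> l. \<alpha> \<in> Q \<Longrightarrow> cmp (\<alpha>, l) \<noteq> {0} \<Longrightarrow> c (\<alpha>, F (\<alpha>, l)) = cmp (\<alpha>, l)"
    and regraded_ex: "\<And>\<alpha> \<mu>. \<alpha> \<in> Q \<Longrightarrow> c (\<alpha>, \<mu>) \<noteq> {0} \<Longrightarrow> \<exists>l. cmp (\<alpha>, l) \<noteq> {0} \<and> F (\<alpha>, l) = \<mu>"
  using assms unfolding regraded_def by simp_all

lemma regraded_0: assumes r: "regraded c F" and \<alpha>: "\<alpha> \<in> Q" shows "0 \<in> c (\<alpha>, \<mu>)"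
proof (cases "c (\<alpha>, \<mu>) = {0}")
  case False
  from regraded_ex[OF r \<alpha> False] obtain l where l: "cmp (\<alpha>, l) \<noteq> {0}" "F (\<alpha>, l) = \<mu>"
    by (elim exE conjE)
  from regraded_cmp[OF r \<alpha> l(1)] show ?thesis by (simp add: l(2) cmp_0)
qed simp

lemma regraded_diff: assumes r: "regraded c F" and p: "p \<in> \<Lambda>" and q: "q \<in> \<Lambda>" shows "F (p - q) = F p - F q"
  using regraded_add[OF r \<Lambda>_diff[OF p q] q] by simp

lemma regraded_init: "regraded cmp snd"
  by (rule regradedI) auto

text \<open>\<open>regrade_s\<close> looks up the degree \<mu> + s \<alpha>, so an element of degree
  F moves to F - s; hence the sign.\<close>

lemma regraded_s:
  assumes r: "regraded c F" and s: "group_hom_on Q s"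
  shows "regraded (regrade_s c s) (\<lambda>p. F p - s (fst p))"
proof (rule regradedI)
  fix p q assume p: "p \<in> \<Lambda>" and q: "q \<in> \<Lambda>"
  have "s (fst p + fst q) = s (fst p) + s (fst q)"
    using s \<Lambda>_fst[OF p] \<Lambda>_fst[OF q] by (simp add: group_hom_on_def)
  then show "F (p + q) - s (fst (p + q)) = F p - s (fst p) + (F q - s (fst q))"
    by (simp add: regraded_add[OF r p q])
next
  fix \<alpha> l assume "\<alpha> \<in> Q" "cmp (\<alpha>, l) \<noteq> {0}"
  from regraded_cmp[OF r this] show "regrade_s c s (\<alpha>, F (\<alpha>, l) - s (fst (\<alpha>, l))) = cmp (\<alpha>, l)"
    by (simp add: regrade_s_def)
next
  fix \<alpha> \<mu> assume a: "\<alpha> \<in> Q" and c: "regrade_s c s (\<alpha>, \<mu>) \<noteq> {0}"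
  have "c (\<alpha>, \<mu> + s \<alpha>) \<noteq> {0}" using c by (simp add: regrade_s_def)
  from regraded_ex[OF r a this] obtain l where "cmp (\<alpha>, l) \<noteq> {0} \<and> F (\<alpha>, l) = \<mu> + s \<alpha>" ..
  then show "\<exists>l. cmp (\<alpha>, l) \<noteq> {0} \<and> F (\<alpha>, l) - s (fst (\<alpha>, l)) = \<mu>" by (intro exI[of _ l]) simp
qed

lemma zn_comp_base: assumes "\<alpha> \<in> Q" "f \<in> c (\<alpha>, \<mu>)" shows "f \<in> zn_comp Q c \<mu>"
  unfolding zn_comp_def using assms by (intro CollectI exI[of _ "{\<alpha>}"] exI[of _ "\<lambda>_. f"]) simp

abbreviation zn_supp :: "(('v \<Rightarrow> 'k) \<times> (int^'n) \<Rightarrow> (int^'n \<Rightarrow> 'v) set) \<Rightarrow> (int^'n) set" where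
  "zn_supp c \<equiv> gen_subgroup {\<mu>. zn_comp Q c \<mu> \<noteq> {0}}"

lemma regraded_zn_supp: assumes r: "regraded c F" shows "zn_supp c = F ` \<Lambda>"
proof
  have F0: "F 0 = 0" using regraded_diff[OF r \<Lambda>_0 \<Lambda>_0] by simp
  show "zn_supp c \<subseteq> F ` \<Lambda>"
  proof (rule gen_subgroup_subset)
    show "{\<mu>. zn_comp Q c \<mu> \<noteq> {0}} \<subseteq> F ` \<Lambda>"
    proof
      fix \<mu> assume "\<mu> \<in> {\<mu>. zn_comp Q c \<mu> \<noteq> {0}}"
      then have ne: "zn_comp Q c \<mu> \<noteq> {0}" by simp
      have "\<exists>\<alpha>\<in>Q. c (\<alpha>, \<mu>) \<noteq> {0}"
      proof (rule ccontr)
        assume "\<not> ?thesis"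
        then have c0: "\<And>\<alpha>. \<alpha> \<in> Q \<Longrightarrow> c (\<alpha>, \<mu>) = {0}" by simp
        have "f = 0" if "f \<in> zn_comp Q c \<mu>" for f
        proof -
          from that obtain I g where g: "f = sum g I" "I \<subseteq> Q" "\<forall>\<alpha>\<in>I. g \<alpha> \<in> c (\<alpha>, \<mu>)" by (auto simp: zn_comp_def)
          have "g \<alpha> = 0" if \<alpha>: "\<alpha> \<in> I" for \<alpha>
          proof -
            have "g \<alpha> \<in> c (\<alpha>, \<mu>)" using g(3) \<alpha> by (rule bspec)
            then show ?thesis by (simp only: c0[OF subsetD[OF g(2) \<alpha>]] singleton_iff)
          qed
          then show ?thesis unfolding g(1) by (intro sum.neutral ballI)
        qed
        moreover have "0 \<in> zn_comp Q c \<mu>" by (rule zn_comp_base[OF Q_0]) (simp add: c0[OF Q_0])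
        ultimately show False using ne by blast
      qed
      then obtain \<alpha> where \<alpha>: "\<alpha> \<in> Q" "c (\<alpha>, \<mu>) \<noteq> {0}" ..
      from regraded_ex[OF r this] obtain l where l: "cmp (\<alpha>, l) \<noteq> {0} \<and> F (\<alpha>, l) = \<mu>" ..
      show "\<mu> \<in> F ` \<Lambda>" by (rule image_eqI[of _ _ "(\<alpha>, l)"]) (use l \<Lambda>_cmp[OF \<alpha>(1)] in simp_all)
    qed
    show "0 \<in> F ` \<Lambda>" by (rule image_eqI[of _ _ 0]) (simp_all add: F0 \<Lambda>_0)
    fix x y assume "x \<in> F ` \<Lambda>" "y \<in> F ` \<Lambda>"
    then obtain p q where "p \<in> \<Lambda>" "q \<in> \<Lambda>" "x = F p" "y = F q" by blast
    then show "x - y \<in> F ` \<Lambda>" by (intro image_eqI[of _ _ "p - q"]) (simp_all add: regraded_diff[OF r] \<Lambda>_diff)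
  qed
  have "\<Lambda> \<subseteq> {p \<in> \<Lambda>. F p \<in> zn_supp c}"
    unfolding \<Lambda>_def
  proof (rule gen_subgroup_subset, unfold \<Lambda>_def[symmetric])
    show "gsupp (Q \<times> UNIV) cmp \<subseteq> {p \<in> \<Lambda>. F p \<in> zn_supp c}"
    proof
      fix p assume p: "p \<in> gsupp (Q \<times> UNIV) cmp"
      obtain \<alpha> l where pe: "p = (\<alpha>, l)" by (cases p)
      have \<alpha>: "\<alpha> \<in> Q" "cmp (\<alpha>, l) \<noteq> {0}" using p by (simp_all add: gsupp_def pe)
      obtain x where x: "x \<in> W \<alpha> \<inter> G l" "x \<noteq> 0" using \<alpha>(2)[unfolded cmp_nonzero_iff] by (rule bexE)
      have "single l x \<in> cmp (\<alpha>, l)" unfolding cmp_iff using x(1) by (rule rev_bexI) (rule refl)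
      then have "single l x \<in> c (\<alpha>, F (\<alpha>, l))" by (simp only: regraded_cmp[OF r \<alpha>])
      then have m: "single l x \<in> zn_comp Q c (F (\<alpha>, l))" by (rule zn_comp_base[where c = c, OF \<alpha>(1)])
      have "zn_comp Q c (F (\<alpha>, l)) \<noteq> {0}"
      proof
        assume "zn_comp Q c (F (\<alpha>, l)) = {0}"
        then show False using m x(2) by simp
      qed
      then show "p \<in> {p \<in> \<Lambda>. F p \<in> zn_supp c}" using \<Lambda>_cmp[OF \<alpha>] by (simp add: pe gen_subgroup_base)
    qed
  qed (auto simp: \<Lambda>_0 F0 gen_subgroup_0 \<Lambda>_diff regraded_diff[OF r] gen_subgroup_diff)
  then show "F ` \<Lambda> \<subseteq> zn_supp c" by blast
qed

lemma regraded_rho: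
  assumes r: "regraded c F" and \<rho>: "zn_monomorphism Q c \<rho>"
  shows "regraded (regrade_rho Q c \<rho>) (\<lambda>p. \<rho> (F p))"
proof (rule regradedI)
  have inj: "inj_on \<rho> (F ` \<Lambda>)" and hom: "group_hom_on (F ` \<Lambda>) \<rho>"
    using \<rho> by (simp_all add: zn_monomorphism_def regraded_zn_supp[OF r])
  fix p q assume p: "p \<in> \<Lambda>" and q: "q \<in> \<Lambda>"
  show "\<rho> (F (p + q)) = \<rho> (F p) + \<rho> (F q)"
    using hom p q by (simp add: group_hom_on_def regraded_add[OF r p q])
next
  have inj: "inj_on \<rho> (F ` \<Lambda>)" using \<rho> by (simp add: zn_monomorphism_def regraded_zn_supp[OF r])
  fix \<alpha> l assume \<alpha>: "\<alpha> \<in> Q" "cmp (\<alpha>, l) \<noteq> {0}"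
  have F: "F (\<alpha>, l) \<in> F ` \<Lambda>" by (rule imageI[OF \<Lambda>_cmp[OF \<alpha>]])
  show "regrade_rho Q c \<rho> (\<alpha>, \<rho> (F (\<alpha>, l))) = cmp (\<alpha>, l)"
    using imageI[OF F, of \<rho>]
    by (simp add: regrade_rho_def regraded_zn_supp[OF r] the_inv_into_f_f[OF inj F] regraded_cmp[OF r \<alpha>])
next
  have inj: "inj_on \<rho> (F ` \<Lambda>)" using \<rho> by (simp add: zn_monomorphism_def regraded_zn_supp[OF r])
  fix \<alpha> \<mu> assume \<alpha>: "\<alpha> \<in> Q" and c: "regrade_rho Q c \<rho> (\<alpha>, \<mu>) \<noteq> {0}"
  have \<mu>: "\<mu> \<in> \<rho> ` F ` \<Lambda>" and c': "c (\<alpha>, the_inv_into (F ` \<Lambda>) \<rho> \<mu>) \<noteq> {0}"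
    using c by (simp_all add: regrade_rho_def regraded_zn_supp[OF r] split: if_splits)
  from regraded_ex[OF r \<alpha> c'] obtain l where "cmp (\<alpha>, l) \<noteq> {0} \<and> F (\<alpha>, l) = the_inv_into (F ` \<Lambda>) \<rho> \<mu>" ..
  then show "\<exists>l. cmp (\<alpha>, l) \<noteq> {0} \<and> \<rho> (F (\<alpha>, l)) = \<mu>"
    by (intro exI[of _ l]) (simp add: f_the_inv_into_f[OF inj \<mu>])
qed

lemma regraded_chain:
  assumes L0: "K 0 = cmp" and step: "\<And>i. i < p \<Longrightarrow> regrade_step Q (K i) (K (Suc i))"
  shows "\<exists>F. regraded (K p) F"
  using step
proof (induction p)
  case 0
  show ?case unfolding L0 using regraded_init by (rule exI[of _ snd])
next
  case (Suc p)
  obtain F where F: "regraded (K p) F" using Suc.IH Suc.prems less_SucI by blast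
  from Suc.prems[of p] have "regrade_step Q (K p) (K (Suc p))" by simp
  then consider \<rho> where "zn_monomorphism Q (K p) \<rho>" "K (Suc p) = regrade_rho Q (K p) \<rho>"
    | s where "group_hom_on Q s" "K (Suc p) = regrade_s (K p) s"
    unfolding regrade_step_def by (elim disjE exE conjE)
  then show ?case
  proof cases
    case 1
    show ?thesis unfolding 1(2) using regraded_rho[OF F 1(1)] by (rule exI[of _ "\<lambda>p. \<rho> (F p)"])
  next
    case 2
    show ?thesis unfolding 2(2) using regraded_s[OF F 2(1)] by (rule exI[of _ "\<lambda>p. F p - s (fst p)"])
  qed
qed

end

section \<open>The degree map as a chain of regradings\<close>

context conj_cartan
begin

text \<open>The root lattice is generated by finitely many roots, so finitely many denominators have
  to be cleared.\<close>

lemma common_denominator_s: "\<exists>D::nat. 0 < D \<and> (\<forall>\<alpha>\<in>a.Q. \<forall>i. of_nat D * s \<alpha> $ i \<in> \<int>)"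
proof -
  have "finite (\<Union>i\<in>UNIV. (\<lambda>\<alpha>. s \<alpha> $ i) ` a.R)" using a.finite_R by simp
  from common_denominator[OF this] obtain D :: nat where D: "0 < D"
    and DR: "\<forall>x\<in>(\<Union>i\<in>UNIV. (\<lambda>\<alpha>. s \<alpha> $ i) ` a.R). of_nat D * x \<in> \<int>" by (elim exE conjE)
  have "a.Q \<subseteq> {\<alpha> \<in> a.Q. \<forall>i. of_nat D * s \<alpha> $ i \<in> \<int>}"
  proof (subst (1) root_lattice_def, rule gen_subgroup_subset)
    show "roots sc br H \<subseteq> {\<alpha> \<in> a.Q. \<forall>i. of_nat D * s \<alpha> $ i \<in> \<int>}"
      using DR a.R_Q by (auto simp: a.roots_R)
    have "s 0 = 0" using s_diff[OF a.Q_0 a.Q_0] by simp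
    then show "0 \<in> {\<alpha> \<in> a.Q. \<forall>i. of_nat D * s \<alpha> $ i \<in> \<int>}" by (simp add: a.Q_0)
    show "\<alpha> - \<beta> \<in> {\<alpha> \<in> a.Q. \<forall>i. of_nat D * s \<alpha> $ i \<in> \<int>}"
      if "\<alpha> \<in> {\<alpha> \<in> a.Q. \<forall>i. of_nat D * s \<alpha> $ i \<in> \<int>}" "\<beta> \<in> {\<alpha> \<in> a.Q. \<forall>i. of_nat D * s \<alpha> $ i \<in> \<int>}" for \<alpha> \<beta>
      using that by (simp add: a.Q_diff s_diff right_diff_distrib)
  qed
  then have "\<forall>\<alpha>\<in>a.Q. \<forall>i. of_nat D * s \<alpha> $ i \<in> \<int>" by blast
  with D show ?thesis by (intro exI[of _ D] conjI)
qed

text \<open>The regrading \<open>l \<mapsto> deg \<alpha> l\<close> is the composite of multiplication by a common denominator,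
  an integral shift, and division by that denominator followed by a rational matrix.\<close>

theorem conjugate_imp_chain:
  "\<exists>p K. K 0 = a.cmp \<and> (\<forall>i<p. regrade_step a.Q (K i) (K (Suc i))) \<and>
    zn_isograded_iso a.L (lsc sc) a.lb a.Q (K p) b.L (lsc sc') b.lb b.Q b.cmp"
proof -
  obtain D :: nat where D: "0 < D" and Ds: "\<And>\<alpha> i. \<alpha> \<in> a.Q \<Longrightarrow> of_nat D * s \<alpha> $ i \<in> \<int>"
    using common_denominator_s by blast
  define \<rho>0 :: "int^'n \<Rightarrow> int^'n" where "\<rho>0 l = (\<chi> i. int D * l $ i)" for l
  \<comment> \<open>This is D m s in each coordinate; the floor is exact on the root lattice because
    D clears the denominators of s.\<close>
  define s0 :: "('v \<Rightarrow> 'k) \<Rightarrow> int^'n" where "s0 \<alpha> = (\<chi> i. int (m i) * \<lfloor>of_nat D * s \<alpha> $ i\<rfloor>)" for \<alpha>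
  \<comment> \<open>Division by D m turns D l - D m s into l/m - s, and the matrix M with the
    factors m' then gives \<open>deg\<close>.\<close>
  define B :: "rat^'n \<Rightarrow> rat^'n" where
    "B v = (\<chi> j. of_nat (m' j) * (\<Sum>i\<in>UNIV. of_int (M $ i $ j) * (v $ i / (of_nat D * of_nat (m i)))))" for v
  \<comment> \<open>On the degrees that occur after the first two steps, B takes integral values, so
    the floor changes nothing there and \<rho> is additive and injective.\<close>
  define \<rho> :: "int^'n \<Rightarrow> int^'n" where "\<rho> \<nu> = (\<chi> j. \<lfloor>B (rv \<nu>) $ j\<rfloor>)" for \<nu>
  have D0: "(of_nat D :: rat) \<noteq> 0" using D by simp
  have rs0: "rv (s0 \<alpha>) $ i = of_nat D * of_nat (m i) * s \<alpha> $ i" if \<alpha>: "\<alpha> \<in> a.Q" for \<alpha> i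
  proof -
    obtain k where k: "of_nat D * s \<alpha> $ i = rat_of_int k" using Ds[OF \<alpha>, of i] by (rule Ints_cases)
    have "rv (s0 \<alpha>) $ i = of_nat (m i) * rat_of_int k" by (simp add: s0_def k)
    then show ?thesis unfolding k[symmetric] by (simp add: mult.commute mult.left_commute)
  qed
  have B_add: "B (v + w) = B v + B w" for v w
    by (simp add: B_def vec_eq_iff add_divide_distrib distrib_left sum.distrib)
  have B_inj: "v = 0" if v: "B v = 0" for v
  proof -
    have "v $ i / (of_nat D * of_nat (m i)) = 0" for i
    proof (rule pairing_inj[of "\<lambda>i. v $ i / (of_nat D * of_nat (m i))"])
      fix j
      have "B v $ j = 0" by (simp add: v)
      then show "(\<Sum>i\<in>UNIV. of_int (M $ i $ j) * (v $ i / (of_nat D * of_nat (m i)))) = 0"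
        using m'_nonzero[of j] unfolding B_def by simp
    qed
    then have "v $ i = 0" for i using m_nonzero[of i] D0 by (metis divide_eq_0_iff no_zero_divisors)
    then show ?thesis by (simp add: vec_eq_iff)
  qed
  have s0_hom: "group_hom_on a.Q s0"
    unfolding group_hom_on_def
  proof (intro ballI)
    fix \<alpha> \<beta> assume ab: "\<alpha> \<in> a.Q" "\<beta> \<in> a.Q"
    have "rv (s0 (\<alpha> + \<beta>)) = rv (s0 \<alpha> + s0 \<beta>)"
      unfolding vec_eq_iff rv_add
      by (simp only: vector_add_component rs0 ab a.Q_add s_add distrib_left) simp
    then show "s0 (\<alpha> + \<beta>) = s0 \<alpha> + s0 \<beta>" by (simp only: rv_inj)
  qed
  define c1 where "c1 = regrade_rho a.Q a.cmp \<rho>0"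
  define c2 where "c2 = regrade_s c1 s0"
  define c3 where "c3 = regrade_rho a.Q c2 \<rho>"
  have m1: "zn_monomorphism a.Q a.cmp \<rho>0"
    unfolding zn_monomorphism_def Let_def
  proof
    show "inj_on \<rho>0 (a.zn_supp a.cmp)" using D by (auto simp: inj_on_def \<rho>0_def vec_eq_iff)
    show "group_hom_on (a.zn_supp a.cmp) \<rho>0" by (simp add: group_hom_on_def \<rho>0_def vec_eq_iff distrib_left)
  qed
  have r1: "a.regraded c1 (\<lambda>p. \<rho>0 (snd p))" unfolding c1_def by (rule a.regraded_rho[OF a.regraded_init m1])
  have r2: "a.regraded c2 (\<lambda>p. \<rho>0 (snd p) - s0 (fst p))" unfolding c2_def by (rule a.regraded_s[OF r1 s0_hom])
  have BF: "B (rv (\<rho>0 (snd p) - s0 (fst p))) = deg (fst p) (snd p)" if p: "p \<in> a.\<Lambda>" for p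
  proof -
    have "rv (\<rho>0 (snd p) - s0 (fst p)) $ i / (of_nat D * of_nat (m i)) = of_int (snd p $ i) / of_nat (m i) - s (fst p) $ i" for i
    proof -
      have "rv (\<rho>0 (snd p) - s0 (fst p)) $ i = of_nat D * of_int (snd p $ i) - of_nat D * of_nat (m i) * s (fst p) $ i"
        unfolding rv_diff vector_minus_component rs0[OF a.\<Lambda>_fst[OF p]] by (simp add: \<rho>0_def)
      then show ?thesis using m_nonzero[of i] D0 by (simp only: diff_divide_distrib) simp
    qed
    then show ?thesis by (simp only: B_def deg_def)
  qed
  have \<rho>F: "rv (\<rho> (\<rho>0 (snd p) - s0 (fst p))) = deg (fst p) (snd p)" if p: "p \<in> a.\<Lambda>" for p
  proof -
    have d: "deg (fst p) (snd p) = rv (dg (fst p) (snd p))" using \<Lambda>_dg[OF p] by simp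
    show ?thesis unfolding \<rho>_def BF[OF p] d by (simp add: vec_eq_iff)
  qed
  define E where "E = (\<lambda>p. \<rho>0 (snd p) - s0 (fst p)) ` a.\<Lambda>"
  have E: "a.zn_supp c2 = E" unfolding E_def by (rule a.regraded_zn_supp[OF r2])
  have \<rho>E: "rv (\<rho> x) = B (rv x)" if "x \<in> E" for x
  proof -
    obtain p where p: "p \<in> a.\<Lambda>" "x = \<rho>0 (snd p) - s0 (fst p)" using \<open>x \<in> E\<close> unfolding E_def by (rule imageE)
    show ?thesis by (simp only: p(2) BF[OF p(1)] \<rho>F[OF p(1)])
  qed
  have m3: "zn_monomorphism a.Q c2 \<rho>"
    unfolding zn_monomorphism_def Let_def E
  proof
    show "inj_on \<rho> E"
    proof (rule inj_onI)
      fix x y assume x: "x \<in> E" and y: "y \<in> E" and e: "\<rho> x = \<rho> y"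
      have "B (rv (x - y)) + B (rv y) = B (rv x)" by (simp add: B_add[symmetric] rv_diff)
      then have "B (rv (x - y)) = 0" using \<rho>E[OF x] \<rho>E[OF y] e by simp
      then have "rv (x - y) = 0" by (rule B_inj)
      then show "x = y" by (simp add: rv_diff rv_inj)
    qed
    show "group_hom_on E \<rho>"
      unfolding group_hom_on_def
    proof (intro ballI)
      fix x y assume x: "x \<in> E" and y: "y \<in> E"
      have xy: "x + y \<in> E" using x y unfolding E[symmetric] by (rule gen_subgroup_add)
      have "rv (\<rho> (x + y)) = rv (\<rho> x + \<rho> y)" by (simp only: rv_add \<rho>E[OF x] \<rho>E[OF y] \<rho>E[OF xy] B_add)
      then show "\<rho> (x + y) = \<rho> x + \<rho> y" by (simp only: rv_inj)
    qed
  qed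
  define F3 where "F3 p = \<rho> (\<rho>0 (snd p) - s0 (fst p))" for p
  have r3: "a.regraded c3 F3" unfolding c3_def F3_def by (rule a.regraded_rho[OF r2 m3])
  have F3: "rv (F3 (\<alpha>, l)) = deg \<alpha> l" if "\<alpha> \<in> a.Q" "a.cmp (\<alpha>, l) \<noteq> {0}" for \<alpha> l
    using \<rho>F[OF a.\<Lambda>_cmp[OF that]] by (simp add: F3_def)
  have zn: "\<Phi> ` zn_comp a.Q c3 \<mu> = zn_comp b.Q b.cmp \<mu>" for \<mu>
  proof (rule \<Phi>_zn_comp)
    fix \<alpha> f assume \<alpha>: "\<alpha> \<in> a.Q" and f: "f \<in> c3 (\<alpha>, \<mu>)" "f \<noteq> 0"
    have "c3 (\<alpha>, \<mu>) \<noteq> {0}" using f by auto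
    from a.regraded_ex[OF r3 \<alpha> this] obtain l where l: "a.cmp (\<alpha>, l) \<noteq> {0}" "F3 (\<alpha>, l) = \<mu>" by (elim exE conjE)
    have "f \<in> a.cmp (\<alpha>, l)" using a.regraded_cmp[OF r3 \<alpha> l(1)] f(1) by (simp only: l(2))
    then show "\<exists>l. deg \<alpha> l = rv \<mu> \<and> f \<in> a.cmp (\<alpha>, l)" using F3[OF \<alpha> l(1)] by (intro exI[of _ l]) (simp add: l(2))
  next
    fix \<alpha> l f assume \<alpha>: "\<alpha> \<in> a.Q" and d: "deg \<alpha> l = rv \<mu>" and f: "f \<in> a.cmp (\<alpha>, l)" "f \<noteq> 0"
    have ne: "a.cmp (\<alpha>, l) \<noteq> {0}" using f by auto
    have "rv (F3 (\<alpha>, l)) = rv \<mu>" using F3[OF \<alpha> ne] d by simp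
    then have "F3 (\<alpha>, l) = \<mu>" by (simp only: rv_inj)
    then show "f \<in> c3 (\<alpha>, \<mu>)" using a.regraded_cmp[OF r3 \<alpha> ne] f(1) by simp
  next
    show "0 \<in> c3 (\<alpha>, \<mu>)" if "\<alpha> \<in> a.Q" for \<alpha> by (rule a.regraded_0[OF r3 that])
  qed
  have iso: "zn_isograded_iso a.L (lsc sc) a.lb a.Q c3 b.L (lsc sc') b.lb b.Q b.cmp"
    unfolding zn_isograded_iso_def
    by (intro exI[of _ \<Phi>] exI[of _ "\<lambda>x. x"] conjI allI \<Phi>_iso zn)
       (auto simp: group_iso_on_def group_hom_on_def bij_betw_def)
  \<comment> \<open>The chain has three steps; the value for i > 3 is an arbitrary
    continuation.\<close>
  define K where "K = (\<lambda>i::nat. if i = 0 then a.cmp else if i = 1 then c1 else if i = 2 then c2 else c3)"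
  have "regrade_step a.Q (K i) (K (Suc i))" if "i < 3" for i
  proof -
    consider "i = 0" | "i = 1" | "i = 2" using \<open>i < 3\<close> by linarith
    then show ?thesis
    proof cases
      case 1
      show ?thesis unfolding regrade_step_def using m1 by (intro disjI1 exI[of _ \<rho>0]) (simp add: 1 K_def c1_def)
    next
      case 2
      show ?thesis unfolding regrade_step_def using s0_hom by (intro disjI2 exI[of _ s0]) (simp add: 2 K_def c2_def)
    next
      case 3
      show ?thesis unfolding regrade_step_def using m3 by (intro disjI1 exI[of _ \<rho>]) (simp add: 3 K_def c3_def)
    qed
  qed
  moreover have "K 0 = a.cmp" "K 3 = c3" by (simp_all add: K_def)
  ultimately show ?thesis using iso by (intro exI[of _ 3] exI[of _ K] conjI allI impI) simp_all
qed

end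

section \<open>Assembling the two equivalences\<close>

locale multiloop_pair = a: multiloop sc br \<sigma> m H z + b: multiloop sc' br' \<sigma>' m' H' z
  for sc :: "'k::field_char_0 \<Rightarrow> 'v::ab_group_add \<Rightarrow> 'v" and br
    and \<sigma> :: "'n::finite \<Rightarrow> 'v \<Rightarrow> 'v" and m H
    and sc' :: "'k \<Rightarrow> 'w::ab_group_add \<Rightarrow> 'w" and br'
    and \<sigma>' :: "'n \<Rightarrow> 'w \<Rightarrow> 'w" and m' H' and z
begin

definition conj_tuples :: bool where
  "conj_tuples \<longleftrightarrow> (\<exists>s P h. group_hom_on a.Q s \<and> GL_int P \<and> lie_iso sc br sc' br' h \<and>
     (\<exists>\<tau>. a.twist s \<tau> \<and> (\<forall>j. \<sigma>' j = h \<circ> tuple_pow (\<lambda>i. \<tau> i \<circ> \<sigma> i) P j \<circ> inv h)))"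

lemma graded_iso_imp_conj:
  fixes F :: "('v \<Rightarrow> 'k) \<times> (int^'n) \<Rightarrow> int^'n"
  assumes \<phi>: "alg_iso a.L (lsc sc) a.lb b.L (lsc sc') b.lb \<phi>"
    and F: "\<And>p q. p \<in> a.\<Lambda> \<Longrightarrow> q \<in> a.\<Lambda> \<Longrightarrow> F (p + q) = F p + F q"
    and hom: "\<And>\<alpha> l x. \<alpha> \<in> a.R \<Longrightarrow> x \<in> a.W \<alpha> \<Longrightarrow> x \<in> a.G l \<Longrightarrow> x \<noteq> 0 \<Longrightarrow>
      \<exists>y\<in>b.G (F (\<alpha>, l)). \<phi> (single l x) = single (F (\<alpha>, l)) y"
  shows conj_tuples
proof -
  let ?i = "the_inv_into a.L \<phi>"
  have b: "bij_betw \<phi> a.L b.L" using \<phi> by (simp add: alg_iso_def)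
  then have inj: "inj_on \<phi> a.L" and im: "\<phi> ` a.L = b.L" by (simp_all add: bij_betw_def)
  have i: "alg_iso b.L (lsc sc') b.lb a.L (lsc sc) a.lb ?i"
    by (rule alg_iso_inv[OF \<phi>]) (rule a.L_add a.L_sc a.L_lb; assumption)+
  interpret regraded_iso sc br \<sigma> m H sc' br' \<sigma>' m' z \<phi> ?i F
    by unfold_locales
       (rule \<phi> i F hom the_inv_into_f_f[OF inj] f_the_inv_into_f[OF inj, unfolded im] | assumption)+
  show ?thesis unfolding conj_tuples_def by (rule regraded_imp_conjugate)
qed

lemma support_iso_imp_conj:
  assumes "support_iso a.L (lsc sc) a.lb (a.Q \<times> UNIV) a.cmp b.L (lsc sc') b.lb (b.Q \<times> UNIV) b.cmp"
  shows conj_tuples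
proof -
  obtain \<phi> \<psi> where \<phi>: "alg_iso a.L (lsc sc) a.lb b.L (lsc sc') b.lb \<phi>"
    and \<psi>: "group_iso_on a.\<Lambda> b.\<Lambda> \<psi>" and c: "\<forall>p\<in>a.\<Lambda>. \<phi> ` a.cmp p = b.cmp (\<psi> p)"
    using assms unfolding support_iso_def a.\<Lambda>_def[symmetric] b.\<Lambda>_def[symmetric] by (elim exE conjE)
  show ?thesis
  proof (rule graded_iso_imp_conj[OF \<phi>, of "\<lambda>p. snd (\<psi> p)"])
    show "snd (\<psi> (p + q)) = snd (\<psi> p) + snd (\<psi> q)" if "p \<in> a.\<Lambda>" "q \<in> a.\<Lambda>" for p q
      using \<psi> that by (simp add: group_iso_on_def group_hom_on_def)
    fix \<alpha> l x assume x: "\<alpha> \<in> a.R" "x \<in> a.W \<alpha>" "x \<in> a.G l" "x \<noteq> 0"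
    have \<Lambda>: "(\<alpha>, l) \<in> a.\<Lambda>" by (rule a.\<Lambda>_base[OF subsetD[OF a.R_Q x(1)] x(2-4)])
    have "single l x \<in> a.cmp (\<alpha>, l)" unfolding a.cmp_iff using IntI[OF x(2,3)] by (rule rev_bexI) (rule refl)
    then have "\<phi> (single l x) \<in> b.cmp (\<psi> (\<alpha>, l))" unfolding bspec[OF c \<Lambda>, symmetric] by (rule imageI)
    then have "\<phi> (single l x) \<in> b.cmp (fst (\<psi> (\<alpha>, l)), snd (\<psi> (\<alpha>, l)))" by simp
    from this[unfolded b.cmp_iff] obtain y where
      y: "y \<in> b.W (fst (\<psi> (\<alpha>, l))) \<inter> b.G (snd (\<psi> (\<alpha>, l)))" "\<phi> (single l x) = single (snd (\<psi> (\<alpha>, l))) y"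
      by (rule bexE)
    show "\<exists>y\<in>b.G (snd (\<psi> (\<alpha>, l))). \<phi> (single l x) = single (snd (\<psi> (\<alpha>, l))) y"
      by (rule bexI[where x = y]) (rule y(2), rule IntD2[OF y(1)])
  qed
qed

lemma chain_imp_conj:
  assumes K: "K 0 = a.cmp" "\<forall>i<p. regrade_step a.Q (K i) (K (Suc i))"
    and iso: "zn_isograded_iso a.L (lsc sc) a.lb a.Q (K p) b.L (lsc sc') b.lb b.Q b.cmp"
  shows conj_tuples
proof -
  have "\<exists>F. a.regraded (K p) F" by (rule a.regraded_chain[where K = K]) (simp_all add: K)
  then obtain F where F: "a.regraded (K p) F" ..
  obtain \<phi> \<psi> where \<phi>: "alg_iso a.L (lsc sc) a.lb b.L (lsc sc') b.lb \<phi>"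
    and \<psi>: "group_iso_on (UNIV :: (int^'n) set) UNIV \<psi>"
    and c: "\<forall>l. \<phi> ` zn_comp a.Q (K p) l = zn_comp b.Q b.cmp (\<psi> l)"
    using iso unfolding zn_isograded_iso_def by (elim exE conjE)
  show ?thesis
  proof (rule graded_iso_imp_conj[OF \<phi>, of "\<lambda>p. \<psi> (F p)"])
    show "\<psi> (F (p + q)) = \<psi> (F p) + \<psi> (F q)" if "p \<in> a.\<Lambda>" "q \<in> a.\<Lambda>" for p q
      using \<psi> by (simp add: a.regraded_add[OF F that] group_iso_on_def group_hom_on_def)
    fix \<alpha> l x assume x: "\<alpha> \<in> a.R" "x \<in> a.W \<alpha>" "x \<in> a.G l" "x \<noteq> 0"
    have Q: "\<alpha> \<in> a.Q" by (rule subsetD[OF a.R_Q x(1)])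
    have m: "single l x \<in> a.cmp (\<alpha>, l)" unfolding a.cmp_iff using IntI[OF x(2,3)] by (rule rev_bexI) (rule refl)
    have ne: "a.cmp (\<alpha>, l) \<noteq> {0}"
    proof
      assume "a.cmp (\<alpha>, l) = {0}"
      then show False using m x(4) by simp
    qed
    have "single l x \<in> K p (\<alpha>, F (\<alpha>, l))" using m by (simp only: a.regraded_cmp[OF F Q ne])
    then have "single l x \<in> zn_comp a.Q (K p) (F (\<alpha>, l))" by (rule a.zn_comp_base[where c = "K p", OF Q])
    then have "\<phi> (single l x) \<in> \<phi> ` zn_comp a.Q (K p) (F (\<alpha>, l))" by (rule imageI)
    then have "\<phi> (single l x) \<in> single (\<psi> (F (\<alpha>, l))) ` b.G (\<psi> (F (\<alpha>, l)))"
      by (simp only: c[rule_format] b.zn_comp_cmp)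
    then obtain y where y: "\<phi> (single l x) = single (\<psi> (F (\<alpha>, l))) y" "y \<in> b.G (\<psi> (F (\<alpha>, l)))" by (rule imageE)
    show "\<exists>y\<in>b.G (\<psi> (F (\<alpha>, l))). \<phi> (single l x) = single (\<psi> (F (\<alpha>, l))) y" by (rule bexI[where x = y]) (rule y)+
  qed
qed

lemma conj_cartan_exists:
  assumes conj_tuples shows "\<exists>s P h \<tau>. conj_cartan sc br \<sigma> m H sc' br' \<sigma>' m' H' z s P h \<tau>"
proof -
  obtain s P h \<tau> where c: "group_hom_on a.Q s" "GL_int P" "lie_iso sc br sc' br' h" "a.twist s \<tau>"
    "\<forall>j. \<sigma>' j = h \<circ> tuple_pow (\<lambda>i. \<tau> i \<circ> \<sigma> i) P j \<circ> inv h"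
    using assms unfolding conj_tuples_def by (elim exE conjE)
  interpret conj_pair sc br \<sigma> m H sc' br' \<sigma>' m' H' z s P h \<tau>
    by unfold_locales (rule c(1-4) c(5)[rule_format])+
  obtain h' where h': "conj_pair sc br \<sigma> m H sc' br' \<sigma>' m' H' z s P h' \<tau>" "h' ` H = H'"
    using adjust_cartan by (elim exE conjE)
  then have "conj_cartan sc br \<sigma> m H sc' br' \<sigma>' m' H' z s P h' \<tau>"
    by (intro conj_cartan.intro conj_cartan_axioms.intro)
  then show ?thesis by (intro exI)
qed

theorem support_iso_iff:
  "support_iso a.L (lsc sc) a.lb (a.Q \<times> UNIV) a.cmp b.L (lsc sc') b.lb (b.Q \<times> UNIV) b.cmp \<longleftrightarrow> conj_tuples"
proof
  assume conj_tuples
  from conj_cartan_exists[OF this] obtain s P h \<tau> where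
    "conj_cartan sc br \<sigma> m H sc' br' \<sigma>' m' H' z s P h \<tau>" by (elim exE)
  from conj_cartan.conjugate_imp_support_iso[OF this]
  show "support_iso a.L (lsc sc) a.lb (a.Q \<times> UNIV) a.cmp b.L (lsc sc') b.lb (b.Q \<times> UNIV) b.cmp" .
qed (rule support_iso_imp_conj)

theorem chain_iff:
  "conj_tuples \<longleftrightarrow> (\<exists>p K. K 0 = a.cmp \<and> (\<forall>i<p. regrade_step a.Q (K i) (K (Suc i))) \<and>
    zn_isograded_iso a.L (lsc sc) a.lb a.Q (K p) b.L (lsc sc') b.lb b.Q b.cmp)"
proof
  assume conj_tuples
  from conj_cartan_exists[OF this] obtain s P h \<tau> where
    "conj_cartan sc br \<sigma> m H sc' br' \<sigma>' m' H' z s P h \<tau>" by (elim exE)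
  from conj_cartan.conjugate_imp_chain[OF this]
  show "\<exists>p K. K 0 = a.cmp \<and> (\<forall>i<p. regrade_step a.Q (K i) (K (Suc i))) \<and>
    zn_isograded_iso a.L (lsc sc) a.lb a.Q (K p) b.L (lsc sc') b.lb b.Q b.cmp" .
qed (elim exE conjE, rule chain_imp_conj)

end

text \<open>The Cartan hypothesis is phrased for the eigenspace of degree 0, the locale for the
  fixed points; \<open>G_zero\<close> identifies the two.\<close>

lemma multiloop_intro:
  fixes z :: "nat \<Rightarrow> 'k::field_char_0"
  assumes ac: "alg_closed TYPE('k)" and z: "root_system z" and g: "fin_dim_simple_lie sc br"
    and \<sigma>: "cfo_tuple sc br \<sigma> m" and H: "cartan_sub sc br (gbar sc z \<sigma> m 0) H"
  shows "multiloop sc br \<sigma> m H z"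
proof -
  interpret vector_space sc using g by (simp add: fin_dim_simple_lie_def lie_algebra_def)
  interpret fd_space sc by unfold_locales (use g in \<open>simp add: fin_dim_simple_lie_def\<close>)
  interpret ac_space sc by unfold_locales (rule ac[unfolded alg_closed_def, rule_format])
  interpret simple_lie sc br by unfold_locales (rule g)
  interpret lie_fixed sc br \<sigma> m by unfold_locales (rule \<sigma>)
  interpret loop_alg sc br \<sigma> m z by unfold_locales (rule z)
  show ?thesis by unfold_locales (rule H[unfolded G_zero])
qed

theorem theorem4p2p5:
  fixes z :: "nat \<Rightarrow> 'k::field_char_0"
    and sc :: "'k \<Rightarrow> 'v::ab_group_add \<Rightarrow> 'v" and br :: "'v \<Rightarrow> 'v \<Rightarrow> 'v"
    and \<sigma> :: "'n::finite \<Rightarrow> 'v \<Rightarrow> 'v" and m :: "'n \<Rightarrow> nat" and H :: "'v set"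
    and sc' :: "'k \<Rightarrow> 'w::ab_group_add \<Rightarrow> 'w" and br' :: "'w \<Rightarrow> 'w \<Rightarrow> 'w"
    and \<sigma>' :: "'n \<Rightarrow> 'w \<Rightarrow> 'w" and m' :: "'n \<Rightarrow> nat" and H' :: "'w set"
  assumes "alg_closed TYPE('k)"
    and "root_system z"
    and "fin_dim_simple_lie sc br" and "fin_dim_simple_lie sc' br'"
    and "cfo_tuple sc br \<sigma> m" and "cfo_tuple sc' br' \<sigma>' m'"
    and "cartan_sub sc br (gbar sc z \<sigma> m 0) H"
    and "cartan_sub sc' br' (gbar sc' z \<sigma>' m' 0) H'"
  shows
   "(support_iso (mloop sc z \<sigma> m) (lsc sc) (lbr br)
        (root_lattice sc br H \<times> UNIV) (mloop_comp sc br z \<sigma> m H)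
        (mloop sc' z \<sigma>' m') (lsc sc') (lbr br')
        (root_lattice sc' br' H' \<times> UNIV) (mloop_comp sc' br' z \<sigma>' m' H')
    \<longleftrightarrow>
    (\<exists>(s :: ('v \<Rightarrow> 'k) \<Rightarrow> rat^'n) (P :: int^'n^'n) (\<phi> :: 'v \<Rightarrow> 'w).
        group_hom_on (root_lattice sc br H) s \<and> GL_int P \<and> lie_iso sc br sc' br' \<phi> \<and>
        (\<exists>\<tau> :: 'n \<Rightarrow> 'v \<Rightarrow> 'v.
           (\<forall>i x y. \<tau> i (x + y) = \<tau> i x + \<tau> i y) \<and>
           (\<forall>i c x. \<tau> i (sc c x) = sc c (\<tau> i x)) \<and>
           (\<forall>i. \<forall>\<alpha>\<in>root_lattice sc br H. \<forall>x\<in>wspace sc br H \<alpha>.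
               \<tau> i x = sc (zpow z (- (s \<alpha> $ i))) x) \<and>
           (\<forall>j. \<sigma>' j = \<phi> \<circ> tuple_pow (\<lambda>i. \<tau> i \<circ> \<sigma> i) P j \<circ> inv \<phi>))))
   \<and>
   ((\<exists>(s :: ('v \<Rightarrow> 'k) \<Rightarrow> rat^'n) (P :: int^'n^'n) (\<phi> :: 'v \<Rightarrow> 'w).
        group_hom_on (root_lattice sc br H) s \<and> GL_int P \<and> lie_iso sc br sc' br' \<phi> \<and>
        (\<exists>\<tau> :: 'n \<Rightarrow> 'v \<Rightarrow> 'v.
           (\<forall>i x y. \<tau> i (x + y) = \<tau> i x + \<tau> i y) \<and>
           (\<forall>i c x. \<tau> i (sc c x) = sc c (\<tau> i x)) \<and>
           (\<forall>i. \<forall>\<alpha>\<in>root_lattice sc br H. \<forall>x\<in>wspace sc br H \<alpha>.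
               \<tau> i x = sc (zpow z (- (s \<alpha> $ i))) x) \<and>
           (\<forall>j. \<sigma>' j = \<phi> \<circ> tuple_pow (\<lambda>i. \<tau> i \<circ> \<sigma> i) P j \<circ> inv \<phi>)))
    \<longleftrightarrow>
    (\<exists>(p :: nat) (L :: nat \<Rightarrow> (('v \<Rightarrow> 'k) \<times> (int^'n) \<Rightarrow> (int^'n \<Rightarrow> 'v) set)).
        L 0 = mloop_comp sc br z \<sigma> m H \<and>
        (\<forall>i<p. regrade_step (root_lattice sc br H) (L i) (L (Suc i))) \<and>
        zn_isograded_iso (mloop sc z \<sigma> m) (lsc sc) (lbr br) (root_lattice sc br H) (L p)
          (mloop sc' z \<sigma>' m') (lsc sc') (lbr br') (root_lattice sc' br' H')
          (mloop_comp sc' br' z \<sigma>' m' H')))"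
proof -
  interpret multiloop_pair sc br \<sigma> m H sc' br' \<sigma>' m' H' z
    by (intro multiloop_pair.intro multiloop_intro) (rule assms)+
  show ?thesis
    \<comment> \<open>Reassociating the conjunctions after unfolding \<open>twist\<close> gives the
      flat list of conditions on \<tau> in the statement.\<close>
    using support_iso_iff chain_iff unfolding conj_tuples_def a.twist_def conj_assoc by (rule conjI)
qed

end
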